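(* Consider the flag manifold $\mathbb F=SO(2\ell)/(U(1)\times U(\ell-1))$, $\ell\ge4$, its projected Ricci flow on $\mathcal S$, and the regions $R_1,\dots,R_{10}$ of the interior of $\mathcal S$ described in the context. The limiting behaviour of the projected Ricci flow is as follows: in forward time, orbits in $R_1,R_3,R_4$ converge to $K$, orbits in $R_2,R_5,R_6,R_9$ converge to $L$, and orbits in $R_7,R_8,R_{10}$ converge to $M$; in backward time, orbits in $R_3,R_8$ converge to $O$, orbits in $R_1,R_2$ converge to $P$, and orbits in $R_9,R_{10}$ converge to $Q$. In particular: 1. the Einstein–Kähler metrics ($R$, $S$ and $T$) are hyperbolic saddles; 2. the Einstein non-Kähler metric ($N$) is a repeller; 3. if the metric $g_0$ belongs to $R_1$, $R_3$ or $R_4$, then $\mathbb F_\infty=(SO(2\ell)/U(\ell),g_{\rm normal})$; 4. if $g_0$ belongs to $R_2$, $R_5$, $R_6$ or $R_9$, then $\mathbb F_\infty=(SO(2\ell)/(SO(2\ell-2)\times SO(2)),g_{\rm normal})$; 5. if $g_0$ belongs to $R_7$, $R_8$ or $R_{10}$, then $\mathbb F_\infty=(SO(2\ell)/U(\ell),g_{\rm normal})$; 6. if $g_0$ lies outside the triangle delimited by $L,T,K,R,M,S$ and the flow lines connecting them, then $\mathbb F_{-\infty}$ is a point. Here $\mathbb F_{\pm\infty}=\lim_{t\to\pm\infty}(\mathbb F,g_t)$, $g_t$ is the projected Ricci flow with initial condition $g_0$, and the convergence is in the Gromov–Hausdorff sense.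
   Context: Let $\mathfrak{so}(2\ell)=\mathfrak k\oplus\mathfrak m_1\oplus\mathfrak m_2\oplus\mathfrak m_3$, where $\mathfrak k=\mathfrak u(1)\oplus\mathfrak u(\ell-1)$ and the $\mathfrak m_i$ are the irreducible, pairwise inequivalent isotropy summands, of real dimensions $2(\ell-1)$, $2(\ell-1)$, $(\ell-1)(\ell-2)$; $\mathfrak k\oplus\mathfrak m_3=\mathfrak{so}(2)\oplus\mathfrak{so}(2\ell-2)$. With $B$ = minus the Killing form, invariant metrics are $xB|_{\mathfrak m_1}+yB|_{\mathfrak m_2}+zB|_{\mathfrak m_3}$, $x,y,z>0$, considered up to scale, normalized by $x+y+z=1$ and identified with the points $(x,y)$ in the interior of $\mathcal S=\{(x,y):x,y\ge0,\ x+y\le1\}$, $z=1-x-y$. The projected Ricci flow is the flow on $\mathcal S$ of $$x'=-x(2x-1)\big(\ell(x(8y-1)+8y^2-7y+1)-4y(2x+2y-1)\big),$$ $$y'=-y(2y-1)\big(\ell(8x^2+x(8y-7)-y+1)-4x(2x+2y-1)\big),$$ whose orbits in the interior of $\mathcal S$ are those of the homogeneous Ricci flow $\frac{dg}{dt}=-2\mathrm{Ric}(g)$ up to rescaling of metrics and positive time reparametrization. Its equilibria are $O=(0,0)$, $P=(0,1)$, $Q=(1,0)$, $K=(0,\tfrac12)$, $L=(\tfrac12,\tfrac12)$, $M=(\tfrac12,0)$ (degenerate metrics) and $N=(\tfrac{\ell}{4(\ell-1)},\tfrac{\ell}{4(\ell-1)})$, $R=(\tfrac14,\tfrac14)$,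 $S=(\tfrac{\ell}{6\ell-8},\tfrac12)$, $T=(\tfrac12,\tfrac{\ell}{6\ell-8})$ (Einstein metrics). $N$ lies inside the triangle $KLM$; $R,S,T$ lie on its sides $KM$, $KL$, $LM$ respectively, and these sides are invariant under the flow. Regions: the sides of the triangle $KLM$ and the stable manifolds of $R,S,T$ cut the interior of $\mathcal S$ into open regions. The corner at $P$ ($y>\tfrac12$) is cut into $R_1$ (with $K$ in its closure) and $R_2$ (with $L$ in its closure); the corner at $O$ ($x+y<\tfrac12$) into $R_3$ (with $K$ in its closure) and $R_8$ (with $M$); the corner at $Q$ ($x>\tfrac12$) into $R_9$ (with $L$) and $R_{10}$ (with $M$); the interior of the triangle $KLM$ into $R_4$ (with $K$), $R_7$ (with $M$), and a part with $L$ in its closure, made up by $R_5$ and $R_6$. $SO(2\ell)/U(\ell)$ is the space of orthogonal complex structures on $\mathbb R^{2\ell}$ and $SO(2\ell)/(SO(2\ell-2)\times SO(2))$ is the Grassmannian of oriented real 2-planes in $\mathbb R^{2\ell}$; $g_{\rm normal}$ is the invariant metric induced by a positive multiple of $B$. Kähler means Kähler with respect to some invariant complex structure. *)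

theory Defs
  imports "HOL-Analysis.Analysis"
begin

section \<open>The projected Ricci flow on the simplex\<close>

text \<open>The invariant metric with parameters \<open>x + y + z = 1\<close> is identified with the point \<open>(x, y)\<close>.\<close>

definition simplex2 :: "(real \<times> real) set" where
  "simplex2 = {(x, y). 0 \<le> x \<and> 0 \<le> y \<and> x + y \<le> 1}"

definition pr_field :: "nat \<Rightarrow> real \<times> real \<Rightarrow> real \<times> real" where
  "pr_field l = (\<lambda>(x, y).
     (- x * (2*x - 1) *
        (real l * (x * (8*y - 1) + 8*y^2 - 7*y + 1) - 4*y * (2*x + 2*y - 1)),
      - y * (2*y - 1) *
        (real l * (8*x^2 + x * (8*y - 7) - y + 1) - 4*x * (2*x + 2*y - 1))))"

definition pr_line :: "nat \<Rightarrow> (real \<Rightarrow> real \<times> real) \<Rightarrow> bool" where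
  "pr_line l \<phi> \<longleftrightarrow>
     (\<forall>t. \<phi> t \<in> simplex2 \<and> (\<phi> has_vector_derivative pr_field l (\<phi> t)) (at t))"

text \<open>\<open>simplex2\<close> is compact and invariant and the field is polynomial, so for \<open>p \<in> simplex2\<close> there
  is exactly one such curve and it is defined for all times.\<close>

definition proj_flow :: "nat \<Rightarrow> real \<times> real \<Rightarrow> real \<Rightarrow> real \<times> real" where
  "proj_flow l p = (THE \<phi>. pr_line l \<phi> \<and> \<phi> 0 = p)"

definition ptO :: "real \<times> real" where "ptO = (0, 0)"
definition ptP :: "real \<times> real" where "ptP = (0, 1)"
definition ptQ :: "real \<times> real" where "ptQ = (1, 0)"
definition ptK :: "real \<times> real" where "ptK = (0, 1/2)"
definition ptL :: "real \<times> real" where "ptL = (1/2, 1/2)"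
definition ptM :: "real \<times> real" where "ptM = (1/2, 0)"
definition ptN :: "nat \<Rightarrow> real \<times> real" where
  "ptN l = (real l / (4 * (real l - 1)), real l / (4 * (real l - 1)))"
definition ptR :: "real \<times> real" where "ptR = (1/4, 1/4)"
definition ptS :: "nat \<Rightarrow> real \<times> real" where "ptS l = (real l / (6 * real l - 8), 1/2)"
definition ptT :: "nat \<Rightarrow> real \<times> real" where "ptT l = (1/2, real l / (6 * real l - 8))"

definition stable_mfd :: "nat \<Rightarrow> real \<times> real \<Rightarrow> (real \<times> real) set" where
  "stable_mfd l p = {q \<in> simplex2. (proj_flow l q \<longlongrightarrow> p) at_top}"

abbreviation triangleKLM :: "(real \<times> real) set" where
  "triangleKLM \<equiv> convex hull {ptK, ptL, ptM}"

text \<open>The three stable manifolds end at \<open>N\<close> inside the triangle, but \<open>N\<close> belongs to none of them.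
  It has to be removed as well: otherwise the pieces of the triangle would be joined through \<open>N\<close>
  and would not be open.\<close>

definition cuts :: "nat \<Rightarrow> (real \<times> real) set" where
  "cuts l = closed_segment ptK ptL \<union> closed_segment ptL ptM \<union> closed_segment ptK ptM
     \<union> stable_mfd l ptR \<union> stable_mfd l (ptS l) \<union> stable_mfd l (ptT l) \<union> {ptN l}"

text \<open>The piece of \<open>D\<close> that has the equilibrium \<open>v\<close> in its closure.\<close>

definition region :: "nat \<Rightarrow> (real \<times> real) set \<Rightarrow> real \<times> real \<Rightarrow> (real \<times> real) set" where
  "region l D v =
     (THE C. C \<in> components (interior simplex2 - cuts l) \<and> C \<subseteq> D \<and> v \<in> closure C)"

definition cornerP :: "(real \<times> real) set" where "cornerP = {(x, y). y > 1/2}"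
definition cornerO :: "(real \<times> real) set" where "cornerO = {(x, y). x + y < 1/2}"
definition cornerQ :: "(real \<times> real) set" where "cornerQ = {(x, y). x > 1/2}"

definition reg1 :: "nat \<Rightarrow> (real \<times> real) set" where "reg1 l = region l cornerP ptK"
definition reg2 :: "nat \<Rightarrow> (real \<times> real) set" where "reg2 l = region l cornerP ptL"
definition reg3 :: "nat \<Rightarrow> (real \<times> real) set" where "reg3 l = region l cornerO ptK"
definition reg4 :: "nat \<Rightarrow> (real \<times> real) set" where
  "reg4 l = region l (interior triangleKLM) ptK"
text \<open>\<open>R\<^sub>5\<close> and \<open>R\<^sub>6\<close> enter only through the part of the triangle that they make up together.\<close>
definition reg5_6 :: "nat \<Rightarrow> (real \<times> real) set" where
  "reg5_6 l = region l (interior triangleKLM) ptL"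
definition reg7 :: "nat \<Rightarrow> (real \<times> real) set" where
  "reg7 l = region l (interior triangleKLM) ptM"
definition reg8 :: "nat \<Rightarrow> (real \<times> real) set" where "reg8 l = region l cornerO ptM"
definition reg9 :: "nat \<Rightarrow> (real \<times> real) set" where "reg9 l = region l cornerQ ptL"
definition reg10 :: "nat \<Rightarrow> (real \<times> real) set" where "reg10 l = region l cornerQ ptM"

text \<open>\<open>u + i v\<close> is an eigenvector of the complexification of the real linear map \<open>f\<close>.\<close>

definition complex_eigenvalue :: "('a::real_vector \<Rightarrow> 'a) \<Rightarrow> complex \<Rightarrow> bool" where
  "complex_eigenvalue f \<mu> \<longleftrightarrow> (\<exists>u v. \<not> (u = 0 \<and> v = 0) \<and>
     f u = Re \<mu> *\<^sub>R u - Im \<mu> *\<^sub>R v \<and> f v = Im \<mu> *\<^sub>R u + Re \<mu> *\<^sub>R v)"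

definition hyperbolic_saddle :: "('a::euclidean_space \<Rightarrow> 'a) \<Rightarrow> 'a \<Rightarrow> bool" where
  "hyperbolic_saddle V p \<longleftrightarrow> V p = 0 \<and>
     (\<exists>A. (V has_derivative A) (at p) \<and>
          (\<forall>\<mu>. complex_eigenvalue A \<mu> \<longrightarrow> Re \<mu> \<noteq> 0) \<and>
          (\<exists>\<mu>. complex_eigenvalue A \<mu> \<and> Re \<mu> < 0) \<and>
          (\<exists>\<mu>. complex_eigenvalue A \<mu> \<and> Re \<mu> > 0))"

text \<open>\<open>\<Phi> q t\<close> is the position at time \<open>t\<close> of the point starting at \<open>q\<close>. A repeller is an equilibrium
  that is asymptotically stable for the time-reversed flow.\<close>

definition repeller :: "('a::metric_space \<Rightarrow> real \<Rightarrow> 'a) \<Rightarrow> 'a \<Rightarrow> bool" where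
  "repeller \<Phi> p \<longleftrightarrow> (\<forall>t. \<Phi> p t = p) \<and>
     (\<forall>\<epsilon>>0. \<exists>\<delta>>0. \<forall>q. dist q p < \<delta> \<longrightarrow> (\<forall>t\<le>0. dist (\<Phi> q t) p < \<epsilon>)) \<and>
     (\<exists>\<delta>>0. \<forall>q. dist q p < \<delta> \<longrightarrow> (\<Phi> q \<longlongrightarrow> p) at_bot)"


section \<open>Gromov--Hausdorff convergence\<close>

text \<open>Infimum of the Hausdorff distances between \<open>X\<close> and \<open>Y\<close> over all metrics on the disjoint union
  that extend both given metrics. It is extended-real valued, so an empty family gives \<open>\<infinity>\<close>.\<close>

definition gh_dist ::
  "'a set \<Rightarrow> ('a \<Rightarrow> 'a \<Rightarrow> real) \<Rightarrow> 'b set \<Rightarrow> ('b \<Rightarrow> 'b \<Rightarrow> real) \<Rightarrow> ereal" where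
  "gh_dist X dX Y dY = (INF r \<in> {r. \<exists>d. Metric_space (X <+> Y) d \<and>
       (\<forall>x\<in>X. \<forall>x'\<in>X. d (Inl x) (Inl x') = dX x x') \<and>
       (\<forall>y\<in>Y. \<forall>y'\<in>Y. d (Inr y) (Inr y') = dY y y') \<and>
       (\<forall>x\<in>X. \<exists>y\<in>Y. d (Inl x) (Inr y) \<le> r) \<and>
       (\<forall>y\<in>Y. \<exists>x\<in>X. d (Inl x) (Inr y) \<le> r)}. ereal r)"

definition gh_tendsto ::
  "'a set \<Rightarrow> (real \<Rightarrow> 'a \<Rightarrow> 'a \<Rightarrow> real) \<Rightarrow> 'b set \<Rightarrow> ('b \<Rightarrow> 'b \<Rightarrow> real) \<Rightarrow> real filter \<Rightarrow> bool"
where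
  "gh_tendsto X d Y dY F \<longleftrightarrow> ((\<lambda>t. gh_dist X (d t) Y dY) \<longlongrightarrow> 0) F"


section \<open>Homogeneous spaces of the special orthogonal group\<close>

definition SO :: "(real^'n^'n) set" where
  "SO = {A. rotation_matrix A}"

definition so :: "(real^'n^'n) set" where
  "so = {X. transpose X = - X}"

definition bracket :: "real^'n^'n \<Rightarrow> real^'n^'n \<Rightarrow> real^'n^'n" where
  "bracket X Y = X ** Y - Y ** X"

text \<open>Orthogonal projection onto a subspace. On \<open>so\<close> the Euclidean inner product is
  \<open>X \<bullet> Y = tr (X\<^sup>T Y)\<close>, of which the form \<open>B\<close> below is a positive multiple; so there it is also the
  \<open>B\<close>-orthogonal projection.\<close>

definition oproj :: "'a::euclidean_space set \<Rightarrow> 'a \<Rightarrow> 'a" where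
  "oproj V x = (THE y. y \<in> V \<and> (\<forall>z\<in>V. (x - y) \<bullet> z = 0))"

text \<open>Trace of an endomorphism \<open>f\<close> of the subspace \<open>V\<close>, as the trace of \<open>f \<circ> oproj V\<close>.\<close>

definition trace_on :: "'a::euclidean_space set \<Rightarrow> ('a \<Rightarrow> 'a) \<Rightarrow> real" where
  "trace_on V f = (\<Sum>b\<in>Basis. f (oproj V b) \<bullet> b)"

text \<open>Minus the Killing form of \<open>so\<close>.\<close>

definition B :: "real^'n^'n \<Rightarrow> real^'n^'n \<Rightarrow> real" where
  "B X Y = - trace_on so (\<lambda>Z. bracket X (bracket Y Z))"

definition cosets :: "(real^'n^'n) set \<Rightarrow> (real^'n^'n) set set" where
  "cosets H = (\<lambda>a. (\<lambda>h. a ** h) ` H) ` SO"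

text \<open>An invariant metric on \<open>SO/H\<close> is given by the \<open>Ad H\<close>-invariant symmetric form \<open>g\<close> on \<open>so\<close> that
  is its value at the base point, pulled back along \<open>so \<rightarrow> so/\<hh>\<close>; thus \<open>g\<close> vanishes on the Lie
  algebra of \<open>H\<close> and is positive definite on its complement. Curves in \<open>SO/H\<close> are represented by
  lifts \<open>c\<close> to \<open>SO\<close>; the projection of \<open>c\<close> has speed \<open>\<surd>(g \<xi> \<xi>)\<close> with \<open>\<xi> = c\<^sup>-\<^sup>1 c'\<close>. The result is
  the Riemannian distance. The derivative of a curve that is \<open>piecewise_C1_differentiable_on\<close> may
  blow up at the break points, so the length is required to be finite by means of \<open>has_integral\<close>.\<close>

definition hom_dist ::
  "(real^'n^'n \<Rightarrow> real^'n^'n \<Rightarrow> real) \<Rightarrow> (real^'n^'n) set \<Rightarrow> (real^'n^'n) set \<Rightarrow> real" where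
  "hom_dist g P Q = Inf {r. \<exists>c. c piecewise_C1_differentiable_on {0..1} \<and>
      (\<forall>t\<in>{0..1}. c t \<in> SO) \<and> c 0 \<in> P \<and> c 1 \<in> Q \<and>
      ((\<lambda>t. let \<xi> = transpose (c t) ** vector_derivative c (at t) in sqrt (g \<xi> \<xi>))
         has_integral r) {0..1}}"

text \<open>The normal metric \<open>c B\<close> on \<open>SO/H\<close>, where \<open>h\<close> is the Lie algebra of \<open>H\<close>.\<close>

definition normal_form ::
  "real \<Rightarrow> (real^'n^'n) set \<Rightarrow> real^'n^'n \<Rightarrow> real^'n^'n \<Rightarrow> real" where
  "normal_form c h X Y = c * B (X - oproj h X) (Y - oproj h Y)"


section \<open>The flag manifold\<close>

text \<open>\<open>\<real>\<close>-coordinates of \<open>\<complex>\<^sup>\<l>\<close>, \<open>\<l> = CARD('m option)\<close>: the coordinates \<open>(i, False)\<close> and \<open>(i, True)\<close>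
  are the real and imaginary parts of the \<open>i\<close>-th complex coordinate. The index \<open>None\<close> is the one
  on which \<open>U(1)\<close> and \<open>SO(2)\<close> act; \<open>U(\<l>-1)\<close> and \<open>SO(2\<l>-2)\<close> act on the indices \<open>Some j\<close>.\<close>

type_synonym 'm mat = "real^('m option \<times> bool)^('m option \<times> bool)"

definition Jmat :: "'m::finite mat" where
  "Jmat = (\<chi> p q. if fst p = fst q \<and> snd p \<and> \<not> snd q then 1
                  else if fst p = fst q \<and> \<not> snd p \<and> snd q then - 1 else 0)"

definition blockdiag :: "'m::finite mat \<Rightarrow> bool" where
  "blockdiag A \<longleftrightarrow> (\<forall>p q. (fst p = None) \<noteq> (fst q = None) \<longrightarrow> A $ p $ q = 0)"

definition offdiag :: "'m::finite mat \<Rightarrow> bool" where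
  "offdiag A \<longleftrightarrow> (\<forall>p q. (fst p = None) = (fst q = None) \<longrightarrow> A $ p $ q = 0)"

definition U_grp :: "'m::finite mat set" where
  "U_grp = {A \<in> SO. A ** Jmat = Jmat ** A}"

definition U1U_grp :: "'m::finite mat set" where
  "U1U_grp = {A \<in> U_grp. blockdiag A}"

text \<open>The last condition says that the 2-by-2 block has determinant 1; then so does the other one.\<close>

definition SO2SO_grp :: "'m::finite mat set" where
  "SO2SO_grp = {A \<in> SO. blockdiag A \<and>
     A $ (None, False) $ (None, False) * A $ (None, True) $ (None, True)
     - A $ (None, False) $ (None, True) * A $ (None, True) $ (None, False) = 1}"

definition u_alg :: "'m::finite mat set" where
  "u_alg = {X \<in> so. X ** Jmat = Jmat ** X}"

definition so2so_alg :: "'m::finite mat set" where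
  "so2so_alg = {X \<in> so. blockdiag X}"

definition k_alg :: "'m::finite mat set" where
  "k_alg = {X \<in> u_alg. blockdiag X}"

text \<open>The isotropy summands: \<open>k_alg + m1\<close> is \<open>u_alg\<close>, \<open>k_alg + m3\<close> is \<open>so2so_alg\<close>, and \<open>k_alg + m2\<close>
  is the image of \<open>u_alg\<close> under conjugation by an element of \<open>O(2\<l>)\<close> of determinant \<open>-1\<close>.\<close>

definition m1 :: "'m::finite mat set" where
  "m1 = {X \<in> so. offdiag X \<and> X ** Jmat = Jmat ** X}"

definition m2 :: "'m::finite mat set" where
  "m2 = {X \<in> so. offdiag X \<and> X ** Jmat = - (Jmat ** X)}"

definition m3 :: "'m::finite mat set" where
  "m3 = {X \<in> so. blockdiag X \<and> X ** Jmat = - (Jmat ** X)}"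

definition m_sp :: "'m::finite mat set" where
  "m_sp = {X \<in> so. \<forall>Z\<in>k_alg. B X Z = 0}"

definition flag_form :: "real \<times> real \<Rightarrow> 'm::finite mat \<Rightarrow> 'm mat \<Rightarrow> real" where
  "flag_form = (\<lambda>(x, y) X Y.
       x * B (oproj m1 X) (oproj m1 Y)
     + y * B (oproj m2 X) (oproj m2 Y)
     + (1 - x - y) * B (oproj m3 X) (oproj m3 Y))"

definition flag_mfd :: "'m::finite mat set set" where
  "flag_mfd = cosets U1U_grp"

text \<open>The metrics \<open>g\<^sub>t\<close> of the projected Ricci flow starting at \<open>g\<^sub>0\<close>, as distances on \<open>flag_mfd\<close>.\<close>

definition flag_dist_at ::
  "nat \<Rightarrow> real \<times> real \<Rightarrow> real \<Rightarrow> 'm::finite mat set \<Rightarrow> 'm mat set \<Rightarrow> real" where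
  "flag_dist_at l g0 t = hom_dist (flag_form (proj_flow l g0 t))"


subsection \<open>Einstein and Kaehler metrics\<close>

text \<open>Invariant tensors on the flag manifold are identified with their values on \<open>m_sp\<close>, the tangent
  space at the base point. \<open>LC g X Y\<close> is the Nomizu operator
  \<open>\<Lambda>(X) Y = 1/2 [X, Y]\<^sub>\<mm> + U(X, Y)\<close> of the Levi-Civita connection of the invariant metric \<open>g\<close>, and
  \<open>curv g\<close> is its curvature tensor
  \<open>R(X, Y) = [\<Lambda>(X), \<Lambda>(Y)] - \<Lambda>([X, Y]\<^sub>\<mm>) - ad [X, Y]\<^sub>\<kk>\<close> (Kobayashi and Nomizu, vol. II, ch. X).\<close>

definition LC ::
  "('m::finite mat \<Rightarrow> 'm mat \<Rightarrow> real) \<Rightarrow> 'm mat \<Rightarrow> 'm mat \<Rightarrow> 'm mat" where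
  "LC g X Y = (1/2) *\<^sub>R oproj m_sp (bracket X Y) +
     (THE W. W \<in> m_sp \<and> (\<forall>Z\<in>m_sp.
        2 * g W Z = g (oproj m_sp (bracket Z X)) Y + g X (oproj m_sp (bracket Z Y))))"

definition curv ::
  "('m::finite mat \<Rightarrow> 'm mat \<Rightarrow> real) \<Rightarrow> 'm mat \<Rightarrow> 'm mat \<Rightarrow> 'm mat \<Rightarrow> 'm mat" where
  "curv g X Y Z = LC g X (LC g Y Z) - LC g Y (LC g X Z)
     - LC g (oproj m_sp (bracket X Y)) Z - bracket (oproj k_alg (bracket X Y)) Z"

definition ricci :: "('m::finite mat \<Rightarrow> 'm mat \<Rightarrow> real) \<Rightarrow> 'm mat \<Rightarrow> 'm mat \<Rightarrow> real" where
  "ricci g Y Z = trace_on m_sp (\<lambda>X. curv g X Y Z)"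

definition einstein :: "('m::finite mat \<Rightarrow> 'm mat \<Rightarrow> real) \<Rightarrow> bool" where
  "einstein g \<longleftrightarrow> (\<exists>\<mu>. \<forall>Y\<in>m_sp. \<forall>Z\<in>m_sp. ricci g Y Z = \<mu> * g Y Z)"

text \<open>Only the restriction of \<open>J\<close> to \<open>m_sp\<close> matters. The last condition, vanishing of the Nijenhuis
  tensor, is integrability.\<close>

definition inv_complex_structure :: "('m::finite mat \<Rightarrow> 'm mat) \<Rightarrow> bool" where
  "inv_complex_structure J \<longleftrightarrow> linear J \<and>
     (\<forall>X\<in>m_sp. J X \<in> m_sp \<and> J (J X) = - X) \<and>
     (\<forall>a\<in>U1U_grp. \<forall>X\<in>m_sp. J (a ** X ** transpose a) = a ** J X ** transpose a) \<and>
     (\<forall>X\<in>m_sp. \<forall>Y\<in>m_sp.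
        oproj m_sp (bracket (J X) (J Y)) - oproj m_sp (bracket X Y)
        - J (oproj m_sp (bracket (J X) Y)) - J (oproj m_sp (bracket X (J Y))) = 0)"

text \<open>\<open>g\<close> is Hermitian and its fundamental form \<open>\<omega>(X, Y) = g (J X) Y\<close> is closed; for an invariant
  2-form, \<open>d\<omega>(X, Y, Z)\<close> is up to a constant factor the cyclic sum of \<open>\<omega>([X, Y]\<^sub>\<mm>, Z)\<close>.\<close>

definition kaehler :: "('m::finite mat \<Rightarrow> 'm mat \<Rightarrow> real) \<Rightarrow> bool" where
  "kaehler g \<longleftrightarrow> (\<exists>J. inv_complex_structure J \<and>
     (\<forall>X\<in>m_sp. \<forall>Y\<in>m_sp. g (J X) (J Y) = g X Y) \<and>
     (\<forall>X\<in>m_sp. \<forall>Y\<in>m_sp. \<forall>Z\<in>m_sp.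
        g (J (oproj m_sp (bracket X Y))) Z
        + g (J (oproj m_sp (bracket Y Z))) X
        + g (J (oproj m_sp (bracket Z X))) Y = 0))"

end

theory Submission
  imports Defs
begin

text \<open>The flow part is planar dynamics: the normalized scalar curvature is a Lyapunov function inside the
  simplex, the largest parameter is one in each corner, so every orbit converges to an equilibrium, and
  each basin cut out of the triangle or of a corner is connected, hence a region. For the Einstein
  metrics the involutions \<open>X \<mapsto> D X D\<close> and \<open>X \<mapsto> - J X J\<close> split \<open>so\<close> into the isotropy summands, and the
  Ricci form is diagonal by a trace computation; an invariant complex structure is \<open>\<plusminus> J\<close> on each summand,
  and closedness of the fundamental form forces \<open>\<plusminus> x \<plusminus> y \<plusminus> z = 0\<close>. For the Gromov--Hausdorff limits, the
  fibres of \<open>SO/(U(1) \<times> U(l-1)) \<rightarrow> SO/U(l)\<close> or \<open>SO/(SO(2) \<times> SO(2l-2))\<close> collapse at \<open>K\<close> and \<open>L\<close> while the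
  metrics converge on the base, so the projection is an almost isometry. At \<open>O\<close>, \<open>P\<close> and \<open>Q\<close> two of
  the three parameters tend to 0, and every rotation is a bounded product of rotations along the
  corresponding two summands, so the diameter tends to 0.\<close>

text \<open>For the collapse the obstacle is that paths are only piecewise C1 and their derivatives
  may blow up at break points. Short arcs are therefore replaced by the estimate d(a, b) <= C |a -
  b|, uniform in the metric; it comes from writing a rotation A as a product of a fixed number of
  plane rotations of total angle at most C |A - 1|. Motion along the fibres is paid for by their
  diameter.

  The central elements \<open>Hmat a b\<close> of the isotropy algebra serve three ends: the
  isotropy groups of the flag manifold and of both limits are their stabilizers, their orbit maps
  show that distances separate cosets, and pairing them with brackets yields closed invariant
  2-forms. The factor 1/2 in the limit metrics is the common value of the two parameters that
  survive at \<open>K\<close>, \<open>L\<close> or \<open>M\<close>.\<close>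

notation scaleR (infixr "*R" 75)

abbreviation "flow \<equiv> proj_flow"

section \<open>Ordinary differential equations\<close>

lemma continuous_antiderivative:
 fixes f :: "real => 'a::euclidean_space"
 assumes "continuous_on UNIV f"
 obtains G where "G 0 = 0" "!!t. (G has_vector_derivative f t) (at t)"
proof -
 have "EX F. ALL x::real. - \<infinity> < ereal x --> ereal x < \<infinity> --> (F has_vector_derivative f x) (at x)"
  by (rule einterval_antiderivative)
   (use assms in "auto simp: continuous_on_eq_continuous_at")
 then obtain F where F: "!!x. (F has_vector_derivative f x) (at x)" by auto
 show ?thesis
  by (rule that[of "%t. F t - F 0"]) (auto intro!: derivative_eq_intros F)
qed

lemma has_vector_derivative_reflect:
 assumes "(f has_vector_derivative v) (at (- t))"
 shows "((%t. f (- t)) has_vector_derivative - v) (at t)"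
proof -
 have "(uminus has_vector_derivative - 1) (at t)"
  by (auto intro!: derivative_eq_intros simp flip: has_real_derivative_iff_has_vector_derivative)
 from vector_diff_chain_at[OF this] assms show ?thesis by (auto simp: o_def)
qed

text \<open>Integrating against the weight exp (2 L |t|) gains a factor 1 / (2 L), which beats a
  Lipschitz constant L and leaves the contraction factor 1/2.\<close>

lemma exp_weighted_bound:
 fixes G :: "real => 'a::real_normed_vector"
 assumes "L > 0" and G: "!!t. (G has_vector_derivative g t) (at t)" and "G 0 = 0"
  and le: "!!t. norm (g t) <= C * exp (2 * L * abs t)"
 shows "norm (G t) <= C / (2 * L) * exp (2 * L * abs t)"
proof -
 have C: "C >= 0" using le[of 0] order_trans[OF norm_ge_zero, of "g 0" C] by simp
 have pos: "norm (H t) <= C / (2 * L) * exp (2 * L * t)"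
  if "t >= 0" and H: "!!t. (H has_vector_derivative h t) (at t)" and "H 0 = 0"
   and hle: "!!t. norm (h t) <= C * exp (2 * L * abs t)"
  for t and H h :: "real => 'a"
 proof (cases "t = 0")
  case True thus ?thesis using `H 0 = 0` C `L > 0` by simp
 next
  case False
  hence "0 < t" using that by simp
  hence "norm (H t - H 0) <= C / (2 * L) * exp (2 * L * t) - C / (2 * L) * exp (2 * L * 0)"
  proof (rule differentiable_bound_general)
   show "continuous_on {0..t} H"
    using H by (meson has_vector_derivative_at_within has_vector_derivative_continuous continuous_on_eq_continuous_within)
   show "continuous_on {0..t} (%t. C / (2 * L) * exp (2 * L * t))"
    by (intro continuous_intros)
   show "((%t. C / (2 * L) * exp (2 * L * t)) has_vector_derivative C * exp (2 * L * x)) (at x)" for x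
    using `L > 0`
    by (auto intro!: derivative_eq_intros simp flip: has_real_derivative_iff_has_vector_derivative)
   show "norm (h x) <= C * exp (2 * L * x)" if "0 < x" "x < t" for x
    using hle[of x] that by simp
  qed (use H in auto)
  moreover have "C / (2 * L) * exp (2 * L * 0) >= 0" using C `L > 0` by simp
  ultimately show ?thesis using `H 0 = 0` by (simp only: diff_zero)
 qed
 show ?thesis
 proof (cases "t >= 0")
  case True
  thus ?thesis using pos[OF True G `G 0 = 0` le] by simp
 next
  case False
  hence "norm ((%s. G (- s)) (- t)) <= C / (2 * L) * exp (2 * L * (- t))"
  proof (intro pos)
   show "((%s. G (- s)) has_vector_derivative - g (- s)) (at s)" for s
    by (rule has_vector_derivative_reflect) (rule G)
   show "norm (- g (- t)) <= C * exp (2 * L * abs t)" for t using le[of "- t"] by simp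
  qed (use `G 0 = 0` in auto)
  thus ?thesis using False by simp
 qed
qed

text \<open>The Picard operator is a contraction for the norm \<open>sup |u t| exp (- 2 L |t|)\<close>, so one
  application of the fixed point theorem yields the solution for all times.\<close>

theorem lipschitz_ode_solution:
 fixes W :: "'a::euclidean_space => 'a"
 assumes lip: "!!u v. norm (W u - W v) <= L * norm (u - v)"
 obtains ph where "ph 0 = p" "!!t. (ph has_vector_derivative W (ph t)) (at t)"
proof -
 \<comment> \<open>\<open>L\<close> may be zero or negative, while the weight needs a positive
   rate.\<close>
 define M where "M = max L 1"
 have M: "M > 0" and lipM: "!!u v. norm (W u - W v) <= M * norm (u - v)"
 proof -
  show "M > 0" by (simp add: M_def)
  show "norm (W u - W v) <= M * norm (u - v)" for u v
   by (rule order_trans[OF lip]) (simp add: M_def mult_right_mono)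
 qed
 have contW: "continuous_on UNIV W"
  by (rule lipschitz_on_continuous_on[of M])
   (use lipM M in "auto simp: lipschitz_on_def dist_norm")
 \<comment> \<open>The unknown is rescaled: the bounded function \<open>u\<close> stands for the
   curve \<open>p + exp (2 M |t|) u t\<close>, which itself may grow exponentially.\<close>
 define f where "f u t = W (p + exp (2 * M * abs t) *R apply_bcontfun u t)"
  for u :: "real \<Rightarrow>\<^sub>C 'a" and t
 have contf: "continuous_on UNIV (f u)" for u
  unfolding f_def
  by (intro continuous_on_compose2[OF contW] continuous_intros) auto
 define G where "G u = (SOME G. G 0 = 0 & (ALL t. (G has_vector_derivative f u t) (at t)))" for u
 have "EX G. G 0 = 0 & (ALL t. (G has_vector_derivative f u t) (at t))" for u
  using continuous_antiderivative[OF contf] by metis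
 from someI_ex[OF this] have G0: "G u 0 = 0"
  and G: "(G u has_vector_derivative f u t) (at t)" for u t
  unfolding G_def by blast+
 have contG: "continuous_on UNIV (G u)" for u
  using G by (meson continuous_at_imp_continuous_on has_vector_derivative_continuous)
 have diff: "norm (f u t - f v t) <= (M * dist u v) * exp (2 * M * abs t)" for u v t
 proof -
  have "norm (f u t - f v t) <= M * norm (exp (2 * M * abs t) *R (apply_bcontfun u t - apply_bcontfun v t))"
   unfolding f_def by (rule order_trans[OF lipM]) (simp add: algebra_simps)
  also have "... = M * (exp (2 * M * abs t) * dist (apply_bcontfun u t) (apply_bcontfun v t))"
   by (simp add: dist_norm)
  also have "... <= M * (exp (2 * M * abs t) * dist u v)"
   using M by (intro mult_left_mono dist_bounded) auto
  finally show ?thesis by (simp add: mult_ac)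
 qed
 have Gdiff: "norm (G u t - G v t) <= dist u v / 2 * exp (2 * M * abs t)" for u v t
 proof -
  have "norm ((%t. G u t - G v t) t) <= (M * dist u v) / (2 * M) * exp (2 * M * abs t)"
   by (rule exp_weighted_bound[OF M, where g = "%t. f u t - f v t"])
    (use G0 diff in "auto intro!: derivative_intros G")
  thus ?thesis using M by simp
 qed
 have Gzero: "norm (G 0 t) <= norm (W p) / (2 * M) * exp (2 * M * abs t)" for t
 proof (rule exp_weighted_bound[OF M, where g = "f 0"])
  show "(G 0 has_vector_derivative f 0 t) (at t)" for t by (rule G)
  show "norm (f 0 t) <= norm (W p) * exp (2 * M * abs t)" for t
   using M mult_left_mono[of 1 "exp (2 * M * abs t)" "norm (W p)"]
   by (simp add: f_def zero_bcontfun.rep_eq)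
 qed (rule G0)
 define T where "T u = Bcontfun (%t. exp (- (2 * M * abs t)) *R G u t)" for u
 have Tmem: "(%t. exp (- (2 * M * abs t)) *R G u t) : bcontfun" for u
 proof (rule bcontfun_normI[where b = "dist u 0 / 2 + norm (W p) / (2 * M)"])
  show "continuous_on UNIV (%t. exp (- (2 * M * abs t)) *R G u t)"
   by (intro continuous_intros continuous_on_subset[OF contG]) auto
  fix t
  have "norm (G u t) <= norm (G u t - G 0 t) + norm (G 0 t)"
   by (metis diff_add_cancel norm_triangle_ineq)
  also have "... <= (dist u 0 / 2 + norm (W p) / (2 * M)) * exp (2 * M * abs t)"
   using Gdiff[of u t 0] Gzero[of t] by (simp add: algebra_simps)
  finally have "exp (- (2 * M * abs t)) * norm (G u t)
    <= exp (- (2 * M * abs t)) * ((dist u 0 / 2 + norm (W p) / (2 * M)) * exp (2 * M * abs t))"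
   by (rule mult_left_mono) simp
  thus "norm (exp (- (2 * M * abs t)) *R G u t) <= dist u 0 / 2 + norm (W p) / (2 * M)"
   by (simp add: exp_minus field_simps)
 qed
 have Tapp: "apply_bcontfun (T u) t = exp (- (2 * M * abs t)) *R G u t" for u t
  using Tmem by (simp add: T_def Bcontfun_inverse)
 have contr: "dist (T u) (T v) <= (1/2) * dist u v" for u v
 proof (rule dist_bound)
  fix t
  have "dist (apply_bcontfun (T u) t) (apply_bcontfun (T v) t) = exp (- (2 * M * abs t)) * norm (G u t - G v t)"
   by (simp add: Tapp dist_norm flip: scaleR_diff_right)
  also have "... <= exp (- (2 * M * abs t)) * (dist u v / 2 * exp (2 * M * abs t))"
   by (intro mult_left_mono Gdiff) auto
  finally show "dist (apply_bcontfun (T u) t) (apply_bcontfun (T v) t) <= (1/2) * dist u v"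
   by (simp add: exp_minus field_simps)
 qed
 have "\<exists>!u\<in>UNIV. T u = u"
  by (rule Banach_fix[where c = "1/2"]) (use contr in "auto simp: complete_UNIV")
 then obtain u where u: "T u = u" by auto
 have Gu: "exp (2 * M * abs t) *R apply_bcontfun u t = G u t" for t
  using Tapp[of u t] u by (simp add: exp_minus)
 show ?thesis
 proof (rule that[of "%t. p + G u t"])
  show "p + G u 0 = p" by (simp add: G0)
  show "((%t. p + G u t) has_vector_derivative W (p + G u t)) (at t)" for t
   using G[of u t] by (auto simp: f_def Gu intro!: derivative_eq_intros)
 qed
qed

lemma gronwall_le:
 fixes u :: "real => real"
 assumes "!!t. t >= 0 ==> (u has_real_derivative u' t) (at t)" and "!!t. t >= 0 ==> u' t <= c * u t" and "t >= 0"
 shows "u t <= u 0 * exp (c * t)"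
proof -
 have "u t * exp (- c * t) <= u 0 * exp (- c * 0)"
 proof (rule DERIV_nonpos_imp_nonincreasing[OF `t >= 0`])
  fix s assume "0 <= s" "s <= t"
  have "((%t. u t * exp (- c * t)) has_real_derivative (u' s - c * u s) * exp (- c * s)) (at s)"
   using `0 <= s` by (auto intro!: derivative_eq_intros assms(1) simp: algebra_simps)
  moreover have "(u' s - c * u s) * exp (- c * s) <= 0"
   using assms(2)[OF `0 <= s`] by (simp add: mult_le_0_iff)
  ultimately show "EX y. ((%t. u t * exp (- c * t)) has_real_derivative y) (at s) & y <= 0" by blast
 qed
 thus ?thesis by (simp add: exp_minus field_simps)
qed

lemma has_real_derivative_norm_sq_diff:
 fixes ph :: "real => 'a::real_inner"
 assumes "(ph has_vector_derivative v) (at t)"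
 shows "((%t. (norm (ph t - p))^2) has_real_derivative 2 * (v \<bullet> (ph t - p))) (at t)"
proof -
 have "((%t. (ph t - p) \<bullet> (ph t - p)) has_derivative
   (%h. (ph t - p) \<bullet> (h *R v) + (h *R v) \<bullet> (ph t - p))) (at t)"
  using assms unfolding has_vector_derivative_def
  by (auto intro!: derivative_eq_intros)
 moreover have "(%h. (ph t - p) \<bullet> (h *R v) + (h *R v) \<bullet> (ph t - p)) = (*) (2 * (v \<bullet> (ph t - p)))"
  by (simp add: fun_eq_iff inner_commute)
 ultimately show ?thesis
  by (simp add: has_field_derivative_def power2_norm_eq_inner)
qed

text \<open>Gronwall is applied to the squared distance, which is differentiable even where the two
  solutions meet.\<close>

lemma lipschitz_ode_forward_dist:
 fixes ph ps :: "real => 'a::real_inner"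
 assumes lip: "!!u v. u : S ==> v : S ==> norm (W u - W v) <= L * norm (u - v)"
  and ph: "!!t. t >= 0 ==> ph t : S & (ph has_vector_derivative W (ph t)) (at t)"
  and ps: "!!t. t >= 0 ==> ps t : S & (ps has_vector_derivative W (ps t)) (at t)"
  and "t >= 0"
 shows "dist (ph t) (ps t) <= dist (ph 0) (ps 0) * exp (L * t)"
proof -
 have "(norm ((ph t - ps t) - 0))^2 <= (norm ((ph 0 - ps 0) - 0))^2 * exp (2 * L * t)"
 proof (rule gronwall_le[OF _ _ `t >= 0`])
  fix t :: real assume t: "t >= 0"
  show "((%t. (norm (ph t - ps t - 0))^2) has_real_derivative
    2 * ((W (ph t) - W (ps t)) \<bullet> (ph t - ps t - 0))) (at t)"
   by (rule has_real_derivative_norm_sq_diff) (use ph ps t in "auto intro!: derivative_intros")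
  have "(W (ph t) - W (ps t)) \<bullet> (ph t - ps t) <= norm (W (ph t) - W (ps t)) * norm (ph t - ps t)"
   by (rule norm_cauchy_schwarz)
  also have "... <= L * norm (ph t - ps t) * norm (ph t - ps t)"
   using ph ps t by (intro mult_right_mono lip) auto
  finally show "2 * ((W (ph t) - W (ps t)) \<bullet> (ph t - ps t - 0)) <= 2 * L * (norm (ph t - ps t - 0))^2"
   by (simp add: power2_eq_square)
 qed
 also have "... = (dist (ph 0) (ps 0) * exp (L * t))^2"
  by (simp add: power_mult_distrib dist_norm mult.assoc flip: exp_double)
 finally have "(dist (ph t) (ps t))^2 <= (dist (ph 0) (ps 0) * exp (L * t))^2"
  by (simp add: dist_norm)
 thus ?thesis by (rule power2_le_imp_le) simp
qed

lemma lipschitz_ode_dist: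
 fixes ph ps :: "real => 'a::real_inner"
 assumes lip: "!!u v. u : S ==> v : S ==> norm (W u - W v) <= L * norm (u - v)"
  and ph: "!!t. ph t : S & (ph has_vector_derivative W (ph t)) (at t)"
  and ps: "!!t. ps t : S & (ps has_vector_derivative W (ps t)) (at t)"
 shows "dist (ph t) (ps t) <= dist (ph 0) (ps 0) * exp (L * abs t)"
proof (cases "t >= 0")
 case True
 thus ?thesis using lipschitz_ode_forward_dist[of S W L ph ps t] assms by auto
next
 case False
 have rev: "((%t. f (- t)) has_vector_derivative - W (f (- t))) (at t)"
  if "!!t. (f has_vector_derivative W (f t)) (at t)" for f t
  by (rule has_vector_derivative_reflect) (rule that)
 have "dist (ph (- (- t))) (ps (- (- t))) <= dist (ph (- 0)) (ps (- 0)) * exp (L * - t)"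
  by (rule lipschitz_ode_forward_dist[of S "%u. - W u" L "%t. ph (- t)" "%t. ps (- t)" "- t"])
   (use False lip ph ps in "auto intro!: rev simp: norm_minus_commute")
 thus ?thesis using False by simp
qed

text \<open>Gronwall's inequality for \<open>h^2\<close>, run in both directions from
  \<open>t0\<close>. It will be applied to equations of invariant lines, which satisfy h' = h k with
  k bounded.\<close>

lemma deriv_le_abs_zero:
 fixes h :: "real => real"
 assumes d: "!!t. (h has_real_derivative h' t) (at t)" and le: "!!t. abs (h' t) <= C * abs (h t)" and "h t0 = 0"
 shows "h t = 0"
proof -
 have sq: "(h t0)^2 * exp (2 * C * abs (t - t0)) >= (h t)^2"
 proof (cases "t >= t0")
  case True
  have "(h (t0 + (t - t0)))^2 <= (h (t0 + 0))^2 * exp (2 * C * (t - t0))"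
  proof (rule gronwall_le)
   fix s :: real
   show "((%s. (h (t0 + s))^2) has_real_derivative 2 * h (t0 + s) * h' (t0 + s)) (at s)"
    using d[of "t0 + s"] by (auto intro!: derivative_eq_intros DERIV_chain2[OF d])
   have "h (t0 + s) * h' (t0 + s) <= abs (h (t0 + s)) * abs (h' (t0 + s))" by (metis abs_mult abs_ge_self)
   also have "... <= abs (h (t0 + s)) * (C * abs (h (t0 + s)))" by (intro mult_left_mono le) auto
   also have "... = C * (h (t0 + s))^2"
    by (metis abs_mult_self_eq mult.left_commute power2_eq_square)
   finally show "2 * h (t0 + s) * h' (t0 + s) <= 2 * C * (h (t0 + s))^2" by simp
  qed (use True in auto)
  thus ?thesis using True by simp
 next
  case False
  have "(h (t0 - (t0 - t)))^2 <= (h (t0 - 0))^2 * exp (2 * C * (t0 - t))"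
  proof (rule gronwall_le)
   fix s :: real
   show "((%s. (h (t0 - s))^2) has_real_derivative - (2 * h (t0 - s) * h' (t0 - s))) (at s)"
    using d[of "t0 - s"] by (auto intro!: derivative_eq_intros DERIV_chain2[OF d])
   have "- (h (t0 - s) * h' (t0 - s)) <= abs (h (t0 - s)) * abs (h' (t0 - s))"
    by (metis abs_mult abs_ge_minus_self)
   also have "... <= abs (h (t0 - s)) * (C * abs (h (t0 - s)))" by (intro mult_left_mono le) auto
   also have "... = C * (h (t0 - s))^2"
    by (metis abs_mult_self_eq mult.left_commute power2_eq_square)
   finally show "- (2 * h (t0 - s) * h' (t0 - s)) <= 2 * C * (h (t0 - s))^2" by simp
  qed (use False in auto)
  thus ?thesis using False by simp
 qed
 thus ?thesis using `h t0 = 0` by simp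
qed

text \<open>Up to the first time at which \<open>f\<close> reaches the level \<open>d\<close>, it
  has only been nonincreasing, so it cannot have climbed there.\<close>

lemma trapped_below:
 fixes f :: "real => real"
 assumes d: "!!t. t >= 0 ==> (f has_real_derivative f' t) (at t)"
  and neg: "!!t. t >= 0 ==> f t < d ==> f' t <= 0" and "f 0 < d" and "t >= 0"
 shows "f t < d"
proof (rule ccontr)
 assume *: "~ f t < d"
 have cont: "continuous_on {0..t} f"
  by (rule DERIV_continuous_on, rule has_field_derivative_at_within, rule d) auto
 define A where "A = {s : {0..t}. f s : {d..}}"
 have "closed A" using continuous_closed_preimage[OF cont, of "{d..}"]
  by (simp add: A_def vimage_def Int_def)
 moreover have "A <= {0..t}" by (auto simp: A_def)
 ultimately have "compact A" by (metis compact_Icc compact_Int_closed inf.absorb2)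
 moreover have "t : A" using * `t >= 0` by (auto simp: A_def)
 ultimately obtain s where s: "s : A" "!!r. r : A ==> s <= r" using compact_attains_inf[of A] by auto
 have s0: "0 <= s" "s <= t" "f s >= d" using s(1) by (auto simp: A_def)
 have "f s <= f 0"
 proof (rule DERIV_nonpos_imp_decreasing_open[OF s0(1)])
  fix r assume "0 < r" "r < s"
  hence "r ~: A" using s(2)[of r] by auto
  hence "f r < d" using `0 < r` `r < s` s0 by (auto simp: A_def)
  thus "EX y. (f has_real_derivative y) (at r) & y <= 0"
   using d[of r] neg[of r] `0 < r` by auto
 next
  show "continuous_on {0..s} f" by (rule continuous_on_subset[OF cont]) (use s0 in auto)
 qed
 thus False using s0 `f 0 < d` by simp
qed

text \<open>Half of the decay rate of the linear part absorbs the remainder of the expansion near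
  \<open>p\<close>, the other half survives.\<close>

lemma derivative_inner_bound:
 fixes V :: "'a::real_inner => 'a"
 assumes A: "(V has_derivative A) (at p)" and "V p = 0" and "c > 0"
  and neg: "!!u. A u \<bullet> u <= - (2 * c) * (norm u)^2"
 obtains de where "de > 0" "!!q. norm (q - p) < de ==> V q \<bullet> (q - p) <= - c * (norm (q - p))^2"
proof -
 from A `c > 0` obtain de where de: "de > 0"
  "!!q. norm (q - p) < de ==> norm (V q - V p - A (q - p)) <= c * norm (q - p)"
  unfolding has_derivative_at_alt by blast
 show ?thesis
 proof (rule that[OF de(1)])
  fix q assume "norm (q - p) < de"
  hence "norm (V q - A (q - p)) <= c * norm (q - p)" using de(2) `V p = 0` by simp
  hence "(V q - A (q - p)) \<bullet> (q - p) <= c * norm (q - p) * norm (q - p)"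
   using order_trans[OF norm_cauchy_schwarz mult_right_mono] norm_ge_zero by blast
  thus "V q \<bullet> (q - p) <= - c * (norm (q - p))^2"
   using neg[of "q - p"] by (simp add: inner_diff_left power2_eq_square)
 qed
qed

text \<open>The squared distance to \<open>p\<close> decays like exp (- 2 c t). Since the estimate
  \<open>neg\<close> is available only inside the ball, it must first be shown that the orbit does
  not leave the ball.\<close>

lemma exponential_attraction:
 fixes V :: "'a::real_inner => 'a"
 assumes "c > 0" "de > 0"
  and neg: "!!q. norm (q - p) < de ==> V q \<bullet> (q - p) <= - c * (norm (q - p))^2"
  and sol: "!!t. t >= 0 ==> (ph has_vector_derivative V (ph t)) (at t)"
  and start: "norm (ph 0 - p) < de"
 shows "t >= 0 ==> norm (ph t - p) <= norm (ph 0 - p)" and "(ph \<longlongrightarrow> p) at_top"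
proof -
 let ?u = "%t. (norm (ph t - p))^2"
 have du: "(?u has_real_derivative 2 * (V (ph t) \<bullet> (ph t - p))) (at t)" if "t >= 0" for t
  by (rule has_real_derivative_norm_sq_diff[OF sol[OF that]])
 have small: "norm (ph t - p) < de" if "t >= 0" for t
 proof -
  have "?u t < de^2"
  proof (rule trapped_below[OF du _ _ that])
   fix t :: real assume "t >= 0" "?u t < de^2"
   hence "norm (ph t - p) < de" using `de > 0` power_less_imp_less_base by (metis less_imp_le)
   hence "V (ph t) \<bullet> (ph t - p) <= - c * (norm (ph t - p))^2" by (rule neg)
   also have "... <= 0" using `c > 0` by simp
   finally show "2 * (V (ph t) \<bullet> (ph t - p)) <= 0" by simp
  qed (use start in "auto intro: power_strict_mono")
  thus ?thesis using `de > 0` power_less_imp_less_base by (metis less_imp_le)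
 qed
 have decay: "?u t <= ?u 0 * exp (- (2 * c) * t)" if "t >= 0" for t
  by (rule gronwall_le[OF du _ that]) (use neg[OF small] in auto)
 show "norm (ph t - p) <= norm (ph 0 - p)" if "t >= 0"
 proof -
  have "?u t <= ?u 0 * 1"
   by (rule order_trans[OF decay[OF that]], rule mult_left_mono) (use that `c > 0` in auto)
  thus ?thesis using power2_le_imp_le[of "norm (ph t - p)" "norm (ph 0 - p)"] by simp
 qed
 have "((%t. ?u 0 * exp (- (2 * c) * t)) \<longlongrightarrow> ?u 0 * 0) at_top"
  by (intro tendsto_intros filterlim_compose[OF exp_at_bot]
     filterlim_tendsto_neg_mult_at_bot[OF tendsto_const _ filterlim_ident])
    (use `c > 0` in auto)
 hence "(?u \<longlongrightarrow> 0) at_top"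
  by (intro tendsto_sandwich[of "%_. 0" ?u at_top "%t. ?u 0 * exp (- (2 * c) * t)"])
   (use decay in "auto simp: eventually_at_top_linorder")
 hence "((%t. sqrt (?u t)) \<longlongrightarrow> sqrt 0) at_top" by (intro tendsto_intros)
 thus "(ph \<longlongrightarrow> p) at_top" by (simp add: tendsto_dist_iff[of ph] dist_norm)
qed

section \<open>Limit points of trajectories\<close>

definition omega_limit :: "(real => 'a::topological_space) => 'a set" where
 "omega_limit ph = {q. EX s. filterlim s at_top sequentially & (%n::nat. ph (s n)) \<longlonglongrightarrow> q}"

text \<open>A trajectory cannot commute between the disjoint balls around the points of \<open>F\<close>, since its
  tail is connected.\<close>

lemma omega_limit_finite_tendsto:
 fixes ph :: "real => 'a::metric_space"
 assumes "compact X" and X: "!!t. t >= 0 ==> ph t : X" and cont: "continuous_on {0..} ph"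
  and fin: "finite F" and sub: "omega_limit ph <= F"
 shows "EX q:F. (ph \<longlongrightarrow> q) at_top"
proof -
 have ev: "EX T>=0. ALL t>=T. EX q:F. dist (ph t) q < ep" if "ep > 0" for ep
 proof (rule ccontr)
  assume "~ ?thesis"
  hence "ALL n::nat. EX t>=real n. ALL q:F. dist (ph t) q >= ep" by (meson not_less of_nat_0_le_iff)
  then obtain s where s: "!!n::nat. s n >= real n" "!!n q. q : F ==> dist (ph (s n)) q >= ep" by metis
  have "ALL n. ph (s n) : X" using X s(1) by (meson of_nat_0_le_iff order_trans)
  from seq_compactE[OF `compact X`[unfolded compact_eq_seq_compact_metric], of "%n. ph (s n)", OF this]
  obtain q r where q: "strict_mono (r::nat => nat)" "(%n. ph (s (r n))) \<longlonglongrightarrow> q"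
   unfolding o_def by blast
  have "filterlim s at_top sequentially"
   by (rule filterlim_at_top_mono[OF filterlim_real_sequentially]) (use s in auto)
  hence "filterlim (%n. s (r n)) at_top sequentially"
   by (rule filterlim_compose) (rule filterlim_subseq[OF q(1)])
  hence "q : F" using q(2) sub by (auto simp: omega_limit_def)
  have "(%n. dist (ph (s (r n))) q) \<longlonglongrightarrow> 0" by (rule tendsto_dist_iff[THEN iffD1, OF q(2)])
  hence "\<forall>\<^sub>F n in sequentially. dist (ph (s (r n))) q < ep"
   using `ep > 0` by (rule order_tendstoD)
  then obtain n where "dist (ph (s (r n))) q < ep"
   using eventually_happens'[OF sequentially_bot] by blast
  thus False using s(2)[OF `q : F`, of "r n"] by simp
 qed
 obtain rh where rh: "rh > 0" "!!q q'. q : F ==> q' : F ==> q ~= q' ==> dist q q' >= rh"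
 proof -
  let ?D = "(%(q,q'). dist q q') ` {(q,q') : F \<times> F. q ~= q'}"
  have fD: "finite ?D" by (rule finite_imageI, rule finite_subset[of _ "F \<times> F"]) (use fin in auto)
  show ?thesis
  \<comment> \<open>The inserted 1 keeps the minimum meaningful when \<open>F\<close> has fewer than
    two points.\<close>
  proof (rule that[of "Min (insert 1 ?D)"])
   show "Min (insert 1 ?D) > 0" using fD by (subst Min_gr_iff) auto
   show "dist q q' >= Min (insert 1 ?D)" if "q : F" "q' : F" "q ~= q'" for q q'
    using fD that by (intro Min_le) auto
  qed
 qed
 obtain T where T: "T >= 0" "!!t. t >= T ==> EX q:F. dist (ph t) q < rh / 2"
  using ev[of "rh / 2"] rh(1) by auto
 obtain q where q: "q : F" "dist (ph T) q < rh / 2" using T by auto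
 have near: "dist (ph t) q < rh / 2" if "t >= T" for t
 proof (rule ccontr)
  assume *: "~ dist (ph t) q < rh / 2"
  have "connected (ph ` {T..t})"
   by (rule connected_continuous_image) (use T in "auto intro: continuous_on_subset[OF cont]")
  moreover have "ph ` {T..t} <= ball q (rh/2) Un (UN q':F - {q}. ball q' (rh/2))"
   using T(2) by (force simp: dist_commute)
  moreover have "ball q (rh/2) Int (UN q':F - {q}. ball q' (rh/2)) = {}"
  proof -
   have "False" if "dist q x < rh/2" "dist q' x < rh/2" "q' : F" "q' ~= q" for x q'
    using that rh(2)[of q q'] q(1) dist_triangle[of q q' x] by (auto simp: dist_commute)
   thus ?thesis by (force simp: mem_ball)
  qed
  moreover have "ball q (rh/2) Int ph ` {T..t} ~= {}" using q that by (force simp: dist_commute)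
  moreover have "(UN q':F - {q}. ball q' (rh/2)) Int ph ` {T..t} ~= {}"
   using T(2)[OF that] * that by (force simp: dist_commute)
  ultimately show False
   using connectedD[of "ph ` {T..t}" "ball q (rh/2)" "UN q':F - {q}. ball q' (rh/2)"] by blast
 qed
 have "(ph \<longlongrightarrow> q) at_top"
  unfolding tendsto_iff
 proof safe
  fix ep :: real assume "ep > 0"
  then obtain T' where T': "T' >= 0" "!!t. t >= T' ==> EX q:F. dist (ph t) q < min ep (rh/2)"
   using ev[of "min ep (rh/2)"] rh(1) by auto
  show "\<forall>\<^sub>F t in at_top. dist (ph t) q < ep"
   unfolding eventually_at_top_linorder
  proof (intro exI[of _ "max T T'"] allI impI)
   fix t assume t: "max T T' <= t"
   then obtain q' where q': "q' : F" "dist (ph t) q' < min ep (rh/2)" using T'(2)[of t] by auto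
   have "q' = q"
   proof (rule ccontr)
    assume "q' ~= q"
    thus False using rh(2)[OF q'(1) q(1)] near[of t] q' t dist_triangle[of q' q "ph t"]
     by (auto simp: dist_commute)
   qed
   thus "dist (ph t) q < ep" using q' by simp
  qed
 qed
 thus ?thesis using q by blast
qed

section \<open>Gromov--Hausdorff distance\<close>

definition metric_on :: "'a set => ('a => 'a => real) => bool" where
 "metric_on X d \<longleftrightarrow> (ALL x:X. ALL y:X. 0 <= d x y & d x y = d y x & (d x y = 0 \<longleftrightarrow> x = y) &
   (ALL z:X. d x z <= d x y + d y z))"

text \<open>The two spaces are glued along the graph of \<open>f\<close> by segments of length
  \<open>ep\<close>: the distance from \<open>a\<close> to \<open>y\<close> is the infimum of
  \<open>dX a a' + ep + dY (f a') y\<close>. Distortion at most \<open>2 * ep\<close> is exactly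
  what prevents shortcuts through the other space.\<close>

lemma gh_dist_le:
 fixes dX :: "'a => 'a => real" and dY :: "'b => 'b => real" and f :: "'a => 'b"
 assumes X: "metric_on X dX" and Y: "metric_on Y dY" and ne: "X ~= {}" and f: "f ` X = Y" and e: "ep > 0"
  and near: "!!a b. a : X ==> b : X ==> abs (dX a b - dY (f a) (f b)) <= 2 * ep"
 shows "gh_dist X dX Y dY <= ereal ep"
proof -
 have X0: "0 <= dX x y" "dX x y = dX y x" "dX x y = 0 \<longleftrightarrow> x = y" if "x : X" "y : X" for x y
  using X that unfolding metric_on_def by blast+
 have XT: "dX x z <= dX x y + dX y z" if "x : X" "y : X" "z : X" for x y z
  using X that unfolding metric_on_def by blast
 have Y0: "0 <= dY x y" "dY x y = dY y x" "dY x y = 0 \<longleftrightarrow> x = y" if "x : Y" "y : Y" for x y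
  using Y that unfolding metric_on_def by blast+
 have YT: "dY x z <= dY x y + dY y z" if "x : Y" "y : Y" "z : Y" for x y z
  using Y that unfolding metric_on_def by blast
 have fY: "f a : Y" if "a : X" for a using f that by auto
 define g where "g a y = (INF a'\<in>X. dX a a' + dY (f a') y) + ep" for a y
 have bdd: "bdd_below ((%a'. dX a a' + dY (f a') y) ` X)" if "a : X" "y : Y" for a y
  using X0(1) Y0(1) fY that by (auto intro!: bdd_belowI2[of _ 0])
 have g_le: "g a y <= dX a a' + dY (f a') y + ep" if "a : X" "y : Y" "a' : X" for a y a'
  unfolding g_def using cINF_lower[OF bdd[OF that(1,2)] that(3)] by simp
 have g_lt: "EX a':X. dX a a' + dY (f a') y + ep < g a y + e" if "a : X" "y : Y" "e > 0" for a y e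
  using cINF_less_iff[OF ne bdd[OF that(1,2)], of "(INF a'\<in>X. dX a a' + dY (f a') y) + e"] that(3)
  by (auto simp: g_def)
 have g_pos: "g a y >= ep" if "a : X" "y : Y" for a y
  unfolding g_def using X0(1) Y0(1) fY that ne by (auto intro!: cINF_greatest)
 have g1: "g a y <= dX a b + g b y" if m: "a : X" "b : X" "y : Y" for a b y
 proof (rule field_le_epsilon)
  fix e :: real assume "e > 0"
  then obtain b' where "b' : X" "dX b b' + dY (f b') y + ep < g b y + e" using g_lt[OF m(2,3)] by blast
  thus "g a y <= dX a b + g b y + e" using g_le[of a y b'] XT[of a b b'] m by linarith
 qed
 have g2: "g a y <= g a z + dY z y" if m: "a : X" "z : Y" "y : Y" for a z y
 proof (rule field_le_epsilon)
  fix e :: real assume "e > 0"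
  then obtain b' where "b' : X" "dX a b' + dY (f b') z + ep < g a z + e" using g_lt[OF m(1,2)] by blast
  thus "g a y <= g a z + dY z y + e" using g_le[of a y b'] YT[of "f b'" z y] m fY[of b'] by linarith
 qed
 have g3: "dX a b <= g a y + g b y" if m: "a : X" "b : X" "y : Y" for a b y
 proof (rule field_le_epsilon)
  fix e :: real assume "e > 0"
  hence "e/2 > 0" by simp
  then obtain a' b' where "a' : X" "dX a a' + dY (f a') y + ep < g a y + e/2"
   "b' : X" "dX b b' + dY (f b') y + ep < g b y + e/2" using g_lt[OF m(1,3)] g_lt[OF m(2,3)] by metis
  thus "dX a b <= g a y + g b y + e"
   using XT[of a a' b] XT[of a' b' b] X0(2)[of b b'] abs_le_D1[OF near[of a' b']] YT[of "f a'" y "f b'"] Y0(2)[of y "f b'"] fY[of a'] fY[of b'] m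
   by simp
 qed
 have g4: "dY y z <= g a y + g a z" if m: "a : X" "y : Y" "z : Y" for a y z
 proof (rule field_le_epsilon)
  fix e :: real assume "e > 0"
  hence "e/2 > 0" by simp
  then obtain a' b' where "a' : X" "dX a a' + dY (f a') y + ep < g a y + e/2"
   "b' : X" "dX a b' + dY (f b') z + ep < g a z + e/2" using g_lt[OF m(1,2)] g_lt[OF m(1,3)] by metis
  thus "dY y z <= g a y + g a z + e"
   using YT[of y "f a'" z] YT[of "f a'" "f b'" z] Y0(2)[of y "f a'"] abs_le_D2[OF near[of a' b']] XT[of a' a b'] X0(2)[of a a'] fY[of a'] fY[of b'] m
   by simp
 qed
 \<comment> \<open>\<open>Metric_space\<close> demands nonnegativity and symmetry for all arguments,
   also off the carrier, hence the default value 0.\<close>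
 define D where "D u v = (case (u, v) of
   (Inl a, Inl b) => if a : X & b : X then dX a b else 0
  | (Inr y, Inr z) => if y : Y & z : Y then dY y z else 0
  | (Inl a, Inr y) => if a : X & y : Y then g a y else 0
  | (Inr y, Inl a) => if a : X & y : Y then g a y else 0)" for u v
 have "Metric_space (X <+> Y) D"
 proof
  show "0 <= D u v" for u v
   using X0(1) Y0(1) g_pos e by (auto simp: D_def split: sum.splits intro: order_trans[of 0 ep])
  show "D u v = D v u" for u v
   using X0(2) Y0(2) by (auto simp: D_def split: sum.splits)
  show "D u v = 0 \<longleftrightarrow> u = v" if "u : X <+> Y" "v : X <+> Y" for u v
  proof -
   have "g a y ~= 0" if "a : X" "y : Y" for a y using g_pos[OF that] e by linarith
   thus ?thesis using X0(3) Y0(3) that by (auto simp: D_def)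
  qed
  show "D u w <= D u v + D v w" if "u : X <+> Y" "v : X <+> Y" "w : X <+> Y" for u v w
   using that
  proof (elim PlusE; hypsubst)
   fix a b y assume "a : X" "b : X" "y : Y"
   thus "D (Inr y) (Inl b) <= D (Inr y) (Inl a) + D (Inl a) (Inl b)"
    using g1[of b a y] X0(2)[of a b] by (simp add: D_def)
  next
   fix a y z assume "a : X" "y : Y" "z : Y"
   thus "D (Inr y) (Inl a) <= D (Inr y) (Inr z) + D (Inr z) (Inl a)"
    using g2[of a z y] Y0(2)[of y z] by (simp add: D_def)
  qed (auto simp: D_def XT YT g1 g2 g3 g4)
 qed
 moreover have "EX y:Y. D (Inl x) (Inr y) <= ep" if "x : X" for x
  using g_le[of x "f x" x] X0(3)[of x x] Y0(3)[of "f x" "f x"] fY[of x] that by (intro bexI[of _ "f x"]) (auto simp: D_def)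
 moreover have "EX x:X. D (Inl x) (Inr y) <= ep" if "y : Y" for y
 proof -
  obtain x where x: "x : X" "y = f x" using f `y : Y` by auto
  thus ?thesis
   using g_le[of x "f x" x] X0(3)[of x x] Y0(3)[of "f x" "f x"] fY[of x] by (intro bexI[of _ x]) (auto simp: D_def)
 qed
 ultimately show ?thesis
  unfolding gh_dist_def by (intro INF_lower CollectI exI[of _ D]) (auto simp: D_def)
qed

text \<open>Any admissible \<open>r\<close> bounds an actual distance from a point of
  \<open>X\<close>. For two empty sets every negative \<open>r\<close> would be admissible.\<close>

lemma gh_dist_nonneg:
 assumes "X ~= {}" shows "gh_dist X dX Y dY >= 0"
 unfolding gh_dist_def
proof (rule INF_greatest)
 fix r assume "r : {r. EX d. Metric_space (X <+> Y) d &
    (ALL x:X. ALL x':X. d (Inl x) (Inl x') = dX x x') &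
    (ALL y:Y. ALL y':Y. d (Inr y) (Inr y') = dY y y') &
    (ALL x:X. EX y:Y. d (Inl x) (Inr y) <= r) &
    (ALL y:Y. EX x:X. d (Inl x) (Inr y) <= r)}"
 then obtain d where d: "Metric_space (X <+> Y) d" "ALL x:X. EX y:Y. d (Inl x) (Inr y) <= r" by blast
 then obtain x y where "d (Inl x) (Inr y) <= r" using assms by blast
 thus "0 <= ereal r" using Metric_space.nonneg[OF d(1), of "Inl x" "Inr y"] by simp
qed

lemma gh_tendstoI:
 assumes ne: "X ~= {}" and Y: "metric_on Y dY" and f: "f ` X = Y"
  and X: "!!t. metric_on X (d t)"
  and near: "!!ep. ep > 0 ==> eventually (%t. ALL a:X. ALL b:X. abs (d t a b - dY (f a) (f b)) <= ep) F"
 shows "gh_tendsto X d Y dY F"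
 unfolding gh_tendsto_def
proof (rule order_tendstoI)
 fix e :: ereal assume "e < 0"
 thus "\<forall>\<^sub>F t in F. e < gh_dist X (d t) Y dY"
  using gh_dist_nonneg[OF ne] by (intro always_eventually allI) (rule less_le_trans)
next
 fix e :: ereal assume "0 < e"
 then obtain ep where ep: "0 < ereal ep" "ereal ep < e" using ereal_dense2 by blast
 hence "2 * ep > 0" by simp
 from near[OF this] show "\<forall>\<^sub>F t in F. gh_dist X (d t) Y dY < e"
 proof (rule eventually_mono)
  fix t assume "ALL a:X. ALL b:X. abs (d t a b - dY (f a) (f b)) <= 2 * ep"
  hence "gh_dist X (d t) Y dY <= ereal ep" using ep(1) by (intro gh_dist_le[OF X Y ne f]) auto
  thus "gh_dist X (d t) Y dY < e" using ep(2) by simp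
 qed
qed

section \<open>The flow on the simplex\<close>

text \<open>What remains of the first component of the field after dividing by the equations of its
  invariant lines x = 0 and x = 1/2; \<open>facz\<close> plays the same role for z = 1 - x -
  y.\<close>

definition fac :: "nat => real => real => real" where
 "fac l x y = real l * (x * (8*y - 1) + 8*y^2 - 7*y + 1) - 4*y * (2*x + 2*y - 1)"

definition facz :: "nat => real => real => real" where
 "facz l x y = real l * (x + y) - 8 * (real l - 1) * x * y"

lemma pr_field_fac: "pr_field l (x, y) = (x * ((1 - 2*x) * fac l x y), y * ((1 - 2*y) * fac l y x))"
 unfolding pr_field_def fac_def prod.case prod.inject
 by (intro conjI) algebra+

lemma pr_field_sum:
 "- (x * ((1 - 2*x) * fac l x y)) - y * ((1 - 2*y) * fac l y x)
   = (1 - x - y) * ((1 - 2 * (1 - x - y)) * facz l x y)"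
 unfolding fac_def facz_def by algebra

text \<open>Boundedness is carried along because it is what makes products of Lipschitz functions
  Lipschitz.\<close>

definition lip_bdd :: "'a::metric_space set => ('a => real) => bool" where
 "lip_bdd S f \<longleftrightarrow> (EX C. ALL u:S. abs (f u) <= C & (ALL v:S. abs (f u - f v) <= C * dist u v))"

lemma lip_bddI: "C >= 0 ==> C' >= 0 ==> (!!u. u : S ==> abs (f u) <= C) ==>
  (!!u v. u : S ==> v : S ==> abs (f u - f v) <= C' * dist u v) ==> lip_bdd S f"
 unfolding lip_bdd_def
 by (rule exI[of _ "max C C'"]) (meson max.coboundedI1 max.coboundedI2 mult_right_mono order_trans zero_le_dist max.cobounded1 max.cobounded2)

lemma lip_bddE:
 assumes "lip_bdd S f"
 obtains C where "C >= 0" "!!u. u : S ==> abs (f u) <= C"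
  "!!u v. u : S ==> v : S ==> abs (f u - f v) <= C * dist u v"
proof -
 obtain C where C: "!!u. u : S ==> abs (f u) <= C" "!!u v. u : S ==> v : S ==> abs (f u - f v) <= C * dist u v"
  using assms unfolding lip_bdd_def by blast
 show ?thesis
 proof (rule that[of "max C 0"])
  show "abs (f u) <= max C 0" if "u : S" for u using C(1)[OF that] by simp
  show "abs (f u - f v) <= max C 0 * dist u v" if "u : S" "v : S" for u v
   by (rule order_trans[OF C(2)[OF that]]) (simp add: mult_right_mono)
 qed simp
qed

lemma lip_bdd_const [intro, simp]: "lip_bdd S (%_. c)"
 by (rule lip_bddI[of "abs c" 0]) auto

lemma lip_bdd_add: assumes "lip_bdd S f" "lip_bdd S g" shows "lip_bdd S (%u. f u + g u)"
proof -
 from assms(1) obtain C where C: "C >= 0" "!!u. u : S ==> abs (f u) <= C"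
  "!!u v. u : S ==> v : S ==> abs (f u - f v) <= C * dist u v" using lip_bddE by blast
 from assms(2) obtain D where D: "D >= 0" "!!u. u : S ==> abs (g u) <= D"
  "!!u v. u : S ==> v : S ==> abs (g u - g v) <= D * dist u v" using lip_bddE by blast
 show ?thesis
 proof (rule lip_bddI[of "C + D" "C + D"])
  show "abs (f u + g u) <= C + D" if "u : S" for u using C(2)[OF that] D(2)[OF that] by simp
  show "abs (f u + g u - (f v + g v)) <= (C + D) * dist u v" if "u : S" "v : S" for u v
   using C(3)[OF that] D(3)[OF that] by (simp add: algebra_simps)
 qed (use C D in auto)
qed

lemma lip_bdd_mult: assumes "lip_bdd S f" "lip_bdd S g" shows "lip_bdd S (%u. f u * g u)"
proof -
 from assms(1) obtain C where C: "C >= 0" "!!u. u : S ==> abs (f u) <= C"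
  "!!u v. u : S ==> v : S ==> abs (f u - f v) <= C * dist u v" using lip_bddE by blast
 from assms(2) obtain D where D: "D >= 0" "!!u. u : S ==> abs (g u) <= D"
  "!!u v. u : S ==> v : S ==> abs (g u - g v) <= D * dist u v" using lip_bddE by blast
 show ?thesis
 proof (rule lip_bddI[of "C * D" "C * D + D * C"])
  show "abs (f u * g u) <= C * D" if "u : S" for u
   using C(2)[OF that] D(2)[OF that] C(1) by (simp add: abs_mult mult_mono)
  show "abs (f u * g u - f v * g v) <= (C * D + D * C) * dist u v" if "u : S" "v : S" for u v
  proof -
   have "abs (f u * g u - f v * g v) = abs (f u * (g u - g v) + g v * (f u - f v))"
    by (simp add: algebra_simps)
   also have "... <= abs (f u) * abs (g u - g v) + abs (g v) * abs (f u - f v)"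
    by (metis abs_mult abs_triangle_ineq)
   also have "... <= C * (D * dist u v) + D * (C * dist u v)"
    using C D that by (intro add_mono mult_mono) auto
   finally show ?thesis by (simp add: algebra_simps)
  qed
 qed (use C D in auto)
qed

lemma lip_bdd_diff: assumes "lip_bdd S f" "lip_bdd S g" shows "lip_bdd S (%u. f u - g u)"
 using lip_bdd_add[OF assms(1) lip_bdd_mult[OF lip_bdd_const[of S "-1"] assms(2)]] by simp

lemma lip_bdd_power2: "lip_bdd S f ==> lip_bdd S (%u. (f u)^2)"
 unfolding power2_eq_square by (rule lip_bdd_mult)

lemma lip_bdd_fst: "bounded S ==> lip_bdd (S :: (real * real) set) fst"
proof -
 assume "bounded S"
 then obtain C where C: "C > 0" "!!u. u : S ==> norm u <= C" by (auto simp: bounded_pos)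
 show ?thesis
 proof (rule lip_bddI[of C 1])
  show "abs (fst u) <= C" if "u : S" for u
   using order_trans[OF norm_fst_le C(2)[of "(fst u, snd u)"]] that by simp
  show "abs (fst u - fst v) <= 1 * dist u v" for u v :: "real * real"
   using dist_fst_le[of u v] by (simp add: dist_real_def)
 qed (use C in auto)
qed

lemma lip_bdd_snd: "bounded S ==> lip_bdd (S :: (real * real) set) snd"
proof -
 assume "bounded S"
 then obtain C where C: "C > 0" "!!u. u : S ==> norm u <= C" by (auto simp: bounded_pos)
 show ?thesis
 proof (rule lip_bddI[of C 1])
  show "abs (snd u) <= C" if "u : S" for u
   using order_trans[OF norm_snd_le C(2)[of "(fst u, snd u)"]] that by simp
  show "abs (snd u - snd v) <= 1 * dist u v" for u v :: "real * real"
   using dist_snd_le[of u v] by (simp add: dist_real_def)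
 qed (use C in auto)
qed

lemmas lip_bdd_intros = lip_bdd_const lip_bdd_add lip_bdd_mult lip_bdd_diff lip_bdd_power2 lip_bdd_fst lip_bdd_snd

lemma pr_field_eq:
 "pr_field l = (%u. (fst u * ((1 - 2 * fst u) * fac l (fst u) (snd u)), snd u * ((1 - 2 * snd u) * fac l (snd u) (fst u))))"
 by (auto simp: pr_field_fac)

lemma lip_bdd_pair:
 assumes "lip_bdd S f" "lip_bdd S g"
 obtains C where "C >= 0" "!!u. u : S ==> norm (f u, g u) <= C"
  "!!u v. u : S ==> v : S ==> norm ((f u, g u) - (f v, g v)) <= C * dist u v"
proof -
 from assms(1) obtain C where C: "C >= 0" "!!u. u : S ==> abs (f u) <= C"
  "!!u v. u : S ==> v : S ==> abs (f u - f v) <= C * dist u v" using lip_bddE by blast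
 from assms(2) obtain D where D: "D >= 0" "!!u. u : S ==> abs (g u) <= D"
  "!!u v. u : S ==> v : S ==> abs (g u - g v) <= D * dist u v" using lip_bddE by blast
 have n: "norm (a, b) <= abs a + abs b" for a b :: real
  using norm_triangle_ineq[of "(a, 0)" "(0, b)"] by (simp add: norm_Pair)
 show ?thesis
 proof (rule that[of "C + D"])
  show "norm (f u, g u) <= C + D" if "u : S" for u
   using C(2)[OF that] D(2)[OF that] n[of "f u" "g u"] by simp
  show "norm ((f u, g u) - (f v, g v)) <= (C + D) * dist u v" if "u : S" "v : S" for u v
   using C(3)[OF that] D(3)[OF that] n[of "f u - f v" "g u - g v"] by (simp add: algebra_simps)
 qed (use C D in auto)
qed

lemma pr_field_lipschitz:
 assumes "bounded S"
 shows "EX C>=0. (ALL u:S. norm (pr_field l u) <= C) & (ALL u:S. ALL v:S. norm (pr_field l u - pr_field l v) <= C * dist u v)"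
 unfolding pr_field_eq
 by (rule lip_bdd_pair[of S "%u. fst u * ((1 - 2 * fst u) * fac l (fst u) (snd u))"
    "%u. snd u * ((1 - 2 * snd u) * fac l (snd u) (fst u))"])
   (use assms in "auto simp: fac_def intro!: lip_bdd_intros")

lemma simplex2_iff: "u : simplex2 \<longleftrightarrow> 0 <= fst u & 0 <= snd u & 0 <= 1 - fst u - snd u"
 by (cases u) (auto simp: simplex2_def)

lemma norm_simplex2: "u : simplex2 ==> norm u <= 1"
proof -
 assume u: "u : simplex2"
 hence "(fst u)^2 + (snd u)^2 <= (fst u + snd u)^2" by (simp add: simplex2_iff power2_sum)
 also have "... <= 1" using u by (simp add: simplex2_iff power_le_one)
 finally show ?thesis by (cases u) (simp add: norm_Pair)
qed

lemma bounded_simplex2: "bounded simplex2"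
 using norm_simplex2 boundedI by blast

lemma closed_simplex2: "closed simplex2"
proof -
 have "simplex2 = {u. 0 <= fst u} Int {u. 0 <= snd u} Int {u. fst u + snd u <= 1}"
  by (auto simp: simplex2_def)
 also have "closed ..." by (intro closed_Int closed_Collect_le continuous_intros)
 finally show ?thesis .
qed

lemma compact_simplex2: "compact simplex2"
 using bounded_simplex2 closed_simplex2 compact_eq_bounded_closed by blast

text \<open>A zero forces \<open>h\<close> to vanish identically, and without zeros the connected
  range stays on one side of 0.\<close>

lemma nonneg_preserved:
 fixes h :: "real => real"
 assumes d: "!!t. (h has_real_derivative h' t) (at t)" and le: "!!t. abs (h' t) <= C * abs (h t)"
 shows "sgn (h t) = sgn (h s)"
proof -
 have z: "h r = 0 ==> h t = 0" for r t using deriv_le_abs_zero[OF d le] by blast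
 have cont: "continuous_on A h" for A
  by (rule DERIV_continuous_on) (rule has_field_derivative_at_within[OF d])
 have conn: "connected (range h)"
  by (rule connected_continuous_image[OF cont]) simp
 have "False" if "h t < 0" "h s > 0" for t s
  using connectedD_interval[OF conn, of "h t" "h s" 0] that z[of _ t] by fastforce
 thus ?thesis using z[of t s] z[of s t] by (cases "h t" "0::real" rule: linorder_cases; cases "h s" "0::real" rule: linorder_cases) auto
qed

text \<open>The field is multiplied by a cutoff that is 1 on \<open>simplex2\<close>. The edges stay invariant, since on
  each of them the modified field is still divisible by the equation of the edge.\<close>

lemma pr_line_exists:
 assumes p: "p : simplex2"
 shows "EX ph. pr_line l ph & ph 0 = p"
proof -
 \<comment> \<open>The cutoff is 1 up to norm 2 and 0 from norm 3 on, while \<open>simplex2\<close>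
   lies in the unit ball.\<close>
 define cutf :: "real * real => real" where "cutf u = max 0 (min 1 (3 - norm u))" for u
 have cut01: "0 <= cutf u" "cutf u <= 1" for u by (auto simp: cutf_def)
 have cutlip: "abs (cutf u - cutf v) <= dist u v" for u v
 proof -
  have "abs (cutf u - cutf v) <= abs (norm u - norm v)" by (auto simp: cutf_def max_def min_def)
  also have "... <= dist u v" by (simp add: dist_norm norm_triangle_ineq3)
  finally show ?thesis .
 qed
 have cut0: "cutf u = 0" if "u ~: cball 0 3" for u using that by (auto simp: cutf_def)
 define W where "W u = cutf u *R pr_field l u" for u
 obtain C where C: "C >= 0" "!!u. u : cball 0 3 ==> norm (pr_field l u) <= C"
  "!!u v. u : cball 0 3 ==> v : cball 0 3 ==> norm (pr_field l u - pr_field l v) <= C * dist u v"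
  using pr_field_lipschitz[of "cball 0 3" l] bounded_cball by blast
 have Wlip1: "norm (W u - W v) <= 2 * C * dist u v" if "u : cball 0 3" for u v
 proof (cases "v : cball 0 3")
  case True
  have "W u - W v = cutf u *R (pr_field l u - pr_field l v) + (cutf u - cutf v) *R pr_field l v"
   by (simp add: W_def algebra_simps)
  also have "norm ... <= abs (cutf u) * norm (pr_field l u - pr_field l v) + abs (cutf u - cutf v) * norm (pr_field l v)"
   by (rule order_trans[OF norm_triangle_ineq]) simp
  also have "... <= 1 * (C * dist u v) + dist u v * C"
   using C that True cut01 cutlip by (intro add_mono mult_mono) auto
  finally show ?thesis by simp
 next
  case False
  hence "norm (W u - W v) = abs (cutf u - cutf v) * norm (pr_field l u)" by (simp add: W_def cut0)
  also have "... <= dist u v * C" using C that cutlip by (intro mult_mono) auto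
  also have "... <= 2 * C * dist u v" using C by (simp add: mult.commute)
  finally show ?thesis .
 qed
 have Wlip: "norm (W u - W v) <= 2 * C * norm (u - v)" for u v
 proof (cases "u : cball 0 3 | v : cball 0 3")
  case True
  thus ?thesis using Wlip1[of u v] Wlip1[of v u] by (auto simp: dist_norm norm_minus_commute)
 next
  case False
  thus ?thesis using C by (simp add: W_def cut0)
 qed
 obtain ph where ph: "ph 0 = p" "!!t. (ph has_vector_derivative W (ph t)) (at t)"
  using lipschitz_ode_solution[OF Wlip] by metis
 have bound: "EX B. ALL u. abs (cutf u * k u) <= B" if "continuous_on UNIV k" for k
 proof -
  have "bounded (k ` cball 0 3)"
   by (intro compact_imp_bounded compact_continuous_image continuous_on_subset[OF that]) auto
  hence "EX B. ALL u:cball 0 3. abs (k u) <= B" unfolding bounded_iff by (simp only: ball_simps real_norm_def)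
  then obtain B where B: "!!u. u : cball 0 3 ==> abs (k u) <= B" by blast
  have "abs (cutf u * k u) <= abs B" for u
  proof (cases "u : cball 0 3")
   case True
   have "abs (cutf u * k u) = cutf u * abs (k u)" using cut01 by (simp add: abs_mult)
   also have "... <= 1 * abs B" using B[OF True] cut01 by (intro mult_mono) auto
   finally show ?thesis by simp
  qed (simp add: cut0)
  thus ?thesis by blast
 qed
 have sgn_const: "sgn (h (ph t)) = sgn (h p)"
  if "!!t. ((%t. h (ph t)) has_real_derivative cutf (ph t) * (h (ph t) * k (ph t))) (at t)"
   and contk: "continuous_on UNIV k" for h k t
 proof -
  obtain B where B: "!!u. abs (cutf u * k u) <= B" using bound[OF contk] by blast
  have "sgn (h (ph t)) = sgn (h (ph 0))"
  proof (rule nonneg_preserved[OF that(1)])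
   fix t
   have "abs (cutf (ph t) * (h (ph t) * k (ph t))) = abs (cutf (ph t) * k (ph t)) * abs (h (ph t))"
    by (simp add: abs_mult mult_ac)
   also have "... <= B * abs (h (ph t))" using B by (intro mult_right_mono) auto
   finally show "abs (cutf (ph t) * (h (ph t) * k (ph t))) <= B * abs (h (ph t))" .
  qed
  thus ?thesis by (simp add: ph)
 qed
 have d1: "((%t. fst (ph t)) has_real_derivative fst (W (ph t))) (at t)"
  and d2: "((%t. snd (ph t)) has_real_derivative snd (W (ph t))) (at t)" for t
  using ph(2)[of t] unfolding has_real_derivative_iff_has_vector_derivative
  by (auto simp: has_vector_derivative_def intro!: derivative_eq_intros)
 have in1: "ph t : simplex2" for t
 proof -
  have "sgn (fst (ph t)) = sgn (fst p)"
   by (rule sgn_const[where k = "%u. (1 - 2 * fst u) * fac l (fst u) (snd u)"])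
    (use d1 in "auto simp: W_def pr_field_eq fac_def intro!: continuous_intros")
  moreover have "sgn (snd (ph t)) = sgn (snd p)"
   by (rule sgn_const[where k = "%u. (1 - 2 * snd u) * fac l (snd u) (fst u)"])
    (use d2 in "auto simp: W_def pr_field_eq fac_def intro!: continuous_intros")
  moreover have "sgn (1 - fst (ph t) - snd (ph t)) = sgn (1 - fst p - snd p)"
  proof (rule sgn_const[where k = "%u. (1 - 2 * (1 - fst u - snd u)) * facz l (fst u) (snd u)"])
   show "((%t. 1 - fst (ph t) - snd (ph t)) has_real_derivative cutf (ph t) * ((1 - fst (ph t) - snd (ph t)) *
      ((1 - 2 * (1 - fst (ph t) - snd (ph t))) * facz l (fst (ph t)) (snd (ph t))))) (at t)" for t
    unfolding pr_field_sum[symmetric]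
    by (auto intro!: derivative_eq_intros d1 d2) (simp add: W_def pr_field_eq algebra_simps)
  qed (auto simp: facz_def intro!: continuous_intros)
  ultimately show ?thesis
   using p unfolding simplex2_iff
   by (metis sgn_1_neg sgn_neg less_le_not_le not_less zero_less_one neg_less_0_iff_less order_less_le_trans sgn_if)
 qed
 have "W (ph t) = pr_field l (ph t)" for t
  using norm_simplex2[OF in1[of t]] by (simp add: W_def cutf_def)
 hence "pr_line l ph" using ph(2) in1 by (simp add: pr_line_def)
 thus ?thesis using ph(1) by blast
qed

text \<open>One constant serves all solutions; it gives uniqueness as well as continuous dependence
  on the initial point.\<close>

lemma flow_lipschitz:
 "EX L. ALL ph ps t. pr_line l ph --> pr_line l ps --> dist (ph t) (ps t) <= dist (ph 0) (ps 0) * exp (L * abs t)"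
proof -
 obtain C where C: "C >= 0" "!!u v. u : simplex2 ==> v : simplex2 ==> norm (pr_field l u - pr_field l v) <= C * dist u v"
  using pr_field_lipschitz[OF bounded_simplex2, of l] by blast
 show ?thesis
  by (intro exI allI impI, rule lipschitz_ode_dist[where S = simplex2 and W = "pr_field l"])
    (use C(2) in "auto simp: pr_line_def dist_norm")
qed

lemma pr_line_unique:
 assumes "pr_line l ph" "pr_line l ps" "ph 0 = ps 0" shows "ph = ps"
 using flow_lipschitz[of l] assms by (fastforce simp: fun_eq_iff)

lemma proj_flow_unique: "pr_line l ph ==> ph 0 = p ==> flow l p = ph"
 unfolding proj_flow_def using pr_line_unique by (intro the_equality) auto

lemma pr_line_flow: "p : simplex2 ==> pr_line l (flow l p)"
 and proj_flow_0 [simp]: "p : simplex2 ==> flow l p 0 = p"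
 using pr_line_exists[of p l] proj_flow_unique by metis+

lemma proj_flow_in: "p : simplex2 ==> flow l p t : simplex2"
 and proj_flow_deriv: "p : simplex2 ==> (flow l p has_vector_derivative pr_field l (flow l p t)) (at t)"
 using pr_line_flow[of p l] by (auto simp: pr_line_def)

lemma proj_flow_add: assumes "p : simplex2" shows "flow l (flow l p s) t = flow l p (s + t)"
proof -
 have "flow l (flow l p s) = (%t. flow l p (s + t))"
 proof (rule proj_flow_unique)
  have "((%t. flow l p (s + t)) has_vector_derivative pr_field l (flow l p (s + t))) (at t)" for t
  proof -
   have "((%t. s + t) has_vector_derivative 1) (at t)"
    by (auto intro!: derivative_eq_intros simp flip: has_real_derivative_iff_has_vector_derivative)
   from vector_diff_chain_at[OF this proj_flow_deriv[OF assms]] show ?thesis by (simp add: o_def)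
  qed
  thus "pr_line l (%t. flow l p (s + t))"
   using proj_flow_in[OF assms] by (simp add: pr_line_def)
 qed simp
 thus ?thesis by (rule fun_cong)
qed

lemma proj_flow_equilibrium: "p : simplex2 ==> pr_field l p = 0 ==> flow l p t = p"
 using proj_flow_unique[of l "%_. p" p] by (simp add: pr_line_def)

lemma proj_flow_tendsto:
 assumes "!!n::nat. u n : simplex2" "q : simplex2" "u \<longlonglongrightarrow> q"
 shows "(%n. flow l (u n) t) \<longlonglongrightarrow> flow l q t"
proof -
 obtain L where L: "!!ph ps t. pr_line l ph ==> pr_line l ps ==> dist (ph t) (ps t) <= dist (ph 0) (ps 0) * exp (L * abs t)"
  using flow_lipschitz by blast
 have "(%n. dist (u n) q * exp (L * abs t)) \<longlonglongrightarrow> 0 * exp (L * abs t)"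
  by (intro tendsto_intros tendsto_dist_iff[THEN iffD1] assms)
 hence lim: "(%n. dist (u n) q * exp (L * abs t)) \<longlonglongrightarrow> 0" by simp
 have "dist (flow l (u n) t) (flow l q t) <= dist (u n) q * exp (L * abs t)" for n
  using L[OF pr_line_flow[OF assms(1)] pr_line_flow[OF assms(2)], of n t] assms by simp
 hence "(%n. dist (flow l (u n) t) (flow l q t)) \<longlonglongrightarrow> 0"
  by (intro tendsto_sandwich[OF _ _ tendsto_const lim]) auto
 thus ?thesis by (rule tendsto_dist_iff[THEN iffD2])
qed

lemma proj_flow_continuous_on: "p : simplex2 ==> continuous_on A (flow l p)"
 using proj_flow_deriv by (meson continuous_at_imp_continuous_on has_vector_derivative_continuous)

lemma proj_flow_coords:
 assumes "p : simplex2" and "flow l p t = (x, y)"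
 shows "((%t. fst (flow l p t)) has_real_derivative x * ((1 - 2*x) * fac l x y)) (at t)"
  and "((%t. snd (flow l p t)) has_real_derivative y * ((1 - 2*y) * fac l y x)) (at t)"
  and "((%t. 1 - fst (flow l p t) - snd (flow l p t)) has_real_derivative
      (1 - x - y) * ((1 - 2 * (1 - x - y)) * facz l x y)) (at t)"
proof -
 show d1: "((%t. fst (flow l p t)) has_real_derivative x * ((1 - 2*x) * fac l x y)) (at t)"
  and d2: "((%t. snd (flow l p t)) has_real_derivative y * ((1 - 2*y) * fac l y x)) (at t)"
  using proj_flow_deriv[OF assms(1), of l t] unfolding has_real_derivative_iff_has_vector_derivative assms(2) pr_field_fac
  by (auto simp: has_vector_derivative_def intro!: derivative_eq_intros)
 show "((%t. 1 - fst (flow l p t) - snd (flow l p t)) has_real_derivative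
      (1 - x - y) * ((1 - 2 * (1 - x - y)) * facz l x y)) (at t)"
  unfolding pr_field_sum[symmetric] by (auto intro!: derivative_eq_intros d1 d2)
qed

lemma sgn_invariant:
 assumes p: "p : simplex2" and "continuous_on UNIV k"
  and d: "!!t. ((%t. h (flow l p t)) has_real_derivative h (flow l p t) * k (flow l p t)) (at t)"
 shows "sgn (h (flow l p t)) = sgn (h p)"
proof -
 have "bounded (k ` simplex2)"
  by (intro compact_imp_bounded compact_continuous_image continuous_on_subset[OF assms(2)] compact_simplex2) auto
 then obtain B where B: "!!u. u : simplex2 ==> abs (k u) <= B" by (auto simp: bounded_iff)
 have "sgn (h (flow l p t)) = sgn (h (flow l p 0))"
  by (rule nonneg_preserved[OF d, of B])
   (simp add: abs_mult, subst mult.commute, intro mult_right_mono B proj_flow_in[OF p] abs_ge_zero)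
 thus ?thesis using p by simp
qed

text \<open>The six functions are the equations of the edges of the simplex and of the sides of
  \<open>KLM\<close>. Each divides its own derivative along the flow, so its sign cannot
  change.\<close>

lemma flow_sgn:
 assumes p: "p : simplex2"
 shows "sgn (fst (flow l p t)) = sgn (fst p)"
  and "sgn (snd (flow l p t)) = sgn (snd p)"
  and "sgn (1 - fst (flow l p t) - snd (flow l p t)) = sgn (1 - fst p - snd p)"
  and "sgn (1 - 2 * fst (flow l p t)) = sgn (1 - 2 * fst p)"
  and "sgn (1 - 2 * snd (flow l p t)) = sgn (1 - 2 * snd p)"
  and "sgn (1 - 2 * (1 - fst (flow l p t) - snd (flow l p t))) = sgn (1 - 2 * (1 - fst p - snd p))"
proof -
 note d = proj_flow_coords[OF p prod.collapse[symmetric]]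
 show "sgn (fst (flow l p t)) = sgn (fst p)"
  by (rule sgn_invariant[OF p, where k = "%u. (1 - 2 * fst u) * fac l (fst u) (snd u)"])
    (use d in "auto simp: fac_def intro!: continuous_intros")
 show "sgn (snd (flow l p t)) = sgn (snd p)"
  by (rule sgn_invariant[OF p, where k = "%u. (1 - 2 * snd u) * fac l (snd u) (fst u)"])
    (use d in "auto simp: fac_def intro!: continuous_intros")
 show "sgn (1 - fst (flow l p t) - snd (flow l p t)) = sgn (1 - fst p - snd p)"
  by (rule sgn_invariant[OF p, where k = "%u. (1 - 2 * (1 - fst u - snd u)) * facz l (fst u) (snd u)"])
    (use d in "auto simp: facz_def intro!: continuous_intros")
 show "sgn (1 - 2 * fst (flow l p t)) = sgn (1 - 2 * fst p)"
  by (rule sgn_invariant[OF p, where k = "%u. - 2 * fst u * fac l (fst u) (snd u)"])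
    (auto simp: fac_def intro!: continuous_intros, (rule derivative_eq_intros d(1) refl)+, simp add: fac_def algebra_simps)
 show "sgn (1 - 2 * snd (flow l p t)) = sgn (1 - 2 * snd p)"
  by (rule sgn_invariant[OF p, where k = "%u. - 2 * snd u * fac l (snd u) (fst u)"])
    (auto simp: fac_def intro!: continuous_intros, (rule derivative_eq_intros d(2) refl)+, simp add: fac_def algebra_simps)
 show "sgn (1 - 2 * (1 - fst (flow l p t) - snd (flow l p t))) = sgn (1 - 2 * (1 - fst p - snd p))"
 proof (rule sgn_invariant[OF p, where k = "%u. - 2 * (1 - fst u - snd u) * facz l (fst u) (snd u)"])
  show "((%t. 1 - 2 * (1 - fst (flow l p t) - snd (flow l p t))) has_real_derivative
      (1 - 2 * (1 - fst (flow l p t) - snd (flow l p t))) *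
       (- 2 * (1 - fst (flow l p t) - snd (flow l p t)) * facz l (fst (flow l p t)) (snd (flow l p t)))) (at t)" for t
   by (rule derivative_eq_intros d(3) refl)+ (simp add: algebra_simps)
 qed (auto simp: facz_def intro!: continuous_intros)
qed

text \<open>LaSalle's principle, with \<open>sg\<close> choosing the direction of time. Continuity
  of \<open>h\<close> is asked for only along the orbit of \<open>q\<close>, because the logarithms
  in \<open>lyap\<close> are singular on the boundary of the simplex.\<close>

lemma omega_stationary:
 fixes h :: "real * real => real"
 assumes p: "p : simplex2"
  and mono: "!!s t. 0 <= s ==> s <= t ==> h (flow l p (sg * s)) <= h (flow l p (sg * t))"
  and q: "q : omega_limit (%t. flow l p (sg * t))"
  and cont: "!!s. s >= 0 ==> isCont h (flow l q (sg * s))"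
 shows "q : simplex2" and "s >= 0 ==> h (flow l q (sg * s)) = h q"
  and "t >= 0 ==> h (flow l p (sg * t)) <= h q"
proof -
 obtain r where r: "filterlim r at_top sequentially" "(%n::nat. flow l p (sg * r n)) \<longlonglongrightarrow> q"
  using q by (auto simp: omega_limit_def)
 show qS: "q : simplex2"
  by (rule closed_sequentially[OF closed_simplex2 _ r(2)]) (simp add: proj_flow_in[OF p])
 have lim: "(%n. h (flow l p (sg * (r n + s)))) \<longlonglongrightarrow> h (flow l q (sg * s))" if "s >= 0" for s
 proof -
  have "(%n. flow l (flow l p (sg * r n)) (sg * s)) \<longlonglongrightarrow> flow l q (sg * s)"
   by (rule proj_flow_tendsto[OF proj_flow_in[OF p] qS r(2)])
  hence "(%n. flow l p (sg * (r n + s))) \<longlonglongrightarrow> flow l q (sg * s)"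
   by (simp add: proj_flow_add[OF p] distrib_left)
  thus ?thesis by (rule isCont_tendsto_compose[OF cont[OF that]])
 qed
 have lim0: "(%n. h (flow l p (sg * r n))) \<longlonglongrightarrow> h q" using lim[of 0] qS by simp
 have le: "h (flow l p (sg * t)) <= h q" if "t >= 0" for t
 proof (rule tendsto_lowerbound[OF lim0])
  have "\<forall>\<^sub>F n in sequentially. t <= r n" using r(1) by (auto simp: filterlim_at_top)
  thus "\<forall>\<^sub>F n in sequentially. h (flow l p (sg * t)) <= h (flow l p (sg * r n))"
   by eventually_elim (use mono that in auto)
 qed simp
 thus "t >= 0 ==> h (flow l p (sg * t)) <= h q" .
 have r0: "\<forall>\<^sub>F n in sequentially. 0 <= r n" using r(1) by (auto simp: filterlim_at_top)
 show "h (flow l q (sg * s)) = h q" if "s >= 0"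
 proof (rule antisym)
  show "h (flow l q (sg * s)) <= h q"
   by (rule tendsto_upperbound[OF lim[OF that]])
     (use r0 in eventually_elim, use le that in auto)
  show "h q <= h (flow l q (sg * s))"
   by (rule tendsto_le[OF _ lim[OF that] lim0])
     (simp, use r0 in eventually_elim, use mono that in auto)
 qed
qed

lemma stationary_deriv_nonpos:
 fixes f :: "real => real"
 assumes "(f has_real_derivative D) (at 0)" "!!s. s >= 0 ==> f s = f 0"
 shows "D <= 0"
proof (rule ccontr)
 assume "~ D <= 0"
 then obtain d where "d > 0" "!!h. h > 0 ==> h < d ==> f 0 < f (0 + h)"
  using DERIV_pos_inc_right[OF assms(1)] by auto
 from this(1) this(2)[of "d/2"] assms(2)[of "d/2"] show False by simp
qed

lemma nondecreasing_along:
 fixes f :: "real => real"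
 assumes "!!t. t >= 0 ==> (f has_real_derivative f' t) (at t)" "!!t. t >= 0 ==> f' t >= 0" "0 <= s" "s <= t"
 shows "f s <= f t"
 by (rule DERIV_nonneg_imp_nondecreasing[OF `s <= t`]) (meson assms(1-3) order_trans)

lemma flow_rescale:
 assumes "!!t. ((%t. h (flow l p t)) has_real_derivative D (flow l p t)) (at t)"
 shows "((%t. h (flow l p (sg * t))) has_real_derivative sg * D (flow l p (sg * t))) (at t)"
proof -
 have "((%t. sg * t) has_real_derivative sg) (at t)" by (auto intro!: derivative_eq_intros)
 from DERIV_chain2[OF assms[of "sg * t"] this] show ?thesis by (simp add: mult.commute)
qed

text \<open>Since \<open>h\<close> is constant along the orbit of a limit point,
  \<open>sg * h'\<close> cannot be positive there. The domain \<open>D\<close> will be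
  \<open>osimplex\<close> for the scalar curvature and \<open>simplex2\<close> for the largest
  parameter in a corner.\<close>

lemma omega_lyapunov:
 assumes p: "p : simplex2"
  and d: "!!u t. u : D ==> ((%t. h (flow l u t)) has_real_derivative h' (flow l u t)) (at t)"
  and cont: "!!u. u : D ==> isCont h u"
  and inv: "!!u t. u : D ==> flow l u t : D"
  and ge: "!!t. t >= 0 ==> sg * h' (flow l p (sg * t)) >= 0"
  and "p : D" and q: "q : omega_limit (%t. flow l p (sg * t))" and "q : D"
 shows "sg * h' q <= 0" and "h p <= h q"
proof -
 have mono: "h (flow l p (sg * s)) <= h (flow l p (sg * t))" if "0 <= s" "s <= t" for s t
  by (rule nondecreasing_along[OF _ ge that, where f = "%t. h (flow l p (sg * t))"])
    (rule flow_rescale[OF d[OF `p : D`]])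
 note st = omega_stationary[where h = h and sg = sg, OF p mono q cont[OF inv[OF `q : D`]]]
 show "h p <= h q" using st(3)[of 0] p by simp
 have "((%t. h (flow l q (sg * t))) has_real_derivative sg * h' (flow l q (sg * 0))) (at 0)"
  by (rule flow_rescale[OF d[OF `q : D`]])
 hence "((%t. h (flow l q (sg * t))) has_real_derivative sg * h' q) (at 0)"
  using st(1) by simp
 thus "sg * h' q <= 0"
  by (rule stationary_deriv_nonpos) (use st in simp)
qed

section \<open>Ricci eigenvalues and the scalar curvature as a Lyapunov function\<close>

definition ric1 :: "nat => real => real => real => real" where
 "ric1 l x y z = (real l - 1) * y * z + (real l - 2) * (x^2 - y^2 - z^2) / 4"

definition ric3 :: "nat => real => real => real => real" where
 "ric3 l x y z = (real l - 1) * x * y + (z^2 - x^2 - y^2) / 2"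

text \<open>\<open>ric1 l x y z\<close>, \<open>ric1 l y x z\<close> and \<open>ric3 l x y z\<close> are \<open>x y z\<close> times the eigenvalues of the
  Ricci endomorphism on the isotropy summands, up to a common constant factor.\<close>

lemma fac_ric:
 assumes "z = 1 - x - y"
 shows "(1 - 2*x) * fac l x y = 4 * (x * ric1 l x y z + y * ric1 l y x z + z * ric3 l x y z - ric1 l x y z)"
  and "(1 - 2*y) * fac l y x = 4 * (x * ric1 l x y z + y * ric1 l y x z + z * ric3 l x y z - ric1 l y x z)"
  and "(1 - 2*z) * facz l x y = 4 * (x * ric1 l x y z + y * ric1 l y x z + z * ric3 l x y z - ric3 l x y z)"
 unfolding assms fac_def facz_def ric1_def ric3_def
 by (simp_all add: field_simps) (algebra+)

text \<open>The first equation splits off the factor x - y. On x = y the second one factors again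
  and gives \<open>R\<close> and \<open>N\<close>; on the other branch x + y and x y are determined,
  and they turn out to satisfy (2 x - 1) (2 y - 1) = 0, which gives \<open>S\<close> and
  \<open>T\<close>.\<close>

lemma ric_equal:
 assumes "l >= 4" "x > 0" "y > 0" "z > 0" "x + y + z = 1"
  and e12: "ric1 l x y z = ric1 l y x z" and e13: "ric1 l x y z = ric3 l x y z"
 shows "(x, y) : {ptN l, ptR, ptS l, ptT l}"
proof -
 define n where "n = real l"
 have n: "n >= 4" using assms by (simp add: n_def)
 have "(x - y) * ((n - 2) * (x + y) - 2 * (n - 1) * z) = 0"
  using e12 unfolding ric1_def n_def[symmetric] by (simp add: field_simps) algebra
 then consider "x = y" | "(n - 2) * (x + y) = 2 * (n - 1) * z" by auto
 thus ?thesis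
 proof cases
  case 1
  have "(z - 2*x) * (n * z - 2 * (n - 2) * x) = 0"
   using e13 unfolding ric1_def ric3_def n_def[symmetric] 1 by (simp add: field_simps) algebra
  then consider "z = 2 * x" | "n * z = 2 * (n - 2) * x" by auto
  thus ?thesis
  proof cases
   case 1
   thus ?thesis using `x = y` assms by (simp add: ptR_def)
  next
   case 2
   have "n * (1 - 2 * x) = 2 * (n - 2) * x" using 2 `x = y` assms(5) by algebra
   hence "x * (4 * (n - 1)) = n" by algebra
   hence "x = n / (4 * (n - 1))" using n by (simp add: field_simps)
   thus ?thesis using `x = y` by (simp add: ptN_def n_def)
  qed
 next
  case 2
  have z: "z * (3 * n - 4) = n - 2" and s: "(x + y) * (3 * n - 4) = 2 * (n - 1)"
   using 2 assms(5) by algebra+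
  have e: "(n - 1) * (x + y) * z - n * z^2 / 2 + (x + y)^2 = 2 * n * (x * y)"
   using e12 e13 unfolding ric1_def ric3_def n_def[symmetric] by (simp add: field_simps) algebra
  \<comment> \<open>With \<open>u\<close> as a symbol for the reciprocal, x + y, z and x y are
    polynomials in \<open>n\<close> and \<open>u\<close>, so the computation needs no
    division.\<close>
  define u where "u = 1 / (3 * n - 4)"
  have u: "u * (3 * n - 4) = 1" "z = (n - 2) * u" "x + y = 2 * (n - 1) * u"
   using z s n by (auto simp: u_def field_simps)
  have "2 * n * (x * y) = 2 * n * (u * n / 4)"
   unfolding e[symmetric] u(2,3) using u(1) by (simp add: field_simps) algebra
  hence xy: "x * y = u * n / 4" using n by (simp add: mult.commute)
  have "(2*x - 1) * (2*y - 1) = 4 * (x * y) - 2 * (x + y) + 1" by algebra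
  also have "... = 0" unfolding xy u(3) using u(1) by (simp add: algebra_simps)
  finally consider "x = 1/2" | "y = 1/2" by force
  thus ?thesis
  proof cases
   case 1
   hence "y * (6 * n - 8) = n" using s by algebra
   hence "y = n / (6 * n - 8)" using n by (simp add: field_simps)
   thus ?thesis using 1 by (simp add: ptT_def n_def)
  next
   case 2
   hence "x * (6 * n - 8) = n" using s by algebra
   hence "x = n / (6 * n - 8)" using n by (simp add: field_simps)
   thus ?thesis using 2 by (simp add: ptS_def n_def)
  qed
 qed
qed

definition osimplex :: "(real * real) set" where
 "osimplex = {u. 0 < fst u & 0 < snd u & 0 < 1 - fst u - snd u}"

lemma interior_simplex2: "interior simplex2 = osimplex"
proof -
 have "simplex2 = {u. (-1, 0) \<bullet> u <= 0} Int {u. (0, -1) \<bullet> u <= 0} Int {u::real * real. (1, 1) \<bullet> u <= 1}"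
  by (auto simp: simplex2_def)
 hence "interior simplex2 = interior {u. (-1, 0) \<bullet> u <= 0} Int interior {u. (0, -1) \<bullet> u <= 0} Int interior {u::real * real. (1, 1) \<bullet> u <= 1}"
  by (metis interior_Int)
 also have "... = {u. (-1, 0) \<bullet> u < 0} Int {u. (0, -1) \<bullet> u < 0} Int {u::real * real. (1, 1) \<bullet> u < 1}"
  by (intro arg_cong2[where f = "(\<inter>)"] interior_halfspace_le) (auto simp: zero_prod_def)
 also have "... = osimplex" by (auto simp: osimplex_def)
 finally show ?thesis .
qed

lemma open_open_simplex: "open osimplex"
 by (simp flip: interior_simplex2)

lemma osimplex_sub: "u : osimplex ==> u : simplex2"
 by (auto simp: simplex2_iff osimplex_def)

lemma flow_open_simplex: assumes "p : osimplex" shows "flow l p t : osimplex"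
 using assms flow_sgn(1-3)[OF osimplex_sub[OF assms], of l t]
 unfolding osimplex_def mem_Collect_eq by (metis sgn_1_pos)

text \<open>Up to a factor, the scalar curvature normalized by the volume. As always, it does not decrease
  along the Ricci flow, and it is stationary only at the Einstein metrics.\<close>

definition lyap :: "nat => real * real => real" where
 "lyap l = (%u. let x = fst u; y = snd u; z = 1 - x - y; n = real l in
   (2 * ric1 l x y z + 2 * ric1 l y x z + (n - 2) * ric3 l x y z) *
   exp ((2 / (n + 2) - 1) * ln x + (2 / (n + 2) - 1) * ln y + ((n - 2) / (n + 2) - 1) * ln z))"

text \<open>The summands have dimensions proportional to 2, 2, n - 2, with sum n + 2; the quotients
  in the exponents come from the volume to the power 2 / dimension, and the further -1 from the
  factor 1 / (x y z) in the Ricci eigenvalues. The derivative is a positive multiple of a weighted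
  sum of squared differences of the Ricci numbers, whence it vanishes only at Einstein
  metrics.\<close>

definition lyap' :: "nat => real * real => real" where
 "lyap' l = (%u. let x = fst u; y = snd u; z = 1 - x - y; n = real l in
   4 / (n + 2) * (4 * (ric1 l x y z - ric1 l y x z)^2 +
    2 * (n - 2) * ((ric1 l x y z - ric3 l x y z)^2 + (ric1 l y x z - ric3 l x y z)^2)) *
   exp ((2 / (n + 2) - 1) * ln x + (2 / (n + 2) - 1) * ln y + ((n - 2) / (n + 2) - 1) * ln z))"

text \<open>Once the partial derivatives of \<open>Q\<close> are eliminated, \<open>x\<close>,
  \<open>y\<close>, \<open>z\<close> and \<open>s\<close> drop out. What remains is the variance of
  the \<open>A\<close>s for the weights 2, 2, n - 2, up to a factor, and a variance is a sum of
  weighted squared differences over pairs.\<close>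

lemma lyap_polynomial_identity:
 fixes n x y z A1 A2 A3 Q s :: real
 assumes "n + 2 ~= 0"
  and A1: "A1 = (n - 1) * y * z + (n - 2) * (x^2 - y^2 - z^2) / 4"
  and A2: "A2 = (n - 1) * x * z + (n - 2) * (y^2 - x^2 - z^2) / 4"
  and A3: "A3 = (n - 1) * x * y + (z^2 - x^2 - y^2) / 2"
  and Q: "Q = 2 * A1 + 2 * A2 + (n - 2) * A3"
 shows "(4 * x * (s - A1)) * (2 * (n - 1) * z + (n - 1) * (n - 2) * y - (n - 2) * x)
   + (4 * y * (s - A2)) * (2 * (n - 1) * z + (n - 1) * (n - 2) * x - (n - 2) * y)
   + (4 * z * (s - A3)) * (2 * (n - 1) * (x + y) - (n - 2) * z)
   + Q * ((2 / (n + 2) - 1) * (4 * (s - A1)) + (2 / (n + 2) - 1) * (4 * (s - A2)) + ((n - 2) / (n + 2) - 1) * (4 * (s - A3)))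
   = 4 / (n + 2) * (4 * (A1 - A2)^2 + 2 * (n - 2) * ((A1 - A3)^2 + (A2 - A3)^2))"
proof -
 have Q': "Q = 2 * (n - 1) * (x * z + y * z) + (n - 1) * (n - 2) * x * y - (n - 2) * (x^2 + y^2 + z^2) / 2"
  unfolding Q A1 A2 A3 by (simp add: field_simps power2_eq_square)
 \<comment> \<open>The second factors are the partial derivatives of \<open>Q\<close> with respect
   to \<open>x\<close>, \<open>y\<close> and \<open>z\<close>.\<close>
 have q1: "x * (2 * (n - 1) * z + (n - 1) * (n - 2) * y - (n - 2) * x) = Q - 2 * A1"
  and q2: "y * (2 * (n - 1) * z + (n - 1) * (n - 2) * x - (n - 2) * y) = Q - 2 * A2"
  and q3: "z * (2 * (n - 1) * (x + y) - (n - 2) * z) = Q - (n - 2) * A3"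
  unfolding Q' A1 A2 A3 by (simp_all add: field_simps) (algebra+)
 \<comment> \<open>Here \<open>g\<close> is n + 2, so that the weight n - 2 reads
   \<open>g - 4\<close>.\<close>
 have id: "4 * (s - A1) * (q - 2 * A1) + 4 * (s - A2) * (q - 2 * A2) + 4 * (s - A3) * (q - (g - 4) * A3)
   + q * ((2 / g - 1) * (4 * (s - A1)) + (2 / g - 1) * (4 * (s - A2)) + ((g - 4) / g - 1) * (4 * (s - A3)))
   = 4 / g * (4 * (A1 - A2)^2 + 2 * (g - 4) * ((A1 - A3)^2 + (A2 - A3)^2))"
  if "g ~= 0" "q = 2 * A1 + 2 * A2 + (g - 4) * A3" for g q
  using that(1) unfolding that(2) by (simp add: field_simps power2_eq_square)
 have "(4 * x * (s - A1)) * (2 * (n - 1) * z + (n - 1) * (n - 2) * y - (n - 2) * x) = 4 * (s - A1) * (Q - 2 * A1)"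
  "(4 * y * (s - A2)) * (2 * (n - 1) * z + (n - 1) * (n - 2) * x - (n - 2) * y) = 4 * (s - A2) * (Q - 2 * A2)"
  "(4 * z * (s - A3)) * (2 * (n - 1) * (x + y) - (n - 2) * z) = 4 * (s - A3) * (Q - (n - 2) * A3)"
  unfolding q1[symmetric] q2[symmetric] q3[symmetric] by algebra+
 thus ?thesis using id[OF assms(1), of Q] Q by simp
qed

lemma lyap_deriv:
 assumes p: "p : osimplex"
 shows "((%t. lyap l (flow l p t)) has_real_derivative lyap' l (flow l p t)) (at t)"
proof -
 define x y where "x = fst (flow l p t)" and "y = snd (flow l p t)"
 define z where "z = 1 - x - y"
 define n where "n = real l"
 have pos: "x > 0" "y > 0" "z > 0"
  using flow_open_simplex[OF p, of l t] by (auto simp: osimplex_def x_def y_def z_def)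
 have pt: "flow l p t = (x, y)" by (simp add: x_def y_def)
 note pS = osimplex_sub[OF p]
 define A1 A2 A3 where A: "A1 = ric1 l x y z" "A2 = ric1 l y x z" "A3 = ric3 l x y z"
 define s where "s = x * A1 + y * A2 + z * A3"
 note d = proj_flow_coords[OF pS pt, folded z_def]
 have d1: "((%t. fst (flow l p t)) has_real_derivative 4 * x * (s - A1)) (at t)"
  and d2: "((%t. snd (flow l p t)) has_real_derivative 4 * y * (s - A2)) (at t)"
  and d3: "((%t. 1 - fst (flow l p t) - snd (flow l p t)) has_real_derivative 4 * z * (s - A3)) (at t)"
  using d unfolding fac_ric[OF z_def] A s_def by (simp_all add: mult_ac)
 define E where "E = exp ((2 / (n + 2) - 1) * ln x + (2 / (n + 2) - 1) * ln y + ((n - 2) / (n + 2) - 1) * ln z)"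
 define Q where "Q = 2 * A1 + 2 * A2 + (n - 2) * A3"
 define DQ where "DQ = (4 * x * (s - A1)) * (2 * (n - 1) * z + (n - 1) * (n - 2) * y - (n - 2) * x)
   + (4 * y * (s - A2)) * (2 * (n - 1) * z + (n - 1) * (n - 2) * x - (n - 2) * y)
   + (4 * z * (s - A3)) * (2 * (n - 1) * (x + y) - (n - 2) * z)"
 define DE where "DE = (2 / (n + 2) - 1) * (4 * (s - A1)) + (2 / (n + 2) - 1) * (4 * (s - A2)) + ((n - 2) / (n + 2) - 1) * (4 * (s - A3))"
 let ?x = "%t. fst (flow l p t)" and ?y = "%t. snd (flow l p t)"
 let ?z = "%t. 1 - ?x t - ?y t"
 have z3: "?z t = z" by (simp add: x_def y_def z_def)
 have zz: "4 * z * (s - A3) = - (4 * x * (s - A1)) - 4 * y * (s - A2)"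
  unfolding s_def z_def by algebra
 have dQ: "((%t. 2 * ric1 l (?x t) (?y t) (?z t) + 2 * ric1 l (?y t) (?x t) (?z t) + (n - 2) * ric3 l (?x t) (?y t) (?z t))
   has_real_derivative DQ) (at t)"
  unfolding ric1_def ric3_def
  by (auto intro!: derivative_eq_intros d1 d2 d3)
    (simp add: z3 DQ_def zz flip: x_def y_def n_def, simp add: z_def field_simps)
 have dE: "((%t. exp ((2 / (n + 2) - 1) * ln (?x t) + (2 / (n + 2) - 1) * ln (?y t) + ((n - 2) / (n + 2) - 1) * ln (?z t)))
   has_real_derivative E * DE) (at t)"
 proof -
  have l1: "((%t. ln (?x t)) has_real_derivative 4 * (s - A1)) (at t)"
   using DERIV_chain2[OF DERIV_ln_divide[of "?x t"] d1] pos by (simp flip: x_def)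
  have l2: "((%t. ln (?y t)) has_real_derivative 4 * (s - A2)) (at t)"
   using DERIV_chain2[OF DERIV_ln_divide[of "?y t"] d2] pos by (simp flip: y_def)
  have l3: "((%t. ln (?z t)) has_real_derivative 4 * (s - A3)) (at t)"
   using DERIV_chain2[OF DERIV_ln_divide[of "?z t"] d3] pos by (simp add: z3)
  have "((%t. (2 / (n + 2) - 1) * ln (?x t) + (2 / (n + 2) - 1) * ln (?y t) + ((n - 2) / (n + 2) - 1) * ln (?z t))
    has_real_derivative DE) (at t)"
   unfolding DE_def by (intro DERIV_add DERIV_cmult l1 l2 l3)
  from DERIV_fun_exp[OF this] show ?thesis
   by (simp only: z3 E_def flip: x_def y_def z_def)
 qed
 have "((%t. lyap l (flow l p t)) has_real_derivative Q * (E * DE) + DQ * E) (at t)"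
  using DERIV_mult'[OF dQ dE]
  by (simp only: lyap_def Let_def Q_def E_def A z3 flip: x_def y_def n_def z_def)
 moreover have "Q * (E * DE) + DQ * E = lyap' l (flow l p t)"
 proof -
  have "DQ + Q * DE = 4 / (n + 2) * (4 * (A1 - A2)^2 + 2 * (n - 2) * ((A1 - A3)^2 + (A2 - A3)^2))"
   unfolding DQ_def DE_def
   by (rule lyap_polynomial_identity) (simp_all add: Q_def A ric1_def ric3_def n_def algebra_simps)
  moreover have "Q * (E * DE) + DQ * E = (DQ + Q * DE) * E" by (simp add: algebra_simps)
  ultimately show ?thesis by (simp add: lyap'_def Let_def E_def A pt z_def n_def)
 qed
 ultimately show ?thesis by simp
qed

lemma lyap_cont: "u : osimplex ==> isCont (lyap l) u"
 unfolding lyap_def Let_def ric1_def ric3_def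
 by (intro continuous_intros) (auto simp: osimplex_def)

lemma lyap'_nonneg: "l >= 2 ==> lyap' l u >= 0"
 unfolding lyap'_def Let_def by (intro mult_nonneg_nonneg add_nonneg_nonneg divide_nonneg_nonneg) auto

lemma lyap'_zero:
 assumes "l >= 4" "u : osimplex" "lyap' l u <= 0"
 shows "u : {ptN l, ptR, ptS l, ptT l}"
proof -
 define x y where "x = fst u" and "y = snd u"
 define z where "z = 1 - x - y"
 define a b c where abc: "a = ric1 l x y z - ric1 l y x z" "b = ric1 l x y z - ric3 l x y z" "c = ric1 l y x z - ric3 l x y z"
 have l: "real l >= 4" using assms by simp
 obtain E where "lyap' l u = 4 / (real l + 2) * (4 * a^2 + 2 * (real l - 2) * (b^2 + c^2)) * exp E"
  unfolding lyap'_def Let_def abc x_def[symmetric] y_def[symmetric] z_def[symmetric] by blast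
 hence "4 / (real l + 2) * (4 * a^2 + 2 * (real l - 2) * (b^2 + c^2)) <= 0"
  using assms(3) by (metis exp_gt_zero mult_le_0_iff not_less)
 hence *: "4 * a^2 + 2 * (real l - 2) * (b^2 + c^2) <= 0"
  using l by (simp add: divide_le_0_iff mult_le_0_iff)
 have "2 * (real l - 2) * (b^2 + c^2) >= 0" using l by (intro mult_nonneg_nonneg) auto
 hence "a^2 <= 0" "2 * (real l - 2) * (b^2 + c^2) <= 0" using * zero_le_power2[of a] by linarith+
 hence "a = 0" "b^2 + c^2 <= 0" using l by (auto simp: mult_le_0_iff)
 hence "a = 0" "b = 0" using sum_power2_le_zero_iff by blast+
 hence "(x, y) : {ptN l, ptR, ptS l, ptT l}"
  using assms(2) by (intro ric_equal[OF assms(1), of x y z]) (auto simp: abc osimplex_def x_def y_def z_def)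
 thus ?thesis by (simp add: x_def y_def)
qed

text \<open>For fixed s = x + y the expression is affine in x on the interval from 0 to s - 1/2. It
  is positive at the right end, and at the left end it is n (1 - s), which vanishes only at the
  excluded point \<open>P\<close>.\<close>

lemma fac_pos:
 assumes "l >= 4" "0 <= x" "1/2 <= y" "x + y <= 1" "y ~= 1"
 shows "fac l y x > 0"
proof -
 define n s where "n = real l" and "s = x + y"
 have n: "n >= 4" using assms by (simp add: n_def)
 have e: "fac l y x = n * (1 - s) + x * (8 * (n - 1) * s - (6 * n - 4))"
  unfolding fac_def s_def n_def by algebra
 have s: "1/2 <= s" "s <= 1" "x <= s - 1/2" using assms by (auto simp: s_def)
 show ?thesis
 proof (cases "8 * (n - 1) * s - (6 * n - 4) >= 0")
  case True
  hence "x * (8 * (n - 1) * s - (6 * n - 4)) >= 0" using assms by simp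
  moreover have "n * (1 - s) > 0 | (s = 1 & x * (8 * (n - 1) * s - (6 * n - 4)) > 0)"
  proof (cases "s = 1")
   case True
   hence "x > 0" using assms by (auto simp: s_def)
   thus ?thesis using True n by simp
  qed (use s n in auto)
  ultimately show ?thesis unfolding e using s n by (smt (verit) mult_nonneg_nonneg)
 next
  case False
  hence "x * (8 * (n - 1) * s - (6 * n - 4)) >= (s - 1/2) * (8 * (n - 1) * s - (6 * n - 4))"
   using s by (intro mult_right_mono_neg) auto
  moreover have "n * (1 - s) + (s - 1/2) * (8 * (n - 1) * s - (6 * n - 4)) > 0"
  proof -
   define m where "m = n - 4"
   define v where "v = s - 1/2"
   have "n * (1 - s) + (s - 1/2) * (8 * (n - 1) * s - (6 * n - 4))
    = m * (8 * v^2 - 3 * v + 1/2) + (24 * v^2 - 12 * v + 2)"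
    unfolding m_def v_def by (simp add: field_simps power2_eq_square)
   also have "8 * v^2 - 3 * v + 1/2 = 8 * (v - 3/16)^2 + 7/32" by (simp add: field_simps power2_eq_square)
   also have "24 * v^2 - 12 * v + 2 = 24 * (v - 1/4)^2 + 1/2" by (simp add: field_simps power2_eq_square)
   finally show ?thesis using n by (simp add: m_def add_nonneg_pos)
  qed
  ultimately show ?thesis unfolding e by linarith
 qed
qed

text \<open>By 4 x y <= (x + y)^2 the worst case is x = y, which leaves a quadratic in x +
  y.\<close>

lemma facz_pos:
 assumes "l >= 4" "0 <= x" "0 <= y" "x + y <= 1/2" "x + y ~= 0"
 shows "facz l x y > 0"
proof -
 define n s where "n = real l" and "s = x + y"
 have n: "n >= 4" and s: "0 < s" "s <= 1/2" using assms by (auto simp: n_def s_def)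
 have "s^2 - 4 * (x * y) = (x - y)^2" unfolding s_def by algebra
 hence "4 * (x * y) <= s^2" by (metis diff_ge_0_iff_ge zero_le_power2)
 hence "2 * (n - 1) * (4 * (x * y)) <= 2 * (n - 1) * s^2" using n by (intro mult_left_mono) auto
 moreover have "n * s - 2 * (n - 1) * s^2 > 0"
 proof -
  have "(n - 1) * s <= (n - 1) * (1/2)" using n s by (intro mult_left_mono) auto
  hence "0 < s * (n - 2 * ((n - 1) * s))" using s by (intro mult_pos_pos) auto
  thus ?thesis by (simp add: algebra_simps power2_eq_square)
 qed
 moreover have "facz l x y = n * s - 2 * (n - 1) * (4 * (x * y))"
  unfolding facz_def n_def s_def by algebra
 ultimately show ?thesis by linarith
qed

section \<open>Linearization at the equilibria\<close>

lemma pr_field_deriv: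
 "(pr_field l has_derivative (%w.
   (((1 - 4*x) * fac l x y + x * (1 - 2*x) * (real l * (8*y - 1) - 8*y)) * fst w
    + x * (1 - 2*x) * (real l * (8*x + 16*y - 7) - 8*x - 16*y + 4) * snd w,
   y * (1 - 2*y) * (real l * (8*y + 16*x - 7) - 8*y - 16*x + 4) * fst w
    + ((1 - 4*y) * fac l y x + y * (1 - 2*y) * (real l * (8*x - 1) - 8*x)) * snd w))) (at (x, y))"
 unfolding pr_field_eq fac_def
 by (rule has_derivative_eq_rhs, (rule derivative_intros has_derivative_power)+)
   (simp add: fun_eq_iff algebra_simps power2_eq_square)

lemma complex_eigenvalue_2x2:
 assumes "complex_eigenvalue (%w. (a * fst w + b * snd w, c * fst w + d * snd w)) mu"
 shows "(mu - complex_of_real a) * (mu - complex_of_real d) = complex_of_real (b * c)"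
proof -
 obtain u1 u2 v1 v2 where nz: "~ ((u1, u2) = (0::real * real) & (v1, v2) = (0::real * real))"
  and e: "a * u1 + b * u2 = Re mu * u1 - Im mu * v1" "c * u1 + d * u2 = Re mu * u2 - Im mu * v2"
   "a * v1 + b * v2 = Im mu * u1 + Re mu * v1" "c * v1 + d * v2 = Im mu * u2 + Re mu * v2"
  using assms unfolding complex_eigenvalue_def by auto
 define w1 w2 where "w1 = Complex u1 v1" and "w2 = Complex u2 v2"
 have w: "w1 ~= 0 | w2 ~= 0" using nz by (auto simp: w1_def w2_def complex_eq_iff zero_prod_def)
 have e1: "(mu - a) * w1 = b * w2" and e2: "(mu - d) * w2 = c * w1"
  using e by (auto simp: w1_def w2_def complex_eq_iff algebra_simps)
 have "((mu - a) * (mu - d) - complex_of_real b * c) * w1 = 0"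
  using e1 e2 by algebra
 moreover have "((mu - a) * (mu - d) - complex_of_real b * c) * w2 = 0"
  using e1 e2 by algebra
 ultimately show ?thesis using w by auto
qed

text \<open>A real 2-by-2 matrix with negative determinant has real eigenvalues of opposite signs; a
  purely imaginary eigenvalue would make the determinant nonnegative.\<close>

lemma hyperbolic_saddleI:
 assumes "V p = 0"
  and A: "(V has_derivative (%w. (a * fst w + b * snd w, c * fst w + d * snd w))) (at p)"
  and det: "a * d - b * c < 0"
 shows "hyperbolic_saddle V (p :: real * real)"
proof -
 let ?A = "%w::real * real. (a * fst w + b * snd w, c * fst w + d * snd w)"
 have re: "Re mu ~= 0" if ev: "complex_eigenvalue ?A mu" for mu
 proof
  assume "Re mu = 0"
  hence "Re ((mu - complex_of_real a) * (mu - complex_of_real d)) = a * d - (Im mu)^2" by (simp add: power2_eq_square)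
  hence "a * d - (Im mu)^2 = b * c" unfolding complex_eigenvalue_2x2[OF ev] by simp
  thus False using det zero_le_power2[of "Im mu"] by linarith
 qed
 \<comment> \<open>An eigenvector can be read off from either row, as \<open>(b, r - a)\<close> or
   \<open>(r - d, c)\<close>; both vanish only in the degenerate case excluded by the
   determinant.\<close>
 have real_ev: "complex_eigenvalue ?A (complex_of_real r)" if r: "(r - a) * (r - d) = b * c" for r
 proof -
  consider "b ~= 0 | r ~= a" | "b = 0" "r = a" "c ~= 0 | r ~= d" | "b = 0" "r = a" "c = 0" "r = d" by blast
  then obtain w where "w ~= 0" "?A w = r *R w"
  proof cases
   case 1
   thus ?thesis using that[of "(b, r - a)"] r by (auto simp: zero_prod_def algebra_simps)
  next
   case 2
   thus ?thesis using that[of "(r - d, c)"] r by (auto simp: zero_prod_def algebra_simps)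
  next
   case 3
   thus ?thesis using det zero_le_square[of r] by simp
  qed
  thus ?thesis unfolding complex_eigenvalue_def by (intro exI[of _ w] exI[of _ 0]) simp
 qed
 define D where "D = sqrt ((a + d)^2 - 4 * (a * d - b * c))"
 have gt: "(a + d)^2 - 4 * (a * d - b * c) > (a + d)^2" using det by simp
 hence D2: "D^2 = (a + d)^2 - 4 * (a * d - b * c)"
  unfolding D_def using zero_le_power2[of "a + d"] by (intro real_sqrt_pow2) linarith
 have "sqrt ((a + d)^2) < D" unfolding D_def using gt by (rule real_sqrt_less_mono)
 hence D: "abs (a + d) < D" by simp
 have "((a + d + D) / 2 - a) * ((a + d + D) / 2 - d) = b * c"
  "((a + d - D) / 2 - a) * ((a + d - D) / 2 - d) = b * c"
  using D2 by (simp_all add: field_simps power2_eq_square)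
 from this[THEN real_ev] D show ?thesis
  unfolding hyperbolic_saddle_def using assms(1) A re
  by (intro conjI exI[of _ ?A]) (force simp: Re_complex_of_real)+
qed

lemma ptS_in: "l >= 4 ==> 0 < real l / (6 * real l - 8)" "l >= 4 ==> real l / (6 * real l - 8) < 1/2"
 by (auto simp: field_simps)

lemma fac_ptS: "l >= 4 ==> fac l (real l / (6 * real l - 8)) (1/2) = 0"
 unfolding fac_def by (simp add: field_simps power2_eq_square)

text \<open>At \<open>S\<close> and \<open>T\<close> the Jacobian is triangular, because the side of
  the triangle through the point is invariant: \<open>pos\<close> gives repulsion along the side and
  \<open>fp\<close> attraction across it. At \<open>R\<close> the determinant is computed
  directly.\<close>

lemma RST_saddle:
 assumes l: "l >= 4" and p: "p : {ptR, ptS l, ptT l}"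
 shows "hyperbolic_saddle (pr_field l) p"
proof -
 define s where "s = real l / (6 * real l - 8)"
 have s: "0 < s" "s < 1/2" using ptS_in[OF l] by (auto simp: s_def)
 have fs: "fac l s (1/2) = 0" using fac_ptS[OF l] by (simp add: s_def)
 have fp: "fac l (1/2) s > 0" using fac_pos[OF l, of s "1/2"] s by simp
 have f4: "fac l (1/4) (1/4) = 0" by (simp add: fac_def power2_eq_square field_simps)
 have pos: "s * (1 - 2 * s) * (real l * 3 - 4) > 0" using s l by (intro mult_pos_pos) auto
 consider "p = (1/4, 1/4)" | "p = (s, 1/2)" | "p = (1/2, s)"
  using p by (auto simp: ptR_def ptS_def ptT_def s_def)
 thus ?thesis
 proof cases
  case 1
  show ?thesis unfolding 1
   by (rule hyperbolic_saddleI[OF _ pr_field_deriv])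
     (use l in "auto simp: pr_field_fac f4 zero_prod_def field_simps")
 next
  case 2
  show ?thesis unfolding 2
   by (rule hyperbolic_saddleI[OF _ pr_field_deriv])
     (use l s fs fp pos in "auto simp: pr_field_fac zero_prod_def")
 next
  case 3
  show ?thesis unfolding 3
   by (rule hyperbolic_saddleI[OF _ pr_field_deriv])
     (use l s fs fp pos in "auto simp: pr_field_fac zero_prod_def")
 qed
qed

text \<open>At \<open>K\<close>, \<open>L\<close> and \<open>M\<close> the Jacobian is a negative
  multiple of the identity, so the Euclidean norm itself decreases along orbits near the
  point.\<close>

lemma sink:
 assumes l: "l >= 4" and v: "v : {ptK, ptL, ptM}"
 obtains de where "de > 0" "!!q. q : simplex2 ==> dist q v < de ==> (flow l q \<longlongrightarrow> v) at_top"
proof -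
 have n: "real l >= 4" using l by simp
 have "EX c>0. pr_field l v = 0 & (pr_field l has_derivative (%w. (- c) *R w)) (at v)"
 proof -
  consider "v = (0, 1/2)" | "v = (1/2, 1/2)" | "v = (1/2, 0)" using v by (auto simp: ptK_def ptL_def ptM_def)
  thus ?thesis
  proof cases
   case 1
   thus ?thesis using n
    by (intro exI[of _ "real l / 2"])
     (auto simp: pr_field_fac zero_prod_def fac_def power2_eq_square field_simps
      intro!: has_derivative_eq_rhs[OF pr_field_deriv])
  next
   case 2
   thus ?thesis using n
    by (intro exI[of _ "real l - 2"])
     (auto simp: pr_field_fac zero_prod_def fac_def power2_eq_square field_simps
      intro!: has_derivative_eq_rhs[OF pr_field_deriv])
  next
   case 3
   thus ?thesis using n
    by (intro exI[of _ "real l / 2"])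
     (auto simp: pr_field_fac zero_prod_def fac_def power2_eq_square field_simps
      intro!: has_derivative_eq_rhs[OF pr_field_deriv])
  qed
 qed
 then obtain c where c: "c > 0" "pr_field l v = 0" "(pr_field l has_derivative (%w. (- c) *R w)) (at v)" by blast
 have "EX de>0. ALL q. norm (q - v) < de --> pr_field l q \<bullet> (q - v) <= - (c / 2) * (norm (q - v))^2"
  by (rule derivative_inner_bound[OF c(3,2), of "c / 2"]) (use c in "auto simp: power2_norm_eq_inner")
 then obtain de where de: "de > 0" "!!q. norm (q - v) < de ==> pr_field l q \<bullet> (q - v) <= - (c / 2) * (norm (q - v))^2" by blast
 show ?thesis
 proof (rule that[OF de(1)])
  fix q assume "q : simplex2" "dist q v < de"
  thus "(flow l q \<longlongrightarrow> v) at_top"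
   using c(1) de
   by (intro exponential_attraction(2)[of "c / 2" de v "pr_field l"]) (auto simp: proj_flow_deriv dist_norm)
 qed
qed

lemma ptN_bounds:
 assumes "l >= 4"
 shows "1/4 < real l / (4 * (real l - 1))" "real l / (4 * (real l - 1)) < 1/2"
 using assms by (auto simp: field_simps)

lemma ptN_in: "l >= 4 ==> ptN l : osimplex"
 using ptN_bounds[of l] by (auto simp: ptN_def osimplex_def)

lemma proj_flow_reverse_deriv:
 "p : simplex2 ==> ((%t. flow l p (- t)) has_vector_derivative - pr_field l (flow l p (- t))) (at t)"
 by (rule has_vector_derivative_reflect) (rule proj_flow_deriv)

text \<open>The Jacobian at \<open>N\<close> is symmetric with eigenvalues \<open>4 * A\<close> and
  \<open>(2 l - 4) * A\<close>. For l >= 4 the smaller one is \<open>4 * A\<close>, the rate used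
  for the reversed flow. Shrinking the ball into \<open>osimplex\<close> ensures that all points in
  it have a flow line.\<close>

lemma source_N:
 assumes l: "l >= 4"
 obtains de where "de > 0" "ball (ptN l) de <= osimplex"
  "!!q t. dist q (ptN l) < de ==> t >= 0 ==> dist (flow l q (- t)) (ptN l) <= dist q (ptN l)"
  "!!q. dist q (ptN l) < de ==> ((%t. flow l q (- t)) \<longlongrightarrow> ptN l) at_top"
  and "pr_field l (ptN l) = 0"
proof -
 define s where "s = real l / (4 * (real l - 1))"
 have s: "1/4 < s" "s < 1/2" using ptN_bounds[OF l] by (auto simp: s_def)
 have N: "ptN l = (s, s)" by (simp add: ptN_def s_def)
 have sl: "4 * (real l - 1) * s = real l" using l by (simp add: s_def)
 have fs: "fac l s s = 0"
 proof -
  have "fac l s s = (4 * s - 1) * (4 * (real l - 1) * s - real l)"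
   unfolding fac_def by algebra
  thus ?thesis using sl by simp
 qed
 define A where "A = s * (1 - 2 * s)"
 have A: "A > 0" using s by (auto simp: A_def)
 have zero: "pr_field l (ptN l) = 0" by (simp add: N pr_field_fac fs zero_prod_def)
 have e: "real l * (8 * s - 1) - 8 * s = real l" "real l * (8 * s + 16 * s - 7) - 8 * s - 16 * s + 4 = 4 - real l"
  using sl by (simp_all add: algebra_simps)
 have d: "(pr_field l has_derivative (%w. (A * real l * fst w + A * (4 - real l) * snd w,
   A * (4 - real l) * fst w + A * real l * snd w))) (at (ptN l))"
  using pr_field_deriv[of l s s] unfolding N e fs A_def by simp
 have "EX de>0. ALL q. norm (q - ptN l) < de --> - pr_field l q \<bullet> (q - ptN l) <= - (2 * A) * (norm (q - ptN l))^2"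
 proof (rule derivative_inner_bound[OF has_derivative_minus[OF d]])
  show "- (A * real l * fst w + A * (4 - real l) * snd w, A * (4 - real l) * fst w + A * real l * snd w) \<bullet> w
    <= - (2 * (2 * A)) * (norm w)^2" for w
  proof -
   have "0 <= A * (real l - 4) * (fst w - snd w)^2" using A l by simp
   moreover have "(norm w)^2 = (fst w)^2 + (snd w)^2" by (cases w) (simp add: norm_Pair)
   ultimately show ?thesis
    by (cases w) (simp add: algebra_simps power2_eq_square)
  qed
 qed (use A zero in auto)
 then obtain de where de: "de > 0" "!!q. norm (q - ptN l) < de ==> - pr_field l q \<bullet> (q - ptN l) <= - (2 * A) * (norm (q - ptN l))^2" by blast
 obtain rh where rh: "rh > 0" "ball (ptN l) rh <= osimplex"
  using open_open_simplex ptN_in[OF l] openE by blast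
 have start: "q : simplex2 & norm (q - ptN l) < de" if "dist q (ptN l) < min de rh" for q
 proof -
  have "q : ball (ptN l) rh" using that by (simp add: dist_commute)
  hence "q : simplex2" using rh(2) osimplex_sub by blast
  thus ?thesis using that by (simp add: dist_norm)
 qed
 note ea = exponential_attraction[of "2 * A" de "ptN l" "%u. - pr_field l u" "%t. flow l q (- t)" for q]
 show ?thesis
 proof (rule that[of "min de rh"])
  show "ball (ptN l) (min de rh) <= osimplex" using rh(2) by auto
  show "dist (flow l q (- t)) (ptN l) <= dist q (ptN l)" if "dist q (ptN l) < min de rh" "t >= 0" for q t
   using ea(1)[of q t] start[OF that(1)] that(2) A de by (simp add: proj_flow_reverse_deriv dist_norm)
  show "((%t. flow l q (- t)) \<longlongrightarrow> ptN l) at_top" if "dist q (ptN l) < min de rh" for q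
   using ea(2)[of q] start[OF that(1)] A de by (simp add: proj_flow_reverse_deriv)
 qed (use de rh zero in auto)
qed

lemma repeller_N:
 assumes l: "l >= 4" shows "repeller (flow l) (ptN l)"
proof (rule source_N[OF l])
 fix de :: real assume de: "de > 0" "ball (ptN l) de <= osimplex"
  "!!q t. dist q (ptN l) < de ==> t >= 0 ==> dist (flow l q (- t)) (ptN l) <= dist q (ptN l)"
  "!!q. dist q (ptN l) < de ==> ((%t. flow l q (- t)) \<longlongrightarrow> ptN l) at_top"
  and zero: "pr_field l (ptN l) = 0"
 show ?thesis
  unfolding repeller_def
 proof (intro conjI allI impI)
  show "flow l (ptN l) t = ptN l" for t
   by (rule proj_flow_equilibrium[OF osimplex_sub[OF ptN_in[OF l]] zero])
  show "EX de>0. ALL q. dist q (ptN l) < de --> (ALL t<=0. dist (flow l q t) (ptN l) < ep)" if "ep > 0" for ep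
  proof (intro exI[of _ "min de ep"] conjI allI impI)
   show "dist (flow l q t) (ptN l) < ep" if "dist q (ptN l) < min de ep" "t <= 0" for q t
    using de(3)[of q "- t"] that by simp
  qed (use de that in auto)
  show "EX de>0. ALL q. dist q (ptN l) < de --> (flow l q \<longlongrightarrow> ptN l) at_bot"
   using de(1,4) by (auto simp: filterlim_at_bot_mirror)
 qed
qed

text \<open>Followed backwards from a point close to \<open>N\<close>, the distance to
  \<open>N\<close> does not grow. An orbit that comes arbitrarily close to \<open>N\<close> in
  forward time must therefore have started at distance 0.\<close>

lemma tendsto_N_imp_eq:
 assumes l: "l >= 4" and p: "p : simplex2" and lim: "(flow l p \<longlongrightarrow> ptN l) at_top"
 shows "p = ptN l"
proof (rule source_N[OF l])
 fix de :: real assume de: "de > 0"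
  "!!q t. dist q (ptN l) < de ==> t >= 0 ==> dist (flow l q (- t)) (ptN l) <= dist q (ptN l)"
 have "dist p (ptN l) <= 0"
 proof (rule tendsto_lowerbound)
  show "((%t. dist (flow l p t) (ptN l)) \<longlongrightarrow> 0) at_top" using lim by (rule tendsto_dist_iff[THEN iffD1])
  have "\<forall>\<^sub>F t in at_top. dist (flow l p t) (ptN l) < de" using lim de(1) by (rule tendstoD)
  thus "\<forall>\<^sub>F t in at_top. dist p (ptN l) <= dist (flow l p t) (ptN l)"
   using eventually_ge_at_top[of 0]
  proof eventually_elim
   case (elim t)
   from de(2)[OF this] show ?case using proj_flow_add[OF p, of l t "- t"] p by simp
  qed
 qed simp
 thus "p = ptN l" by simp
qed

section \<open>The triangle, the corners and the limits of single orbits\<close>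

definition open_triangle :: "(real * real) set" where
 "open_triangle = {u. fst u < 1/2 & snd u < 1/2 & 1/2 < fst u + snd u}"

lemma triangle_eq: "triangleKLM = {u. fst u <= 1/2 & snd u <= 1/2 & 1/2 <= fst u + snd u}"
proof -
 have "u : triangleKLM" if "fst u <= 1/2" "snd u <= 1/2" "1/2 <= fst u + snd u" for u :: "real * real"
  unfolding convex_hull_3 mem_Collect_eq ptK_def ptL_def ptM_def
  \<comment> \<open>The witnesses are the barycentric coordinates with respect to \<open>K\<close>,
    \<open>L\<close>, \<open>M\<close>.\<close>
  by (rule exI[of _ "1 - 2 * fst u"], rule exI[of _ "2 * (fst u + snd u) - 1"], rule exI[of _ "1 - 2 * snd u"])
    (use that in "auto simp: prod_eq_iff field_simps")
 moreover have "fst u <= 1/2 & snd u <= 1/2 & 1/2 <= fst u + snd u" if "u : triangleKLM" for u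
  using that unfolding convex_hull_3 ptK_def ptL_def ptM_def by auto
 ultimately show ?thesis by blast
qed

lemma interior_triangle: "interior triangleKLM = open_triangle"
proof -
 have "triangleKLM = {u. (1, 0) \<bullet> u <= 1/2} Int {u. (0, 1) \<bullet> u <= 1/2} Int {u::real * real. (-1, -1) \<bullet> u <= - 1/2}"
  unfolding triangle_eq by (auto simp: inner_prod_def)
 hence "interior triangleKLM = interior {u. (1, 0) \<bullet> u <= 1/2} Int interior {u. (0, 1) \<bullet> u <= 1/2} Int interior {u::real * real. (-1, -1) \<bullet> u <= - 1/2}"
  by (metis interior_Int)
 also have "... = {u. (1, 0) \<bullet> u < 1/2} Int {u. (0, 1) \<bullet> u < 1/2} Int {u::real * real. (-1, -1) \<bullet> u < - 1/2}"
  by (intro arg_cong2[where f = "(\<inter>)"] interior_halfspace_le) (auto simp: zero_prod_def)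
 also have "... = open_triangle" by (auto simp: open_triangle_def inner_prod_def)
 finally show ?thesis .
qed

lemma corner_iff:
 "u : cornerP \<longleftrightarrow> 1/2 < snd u" "u : cornerO \<longleftrightarrow> fst u + snd u < 1/2" "u : cornerQ \<longleftrightarrow> 1/2 < fst u"
 by (auto simp: cornerP_def cornerO_def cornerQ_def split: prod.splits)

lemma flow_corner:
 assumes "p : simplex2"
 shows "p : cornerP ==> flow l p t : cornerP"
  and "p : cornerO ==> flow l p t : cornerO"
  and "p : cornerQ ==> flow l p t : cornerQ"
  and "p : open_triangle ==> flow l p t : open_triangle"
proof -
 note s = flow_sgn(4-6)[OF assms, of l t]
 have neg: "a < 0" if "sgn a = sgn b" "b < 0" for a b :: real using that by (metis sgn_1_neg)
 have pos: "a > 0" if "sgn a = sgn b" "b > 0" for a b :: real using that by (metis sgn_1_pos)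
 show "p : cornerP ==> flow l p t : cornerP"
  using neg[OF s(2)] by (auto simp: cornerP_def split: prod.splits)
 show "p : cornerO ==> flow l p t : cornerO"
  using neg[OF s(3)] by (auto simp: cornerO_def split: prod.splits)
 show "p : cornerQ ==> flow l p t : cornerQ"
  using neg[OF s(1)] by (auto simp: cornerQ_def split: prod.splits)
 show "p : open_triangle ==> flow l p t : open_triangle"
  using pos[OF s(1)] pos[OF s(2)] pos[OF s(3)] by (auto simp: open_triangle_def)
qed

lemma omega_limit_closed: "q : omega_limit ph ==> closed S ==> (!!t. ph t : S) ==> q : S"
 unfolding omega_limit_def by clarify (rule closed_sequentially)

text \<open>In a corner the largest of the three parameters decreases strictly as long as it is between
  \<open>1/2\<close> and \<open>1\<close>.\<close>

lemma corner_omega: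
 assumes l: "l >= 4" and p: "p : osimplex"
  and f: "(f, D) : {(snd, cornerP), (%u. 1 - fst u - snd u, cornerO), (fst, cornerQ)}" and D: "p : D"
 shows "q : omega_limit (flow l p) ==> f q = 1/2"
  and "q : omega_limit (%t. flow l p (- 1 * t)) ==> f q = 1"
proof -
 note pS = osimplex_sub[OF p]
 have "EX F. (ALL u:simplex2. ALL t. ((%t. f (flow l u t)) has_real_derivative
    f (flow l u t) * ((1 - 2 * f (flow l u t)) * F (flow l u t))) (at t)) &
   (ALL u:simplex2. 1/2 <= f u --> f u ~= 1 --> F u > 0)"
 proof -
  consider "f = snd" | "f = (%u. 1 - fst u - snd u)" | "f = fst" using f by auto
  thus ?thesis
  proof cases
   case 1
   have "fac l (snd u) (fst u) > 0" if "u : simplex2" "1/2 <= snd u" "snd u ~= 1" for u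
    using that by (intro fac_pos[OF l]) (auto simp: simplex2_iff)
   thus ?thesis unfolding 1
    by (intro exI[of _ "%u. fac l (snd u) (fst u)"] conjI ballI allI impI proj_flow_coords(2)) auto
  next
   case 2
   have "facz l (fst u) (snd u) > 0" if "u : simplex2" "1/2 <= 1 - fst u - snd u" "1 - fst u - snd u ~= 1" for u
    using that by (intro facz_pos[OF l]) (auto simp: simplex2_iff)
   thus ?thesis unfolding 2
    by (intro exI[of _ "%u. facz l (fst u) (snd u)"] conjI ballI allI impI proj_flow_coords(3)) auto
  next
   case 3
   have "fac l (fst u) (snd u) > 0" if "u : simplex2" "1/2 <= fst u" "fst u ~= 1" for u
    using that by (intro fac_pos[OF l]) (auto simp: simplex2_iff)
   thus ?thesis unfolding 3
    by (intro exI[of _ "%u. fac l (fst u) (snd u)"] conjI ballI allI impI proj_flow_coords(1)) auto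
  qed
 qed
 then obtain F where d: "!!u t. u : simplex2 ==> ((%t. f (flow l u t)) has_real_derivative
    f (flow l u t) * ((1 - 2 * f (flow l u t)) * F (flow l u t))) (at t)"
  and F: "!!u. u : simplex2 ==> 1/2 <= f u ==> f u ~= 1 ==> F u > 0" by metis
 have cont: "isCont f u" for u using f by (auto intro!: continuous_intros)
 have lt: "1/2 < f (flow l p t)" for t using f D flow_corner(1-3)[OF pS, of l t] by (auto simp: corner_iff)
 have lt1: "f u < 1" if "u : osimplex" for u using f that by (auto simp: osimplex_def)
 have p1: "1/2 < f p" "f p < 1" using f D lt1[OF p] by (auto simp: corner_iff)
 have neg: "f (flow l p t) * ((1 - 2 * f (flow l p t)) * F (flow l p t)) <= 0" for t
  using lt[of t] F[OF proj_flow_in[OF pS], of l t] lt1[OF flow_open_simplex[OF p], of l t]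
  by (auto simp: mult_le_0_iff)
 show "f q = 1/2" if q: "q : omega_limit (flow l p)"
 proof -
  have qS: "q : simplex2" by (rule omega_limit_closed[OF q closed_simplex2 proj_flow_in[OF pS]])
  have "closed {u. 1/2 <= f u}" using cont by (intro closed_Collect_le continuous_intros continuous_at_imp_continuous_on) auto
  hence "q : {u. 1/2 <= f u}" by (rule omega_limit_closed[OF q]) (use less_imp_le[OF lt] in simp)
  moreover have "1 * - (f q * ((1 - 2 * f q) * F q)) <= 0" "- f p <= - f q"
   by (rule omega_lyapunov[where h = "%u. - f u" and p = p and q = q and D = simplex2 and sg = 1 and l = l
     and h' = "%u. - (f u * ((1 - 2 * f u) * F u))"]; use pS qS q neg in "auto intro!: DERIV_minus d continuous_intros cont proj_flow_in")+
  ultimately show ?thesis using F[OF qS] p1 by (auto simp: zero_le_mult_iff)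
 qed
 show "f q = 1" if q: "q : omega_limit (%t. flow l p (- 1 * t))"
 proof -
  have qS: "q : simplex2" by (rule omega_limit_closed[OF q closed_simplex2 proj_flow_in[OF pS]])
  have "- 1 * (f q * ((1 - 2 * f q) * F q)) <= 0" "f p <= f q"
   by (rule omega_lyapunov[where h = f and p = p and q = q and D = simplex2 and sg = "- 1" and l = l
     and h' = "%u. f u * ((1 - 2 * f u) * F u)"]; use pS qS q neg in "auto intro!: d cont proj_flow_in")+
  thus ?thesis using F[OF qS] p1 by (auto simp: zero_le_mult_iff)
 qed
qed

text \<open>A limit point inside the simplex is an Einstein metric by the Lyapunov function. One on
  the boundary, where that function is undefined, lies in the closed triangle or on the line of one
  of its sides, and these meet the boundary of the simplex only in \<open>K\<close>,
  \<open>L\<close> and \<open>M\<close>.\<close>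

lemma flow_omega_sub:
 assumes l: "l >= 4" and p: "p : osimplex"
  and D: "p : cornerP | p : cornerO | p : cornerQ | p : open_triangle"
  and q: "q : omega_limit (flow l p)"
 shows "q : {ptN l, ptR, ptS l, ptT l, ptK, ptL, ptM}"
proof -
 note pS = osimplex_sub[OF p]
 have q1: "q : omega_limit (%t. flow l p (1 * t))" using q by simp
 have qS: "q : simplex2" by (rule omega_limit_closed[OF q closed_simplex2 proj_flow_in[OF pS]])
 show ?thesis
 proof (cases "q : osimplex")
  case True
  have "1 * lyap' l q <= 0"
   by (rule omega_lyapunov(1)[where h = "lyap l" and p = p and D = osimplex and sg = 1])
     (use pS p q1 True lyap_deriv lyap_cont flow_open_simplex lyap'_nonneg l in auto)
  thus ?thesis using lyap'_zero[OF l True] by auto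
 next
  case False
  note co = corner_omega(1)[OF l p _ _ q]
  have "closed triangleKLM" by (intro compact_imp_closed finite_imp_compact_convex_hull) simp
  hence "q : triangleKLM" if "p : open_triangle"
   by (rule omega_limit_closed[OF q]) (use flow_corner(4)[OF pS that] triangle_eq in "auto simp: open_triangle_def less_imp_le")
  hence "snd q = 1/2 | fst q + snd q = 1/2 | fst q = 1/2 | q : triangleKLM"
   using D co[of snd cornerP] co[of fst cornerQ] co[of "%u. 1 - fst u - snd u" cornerO] by auto
  thus ?thesis using False qS unfolding triangle_eq
   by (cases q) (auto simp: osimplex_def simplex2_iff ptK_def ptL_def ptM_def)
 qed
qed

lemma flow_limit:
 assumes l: "l >= 4" and p: "p : osimplex"
  and D: "p : cornerP | p : cornerO | p : cornerQ | p : open_triangle"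
 shows "EX q:{ptN l, ptR, ptS l, ptT l, ptK, ptL, ptM}. (flow l p \<longlongrightarrow> q) at_top"
 by (rule omega_limit_finite_tendsto[OF compact_simplex2])
   (use flow_omega_sub[OF l p D] proj_flow_in proj_flow_continuous_on osimplex_sub[OF p] in auto)

text \<open>In backward time the largest parameter tends to 1, and only one point of the simplex has
  that value.\<close>

lemma flow_backward:
 assumes l: "l >= 4" and p: "p : osimplex"
 shows "p : cornerP ==> (flow l p \<longlongrightarrow> ptP) at_bot"
  and "p : cornerO ==> (flow l p \<longlongrightarrow> ptO) at_bot"
  and "p : cornerQ ==> (flow l p \<longlongrightarrow> ptQ) at_bot"
proof -
 note pS = osimplex_sub[OF p]
 have bot: "(flow l p \<longlongrightarrow> v) at_bot"
  if v: "!!q. q : omega_limit (%t. flow l p (- 1 * t)) ==> q : simplex2 ==> q = v" for v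
 proof -
  have "EX q:{v}. ((%t. flow l p (- 1 * t)) \<longlongrightarrow> q) at_top"
  proof (rule omega_limit_finite_tendsto[OF compact_simplex2])
   show "continuous_on {0..} (%t. flow l p (- 1 * t))"
    by (rule continuous_on_compose2[OF proj_flow_continuous_on[OF pS]]) (auto intro!: continuous_intros)
   show "omega_limit (%t. flow l p (- 1 * t)) <= {v}"
   proof
    fix q assume q: "q : omega_limit (%t. flow l p (- 1 * t))"
    have "q : simplex2" by (rule omega_limit_closed[OF q closed_simplex2 proj_flow_in[OF pS]])
    thus "q : {v}" using v[OF q] by simp
   qed
  qed (auto simp: proj_flow_in[OF pS])
  thus ?thesis by (simp add: filterlim_at_bot_mirror)
 qed
 note co = corner_omega(2)[OF l p]
 show "(flow l p \<longlongrightarrow> ptP) at_bot" if c: "p : cornerP"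
  by (rule bot) (use co[of snd, OF _ c] in "force simp: simplex2_iff ptP_def prod_eq_iff")
 show "(flow l p \<longlongrightarrow> ptQ) at_bot" if c: "p : cornerQ"
  by (rule bot) (use co[of fst, OF _ c] in "force simp: simplex2_iff ptQ_def prod_eq_iff")
 show "(flow l p \<longlongrightarrow> ptO) at_bot" if c: "p : cornerO"
  by (rule bot) (use co[of "%u. 1 - fst u - snd u", OF _ c] in "force simp: simplex2_iff ptO_def prod_eq_iff")
qed

lemma flow_backward_outside:
 assumes "l >= 4" "p : osimplex" "p ~: triangleKLM"
 shows "EX v:{ptO, ptP, ptQ}. (flow l p \<longlongrightarrow> v) at_bot"
proof -
 have "p : cornerP | p : cornerO | p : cornerQ"
  using assms(3) unfolding triangle_eq by (auto simp: cornerP_def cornerO_def cornerQ_def split: prod.splits)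
 thus ?thesis using flow_backward[OF assms(1,2)] by blast
qed

section \<open>Basins of attraction and the regions\<close>

definition corners :: "((real * real) set \<times> (real * real)) set" where
 "corners = {(cornerP, ptK), (cornerP, ptL), (cornerO, ptK), (cornerO, ptM), (cornerQ, ptL), (cornerQ, ptM),
   (open_triangle, ptK), (open_triangle, ptL), (open_triangle, ptM)}"

text \<open>The basin of \<open>v\<close> within \<open>D\<close>. There are nine pairs and not ten,
  as \<open>R5\<close> and \<open>R6\<close> together form the basin of \<open>L\<close> in the
  triangle.\<close>

definition piece :: "nat => (real * real) set \<times> (real * real) => (real * real) set" where
 "piece l = (%(D, v). {q : osimplex Int D. (flow l q \<longlongrightarrow> v) at_top})"

lemma corners_mem:
 "(cornerP, ptK) : corners" "(cornerP, ptL) : corners" "(cornerO, ptK) : corners" "(cornerO, ptM) : corners"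
 "(cornerQ, ptL) : corners" "(cornerQ, ptM) : corners" "(open_triangle, ptK) : corners"
 "(open_triangle, ptL) : corners" "(open_triangle, ptM) : corners"
 by (simp_all add: corners_def)

lemma corners_props:
 assumes "(D, v) : corners"
 shows "v : {ptK, ptL, ptM}" "open D" "convex D"
  "!!q t. q : osimplex ==> q : D ==> flow l q t : D"
  "v : closure (osimplex Int D)"
proof -
 show "v : {ptK, ptL, ptM}" using assms by (auto simp: corners_def)
 have sets: "cornerP = {u. (0, 1) \<bullet> u > 1/2}" "cornerQ = {u. (1, 0) \<bullet> u > 1/2}" "cornerO = {u. (1, 1) \<bullet> u < 1/2}"
  "open_triangle = {u. (1, 0) \<bullet> u < 1/2} Int {u. (0, 1) \<bullet> u < 1/2} Int {u. (1, 1) \<bullet> u > 1/2}"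
  by (auto simp: corner_iff open_triangle_def inner_prod_def)
 have "open cornerP" "open cornerQ" "open cornerO" "open open_triangle"
  unfolding sets by (intro open_Int open_halfspace_lt open_halfspace_gt)+
 thus "open D" using assms by (auto simp: corners_def)
 have "convex cornerP" "convex cornerQ" "convex cornerO" "convex open_triangle"
  unfolding sets by (intro convex_Int convex_halfspace_lt convex_halfspace_gt)+
 thus "convex D" using assms by (auto simp: corners_def)
 show "flow l q t : D" if "q : osimplex" "q : D" for q t
  using assms flow_corner[OF osimplex_sub[OF that(1)], of l t] that(2) by (auto simp: corners_def)
 have cl: "v : closure (osimplex Int D)"
  if w: "!!e. 0 < e ==> e < 1 ==> v + e *R w : osimplex Int D" for w
 proof -
  \<comment> \<open>The shift by 2 keeps the parameter strictly below 1.\<close>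
  have "(%n. v + (1 / real (n + 2)) *R w) \<longlonglongrightarrow> v + 0 *R w"
   by (intro tendsto_intros LIMSEQ_ignore_initial_segment[OF lim_1_over_n[where 'a = real]])
  moreover have "v + (1 / real (n + 2)) *R w : osimplex Int D" for n by (rule w) auto
  ultimately show ?thesis unfolding closure_sequential by (intro exI[of _ "%n. v + (1 / real (n + 2)) *R w"]) simp
 qed
 from assms consider "(D, v) = (cornerP, ptK)" | "(D, v) = (cornerP, ptL)" | "(D, v) = (cornerO, ptK)" | "(D, v) = (cornerO, ptM)"
  | "(D, v) = (cornerQ, ptL)" | "(D, v) = (cornerQ, ptM)" | "(D, v) = (open_triangle, ptK)"
  | "(D, v) = (open_triangle, ptL)" | "(D, v) = (open_triangle, ptM)"
  by (auto simp: corners_def)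
 thus "v : closure (osimplex Int D)"
 proof cases
  case 1 thus ?thesis by (intro cl[of "(1/8, 1/8)"]) (auto simp: corner_iff osimplex_def ptK_def)
 next
  case 2 thus ?thesis by (intro cl[of "(-1/4, 1/8)"]) (auto simp: corner_iff osimplex_def ptL_def)
 next
  case 3 thus ?thesis by (intro cl[of "(1/8, -1/4)"]) (auto simp: corner_iff osimplex_def ptK_def)
 next
  case 4 thus ?thesis by (intro cl[of "(-1/4, 1/8)"]) (auto simp: corner_iff osimplex_def ptM_def)
 next
  case 5 thus ?thesis by (intro cl[of "(1/8, -1/4)"]) (auto simp: corner_iff osimplex_def ptL_def)
 next
  case 6 thus ?thesis by (intro cl[of "(1/8, 1/8)"]) (auto simp: corner_iff osimplex_def ptM_def)
 next
  case 7 thus ?thesis by (intro cl[of "(1/4, -1/8)"]) (auto simp: open_triangle_def osimplex_def ptK_def)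
 next
  case 8 thus ?thesis by (intro cl[of "(-1/8, -1/8)"]) (auto simp: open_triangle_def osimplex_def ptL_def)
 next
  case 9 thus ?thesis by (intro cl[of "(-1/8, 1/4)"]) (auto simp: open_triangle_def osimplex_def ptM_def)
 qed
qed

lemma corners_disjoint:
 assumes "(D, v) : corners" "(D', v') : corners" "q : osimplex" "q : D" "q : D'"
 shows "D = D'"
proof -
 have "D : {cornerP, cornerO, cornerQ, open_triangle}" "D' : {cornerP, cornerO, cornerQ, open_triangle}"
  using assms(1,2) by (auto simp: corners_def)
 thus ?thesis using assms(3-)
  by (elim insertE emptyE) (simp_all add: corner_iff open_triangle_def osimplex_def)
qed

lemma vertices_distinct: "ptK ~= ptL" "ptK ~= ptM" "ptL ~= ptM"
 by (auto simp: ptK_def ptL_def ptM_def)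

lemma flow_limit_unique:
 "(flow l q \<longlongrightarrow> v) at_top ==> (flow l q \<longlongrightarrow> w) at_top ==> v = w"
 by (rule tendsto_unique[OF trivial_limit_at_top_linorder])

lemma convex_open_simplex: "convex osimplex"
 unfolding interior_simplex2[symmetric]
proof (rule convex_interior)
 have eq: "simplex2 = {u. (-1, 0) \<bullet> u <= 0} Int {u. (0, -1) \<bullet> u <= 0} Int {u::real * real. (1, 1) \<bullet> u <= 1}"
  by (auto simp: simplex2_def)
 show "convex simplex2" by (subst eq) (intro convex_Int convex_halfspace_le)
qed

lemma piece_core:
 assumes l: "l >= 4" and c: "(D, v) : corners"
 obtains de where "de > 0" "osimplex Int D Int ball v de <= piece l (D, v)"
  "!!q. q : simplex2 ==> q : ball v de ==> (flow l q \<longlongrightarrow> v) at_top"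
proof -
 obtain de where de: "de > 0" "!!q. q : simplex2 ==> dist q v < de ==> (flow l q \<longlongrightarrow> v) at_top"
  using sink[OF l corners_props(1)[OF c]] by metis
 show ?thesis
  by (rule that[OF de(1)]) (use de(2) osimplex_sub in "auto simp: piece_def dist_commute")
qed

lemma piece_reaches:
 assumes c: "(D, v) : corners" and q: "q : piece l (D, v)" and "de > 0"
 obtains t where "t >= 0" "flow l q t : osimplex Int D Int ball v de"
proof -
 have q': "q : osimplex" "q : D" "(flow l q \<longlongrightarrow> v) at_top" using q by (auto simp: piece_def)
 have "\<forall>\<^sub>F t in at_top. dist (flow l q t) v < de" using q'(3) `de > 0` by (rule tendstoD)
 then obtain T where "!!t. t >= T ==> dist (flow l q t) v < de" by (auto simp: eventually_at_top_linorder)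
 from this[of "max T 0"] show ?thesis
  using flow_open_simplex[OF q'(1)] corners_props(4)[OF c q'(1,2)] by (intro that[of "max T 0"]) (auto simp: dist_commute)
qed

lemma piece_flow: "(D, v) : corners ==> q : piece l (D, v) ==> flow l q t : piece l (D, v)"
proof -
 assume c: "(D, v) : corners" and q: "q : piece l (D, v)"
 hence q': "q : osimplex" "q : D" "(flow l q \<longlongrightarrow> v) at_top" by (auto simp: piece_def)
 have "((%s. flow l q (t + s)) \<longlongrightarrow> v) at_top"
  by (rule filterlim_compose[OF q'(3)]) (rule filterlim_tendsto_add_at_top[OF tendsto_const filterlim_ident])
 hence "(flow l (flow l q t) \<longlongrightarrow> v) at_top"
  using proj_flow_add[OF osimplex_sub[OF q'(1)]] by presburger
 thus ?thesis
  using flow_open_simplex[OF q'(1)] corners_props(4)[OF c q'(1,2)] by (simp add: piece_def)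
qed

lemma flow_back_limit:
 assumes "q : simplex2" "(flow l (flow l q t) \<longlongrightarrow> v) at_top"
 shows "(flow l q \<longlongrightarrow> v) at_top"
proof -
 have "((%s. flow l (flow l q t) (- t + s)) \<longlongrightarrow> v) at_top"
  by (rule filterlim_compose[OF assms(2)]) (rule filterlim_tendsto_add_at_top[OF tendsto_const filterlim_ident])
 thus ?thesis by (simp add: proj_flow_add[OF assms(1)])
qed

text \<open>At some time \<open>t\<close> the orbit of \<open>q\<close> is in the ball of attraction
  of \<open>v\<close>. By continuous dependence the neighbours of \<open>q\<close> are there at the
  same time, and then they converge to \<open>v\<close> too.\<close>

lemma piece_open:
 assumes l: "l >= 4" and c: "(D, v) : corners"
 shows "open (piece l (D, v))"
proof (rule openI)
 fix q assume q: "q : piece l (D, v)"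
 obtain de where de: "de > 0" "!!q. q : simplex2 ==> q : ball v de ==> (flow l q \<longlongrightarrow> v) at_top"
  using piece_core[OF l c] by metis
 obtain t where t: "t >= 0" "flow l q t : osimplex Int D Int ball v de"
  using piece_reaches[OF c q de(1)] by metis
 have q': "q : osimplex" "q : D" using q by (auto simp: piece_def)
 have "open (osimplex Int D)" using open_open_simplex corners_props(2)[OF c] by auto
 then obtain r where r: "r > 0" "ball q r <= osimplex Int D" using q' openE by (metis IntI)
 obtain L where L: "ALL ph ps t. pr_line l ph --> pr_line l ps --> dist (ph t) (ps t) <= dist (ph 0) (ps 0) * exp (L * abs t)"
  using flow_lipschitz by blast
 define E where "E = exp (L * abs t)"
 have E: "E > 0" by (simp add: E_def)
 define ep where "ep = de - dist v (flow l q t)"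
 have ep: "ep > 0" using t by (simp add: ep_def)
 show "EX e>0. ball q e <= piece l (D, v)"
 proof (intro exI[of _ "min r (ep / E)"] conjI subsetI)
  fix p assume p: "p : ball q (min r (ep / E))"
  hence p': "p : osimplex Int D" using r(2) by auto
  have pS: "p : simplex2" "q : simplex2" using p' q' osimplex_sub by auto
  have "dist (flow l q t) (flow l p t) <= dist q p * E"
   using L[rule_format, OF pr_line_flow[OF pS(2)] pr_line_flow[OF pS(1)], of t] pS by (simp add: E_def)
  also have "... < ep" using p E by (simp add: field_simps)
  finally have "flow l p t : ball v de"
   using dist_triangle[of v "flow l p t" "flow l q t"] by (simp add: ep_def)
  hence "(flow l (flow l p t) \<longlongrightarrow> v) at_top" by (rule de(2)[OF proj_flow_in[OF pS(1)]])
  hence "(flow l p \<longlongrightarrow> v) at_top" by (rule flow_back_limit[OF pS(1)])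
  thus "p : piece l (D, v)" using p' by (simp add: piece_def)
 qed (use r ep E in auto)
qed

text \<open>Every orbit in a piece enters the convex set where the piece meets a small ball around the sink.\<close>

lemma piece_connected:
 assumes l: "l >= 4" and c: "(D, v) : corners"
 shows "connected (piece l (D, v))" and "piece l (D, v) ~= {}" and "v : closure (piece l (D, v))"
proof -
 obtain de where de: "de > 0" "osimplex Int D Int ball v de <= piece l (D, v)"
  using piece_core[OF l c] by metis
 let ?C = "osimplex Int D Int ball v de"
 have "v : closure ?C"
  using corners_props(5)[OF c] de(1) open_Int_closure_subset[of "ball v de" "osimplex Int D"]
  by (auto simp: Int_commute)
 thus "v : closure (piece l (D, v))" using closure_mono[OF de(2)] by blast
 thus ne: "piece l (D, v) ~= {}" by auto
 have Cne: "?C ~= {}" using `v : closure ?C` by auto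
 have conC: "connected ?C"
  by (intro convex_connected convex_Int convex_open_simplex corners_props(3)[OF c] convex_ball)
 define G where "G q = flow l q ` {0..} Un ?C" for q
 have G: "connected (G q)" "q : G q" "G q <= piece l (D, v)" "?C <= G q" if q: "q : piece l (D, v)" for q
 proof -
  have qS: "q : simplex2" using q osimplex_sub by (auto simp: piece_def)
  obtain t where "t >= 0" "flow l q t : ?C" using piece_reaches[OF c q de(1)] by metis
  hence "flow l q ` {0..} Int ?C ~= {}" by auto
  thus "connected (G q)" unfolding G_def
   by (intro connected_Un conC connected_continuous_image proj_flow_continuous_on qS) auto
  show "q : G q" using qS by (auto simp: G_def intro!: image_eqI[of _ _ 0])
  show "G q <= piece l (D, v)" using piece_flow[OF c q] de(2) by (auto simp: G_def)
 qed (simp add: G_def)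
 have "piece l (D, v) = (UN q:piece l (D, v). G q)" using G by blast
 moreover have "connected (UN q:piece l (D, v). G q)"
  by (rule connected_Union) (use G Cne in "auto, blast")
 ultimately show "connected (piece l (D, v))" by simp
qed

lemma segments_line:
 "closed_segment ptK ptL <= {u. snd u = 1/2}" "closed_segment ptL ptM <= {u. fst u = 1/2}"
 "closed_segment ptK ptM <= {u. fst u + snd u = 1/2}"
 by (auto simp: closed_segment_def ptK_def ptL_def ptM_def field_simps)

lemma line_segments:
 assumes "u : simplex2"
 shows "snd u = 1/2 ==> u : closed_segment ptK ptL" "fst u = 1/2 ==> u : closed_segment ptL ptM"
  "fst u + snd u = 1/2 ==> u : closed_segment ptK ptM"
proof -
 note defs = closed_segment_def ptK_def ptL_def ptM_def mem_Collect_eq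
 show "snd u = 1/2 ==> u : closed_segment ptK ptL"
  using assms unfolding defs simplex2_iff
  by (intro exI[of _ "2 * fst u"]) (auto simp: prod_eq_iff field_simps)
 show "fst u = 1/2 ==> u : closed_segment ptL ptM"
  using assms unfolding defs simplex2_iff
  by (intro exI[of _ "1 - 2 * snd u"]) (auto simp: prod_eq_iff field_simps)
 show "fst u + snd u = 1/2 ==> u : closed_segment ptK ptM"
  using assms unfolding defs simplex2_iff
  by (intro exI[of _ "2 * fst u"]) (auto simp: prod_eq_iff field_simps)
qed

text \<open>Off the sides a point is in one of four invariant sets, and off \<open>cuts\<close> its
  limit is neither \<open>N\<close> nor a saddle. The limit also lies in the closure of the
  invariant set, which excludes the one vertex of the triangle that is not adjacent to a given
  corner.\<close>

lemma pieces_union: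
 assumes l: "l >= 4"
 shows "osimplex - cuts l = (UN c:corners. piece l c)"
proof (intro equalityI subsetI)
 fix q assume q: "q : osimplex - cuts l"
 hence qS: "q : simplex2" using osimplex_sub by auto
 have ne: "snd q ~= 1/2" "fst q ~= 1/2" "fst q + snd q ~= 1/2"
  using line_segments[OF qS] q by (auto simp: cuts_def)
 hence D: "q : cornerP | q : cornerO | q : cornerQ | q : open_triangle"
  by (auto simp: corner_iff open_triangle_def)
 obtain v where v: "v : {ptN l, ptR, ptS l, ptT l, ptK, ptL, ptM}" "(flow l q \<longlongrightarrow> v) at_top"
  using flow_limit[OF l _ D] q by blast
 have "v ~= ptN l" using tendsto_N_imp_eq[OF l qS] v(2) q by (auto simp: cuts_def)
 moreover have "v ~: {ptR, ptS l, ptT l}" using v(2) q qS by (auto simp: cuts_def stable_mfd_def)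
 ultimately have v': "v : {ptK, ptL, ptM}" using v(1) by auto
 have lim: "v : S" if "closed S" "!!t. flow l q t : S" for S
  by (rule Lim_in_closed_set[OF that(1) _ trivial_limit_at_top_linorder v(2)]) (simp add: that(2))
 have c1: "closed {u :: real * real. 1/2 <= snd u}" and c2: "closed {u :: real * real. 1/2 <= fst u}"
  and c3: "closed {u :: real * real. fst u + snd u <= 1/2}"
  by (intro closed_Collect_le continuous_intros)+
 have mem: "(D, v) : corners ==> q : D ==> q : (UN c:corners. piece l c)" for D
  using q v(2) by (auto simp: piece_def)
 from D consider "q : cornerP" | "q : cornerO" | "q : cornerQ" | "q : open_triangle" by blast
 thus "q : (UN c:corners. piece l c)"
 proof cases
  case 1
  have "v : {u. 1/2 <= snd u}"
   by (rule lim[OF c1]) (use flow_corner(1)[OF qS 1] in "simp add: corner_iff less_imp_le")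
  hence "v ~= ptM" by (auto simp: ptM_def)
  hence "(cornerP, v) : corners" using v' corners_mem by blast
  thus ?thesis using mem 1 by blast
 next
  case 2
  have "v : {u. fst u + snd u <= 1/2}"
   by (rule lim[OF c3]) (use flow_corner(2)[OF qS 2] in "simp add: corner_iff less_imp_le")
  hence "v ~= ptL" by (auto simp: ptL_def)
  hence "(cornerO, v) : corners" using v' corners_mem by blast
  thus ?thesis using mem 2 by blast
 next
  case 3
  have "v : {u. 1/2 <= fst u}"
   by (rule lim[OF c2]) (use flow_corner(3)[OF qS 3] in "simp add: corner_iff less_imp_le")
  hence "v ~= ptK" by (auto simp: ptK_def)
  hence "(cornerQ, v) : corners" using v' corners_mem by blast
  thus ?thesis using mem 3 by blast
 next
  case 4
  have "(open_triangle, v) : corners" using v' corners_mem by blast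
  thus ?thesis using mem 4 by blast
 qed
next
 fix q assume "q : (UN c:corners. piece l c)"
 then obtain D v where c: "(D, v) : corners" and q: "q : piece l (D, v)" by auto
 have q': "q : osimplex" "q : D" "(flow l q \<longlongrightarrow> v) at_top" using q by (auto simp: piece_def)
 note v = corners_props(1)[OF c]
 have "v ~: osimplex" using v by (auto simp: ptK_def ptL_def ptM_def osimplex_def)
 moreover have "{ptR, ptS l, ptT l, ptN l} <= osimplex"
  using ptS_in[OF l] ptN_in[OF l] by (auto simp: ptR_def ptS_def ptT_def osimplex_def)
 ultimately have "v ~: {ptR, ptS l, ptT l, ptN l}" by blast
 hence "q ~: stable_mfd l ptR" "q ~: stable_mfd l (ptS l)" "q ~: stable_mfd l (ptT l)"
  using flow_limit_unique[OF q'(3)] unfolding stable_mfd_def by blast+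
 moreover have "q ~= ptN l"
 proof
  assume "q = ptN l"
  hence "flow l q = (%_. ptN l)" using repeller_N[OF l] by (auto simp: repeller_def)
  hence "v = ptN l" using flow_limit_unique[OF q'(3), of "ptN l"] by simp
  thus False using `v ~: {ptR, ptS l, ptT l, ptN l}` by simp
 qed
 moreover have "q ~: closed_segment ptK ptL Un closed_segment ptL ptM Un closed_segment ptK ptM"
 proof -
  have "D : {cornerP, cornerO, cornerQ, open_triangle}" using c by (auto simp: corners_def)
  hence "snd q ~= 1/2 & fst q ~= 1/2 & fst q + snd q ~= 1/2"
   using q'(1,2) by (elim insertE emptyE) (simp_all add: corner_iff open_triangle_def osimplex_def)
  thus ?thesis using segments_line[THEN subsetD, of q] by auto
 qed
 ultimately show "q : osimplex - cuts l" using q'(1) by (simp add: cuts_def)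
qed

lemma piece_disjoint:
 assumes "(D, v) : corners" "(D', v') : corners" "q : piece l (D, v)" "q : piece l (D', v')"
 shows "D = D'" "v = v'"
 using assms corners_disjoint[OF assms(1,2), of q] flow_limit_unique[of l q v v'] by (auto simp: piece_def)

lemma components_pieces:
 assumes l: "l >= 4"
 shows "components (interior simplex2 - cuts l) = piece l ` corners"
proof (rule components_open_unique)
 show "pairwise disjnt (piece l ` corners)"
  unfolding pairwise_def disjnt_iff
 proof (intro ballI impI allI notI, elim imageE conjE, goal_cases)
  case (1 A B q c c')
  hence "c = c'" using piece_disjoint[of "fst c" "snd c" "fst c'" "snd c'" q l] by (metis prod.collapse)
  thus ?case using 1 by simp
 qed
 show "\<Union> (piece l ` corners) = interior simplex2 - cuts l"
  using pieces_union[OF l] by (simp add: interior_simplex2)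
 show "open X & connected X & X ~= {}" if "X : piece l ` corners" for X
  using that piece_open[OF l] piece_connected[OF l] by auto
qed

text \<open>Points of a candidate component that are close enough to \<open>v\<close> flow to
  \<open>v\<close>, so its sink can only be \<open>v\<close>; this is how the closure condition
  singles out one component.\<close>

lemma region_piece:
 assumes l: "l >= 4" and c: "(D, v) : corners"
 shows "region l D v = piece l (D, v)"
 unfolding region_def components_pieces[OF l]
proof (rule the_equality)
 show "piece l (D, v) : piece l ` corners & piece l (D, v) <= D & v : closure (piece l (D, v))"
  using c piece_connected[OF l c] by (auto simp: piece_def)
 fix C assume C: "C : piece l ` corners & C <= D & v : closure C"
 then obtain D' v' where c': "(D', v') : corners" "C = piece l (D', v')" by auto
 obtain de where de: "de > 0" "!!q. q : simplex2 ==> q : ball v de ==> (flow l q \<longlongrightarrow> v) at_top"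
  using piece_core[OF l c] by metis
 obtain q where q: "q : C" "q : ball v de"
  using C de(1) by (metis closure_approachable dist_commute mem_ball)
 have q': "q : osimplex" "q : D'" "(flow l q \<longlongrightarrow> v') at_top" using q c'(2) by (auto simp: piece_def)
 have "D = D'" using corners_disjoint[OF c c'(1) q'(1)] q q'(2) C by blast
 moreover have "v = v'" using flow_limit_unique de(2)[OF osimplex_sub[OF q'(1)] q(2)] q'(3) by blast
 ultimately show "C = piece l (D, v)" using c'(2) by simp
qed

lemma regions:
 assumes "l >= 4"
 shows "reg1 l = piece l (cornerP, ptK)" "reg2 l = piece l (cornerP, ptL)" "reg3 l = piece l (cornerO, ptK)"
  "reg4 l = piece l (open_triangle, ptK)" "reg5_6 l = piece l (open_triangle, ptL)" "reg7 l = piece l (open_triangle, ptM)"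
  "reg8 l = piece l (cornerO, ptM)" "reg9 l = piece l (cornerQ, ptL)" "reg10 l = piece l (cornerQ, ptM)"
 unfolding reg1_def reg2_def reg3_def reg4_def reg5_6_def reg7_def reg8_def reg9_def reg10_def interior_triangle
 by (rule region_piece[OF assms]; simp add: corners_def)+

lemma region_limits:
 assumes "l >= 4"
 shows "g0 : reg1 l Un reg3 l Un reg4 l ==> g0 : osimplex & (flow l g0 \<longlongrightarrow> ptK) at_top"
  "g0 : reg2 l Un reg5_6 l Un reg9 l ==> g0 : osimplex & (flow l g0 \<longlongrightarrow> ptL) at_top"
  "g0 : reg7 l Un reg8 l Un reg10 l ==> g0 : osimplex & (flow l g0 \<longlongrightarrow> ptM) at_top"
  "g0 : reg3 l Un reg8 l ==> (flow l g0 \<longlongrightarrow> ptO) at_bot"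
  "g0 : reg1 l Un reg2 l ==> (flow l g0 \<longlongrightarrow> ptP) at_bot"
  "g0 : reg9 l Un reg10 l ==> (flow l g0 \<longlongrightarrow> ptQ) at_bot"
 unfolding regions[OF assms] piece_def using flow_backward[OF assms, of g0] by auto

section \<open>Matrix algebra\<close>

lemma matrix_add_rdistrib: "((A::real^'n^'m) + U) ** C = A ** C + U ** C"
 by (vector matrix_matrix_mult_def sum.distrib[symmetric] distrib_right)

lemma matrix_diff_ldistrib: "(A::real^'n^'m) ** (U - C) = A ** U - A ** C"
 by (vector matrix_matrix_mult_def sum_subtractf[symmetric] right_diff_distrib)

lemma matrix_diff_rdistrib: "((A::real^'n^'m) - U) ** C = A ** C - U ** C"
 by (vector matrix_matrix_mult_def sum_subtractf[symmetric] left_diff_distrib)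

lemma mat_neg_left: "(- (A::real^'n^'m)) ** C = - (A ** C)"
 by (vector matrix_matrix_mult_def sum_negf[symmetric])

lemma mat_neg_right: "(A::real^'n^'m) ** (- C) = - (A ** C)"
 by (vector matrix_matrix_mult_def sum_negf[symmetric])

lemma mat_scaleR_left: "(c *R (A::real^'n^'m)) ** C = c *R (A ** C)"
 by (vector matrix_matrix_mult_def sum_distrib_left mult.assoc)

lemma mat_scaleR_right: "(A::real^'n^'m) ** (c *R C) = c *R (A ** C)"
 by (vector matrix_matrix_mult_def sum_distrib_left mult.left_commute)

lemma transpose_add: "transpose ((A::real^'n^'m) + C) = transpose A + transpose C"
 by (vector transpose_def)

lemma transpose_diff: "transpose ((A::real^'n^'m) - C) = transpose A - transpose C"
 by (vector transpose_def)

lemma transpose_neg: "transpose (- (A::real^'n^'m)) = - transpose A"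
 by (vector transpose_def)

lemma transpose_zero: "transpose (0::real^'n^'m) = 0"
 by (vector transpose_def)

lemmas mat_assoc = matrix_mul_assoc

lemmas mat_lin = matrix_add_ldistrib matrix_add_rdistrib matrix_diff_ldistrib matrix_diff_rdistrib
 mat_neg_left mat_neg_right mat_scaleR_left mat_scaleR_right

lemmas tr_simps = transpose_add transpose_diff transpose_neg transpose_zero transpose_scalar
 matrix_transpose_mul transpose_transpose transpose_mat

lemma inner_matrix: "(X::real^'n^'m) \<bullet> Y = (SUM i:UNIV. SUM j:UNIV. X $ i $ j * Y $ i $ j)"
 by (simp add: inner_vec_def)

lemma inner_eq_trace: "(X::real^'n^'m) \<bullet> Y = trace (transpose X ** Y)"
 by (simp add: inner_matrix trace_def matrix_matrix_mult_def transpose_def) (rule sum.swap)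

lemma inner_transpose: "transpose (X::real^'n^'m) \<bullet> transpose Y = X \<bullet> Y"
 by (simp add: inner_matrix transpose_def) (rule sum.swap)

lemma inner_matrix_left: "(A ** X) \<bullet> Y = (X::real^'n^'m) \<bullet> (transpose A ** Y)"
 by (simp add: inner_eq_trace matrix_transpose_mul mat_assoc)

lemma inner_matrix_right: "(X ** A) \<bullet> Y = (X::real^'n^'m) \<bullet> (Y ** transpose A)"
proof -
 have "(X ** A) \<bullet> Y = trace (transpose A ** (transpose X ** Y))"
  by (simp add: inner_eq_trace matrix_transpose_mul mat_assoc)
 also have "... = trace ((transpose X ** Y) ** transpose A)" by (rule trace_mul_sym)
 finally show ?thesis by (simp add: inner_eq_trace mat_assoc)
qed

lemma inner_conj: "(A ** X ** C) \<bullet> Y = (X::real^'n^'n) \<bullet> (transpose A ** Y ** transpose C)"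
 by (simp add: inner_matrix_right[of "A ** X"] inner_matrix_left[of A X] mat_assoc)

lemma trace_neg: "trace (- (A::real^'n^'n)) = - trace A"
 by (simp add: trace_def sum_negf)

lemma trace_scaleR: "trace (c *R (A::real^'n^'n)) = c * trace A"
 by (simp add: trace_def sum_distrib_left)

lemma trace_transpose: "trace (transpose (A::real^'n^'n)) = trace A"
 by (simp add: trace_def transpose_def)

lemma trace_zero: "trace (0::real^'n^'n) = 0"
 by (simp add: trace_def)

lemmas trace_simps = trace_add trace_sub trace_neg trace_scaleR trace_zero

section \<open>Traces of linear maps on matrices, projections and the Killing form\<close>

definition tr_op :: "('a::euclidean_space => 'a) => real" where
 "tr_op f = (SUM b:Basis. f b \<bullet> b)"

lemma tr_op_add: "tr_op (%b. f b + g b) = tr_op f + tr_op g"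
 and tr_op_diff: "tr_op (%b. f b - g b) = tr_op f - tr_op g"
 and tr_op_minus: "tr_op (%b. - f b) = - tr_op f"
 and tr_op_scaleR: "tr_op (%b. c *R f b) = c * tr_op f"
 and tr_op_zero: "tr_op (%b. 0) = 0"
 by (simp_all add: tr_op_def inner_add_left inner_diff_left sum.distrib sum_subtractf sum_negf sum_distrib_left)

text \<open>Cyclicity of the trace; it makes traces of maps that shift the degree of the grading
  vanish.\<close>

lemma tr_op_comp_commute:
 fixes f g :: "'a::euclidean_space => 'a"
 assumes "linear f" "linear g"
 shows "tr_op (%b. f (g b)) = tr_op (%b. g (f b))"
proof -
 have e: "f (g b) \<bullet> b = (SUM c:Basis. (g b \<bullet> c) * (f c \<bullet> b))" if "linear f" for f g :: "'a => 'a" and b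
 proof -
  have "f (g b) = f (SUM c:Basis. (g b \<bullet> c) *R c)" by (simp add: euclidean_representation)
  also have "... = (SUM c:Basis. (g b \<bullet> c) *R f c)" by (simp add: linear_sum[OF that] linear_scale[OF that])
  finally show ?thesis by (simp add: inner_sum_left)
 qed
 have "tr_op (%b. f (g b)) = (SUM b:Basis. SUM c:Basis. (g b \<bullet> c) * (f c \<bullet> b))"
  unfolding tr_op_def by (simp add: e[OF assms(1)])
 also have "... = (SUM c:Basis. SUM b:Basis. (g b \<bullet> c) * (f c \<bullet> b))" by (rule sum.swap)
 also have "... = tr_op (%b. g (f b))"
  unfolding tr_op_def by (simp add: e[OF assms(2)] mult.commute)
 finally show ?thesis .
qed

lemma sum_Basis_matrix:
 "(SUM b:(Basis::(real^'n^'m) set). F b) = (SUM i:UNIV. SUM j:UNIV. F (axis i (axis j 1)))"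
proof -
 have Beq: "(Basis::(real^'n^'m) set) = (%(i, j). axis i (axis j 1)) ` (UNIV \<times> UNIV)"
  by (auto simp: Basis_vec_def)
 have "inj_on (%(i, j). axis i (axis j (1::real)) :: real^'n^'m) (UNIV \<times> UNIV)"
  by (auto simp: inj_on_def axis_eq_axis)
 thus ?thesis unfolding Beq
  by (subst sum.reindex) (simp_all add: sum.cartesian_product split_def o_def)
qed

lemma sandwich_axis: "((A::real^'n^'n) ** axis i (axis j 1) ** (C::real^'n^'n)) $ p $ q = A $ p $ i * C $ j $ q"
proof -
 have 1: "(A ** axis i (axis j 1)) $ p $ r = (if r = j then A $ p $ i else 0)" for r
 proof -
  have "(SUM k:UNIV. A $ p $ k * (axis i (axis j 1) :: real^'n^'n) $ k $ r) = (SUM k:UNIV. if k = i then A $ p $ i * (if r = j then 1 else 0) else 0)"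
   by (rule sum.cong) (auto simp: axis_def)
  thus ?thesis by (simp add: matrix_matrix_mult_def)
 qed
 have "(A ** axis i (axis j 1) ** C) $ p $ q = (SUM r:UNIV. (A ** axis i (axis j 1)) $ p $ r * C $ r $ q)"
  by (simp add: matrix_matrix_mult_def)
 also have "... = (SUM r:UNIV. (if r = j then A $ p $ i * C $ j $ q else 0))"
  unfolding 1 by (rule sum.cong) auto
 finally show ?thesis by simp
qed

text \<open>Together with the variant for transposes this computes all traces below: the Killing
  form and the Ricci form are built from multiplications on both sides, and transposes enter through
  the projection to skew matrices.\<close>

lemma tr_op_sandwich: "tr_op (%b. (A::real^'n^'n) ** b ** (C::real^'n^'n)) = trace A * trace C"
proof -
 have "(A ** axis i (axis j 1) ** C) \<bullet> axis i (axis j 1) = A $ i $ i * C $ j $ j" for i j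
  by (simp only: inner_axis sandwich_axis inner_real_def mult_1_right)
 thus ?thesis by (simp add: tr_op_def sum_Basis_matrix trace_def sum_product)
qed

lemma tr_op_sandwich_transpose: "tr_op (%b. (A::real^'n^'n) ** transpose b ** C) = A \<bullet> C"
proof -
 have t: "transpose (axis i (axis j 1) :: real^'n^'n) = axis j (axis i 1)" for i j
  by (auto simp: vec_eq_iff transpose_def axis_def)
 show ?thesis
  unfolding tr_op_def sum_Basis_matrix t inner_matrix[of A]
  by (simp only: inner_axis sandwich_axis inner_real_def mult_1_right)
qed

lemma oproj_eqI:
 fixes V :: "'a::euclidean_space set"
 assumes "subspace V" "y : V" "!!z. z : V ==> (x - y) \<bullet> z = 0"
 shows "oproj V x = y"
 unfolding oproj_def
proof (rule the_equality)
 fix y' assume y': "y' : V & (ALL z:V. (x - y') \<bullet> z = 0)"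
 have m: "y' - y : V" using y' assms by (simp add: subspace_diff)
 hence "(x - y) \<bullet> (y' - y) - (x - y') \<bullet> (y' - y) = 0" using assms y' by simp
 hence "(y' - y) \<bullet> (y' - y) = 0" by (simp add: algebra_simps)
 thus "y' = y" by simp
qed (use assms in auto)

lemma oproj_projector:
 fixes V :: "'a::euclidean_space set"
 assumes "subspace V" "!!x. P x : V" "!!z. z : V ==> P z = z" "!!x y. P x \<bullet> y = x \<bullet> P y"
 shows "oproj V = P"
proof
 fix x show "oproj V x = P x"
  by (rule oproj_eqI[OF assms(1,2)]) (use assms(3,4) in "simp add: inner_diff_left")
qed

lemma so_iff: "X : so \<longleftrightarrow> transpose X = - X"
 by (simp add: so_def)

lemma bracket_linear:
 "bracket (X + X') Y = bracket X Y + bracket X' Y" "bracket X (Y + Y') = bracket X Y + bracket X Y'"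
 "bracket (c *R X) Y = c *R bracket X Y" "bracket X (c *R Y) = c *R bracket X Y"
 "bracket 0 Y = 0" "bracket X 0 = 0" "bracket (- X) Y = - bracket X Y" "bracket X (- Y) = - bracket X Y"
 "bracket (X - X') Y = bracket X Y - bracket X' Y" "bracket X (Y - Y') = bracket X Y - bracket X Y'"
 unfolding bracket_def by (simp_all add: mat_lin algebra_simps)

lemma bracket_skew: "bracket X Y = - bracket Y X"
 by (simp add: bracket_def)

lemma bracket_jacobi: "bracket X (bracket Y Z) = bracket (bracket X Y) Z + bracket Y (bracket X Z)"
 by (simp add: bracket_def mat_lin mat_assoc)

lemma bracket_so: "X : so ==> Y : so ==> bracket X Y : so"
 by (simp add: so_iff bracket_def tr_simps mat_lin)

lemma inner_bracket: "X : so ==> bracket X Y \<bullet> Z = - (Y \<bullet> bracket X Z)"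
 by (simp add: so_iff bracket_def inner_diff_left inner_diff_right inner_matrix_left[of X Y] inner_matrix_right[of Y X]
   mat_lin)

lemma subspace_so: "subspace so"
 by (auto simp: subspace_def so_iff tr_simps)

lemma oproj_so: "oproj so = (%X. (1/2) *R (X - transpose X))"
proof (rule oproj_projector[OF subspace_so])
 show "((1/2) *R (X - transpose X)) \<bullet> Y = X \<bullet> ((1/2) *R (Y - transpose Y))" for X Y :: "real^'n^'n"
  using inner_transpose[of X "transpose Y"] by (simp add: inner_diff_left inner_diff_right)
 show "(1/2) *R (X - transpose X) : so" for X :: "real^'n^'n"
  by (simp add: so_iff tr_simps scaleR_diff_right)
qed (auto simp: so_iff scaleR_2[symmetric])

lemma trace_skew: "X : so ==> trace X = 0"
 using trace_transpose[of X] by (simp add: so_iff trace_neg)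

lemma inner_so: "X : so ==> X \<bullet> Y = - trace (X ** Y)"
 by (simp add: inner_eq_trace so_iff mat_neg_left trace_neg)

lemma inner_mat1: "(X::real^'n^'n) \<bullet> mat 1 = trace X" "mat 1 \<bullet> (X::real^'n^'n) = trace X"
 by (simp_all add: inner_eq_trace trace_transpose)

text \<open>This is the classical formula for the Killing form of so(N), namely (N - 2) tr (X Y).
  The trace over \<open>so\<close> is taken over all matrices after composing with the projection to
  the skew part.\<close>

lemma B_so:
 fixes X Y :: "real^'n^'n"
 assumes "X : so" "Y : so"
 shows "B X Y = (real CARD('n) - 2) * (X \<bullet> Y)"
proof -
 have "bracket X (bracket Y ((1/2) *R (b - transpose b))) =
   (1/2) *R ((X ** Y) ** b ** mat 1 - (X ** Y) ** transpose b ** mat 1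
    - (X ** b ** Y - X ** transpose b ** Y) - (Y ** b ** X - Y ** transpose b ** X)
    + (mat 1 ** b ** (Y ** X) - mat 1 ** transpose b ** (Y ** X)))" for b
  by (simp add: bracket_def mat_lin mat_assoc algebra_simps)
 hence "trace_on so (%Z. bracket X (bracket Y Z)) = (1/2) * (trace (X ** Y) * CARD('n) - (X ** Y) \<bullet> mat 1
   - (trace X * trace Y - X \<bullet> Y) - (trace Y * trace X - Y \<bullet> X) + (CARD('n) * trace (Y ** X) - mat 1 \<bullet> (Y ** X)))"
  unfolding trace_on_def oproj_so tr_op_def[symmetric]
  by (simp only: tr_op_add tr_op_diff tr_op_scaleR tr_op_sandwich tr_op_sandwich_transpose trace_I)
 also have "... = (real CARD('n) - 2) * trace (X ** Y)"
  using inner_so[OF assms(1), of Y] trace_skew[OF assms(1)] trace_skew[OF assms(2)]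
  by (simp add: inner_mat1 inner_commute[of Y X] trace_mul_sym[of Y X] algebra_simps)
 finally show ?thesis using inner_so[OF assms(1), of Y] by (simp add: B_def)
qed

section \<open>The matrices \<open>Dmat\<close> and \<open>Jmat\<close> and the grading of
  \<open>so\<close>\<close>

definition Dmat :: "'m::finite mat" where
 "Dmat = (\<chi> p q. if p = q then if fst p = None then - 1 else 1 else 0)"

lemma Dmat_left:
 fixes X :: "'m::finite mat"
 shows "(Dmat ** X) $ p $ q = (if fst p = None then - 1 else 1) * X $ p $ q"
proof -
 have "(SUM k:UNIV. (Dmat :: 'm mat) $ p $ k * X $ k $ q) = (SUM k:UNIV. if k = p then (if fst p = None then - 1 else 1) * X $ p $ q else 0)"
  by (rule sum.cong) (auto simp: Dmat_def)
 thus ?thesis by (simp add: matrix_matrix_mult_def)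
qed

lemma tr_Dmat: "transpose Dmat = Dmat"
 by (auto simp: vec_eq_iff transpose_def Dmat_def)

lemma Dmat_right:
 fixes X :: "'m::finite mat"
 shows "(X ** Dmat) $ p $ q = (if fst q = None then - 1 else 1) * X $ p $ q"
proof -
 have "X ** Dmat = transpose (Dmat ** transpose X)"
  by (simp add: tr_simps tr_Dmat)
 hence "(X ** Dmat) $ p $ q = (Dmat ** transpose X) $ q $ p" by (simp add: transpose_def)
 thus ?thesis by (simp add: Dmat_left transpose_def)
qed

lemma Dmat_sq: "Dmat ** Dmat = mat 1"
proof -
 have "(Dmat ** Dmat) $ p $ q = (mat 1 :: 'a mat) $ p $ q" for p q
  unfolding Dmat_left by (simp add: Dmat_def mat_def)
 thus ?thesis by (simp add: vec_eq_iff)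
qed

lemma Jmat_left:
 fixes X :: "'a::finite mat"
 shows "(Jmat ** X) $ (i, False) $ q = - (X $ (i, True) $ q)" "(Jmat ** X) $ (i, True) $ q = X $ (i, False) $ q"
proof -
 have "(SUM k:UNIV. (Jmat :: 'a mat) $ (i, False) $ k * X $ k $ q) = (SUM k:UNIV. if k = (i, True) then - (X $ (i, True) $ q) else 0)"
  by (rule sum.cong) (auto simp: Jmat_def)
 thus "(Jmat ** X) $ (i, False) $ q = - (X $ (i, True) $ q)" by (simp add: matrix_matrix_mult_def)
 have "(SUM k:UNIV. (Jmat :: 'a mat) $ (i, True) $ k * X $ k $ q) = (SUM k:UNIV. if k = (i, False) then X $ (i, False) $ q else 0)"
  by (rule sum.cong) (auto simp: Jmat_def)
 thus "(Jmat ** X) $ (i, True) $ q = X $ (i, False) $ q" by (simp add: matrix_matrix_mult_def)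
qed

lemma tr_Jmat: "transpose Jmat = - Jmat"
 by (auto simp: vec_eq_iff transpose_def Jmat_def)

lemma Jmat_right:
 fixes X :: "'a::finite mat"
 shows "(X ** Jmat) $ p $ (i, False) = X $ p $ (i, True)" "(X ** Jmat) $ p $ (i, True) = - (X $ p $ (i, False))"
proof -
 have e: "(X ** Jmat) $ p $ q = - ((Jmat ** transpose X) $ q $ p)" for q
 proof -
  have "X ** Jmat = transpose (- (Jmat ** transpose X))"
   by (simp add: tr_simps tr_Jmat mat_lin)
  thus ?thesis by (simp add: transpose_def)
 qed
 show "(X ** Jmat) $ p $ (i, False) = X $ p $ (i, True)" "(X ** Jmat) $ p $ (i, True) = - (X $ p $ (i, False))"
  unfolding e Jmat_left by (simp_all add: transpose_def)
qed

lemma Jmat_sq: "Jmat ** Jmat = - mat 1"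
proof -
 have "(Jmat ** Jmat) $ p $ q = (- mat 1 :: 'a mat) $ p $ q" for p q
 proof -
  obtain i b j c where pq: "p = (i, b)" "q = (j, c)" by (metis surj_pair)
  show ?thesis unfolding pq by (cases b; cases c) (auto simp: Jmat_left, auto simp: Jmat_def mat_def)
 qed
 thus ?thesis by (simp add: vec_eq_iff)
qed

lemma Dmat_Jmat: "Dmat ** Jmat = Jmat ** Dmat"
proof -
 have "(Dmat ** Jmat :: 'a mat) $ p $ q = (Jmat ** Dmat) $ p $ q" for p q
  unfolding Dmat_left Dmat_right by (cases "fst p = fst q") (auto simp: Jmat_def)
 thus ?thesis by (simp add: vec_eq_iff)
qed

lemma trace_Dmat: "trace (Dmat :: 'm::finite mat) = real CARD('m option * bool) - 4"
proof -
 have "trace (Dmat :: 'm mat) = (SUM p:(UNIV \<times> UNIV :: ('m option * bool) set). 1 - (if fst p = (None :: 'm option) then 2 else (0::real)))"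
  unfolding trace_def UNIV_Times_UNIV by (intro sum.cong refl) (simp add: Dmat_def)
 also have "... = (SUM i:(UNIV::'m option set). SUM b:(UNIV :: bool set). 1 - (if i = None then 2 else 0))"
  by (simp only: sum.cartesian_product split_def)
 also have "... = (SUM i:(UNIV::'m option set). 2 - (if i = None then 4 else 0))"
  by (rule sum.cong) auto
 also have "... = 2 * real CARD('m option) - 4" by (simp add: sum_subtractf)
 finally show ?thesis by (simp add: card_cartesian_product flip: UNIV_Times_UNIV)
qed

lemma trace_Jmat: "trace (Jmat :: 'm::finite mat) = 0"
 using trace_transpose[of "Jmat :: 'm mat"] by (simp add: tr_Jmat trace_neg)

lemma trace_Dmat_Jmat: "trace (Dmat ** Jmat :: 'm::finite mat) = 0" "trace (Jmat ** Dmat :: 'm::finite mat) = 0"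
proof -
 show "trace (Dmat ** Jmat :: 'm mat) = 0"
  using trace_transpose[of "Dmat ** Jmat :: 'm mat"]
  by (simp add: tr_simps tr_Jmat tr_Dmat mat_lin trace_neg Dmat_Jmat)
 thus "trace (Jmat ** Dmat :: 'm mat) = 0" by (simp add: Dmat_Jmat)
qed

text \<open>The two commuting involutions \<open>X \<mapsto> D X D\<close> and \<open>X \<mapsto> - J X J\<close> grade \<open>so\<close> by the Klein four
  group, with \<open>k_alg\<close> in degree 0 and the isotropy summands in the other degrees.\<close>

definition Esp :: "real => real => 'm::finite mat set" where
 "Esp a b = {X : so. Dmat ** X ** Dmat = a *R X & Jmat ** X ** Jmat = b *R X}"

lemma Jmat_conj_iff: "X ** Jmat = Jmat ** X \<longleftrightarrow> Jmat ** X ** Jmat = - X" "X ** Jmat = - (Jmat ** X) \<longleftrightarrow> Jmat ** X ** Jmat = X"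
proof -
 have e: "X ** Jmat = - (Jmat ** (Jmat ** X ** Jmat))"
  by (simp add: mat_assoc Jmat_sq mat_lin)
 show "X ** Jmat = Jmat ** X \<longleftrightarrow> Jmat ** X ** Jmat = - X"
 proof
  assume "X ** Jmat = Jmat ** X"
  hence "Jmat ** (X ** Jmat) = Jmat ** (Jmat ** X)" by simp
  thus "Jmat ** X ** Jmat = - X" by (simp add: mat_assoc Jmat_sq mat_lin)
 qed (use e in "simp add: mat_lin")
 show "X ** Jmat = - (Jmat ** X) \<longleftrightarrow> Jmat ** X ** Jmat = X"
 proof
  assume "X ** Jmat = - (Jmat ** X)"
  hence "Jmat ** (X ** Jmat) = Jmat ** - (Jmat ** X)" by simp
  thus "Jmat ** X ** Jmat = X" by (simp add: mat_assoc Jmat_sq mat_lin)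
 qed (use e in simp)
qed

lemma Dmat_conj:
 fixes X :: "'m::finite mat"
 shows "(Dmat ** X ** Dmat) $ p $ q = (if (fst p = None) = (fst q = None) then 1 else - 1) * X $ p $ q"
 by (auto simp: Dmat_right Dmat_left)

lemma blockdiag_iff: "blockdiag X \<longleftrightarrow> Dmat ** X ** Dmat = X"
proof -
 have "(- X $ p $ q = X $ p $ q) \<longleftrightarrow> X $ p $ q = 0" for p q by auto
 thus ?thesis unfolding blockdiag_def vec_eq_iff Dmat_conj by auto
qed

lemma offdiag_iff: "offdiag X \<longleftrightarrow> Dmat ** X ** Dmat = - X"
proof -
 have "(X $ p $ q = - X $ p $ q) \<longleftrightarrow> X $ p $ q = 0" for p q by auto
 thus ?thesis unfolding offdiag_def vec_eq_iff Dmat_conj by auto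
qed

lemma m1_E: "m1 = Esp (-1) (-1)" and m2_E: "m2 = Esp (-1) 1" and m3_E: "m3 = Esp 1 1" and k_alg_E: "k_alg = Esp 1 (-1)"
 by (auto simp: m1_def m2_def m3_def k_alg_def u_alg_def Esp_def offdiag_iff blockdiag_iff Jmat_conj_iff)

text \<open>The projection to the character \<open>(a, b)\<close> of the four-group of involutions,
  applied to the skew part: 1/8 is 1/4 for the average times 1/2 for the skew part.\<close>

definition Pr :: "real => real => 'm::finite mat => 'm mat" where
 "Pr a b X = (1/8) *R ((X - transpose X) + a *R (Dmat ** (X - transpose X) ** Dmat)
   + b *R (Jmat ** (X - transpose X) ** Jmat) + (a * b) *R (Jmat ** Dmat ** (X - transpose X) ** Dmat ** Jmat))"

lemma subspace_E: "subspace (Esp a b)"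
 by (auto simp: subspace_def Esp_def so_iff tr_simps mat_lin scaleR_add_right)

lemma Pr_linear: "linear (Pr a b)"
 by (rule linearI) (simp_all add: Pr_def tr_simps mat_lin algebra_simps)

lemma sign_cases: "a : {1, -1 :: real} ==> a * a = 1" "a : {1, -1 :: real} ==> a * (a * c) = c"
 by auto

lemma Dmat_sq_right: "X ** Dmat ** Dmat = X" and Jmat_sq_right: "X ** Jmat ** Jmat = - X"
 by (simp_all add: Dmat_sq Jmat_sq mat_lin flip: mat_assoc)

lemma Dmat_Jmat_right: "X ** Dmat ** Jmat = X ** Jmat ** Dmat"
 by (simp add: Dmat_Jmat flip: mat_assoc)

lemmas DJ_simps = Dmat_sq Jmat_sq Dmat_sq_right Jmat_sq_right Dmat_Jmat Dmat_Jmat_right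

lemma Pr_in_E:
 assumes "a : {1, -1}" "b : {1, -1}"
 shows "Pr a b X : Esp a b"
proof -
 note s = sign_cases[OF assms(1)] sign_cases[OF assms(2)]
 have "transpose (Pr a b X) = - Pr a b X"
  by (simp add: Pr_def tr_simps tr_Dmat tr_Jmat mat_lin mat_assoc DJ_simps
    algebra_simps)
 moreover have "Dmat ** Pr a b X ** Dmat = a *R Pr a b X"
  by (simp add: Pr_def mat_lin mat_assoc DJ_simps s algebra_simps)
 moreover have "Jmat ** Pr a b X ** Jmat = b *R Pr a b X"
  by (simp add: Pr_def mat_lin mat_assoc DJ_simps s algebra_simps)
 ultimately show ?thesis by (simp add: Esp_def so_iff)
qed

lemma Pr_id:
 assumes "a : {1, -1}" "b : {1, -1}" "X : Esp a b"
 shows "Pr a b X = X"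
proof -
 have X: "transpose X = - X" "Dmat ** X ** Dmat = a *R X" "Jmat ** X ** Jmat = b *R X"
  using assms(3) by (auto simp: Esp_def so_iff)
 have "Jmat ** Dmat ** X ** Dmat ** Jmat = Jmat ** (Dmat ** X ** Dmat) ** Jmat" by (simp add: mat_assoc)
 also have "... = (a * b) *R X" by (simp add: X mat_lin)
 finally have JD: "Jmat ** Dmat ** X ** Dmat ** Jmat = (a * b) *R X" .
 have XX: "X - transpose X = 2 *R X" by (simp add: X scaleR_2)
 show ?thesis unfolding Pr_def XX
  using assms(1,2) by (auto simp: mat_lin X JD simp flip: scaleR_left_distrib)
qed

lemma Pr_selfadj: "Pr a b X \<bullet> Y = X \<bullet> Pr a b Y"
proof -
 have "(Dmat ** X ** Dmat) \<bullet> Y = X \<bullet> (Dmat ** Y ** Dmat)" for X Y :: "'a mat"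
  by (simp add: inner_conj tr_Dmat)
 moreover have "(Jmat ** X ** Jmat) \<bullet> Y = X \<bullet> (Jmat ** Y ** Jmat)" for X Y :: "'a mat"
  by (simp add: inner_conj tr_Jmat mat_lin)
 moreover have "(Jmat ** Dmat ** X ** Dmat ** Jmat) \<bullet> Y = X \<bullet> (Jmat ** Dmat ** Y ** Dmat ** Jmat)" for X Y :: "'a mat"
  using inner_conj[of "Jmat ** Dmat" X "Dmat ** Jmat" Y]
  by (simp add: tr_simps tr_Dmat tr_Jmat mat_lin mat_assoc DJ_simps)
 moreover have "transpose X \<bullet> Y = X \<bullet> transpose Y" for X Y :: "'a mat"
  using inner_transpose[of X "transpose Y"] by simp
 moreover have "transpose (Dmat ** X ** Dmat) = Dmat ** transpose X ** Dmat"
  "transpose (Jmat ** X ** Jmat) = Jmat ** transpose X ** Jmat"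
  "transpose (Jmat ** Dmat ** X ** Dmat ** Jmat) = Jmat ** Dmat ** transpose X ** Dmat ** Jmat" for X :: "'a mat"
  by (simp_all add: tr_simps tr_Dmat tr_Jmat mat_lin mat_assoc DJ_simps)
 ultimately show ?thesis
  unfolding Pr_def by (simp add: inner_add_left inner_add_right inner_diff_left inner_diff_right mat_lin)
qed

lemma oproj_E: "a : {1, -1} ==> b : {1, -1} ==> oproj (Esp a b) = Pr a b"
 by (rule oproj_projector[OF subspace_E Pr_in_E Pr_id Pr_selfadj])

lemma so_decomp: "X : so ==> X = Pr 1 (-1) X + (Pr (-1) (-1) X + Pr (-1) 1 X + Pr 1 1 X)"
 by (simp add: vec_eq_iff Pr_def so_iff field_simps)

lemma E_orth:
 assumes "X : Esp a b" "Y : Esp a' b'" "(a, b) ~= (a', b')" "a : {1,-1}" "b : {1,-1}" "a' : {1,-1}" "b' : {1,-1}"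
 shows "X \<bullet> Y = 0"
proof -
 have X: "Dmat ** X ** Dmat = a *R X" "Jmat ** X ** Jmat = b *R X" and Y: "Dmat ** Y ** Dmat = a' *R Y" "Jmat ** Y ** Jmat = b' *R Y"
  using assms by (auto simp: Esp_def)
 have "(Dmat ** X ** Dmat) \<bullet> Y = X \<bullet> (Dmat ** Y ** Dmat)"
  by (simp add: inner_conj tr_Dmat)
 hence 1: "a * (X \<bullet> Y) = a' * (X \<bullet> Y)" by (simp add: X Y)
 have "(Jmat ** X ** Jmat) \<bullet> Y = X \<bullet> (Jmat ** Y ** Jmat)"
  by (simp add: inner_conj tr_Jmat mat_lin)
 hence 2: "b * (X \<bullet> Y) = b' * (X \<bullet> Y)" by (simp add: X Y)
 show ?thesis using 1 2 assms(3) by auto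
qed

lemma Pr_other:
 assumes "X : Esp a b" "(a, b) ~= (a', b')" "a : {1,-1}" "b : {1,-1}" "a' : {1,-1}" "b' : {1,-1}"
 shows "Pr a' b' X = 0"
proof -
 have "Pr a' b' X \<bullet> Pr a' b' X = X \<bullet> Pr a' b' (Pr a' b' X)" by (rule Pr_selfadj)
 also have "... = 0" using assms by (intro E_orth[of X a b _ a' b'] Pr_in_E) auto
 finally show ?thesis by simp
qed

lemma E_sub_so: "X : Esp a b ==> X : so"
 by (simp add: Esp_def)

text \<open>\<open>b\<close> is the eigenvalue of X \<mapsto> J X J, whereas the automorphism of the
  algebra is X \<mapsto> - J X J; hence the minus sign.\<close>

lemma E_bracket:
 assumes "X : Esp a b" "Y : Esp a' b'"
 shows "bracket X Y : Esp (a * a') (- (b * b'))"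
proof -
 have X: "Dmat ** X ** Dmat = a *R X" "Jmat ** X ** Jmat = b *R X" and Y: "Dmat ** Y ** Dmat = a' *R Y" "Jmat ** Y ** Jmat = b' *R Y"
  using assms by (auto simp: Esp_def)
 have D: "Dmat ** (U ** V) ** Dmat = (Dmat ** U ** Dmat) ** (Dmat ** V ** Dmat)" for U V :: "'a mat"
  by (simp add: mat_assoc DJ_simps)
 have J: "Jmat ** (U ** V) ** Jmat = - ((Jmat ** U ** Jmat) ** (Jmat ** V ** Jmat))" for U V :: "'a mat"
  by (simp add: mat_assoc DJ_simps mat_lin)
 have "Dmat ** bracket X Y ** Dmat = (a * a') *R bracket X Y"
  unfolding bracket_def matrix_diff_ldistrib matrix_diff_rdistrib D X Y by (simp add: mat_lin algebra_simps)
 moreover have "Jmat ** bracket X Y ** Jmat = (- (b * b')) *R bracket X Y"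
  unfolding bracket_def matrix_diff_ldistrib matrix_diff_rdistrib J X Y by (simp add: mat_lin algebra_simps)
 moreover have "bracket X Y : so" by (intro bracket_so E_sub_so[OF assms(1)] E_sub_so[OF assms(2)])
 ultimately show ?thesis by (simp add: Esp_def)
qed

section \<open>Invariant metrics on homogeneous spaces\<close>

text \<open>The metric enters only through the speed functional \<open>N\<close>, here allowed to be
  arbitrary. This way the metrics of the flow and their degenerate limits are handled alike, all on
  the group itself.\<close>

definition is_path :: "(real^'n^'n => real) => (real => real^'n^'n) => real => bool" where
 "is_path N c r \<longleftrightarrow> c piecewise_C1_differentiable_on {0..1} & (ALL t:{0..1}. c t : SO) &
   ((%t. N (transpose (c t) ** vector_derivative c (at t))) has_integral r) {0..1}"

definition gdist :: "(real^'n^'n => real) => (real^'n^'n) set => (real^'n^'n) set => real" where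
 "gdist N P Q = Inf {r. EX c. is_path N c r & c 0 : P & c 1 : Q}"

lemma hom_dist_gdist: "hom_dist g = gdist (%xi. sqrt (g xi xi))"
 unfolding hom_dist_def gdist_def is_path_def Let_def by (intro ext) (simp add: conj_ac)

lemma SO_mult: "A : SO ==> C : SO ==> A ** C : SO"
 by (simp add: SO_def rotation_matrix_def orthogonal_matrix_mul det_mul)

lemma SO_id: "mat 1 : SO"
 by (simp add: SO_def rotation_matrix_def orthogonal_matrix_id)

lemma SO_inv: "A : SO ==> transpose A : SO"
 by (simp add: SO_def rotation_matrix_def)

lemma SO_transpose: "A : SO ==> transpose A ** A = mat 1" "A : SO ==> A ** transpose A = mat 1"
 by (auto simp: SO_def rotation_matrix_def orthogonal_matrix_def)

lemma bounded_linear_matrix_mult: "bounded_linear (%X. (A::real^'n^'n) ** X ** C)"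
 by (rule linear_conv_bounded_linear[THEN iffD1]) (auto intro!: linearI simp: mat_lin)

lemma bounded_linear_transpose: "bounded_linear (transpose :: real^'n^'n => _)"
 by (rule linear_conv_bounded_linear[THEN iffD1]) (auto intro!: linearI simp: tr_simps)

lemma bounded_bilinear_matrix: "bounded_bilinear ((**) :: real^'n^'n => real^'n^'n => _)"
 by (rule bilinear_conv_bounded_bilinear[THEN iffD1])
   (auto simp: bilinear_def intro!: linearI simp: mat_lin)

lemma path_C1:
 assumes "is_path N c r"
 obtains S D where "finite S" "!!t. t : {0..1} - S ==> (c has_vector_derivative D t) (at t)"
  "continuous_on ({0..1} - S) D" "!!t. t : {0..1} - S ==> vector_derivative c (at t) = D t"
proof -
 obtain S where S: "finite S" "c C1_differentiable_on ({0..1} - S)"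
  using assms by (auto simp: is_path_def piecewise_C1_differentiable_on_def)
 then obtain D where D: "ALL t:{0..1} - S. (c has_vector_derivative D t) (at t)" "continuous_on ({0..1} - S) D"
  unfolding C1_differentiable_on_def by blast
 have "vector_derivative c (at t) = D t" if "t : {0..1} - S" for t
  by (rule vector_derivative_at) (use D(1) that in blast)
 thus ?thesis using that S(1) D by presburger
qed

lemma path_cont: "is_path N c r ==> continuous_on {0..1} c"
 by (auto simp: is_path_def piecewise_C1_differentiable_on_def)

lemma path_SO: "is_path N c r ==> t : {0..1} ==> c t : SO"
 by (simp add: is_path_def)

lemma path_nonneg:
 assumes "is_path N c r" "!!xi. N xi >= 0" shows "r >= 0"
proof -
 have "((%t. N (transpose (c t) ** vector_derivative c (at t))) has_integral r) {0..1}"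
  using assms(1) by (simp add: is_path_def)
 thus ?thesis by (rule has_integral_nonneg) (rule assms(2))
qed

lemma velocity_so:
 assumes c: "!!t. t : {a<..<b} ==> c t : SO" and t: "t : {a<..<b}" and d: "(c has_vector_derivative v) (at t)"
 shows "transpose (c t) ** v : so"
proof -
 have dt: "((%t. transpose (c t)) has_vector_derivative transpose v) (at t)"
  by (rule bounded_linear.has_vector_derivative[OF bounded_linear_transpose d])
 have "((%t. transpose (c t) ** c t) has_vector_derivative transpose (c t) ** v + transpose v ** c t) (at t)"
  by (rule bounded_bilinear.has_vector_derivative[OF bounded_bilinear_matrix dt d])
 moreover have "((%t. transpose (c t) ** c t) has_vector_derivative 0) (at t)"
 proof (rule has_vector_derivative_transform_within_open[OF has_vector_derivative_const])
  show "open {a<..<b}" "t : {a<..<b}" using t by auto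
  show "mat 1 = transpose (c t) ** c t" if "t : {a<..<b}" for t using SO_transpose(1)[OF c[OF that]] by simp
 qed
 ultimately have "transpose (c t) ** v + transpose v ** c t = 0" by (rule vector_derivative_unique_at)
 hence "transpose v ** c t = - (transpose (c t) ** v)" by (metis add.commute add_eq_0_iff)
 thus ?thesis by (simp add: so_iff tr_simps)
qed

text \<open>Left translation by \<open>a\<close> leaves the velocity
  \<open>transpose (c t) ** c'\<close> unchanged and right translation by \<open>k\<close>
  conjugates it. Only the products \<open>a ** X ** k\<close> have to stay in \<open>SO\<close>, so
  a reflection of determinant -1 may be used on both sides.\<close>

lemma path_transform:
 fixes a k :: "real^'n^'n"
 assumes c: "is_path N c r" and a: "transpose a ** a = mat 1" and ak: "!!X. X : SO ==> a ** X ** k : SO"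
  and N: "!!xi. xi : so ==> N' (transpose k ** xi ** k) = N xi"
 shows "is_path N' (%t. a ** c t ** k) r"
proof -
 obtain S D where S: "finite S" "!!t. t : {0..1} - S ==> (c has_vector_derivative D t) (at t)"
  "continuous_on ({0..1} - S) D" "!!t. t : {0..1} - S ==> vector_derivative c (at t) = D t"
  using path_C1[OF c] by metis
 note bl = bounded_linear_matrix_mult[of a k]
 have d: "((%t. a ** c t ** k) has_vector_derivative a ** D t ** k) (at t)" if "t : {0..1} - S" for t
  by (rule bounded_linear.has_vector_derivative[OF bl S(2)[OF that]])
 have "(%t. a ** c t ** k) piecewise_C1_differentiable_on {0..1}"
  unfolding piecewise_C1_differentiable_on_def C1_differentiable_on_def
 proof (intro conjI exI[of _ S] exI[of _ "%t. a ** D t ** k"] ballI)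
  show "continuous_on {0..1} (%t. a ** c t ** k)"
   by (rule continuous_on_compose2[OF bounded_linear.continuous_on[OF bl continuous_on_id] path_cont[OF c]]) auto
  show "continuous_on ({0..1} - S) (%t. a ** D t ** k)"
   by (rule continuous_on_compose2[OF bounded_linear.continuous_on[OF bl continuous_on_id] S(3)]) auto
 qed (use S d in auto)
 moreover have "((%t. N' (transpose (a ** c t ** k) ** vector_derivative (%t. a ** c t ** k) (at t))) has_integral r) {0..1}"
 proof (rule has_integral_spike_finite)
  show "finite (insert 0 (insert 1 S))" using S by simp
  show "((%t. N (transpose (c t) ** vector_derivative c (at t))) has_integral r) {0..1}" using c by (simp add: is_path_def)
  fix t assume t: "t : {0..1} - insert 0 (insert 1 S)"
  hence t': "t : {0..1} - S" "t : {0<..<1}" by auto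
  have "transpose (c t) ** D t : so"
   by (rule velocity_so[OF _ t'(2) S(2)[OF t'(1)]]) (use path_SO[OF c] in auto)
  moreover have "transpose (a ** c t ** k) ** (a ** D t ** k) = transpose k ** (transpose (c t) ** D t) ** k"
  proof -
   have "transpose (a ** c t ** k) ** (a ** D t ** k) = transpose k ** transpose (c t) ** (transpose a ** a) ** D t ** k"
    by (simp add: tr_simps mat_assoc)
   thus ?thesis by (simp add: a mat_assoc)
  qed
  ultimately show "N' (transpose (a ** c t ** k) ** vector_derivative (%t. a ** c t ** k) (at t)) = N (transpose (c t) ** vector_derivative c (at t))"
   using N vector_derivative_at[OF d[OF t'(1)]] S(4)[OF t'(1)] by simp
 qed
 ultimately show ?thesis using ak path_SO[OF c] by (simp add: is_path_def)
qed

lemma path_cong: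
 assumes c: "is_path N c r" and N: "!!xi. xi : so ==> N' xi = N xi"
 shows "is_path N' c r"
 using path_transform[OF c, of "mat 1" "mat 1" N'] N by (simp add: SO_id)

lemma gdist_cong:
 assumes "!!xi. xi : so ==> N' xi = N xi" shows "gdist N' = gdist N"
proof -
 have "is_path N' c r = is_path N c r" for c r
  using path_cong[of N c r N'] path_cong[of N' c r N] assms by auto
 thus ?thesis by (simp add: gdist_def fun_eq_iff)
qed

lemma path_reverse:
 assumes c: "is_path N c r" and N: "!!xi. N (- xi) = N xi"
 shows "is_path N (%t. c (1 - t)) r"
proof -
 obtain S D where S: "finite S" "!!t. t : {0..1} - S ==> (c has_vector_derivative D t) (at t)"
  "continuous_on ({0..1} - S) D" "!!t. t : {0..1} - S ==> vector_derivative c (at t) = D t"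
  using path_C1[OF c] by metis
 have "valid_path c" using c by (simp add: is_path_def valid_path_def)
 hence "(%t. c (1 - t)) piecewise_C1_differentiable_on {0..1}"
  using valid_path_imp_reverse[of c] by (simp add: valid_path_def reversepath_def)
 moreover have "((%t. N (transpose (c (1 - t)) ** vector_derivative (%t. c (1 - t)) (at t))) has_integral r) {0..1}"
 proof (rule has_integral_spike_finite)
  show "finite ((%t. 1 - t) ` S)" using S by simp
  have "((%t. N (transpose (c t) ** vector_derivative c (at t))) has_integral r) (cbox 0 1)" using c by (simp add: is_path_def)
  from has_integral_affinity[OF this, of "-1" 1]
  show "((%t. N (transpose (c (1 - t)) ** vector_derivative c (at (1 - t)))) has_integral r) {0..1}"
   by simp
  fix t assume t: "t : {0..1} - (%t. 1 - t) ` S"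
  hence t': "1 - t : {0..1} - S" by force
  have "((%t. 1 - t) has_vector_derivative - 1) (at t)"
   by (auto intro!: derivative_eq_intros simp flip: has_real_derivative_iff_has_vector_derivative)
  from vector_diff_chain_at[OF this S(2)[OF t']]
  have "vector_derivative (%t. c (1 - t)) (at t) = - D (1 - t)"
   by (intro vector_derivative_at) (simp add: o_def)
  thus "N (transpose (c (1 - t)) ** vector_derivative (%t. c (1 - t)) (at t)) = N (transpose (c (1 - t)) ** vector_derivative c (at (1 - t)))"
   using S(4)[OF t'] by (simp add: mat_neg_right N)
 qed
 ultimately show ?thesis using path_SO[OF c] by (simp add: is_path_def)
qed

lemma path_join:
 assumes c1: "is_path N c1 r1" and c2: "is_path N c2 r2" and "c1 1 = c2 0" and N: "!!xi a. a >= 0 ==> N (a *R xi) = a * N xi"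
 shows "is_path N (c1 +++ c2) (r1 + r2)"
proof -
 obtain S1 D1 where S1: "finite S1" "!!t. t : {0..1} - S1 ==> (c1 has_vector_derivative D1 t) (at t)"
  "!!t. t : {0..1} - S1 ==> vector_derivative c1 (at t) = D1 t"
  using path_C1[OF c1] by metis
 obtain S2 D2 where S2: "finite S2" "!!t. t : {0..1} - S2 ==> (c2 has_vector_derivative D2 t) (at t)"
  "!!t. t : {0..1} - S2 ==> vector_derivative c2 (at t) = D2 t"
  using path_C1[OF c2] by metis
 have "valid_path c1" "valid_path c2" using c1 c2 by (simp_all add: is_path_def valid_path_def)
 hence "(c1 +++ c2) piecewise_C1_differentiable_on {0..1}"
  using valid_path_join[of c1 c2] assms(3) by (simp add: valid_path_def pathstart_def pathfinish_def)
 moreover have "(c1 +++ c2) t : SO" if "t : {0..1}" for t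
  using that path_SO[OF c1] path_SO[OF c2] by (simp add: joinpaths_def)
 moreover have "((%t. N (transpose ((c1 +++ c2) t) ** vector_derivative (c1 +++ c2) (at t))) has_integral r1 + r2) {0..1}"
 proof -
  have 1: "((%t. N (transpose ((c1 +++ c2) t) ** vector_derivative (c1 +++ c2) (at t))) has_integral r1) {0..1/2}"
  proof (rule has_integral_spike_finite)
   show "finite (insert (1/2) ((%s. s / 2) ` S1))" using S1 by simp
   have "((%t. N (transpose (c1 t) ** vector_derivative c1 (at t))) has_integral r1) (cbox 0 1)" using c1 by (simp add: is_path_def)
   from has_integral_affinity'[OF this, of 2 0, THEN has_integral_mult_right, of 2]
   show "((%t. 2 * N (transpose (c1 (2 * t)) ** vector_derivative c1 (at (2 * t)))) has_integral r1) {0..1/2}"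
    by simp
   fix t assume t: "t : {0..1/2} - insert (1/2) ((%s. s / 2) ` S1)"
   hence "2 * t ~: S1" using image_eqI[of t "%s. s / 2" "2 * t" S1] by auto
   hence t': "2 * t : {0..1} - S1" "t < 1/2" using t by auto
   have "((%t. 2 * t) has_vector_derivative 2) (at t)"
    by (auto intro!: derivative_eq_intros simp flip: has_real_derivative_iff_has_vector_derivative)
   from vector_diff_chain_at[OF this S1(2)[OF t'(1)]]
   have "((%t. c1 (2 * t)) has_vector_derivative 2 *R D1 (2 * t)) (at t)" by (simp add: o_def)
   hence "((c1 +++ c2) has_vector_derivative 2 *R D1 (2 * t)) (at t)"
    by (rule has_vector_derivative_transform_within_open[of _ _ _ "{..<1/2}"]) (use t' in "auto simp: joinpaths_def")
   thus "N (transpose ((c1 +++ c2) t) ** vector_derivative (c1 +++ c2) (at t)) = 2 * N (transpose (c1 (2 * t)) ** vector_derivative c1 (at (2 * t)))"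
    using t' S1(3)[OF t'(1)] by (simp add: vector_derivative_at joinpaths_def mat_scaleR_right N)
  qed
  have 2: "((%t. N (transpose ((c1 +++ c2) t) ** vector_derivative (c1 +++ c2) (at t))) has_integral r2) {1/2..1}"
  proof (rule has_integral_spike_finite)
   show "finite (insert (1/2) ((%s. (s + 1) / 2) ` S2))" using S2 by simp
   have "((%t. N (transpose (c2 t) ** vector_derivative c2 (at t))) has_integral r2) (cbox 0 1)" using c2 by (simp add: is_path_def)
   from has_integral_affinity'[OF this, of 2 "-1", THEN has_integral_mult_right, of 2]
   show "((%t. 2 * N (transpose (c2 (2 * t - 1)) ** vector_derivative c2 (at (2 * t - 1)))) has_integral r2) {1/2..1}"
    by simp
   fix t assume t: "t : {1/2..1} - insert (1/2) ((%s. (s + 1) / 2) ` S2)"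
   hence "2 * t - 1 ~: S2" using image_eqI[of t "%s. (s + 1) / 2" "2 * t - 1" S2] by auto
   hence t': "2 * t - 1 : {0..1} - S2" "t > 1/2" using t by auto
   have "((%t. 2 * t - 1) has_vector_derivative 2) (at t)"
    by (auto intro!: derivative_eq_intros simp flip: has_real_derivative_iff_has_vector_derivative)
   from vector_diff_chain_at[OF this S2(2)[OF t'(1)]]
   have "((%t. c2 (2 * t - 1)) has_vector_derivative 2 *R D2 (2 * t - 1)) (at t)" by (simp add: o_def)
   hence "((c1 +++ c2) has_vector_derivative 2 *R D2 (2 * t - 1)) (at t)"
    by (rule has_vector_derivative_transform_within_open[of _ _ _ "{1/2<..}"]) (use t' in "auto simp: joinpaths_def")
   thus "N (transpose ((c1 +++ c2) t) ** vector_derivative (c1 +++ c2) (at t)) = 2 * N (transpose (c2 (2 * t - 1)) ** vector_derivative c2 (at (2 * t - 1)))"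
    using t' S2(3)[OF t'(1)] by (simp add: vector_derivative_at joinpaths_def mat_scaleR_right N)
  qed
  show ?thesis by (rule has_integral_combine[OF _ _ 1 2]) auto
 qed
 ultimately show ?thesis by (simp add: is_path_def)
qed

text \<open>One-parameter group of a skew matrix whose square is minus a projection (Rodrigues' formula).\<close>

definition gen :: "real^'n^'n => bool" where
 "gen X \<longleftrightarrow> X : so & X ** X ** X = - X"

definition rot :: "real^'n^'n => real => real^'n^'n" where
 "rot X t = mat 1 + sin t *R X + (1 - cos t) *R (X ** X)"

lemma gen_simps:
 fixes W X :: "real^'n^'n"
 assumes "gen X"
 shows "transpose X = - X" "X ** X ** X = - X" "X ** (X ** X) = - X" "W ** X ** X ** X = - (W ** X)"
 using assms by (auto simp: gen_def so_iff mat_assoc) (simp add: mat_neg_right flip: mat_assoc)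

lemma rot_zero [simp]: "rot X 0 = mat 1"
 by (simp add: rot_def)

lemma rot_transpose: "gen X ==> transpose (rot X t) = rot X (- t)"
 by (simp add: rot_def tr_simps gen_simps mat_lin)

lemma rot_add:
 assumes X: "gen X" shows "rot X s ** rot X t = rot X (s + t)"
proof -
 have "rot X s ** rot X t = mat 1 + (sin s + sin t - sin s * (1 - cos t) - (1 - cos s) * sin t) *R X
   + ((1 - cos s) + (1 - cos t) + sin s * sin t - (1 - cos s) * (1 - cos t)) *R (X ** X)"
  unfolding rot_def
  by (simp add: mat_lin mat_assoc gen_simps[OF X] vec_eq_iff) (simp add: algebra_simps)
 also have "(sin s + sin t - sin s * (1 - cos t) - (1 - cos s) * sin t) = sin (s + t)"
  by (simp add: sin_add algebra_simps)
 also have "((1 - cos s) + (1 - cos t) + sin s * sin t - (1 - cos s) * (1 - cos t)) = 1 - cos (s + t)"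
  by (simp add: cos_add algebra_simps)
 finally show ?thesis by (simp add: rot_def)
qed

lemma rot_SO: assumes X: "gen X" shows "rot X t : SO"
proof -
 have o: "orthogonal_matrix (rot X t)" for t
  unfolding orthogonal_matrix_def rot_transpose[OF X] rot_add[OF X] by simp
 have "rot X t = rot X (t/2) ** rot X (t/2)" by (simp add: rot_add[OF X])
 hence "det (rot X t) = 1" using det_orthogonal_matrix[OF o[of "t/2"]] by (auto simp: det_mul)
 thus ?thesis using o by (simp add: SO_def rotation_matrix_def)
qed

lemma rot_deriv: assumes X: "gen X" shows "((%t. rot X t) has_vector_derivative rot X t ** X) (at t)"
proof -
 have "((%t. rot X t) has_vector_derivative cos t *R X + sin t *R (X ** X)) (at t)"
  unfolding rot_def by (auto intro!: derivative_eq_intros simp flip: has_real_derivative_iff_has_vector_derivative)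
 moreover have "rot X t ** X = cos t *R X + sin t *R (X ** X)"
  by (simp add: rot_def mat_lin gen_simps[OF X] algebra_simps)
 ultimately show ?thesis by simp
qed

lemma rot_path:
 assumes X: "gen X" and a: "a : SO" and N: "!!xi b. N (b *R xi) = abs b * N xi"
 shows "is_path N (%s. a ** rot X (t * s)) (abs t * N X)"
proof -
 have d: "((%s. a ** rot X (t * s)) has_vector_derivative t *R (a ** rot X (t * s) ** X)) (at s)" for s
 proof -
  have "((%s. t * s) has_vector_derivative t) (at s)"
   by (auto intro!: derivative_eq_intros simp flip: has_real_derivative_iff_has_vector_derivative)
  from vector_diff_chain_at[OF this rot_deriv[OF X]]
  have "((%s. rot X (t * s)) has_vector_derivative t *R (rot X (t * s) ** X)) (at s)" by (simp add: o_def)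
  from bounded_linear.has_vector_derivative[OF bounded_linear_matrix_mult[of a "mat 1"] this]
  show ?thesis by (simp add: mat_scaleR_right mat_assoc)
 qed
 have c: "continuous_on A (%s. rot X (t * s))" for A unfolding rot_def by (intro continuous_intros)
 have c': "continuous_on A (%s. a ** rot X (t * s) ** k)" for k A
  by (rule continuous_on_compose2[OF bounded_linear.continuous_on[OF bounded_linear_matrix_mult[of a k] continuous_on_id] c]) auto
 have "(%s. a ** rot X (t * s)) piecewise_C1_differentiable_on {0..1}"
  unfolding piecewise_C1_differentiable_on_def C1_differentiable_on_def
  using d c'[of _ X] c'[of _ "mat 1"] by (auto intro!: exI[of _ "{}"] exI[of _ "%s. t *R (a ** rot X (t * s) ** X)"] continuous_intros)
 moreover have SO: "a ** rot X (t * s) : SO" for s by (rule SO_mult[OF a rot_SO[OF X]])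
 moreover have "((%s. N (transpose (a ** rot X (t * s)) ** vector_derivative (%s. a ** rot X (t * s)) (at s))) has_integral (abs t) * N X) {0..1}"
 proof -
  have "transpose (a ** rot X (t * s)) ** (t *R (a ** rot X (t * s) ** X)) = t *R X" for s
   using SO_transpose(1)[OF SO[of s]] by (simp add: mat_scaleR_right mat_assoc)
  thus ?thesis using vector_derivative_at[OF d] N has_integral_const_real[of "abs t * N X" 0 1] by simp
 qed
 ultimately show ?thesis by (simp add: is_path_def)
qed

text \<open>For such \<open>X\<close> the matrix \<open>- (X ** X)\<close> is an orthogonal
  projection, so its diagonal entries are at most 1, and its trace is the squared norm of
  \<open>X\<close>.\<close>

lemma gen_norm: assumes X: "gen (X :: real^'n^'n)" shows "(norm X)^2 <= real CARD('n)"
proof -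
 define P where "P = - (X ** X)"
 have PP: "P ** P = P" "transpose P = P" using gen_simps[OF X] by (simp_all add: P_def mat_lin mat_assoc tr_simps)
 have "P $ i $ i <= 1" for i
 proof -
  have "P $ i $ i = (SUM k:UNIV. P $ i $ k * P $ k $ i)"
   using arg_cong[OF PP(1), of "%M. M $ i $ i"] by (simp add: matrix_matrix_mult_def)
  also have "... = (SUM k:UNIV. (P $ i $ k)^2)"
  proof (intro sum.cong refl)
   fix k have "P $ k $ i = P $ i $ k" using arg_cong[OF PP(2), of "%M. M $ i $ k"] by (simp add: transpose_def)
   thus "P $ i $ k * P $ k $ i = (P $ i $ k)^2" by (simp add: power2_eq_square)
  qed
  also have "... >= (P $ i $ i)^2" by (rule member_le_sum) auto
  finally have "P $ i $ i * (P $ i $ i - 1) <= 0" by (simp add: power2_eq_square algebra_simps)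
  thus ?thesis by (simp add: mult_le_0_iff) (use zero_le_one in linarith)
 qed
 hence "trace P <= (SUM i:(UNIV::'n set). 1)" unfolding trace_def by (intro sum_mono)
 moreover have "(norm X)^2 = trace P"
  using X by (simp add: power2_norm_eq_inner inner_so gen_def P_def trace_neg)
 ultimately show ?thesis by simp
qed

section \<open>Plane rotations and the factorization of rotation matrices\<close>

lemma norm_SO_mult: "A : SO ==> norm (A ** X) = norm X" "A : SO ==> norm (X ** A) = norm (X :: real^'n^'n)"
 using SO_transpose[of A]
 by (auto simp: norm_eq_sqrt_inner inner_matrix_left[of A X] inner_matrix_right[of X A] mat_assoc)
   (simp flip: mat_assoc)

lemma SO_norm: "A : SO ==> norm (A :: real^'n^'n) = sqrt (real CARD('n))"
 using norm_SO_mult(1)[of A "mat 1"] by (simp add: norm_eq_sqrt_inner[of "mat 1"] inner_mat1 trace_I)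

lemma SO_inner: "A : SO ==> (A *v x) \<bullet> (A *v y) = x \<bullet> (y :: real^'n)"
 using orthogonal_transformation_matrix[of "(*v) A"]
 by (simp add: SO_def rotation_matrix_def orthogonal_transformation_def)

lemma norm_mult_minus_1:
 assumes "W : SO" shows "norm (W ** A - mat 1) <= norm (A - mat 1) + norm (W - mat 1)"
proof -
 have "W ** A - mat 1 = W ** (A - mat 1) + (W - mat 1)" by (simp add: mat_lin)
 thus ?thesis by (metis norm_triangle_ineq norm_SO_mult(1)[OF assms])
qed

text \<open>For orthonormal vectors this is the infinitesimal rotation that turns \<open>u\<close>
  towards \<open>v\<close>.\<close>

definition Xg :: "real^'n => real^'n => real^'n^'n" where
 "Xg u v = (\<chi> i j. v $ i * u $ j - u $ i * v $ j)"

lemma Xg_vec: "Xg u v *v w = (u \<bullet> w) *R v - (v \<bullet> w) *R u"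
 by (simp add: Xg_def vec_eq_iff matrix_vector_mult_def inner_vec_def algebra_simps sum_subtractf sum_distrib_left)

lemma Xg_so: "Xg u v : so"
 by (simp add: so_iff Xg_def transpose_def vec_eq_iff)

lemma Xg_flip: "Xg v u = - Xg u v"
 by (simp add: Xg_def vec_eq_iff)

lemma gen_Xg:
 assumes "norm u = 1" "norm v = 1" "u \<bullet> v = 0" shows "gen (Xg u v)"
proof -
 have "u \<bullet> u = 1" "v \<bullet> v = 1" "v \<bullet> u = 0" using assms by (simp_all add: norm_eq_1 inner_commute)
 hence "(Xg u v ** Xg u v ** Xg u v) *v w = Xg v u *v w" for w
  by (simp add: Xg_vec inner_diff_right assms(3) flip: matrix_vector_mul_assoc) 
 thus ?thesis unfolding gen_def by (simp add: matrix_eq Xg_so flip: Xg_flip)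
qed

lemma rot_Xg_vec:
 assumes "norm u = 1" "norm v = 1" "u \<bullet> v = 0"
 shows "rot (Xg u v) t *v w = w + sin t *R ((u \<bullet> w) *R v - (v \<bullet> w) *R u)
  - (1 - cos t) *R ((u \<bullet> w) *R u + (v \<bullet> w) *R v)"
proof -
 have "u \<bullet> u = 1" "v \<bullet> v = 1" "v \<bullet> u = 0" using assms by (simp_all add: norm_eq_1 inner_commute)
 hence "(Xg u v ** Xg u v) *v w = - ((u \<bullet> w) *R u + (v \<bullet> w) *R v)"
  by (simp add: Xg_vec assms(3) inner_diff_right flip: matrix_vector_mul_assoc)
 thus ?thesis
  by (simp add: rot_def matrix_vector_mult_add_rdistrib scaleR_matrix_vector_assoc[symmetric] Xg_vec scaleR_diff_right scaleR_add_right)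
qed

lemma Xg_conj: "(a :: real^'n^'n) ** Xg u v ** transpose a = Xg (a *v u) (a *v v)"
proof -
 have "(transpose a *v w) \<bullet> x = w \<bullet> (a *v x)" for w x :: "real^'n"
  by (metis dot_lmul_matrix transpose_matrix_vector)
 hence "(a ** Xg u v ** transpose a) *v w = Xg (a *v u) (a *v v) *v w" for w
  by (simp add: Xg_vec inner_commute matrix_vector_mult_diff_distrib matrix_vector_mult_scaleR flip: matrix_vector_mul_assoc)
 thus ?thesis by (simp add: matrix_eq)
qed

lemma rot_conj:
 assumes "a : SO" shows "a ** rot X t ** transpose a = rot (a ** X ** transpose a) t"
proof -
 have "a ** X ** transpose a ** (a ** X ** transpose a) = a ** X ** (transpose a ** a) ** X ** transpose a"
  by (simp only: mat_assoc)
 thus ?thesis using SO_transpose[OF assms]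
  by (simp add: rot_def mat_lin mat_assoc)
qed

lemma norm_rot: assumes X: "gen X" shows "norm (rot X t - mat 1) <= 2 * abs t * norm X"
proof -
 have "(norm (X ** X))^2 = (norm X)^2"
  by (simp add: power2_norm_eq_inner inner_matrix_left gen_simps[OF X] mat_assoc mat_lin)
 hence n: "norm (X ** X) = norm X" by (simp add: power2_eq_iff_nonneg)
 have "cos t = cos (2 * (t/2))" by simp
 also have "... = 1 - 2 * (sin (t/2))^2" by (rule cos_double_sin)
 finally have "abs (1 - cos t) = 2 * abs (sin (t/2)) * abs (sin (t/2))" by (simp add: power2_eq_square abs_mult)
 also have "... <= 2 * abs (t/2) * 1" by (intro mult_mono abs_sin_x_le_abs_x) auto
 finally have c: "abs (1 - cos t) <= abs t" by simp
 have "norm (rot X t - mat 1) <= norm (sin t *R X) + norm ((1 - cos t) *R (X ** X))"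
  using norm_triangle_ineq[of "sin t *R X" "(1 - cos t) *R (X ** X)"] by (simp add: rot_def)
 also have "... = (abs (sin t) + abs (1 - cos t)) * norm X" unfolding norm_scaleR n by (simp only: distrib_right)
 also have "... <= (abs t + abs t) * norm X"
  by (intro mult_right_mono add_mono c abs_sin_x_le_abs_x) auto
 finally show ?thesis by simp
qed

text \<open>\<open>A\<close> is a product of \<open>n\<close> rotations generated by elements of
  \<open>D\<close>, with total angle \<open>r\<close>. The number of factors is counted as well,
  because in \<open>planar_cost_O\<close> and \<open>planar_cost_PQ\<close> a single factor has a
  cost that does not shrink with its angle.\<close>

inductive reach :: "(real^'n^'n) set => nat => real => real^'n^'n => bool" for D where
 zero: "reach D 0 0 (mat 1)"
| step: "reach D n r A ==> X : D ==> reach D (Suc n) (r + abs t) (A ** rot X t)"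

lemma reach_mono: "reach D n r A ==> D <= D' ==> reach D' n r A"
 by (induction rule: reach.induct) (auto intro: reach.intros)

lemma reach_single: "X : D ==> reach D 1 (abs t) (rot X t)"
 using reach.step[OF reach.zero, of X D t] by simp

lemma reach_append:
 assumes "reach D n r A" "reach D m s C" shows "reach D (n + m) (r + s) (A ** C)"
 using assms(2)
proof (induction rule: reach.induct)
 case zero thus ?case using assms(1) by simp
next
 case (step m s C X t)
 from reach.step[OF step.IH step.hyps(2), of t] show ?case by (simp add: add.assoc mat_assoc)
qed

lemma reach_SO: "reach D n r A ==> D <= Collect gen ==> A : SO"
 by (induction rule: reach.induct) (auto intro: SO_id SO_mult rot_SO)

lemma reach_inv: "reach D n r A ==> D <= Collect gen ==> reach D n r (transpose A)"
proof (induction rule: reach.induct)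
 case zero thus ?case by (simp add: reach.zero)
next
 case (step n r A X t)
 have "gen X" using step by auto
 from reach_append[OF reach_single[OF step.hyps(2), of "- t"] step.IH[OF step.prems]]
 show ?case by (simp add: tr_simps rot_transpose[OF `gen X`] add.commute)
qed

lemma reach_norm:
 fixes A :: "real^'n^'n"
 shows "reach D n r A ==> D <= Collect gen ==> norm (A - mat 1) <= 2 * sqrt (real CARD('n)) * r"
proof (induction rule: reach.induct)
 case (step n r A X t)
 have X: "gen X" and A: "A : SO" using step reach_SO by auto
 have "norm (A ** rot X t - mat 1) <= norm (rot X t - mat 1) + norm (A - mat 1)" by (rule norm_mult_minus_1[OF A])
 also have "... <= 2 * abs t * norm X + 2 * sqrt (real CARD('n)) * r"
  using norm_rot[OF X] step by (simp add: add_mono)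
 also have "... <= 2 * abs t * sqrt (real CARD('n)) + 2 * sqrt (real CARD('n)) * r"
  using gen_norm[OF X] by (intro add_right_mono mult_left_mono real_le_rsqrt) auto
 finally show ?case by (simp add: algebra_simps)
qed auto

definition planar :: "'n set => (real^'n^'n) set" where
 "planar T = {Xg (axis i 1) (axis j 1) | i j. i : T & j : T & i ~= j}"

definition fixes_off :: "'n set => real^'n^'n => bool" where
 "fixes_off T A \<longleftrightarrow> (ALL i. i ~: T --> A *v axis i 1 = axis i 1)"

lemma planar_gen: "planar T <= Collect gen"
 by (auto simp: planar_def inner_axis_axis intro!: gen_Xg)

lemma planar_mono: "S <= T ==> planar S <= planar T"
 by (auto simp: planar_def)

lemma fixes_off_mult: "fixes_off T A ==> fixes_off T C ==> fixes_off T (A ** C)"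
 by (simp add: fixes_off_def flip: matrix_vector_mul_assoc)

lemma fixes_off_rot:
 fixes p q :: "'n::finite"
 assumes "p : T" "q : T" "p ~= q" shows "fixes_off T (rot (Xg (axis p 1) (axis q 1)) t)"
proof -
 have "(axis p 1 :: real^'n) \<bullet> axis i 1 = 0" "(axis q 1 :: real^'n) \<bullet> axis i 1 = 0" if "i ~: T" for i
  using that assms by (auto simp: inner_axis_axis)
 thus ?thesis using assms(3) by (simp add: fixes_off_def rot_Xg_vec inner_axis_axis)
qed

lemma fixes_off_reach: "reach (planar T) n r A ==> fixes_off T A"
proof (induction rule: reach.induct)
 case (step n r A X t)
 thus ?case by (auto simp: planar_def intro!: fixes_off_mult fixes_off_rot)
qed (simp add: fixes_off_def)

text \<open>Polar coordinates whose angle is controlled by the distance to (1, 0). Near (1, 0) the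
  arctangent is small enough; farther away the bound exceeds \<open>pi\<close> and the principal
  argument will do.\<close>

lemma polar_angle:
 fixes a b de :: real
 assumes "abs (a - 1) <= de" "abs b <= de"
 obtains rh ph where "rh >= 0" "a = rh * cos ph" "b = rh * sin ph" "abs ph <= 2 * pi * de"
proof (cases "de < 1/2")
 case True
 hence a: "a > 1/2" using assms by linarith
 have d: "de >= 0" using assms by linarith
 define ph where "ph = arctan (b / a)"
 have c: "cos ph > 0" unfolding ph_def by (rule cos_gt_zero_pi) (rule arctan_lbound arctan_ubound)+
 have t: "tan ph = b / a" by (simp add: ph_def tan_arctan)
 have "abs ph <= abs (b / a)"
 proof -
  have "abs (arctan x) <= abs x" for x :: real
   using arctan_le_self[of x] arctan_le_self[of "- x"] by (cases "x >= 0") (auto simp: arctan_minus)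
  thus ?thesis unfolding ph_def .
 qed
 also have "... <= 2 * de" 
 proof -
  have "abs b <= 2 * de * (1/2)" using assms by simp
  also have "... <= 2 * de * a" using a d by (intro mult_left_mono) auto
  finally show ?thesis using a by (simp add: field_simps)
 qed
 also have "... <= 2 * pi * de" using pi_ge_two d mult_right_mono[of 1 pi de] by simp
 finally have "abs ph <= 2 * pi * de" .
 moreover have "b = (a / cos ph) * sin ph" using t a c by (simp add: tan_def field_simps)
 ultimately show ?thesis using that[of "a / cos ph" ph] a c by simp
next
 case False
 define z where "z = Complex a b"
 have "z = rcis (cmod z) (Arg z)" by (simp add: rcis_cmod_Arg)
 hence "a = cmod z * cos (Arg z)" "b = cmod z * sin (Arg z)"
  unfolding z_def by (metis Re_rcis complex.sel(1), metis Im_rcis complex.sel(2))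
 moreover have "abs (Arg z) <= 2 * pi * de"
 proof -
  have "abs (Arg z) <= pi" using Arg_bounded[of z] by auto
  also have "... <= 2 * pi * de" using False mult_left_mono[of 1 "2 * de" pi] by simp
  finally show ?thesis .
 qed
 ultimately show ?thesis using that[of "cmod z" "Arg z"] by simp
qed

text \<open>Givens rotations: each one turns a coordinate of the image of the basis vector at
  \<open>p\<close> to 0, moving its mass to coordinate \<open>p\<close>. The polar radius becomes
  the new coordinate at \<open>p\<close>, hence it is nonnegative as soon as one rotation has been
  made.\<close>

lemma SO_zero_column:
 fixes T Q :: "'n::finite set"
 assumes "p : T" "p ~: Q" "Q <= T"
 shows "EX n C. C >= 0 & (ALL A:SO. EX r W. reach (planar T) n r W & r <= C * norm (A - mat 1) &
   (ALL q:Q. ((W ** A) *v axis p 1) $ q = 0) & (Q ~= {} --> ((W ** A) *v axis p 1) $ p >= 0))"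
 using finite[of Q] assms(2,3)
proof (induction Q rule: finite_induct)
 case empty
 thus ?case using reach.zero by (intro exI[of _ 0]) fastforce
next
 case (insert q Q)
 let ?c = "sqrt (real CARD('n))"
 obtain n C where C: "C >= 0" "ALL A:SO. EX r W. reach (planar T) n r W & r <= C * norm (A - mat 1) &
   (ALL q:Q. ((W ** A) *v axis p 1) $ q = 0) & (Q ~= {} --> ((W ** A) *v axis p 1) $ p >= 0)"
  using insert by auto
 \<comment> \<open>The new angle is at most 2 pi times the distance of \<open>W ** A\<close> from
   the identity, and that is at most (2 c C + 1) times the distance of \<open>A\<close> by
   \<open>reach_norm\<close>.\<close>
 define C' where "C' = 2 * pi * (2 * ?c * C + 1) + C"
 have "C' >= 0" using C(1) by (simp add: C'_def)
 moreover have "EX r W. reach (planar T) (Suc n) r W & r <= C' * norm (A - mat 1) &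
   (ALL q:insert q Q. ((W ** A) *v axis p 1) $ q = 0) & ((W ** A) *v axis p 1) $ p >= 0"
  if A: "A : SO" for A
 proof -
  obtain r W where W: "reach (planar T) n r W" "r <= C * norm (A - mat 1)"
   "ALL q:Q. ((W ** A) *v axis p 1) $ q = 0"
   using C(2) A by meson
  define v where "v = (W ** A) *v axis p 1"
  define de where "de = (2 * ?c * C + 1) * norm (A - mat 1)"
  have WS: "W : SO" by (rule reach_SO[OF W(1) planar_gen])
  have "norm (W ** A - mat 1) <= norm (A - mat 1) + norm (W - mat 1)" by (rule norm_mult_minus_1[OF WS])
  also have "... <= norm (A - mat 1) + 2 * ?c * (C * norm (A - mat 1))"
   using order_trans[OF reach_norm[OF W(1) planar_gen] mult_left_mono[OF W(2)]] by simp
  finally have d: "norm (W ** A - mat 1) <= de" by (simp add: de_def algebra_simps)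
  have e: "abs ((W ** A - mat 1) $ i $ j) <= de" for i j
   using component_le_norm_cart[of "(W ** A - mat 1) $ i" j] Finite_Cartesian_Product.norm_nth_le[of "W ** A - mat 1" i] d by (simp del: vector_minus_component)
  have v: "v $ i = (W ** A) $ i $ p" for i by (simp add: v_def matrix_vector_mult_basis column_def)
  have pq: "p ~= q" using insert by auto
  obtain rh ph where rh: "rh >= 0" "v $ p = rh * cos ph" "v $ q = rh * sin ph" "abs ph <= 2 * pi * de"
   using polar_angle[of "v $ p" de "v $ q"] e[of p p] e[of q p] pq by (auto simp: v mat_def)
  define X where "X = Xg (axis p 1) (axis q 1 :: real^'n)"
  have X: "X : planar T" using insert assms(1) pq by (auto simp: X_def planar_def)
  have 1: "reach (planar T) (Suc n) (abs ph + r) (rot X (- ph) ** W)"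
   using reach_append[OF reach_single[OF X, of "- ph"] W(1)] by simp
  have 2: "abs ph + r <= C' * norm (A - mat 1)"
   using rh(4) W(2) by (simp add: C'_def de_def algebra_simps)
  have w: "((rot X (- ph) ** W) ** A) *v axis p 1 = rot X (- ph) *v v"
   by (simp add: v_def matrix_vector_mul_assoc mat_assoc)
  have "axis q 1 $ p = (0::real)" using pq by (simp add: axis_def)
  hence x: "rot X (- ph) *v v = v - sin ph *R (v $ p *R axis q 1 - v $ q *R axis p 1)
    - (1 - cos ph) *R (v $ p *R axis p 1 + v $ q *R axis q 1)"
   unfolding X_def by (subst rot_Xg_vec) (use `axis q 1 $ p = (0::real)` in "auto simp: inner_axis'")
  have "(rot X (- ph) *v v) $ q = 0" using pq rh by (simp add: x axis_def algebra_simps)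
  moreover have "(rot X (- ph) *v v) $ p = rh * (sin ph * sin ph + cos ph * cos ph)"
   unfolding x using pq rh by (simp add: axis_def del: sin_cos_squared_add3) (simp add: algebra_simps del: sin_cos_squared_add3)
  moreover have "(rot X (- ph) *v v) $ i = 0" if "i : Q" for i
  proof -
   have "i ~= p" "i ~= q" "v $ i = 0" using that W(3) insert by (auto simp: v_def)
   thus ?thesis unfolding x by (simp add: axis_def)
  qed
  ultimately show ?thesis using 1 2 rh(1) w by (intro exI[of _ "abs ph + r"] exI[of _ "rot X (- ph) ** W"]) auto
 qed
 ultimately show ?case by (intro exI[of _ "Suc n"] exI[of _ C']) auto
qed

text \<open>Induction on the set of moved coordinates: Givens rotations bring the image of one basis
  vector back to it, and by orthogonality the remaining matrix moves only the others. The linear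
  bound on the angle survives, since every step changes the distance to the identity at most by a
  fixed factor.\<close>

lemma SO_reach:
 fixes T :: "'n::finite set"
 shows "EX n C. C >= 0 & (ALL A:SO. fixes_off T A --> (EX r. reach (planar T) n r A & r <= C * norm (A - mat 1)))"
 using finite[of T]
proof (induction T rule: finite_induct)
 case empty
 have "A = mat 1" if "fixes_off {} A" for A :: "real^'n^'n"
 proof -
  have "A $ i $ j = mat 1 $ i $ j" for i j
   using that unfolding fixes_off_def matrix_vector_mult_basis by (simp add: column_def vec_eq_iff axis_def mat_def)
  thus ?thesis by (simp add: vec_eq_iff)
 qed
 thus ?case using reach.zero by (intro exI[of _ 0]) fastforce
next
 case (insert p T)
 let ?c = "sqrt (real CARD('n))"
 obtain n C where C: "C >= 0" "ALL A:SO. fixes_off T A --> (EX r. reach (planar T) n r A & r <= C * norm (A - mat 1))"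
  using insert.IH by blast
 have orth: "(A *v axis p 1) $ i = 0" if "A : SO" "fixes_off (insert p T) A" "i ~: insert p T" for A i
 proof -
  have "(A *v axis p 1) \<bullet> (A *v axis i 1) = 0"
   using that by (auto simp: SO_inner inner_axis_axis)
  thus ?thesis using that by (simp add: fixes_off_def inner_axis)
 qed
 show ?case
 proof (cases "T = {}")
  \<comment> \<open>With no second coordinate left there is no rotation that could correct a sign;
    the determinant forces the entry to be 1.\<close>
  case True
  have "fixes_off T A" if A: "A : SO" "fixes_off (insert p T) A" for A
  proof -
   have e: "A $ i $ j = (A *v axis j 1) $ i" for i j by (simp add: matrix_vector_mult_basis column_def)
   have "A *v axis j 1 = axis j 1" if "j ~= p" for j using A that True by (simp add: fixes_off_def)
   hence o: "A $ i $ j = (if i = j then 1 else 0)" if "j ~= p" for i j using that by (simp add: e axis_def)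
   have o': "A $ i $ p = 0" if "i ~= p" for i using orth[OF A, of i] that True by (simp add: e)
   have "det A = (PROD i:UNIV. A $ i $ i)" by (rule det_diagonal) (metis o o')
   also have "... = A $ p $ p * (PROD i:UNIV - {p}. A $ i $ i)" by (rule prod.remove) auto
   also have "(PROD i:UNIV - {p}. A $ i $ i) = 1" by (rule prod.neutral) (simp add: o)
   finally have "A $ p $ p = 1" using A(1) by (simp add: SO_def rotation_matrix_def)
   hence "(A *v axis p 1) $ i = axis p 1 $ i" for i
    using o'[of i] unfolding matrix_vector_mult_basis by (cases "i = p") (simp_all add: column_def axis_def)
   hence "A *v axis p 1 = axis p 1" by (simp add: vec_eq_iff)
   thus ?thesis using A(2) by (auto simp: fixes_off_def)
  qed
  thus ?thesis using C reach_mono[OF _ planar_mono, of T _ _ _ "insert p T"]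
   by (intro exI[of _ n] exI[of _ C]) blast
 next
  case False
  obtain m E where E: "E >= 0" "ALL A:SO. EX r W. reach (planar (insert p T)) m r W & r <= E * norm (A - mat 1) &
    (ALL q:T. ((W ** A) *v axis p 1) $ q = 0) & (T ~= {} --> ((W ** A) *v axis p 1) $ p >= 0)"
   using SO_zero_column[of p "insert p T" T] insert.hyps by auto
  define C' where "C' = E + C * (2 * ?c * E + 1)"
  have "EX r. reach (planar (insert p T)) (m + n) r A & r <= C' * norm (A - mat 1)"
   if A: "A : SO" "fixes_off (insert p T) A" for A
  proof -
   obtain r W where W: "reach (planar (insert p T)) m r W" "r <= E * norm (A - mat 1)"
    "ALL q:T. ((W ** A) *v axis p 1) $ q = 0" "((W ** A) *v axis p 1) $ p >= 0"
    using E(2) A False by meson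
   have WS: "W : SO" by (rule reach_SO[OF W(1) planar_gen])
   have S: "W ** A : SO" by (rule SO_mult[OF WS A(1)])
   have f: "fixes_off (insert p T) (W ** A)" by (rule fixes_off_mult[OF fixes_off_reach[OF W(1)] A(2)])
   define v where "v = (W ** A) *v axis p 1"
   have v: "v $ i = 0" if "i ~= p" for i
    using W(3) orth[OF S f, of i] that by (auto simp: v_def)
   have "v \<bullet> v = 1" unfolding v_def SO_inner[OF S] by (simp add: inner_axis_axis)
   moreover have "v \<bullet> v = (v $ p)^2"
    unfolding inner_vec_def by (subst sum.remove[of _ p]) (auto simp: v power2_eq_square)
   ultimately have "v $ p = 1" using W(4) unfolding v_def[symmetric] by (simp add: power2_eq_1_iff)
   hence "v = axis p 1" using v by (auto simp: vec_eq_iff axis_def)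
   hence "fixes_off T (W ** A)" using f by (auto simp: fixes_off_def v_def)
   then obtain s where s: "reach (planar T) n s (W ** A)" "s <= C * norm (W ** A - mat 1)" using C(2) S by blast
   have "norm (W ** A - mat 1) <= norm (A - mat 1) + norm (W - mat 1)" by (rule norm_mult_minus_1[OF WS])
   also have "... <= norm (A - mat 1) + 2 * ?c * (E * norm (A - mat 1))"
    using order_trans[OF reach_norm[OF W(1) planar_gen] mult_left_mono[OF W(2)]] by simp
   finally have "s <= C * (norm (A - mat 1) + 2 * ?c * (E * norm (A - mat 1)))"
    using s(2) C(1) by (meson mult_left_mono order_trans)
   hence "r + s <= C' * norm (A - mat 1)" using W(2) by (simp add: C'_def algebra_simps)
   moreover have "reach (planar (insert p T)) (m + n) (r + s) (transpose W ** (W ** A))"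
    by (intro reach_append reach_inv[OF W(1) planar_gen] reach_mono[OF s(1) planar_mono]) auto
   moreover have "transpose W ** (W ** A) = A" using SO_transpose(1)[OF WS] by (simp add: mat_assoc)
   ultimately show ?thesis by auto
  qed
  moreover have "C' >= 0" using C(1) E(1) by (simp add: C'_def)
  ultimately show ?thesis by (intro exI[of _ "m + n"] exI[of _ C']) blast
 qed
qed

section \<open>The distance on a homogeneous space\<close>

definition coset :: "(real^'n^'n) set => real^'n^'n => (real^'n^'n) set" where
 "coset H a = (%h. a ** h) ` H"

lemma cosets_eq: "cosets H = coset H ` SO"
 by (simp add: cosets_def coset_def)

text \<open>Definiteness transverse to \<open>H\<close> is left out on purpose, so that boundary
  points of the simplex give instances too. Where the distance has to separate cosets,
  \<open>d_eq_0\<close> derives this from a lower bound for \<open>N\<close> by a bracket.\<close>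

locale hom_metric =
 fixes N :: "real^'n^'n => real" and H :: "(real^'n^'n) set"
 assumes N_nonneg: "N xi >= 0" and N_scale: "N (b *R xi) = abs b * N xi"
  and H_SO: "H <= SO" and H_id: "mat 1 : H" and H_mult: "h : H ==> k : H ==> h ** k : H"
  and H_inv: "h : H ==> transpose h : H"
  and N_Ad: "k : H ==> xi : so ==> N (transpose k ** xi ** k) = N xi"
begin

abbreviation d where "d a b \<equiv> gdist N (coset H a) (coset H b)"

lemma coset_refl: "a : coset H a"
 using H_id by (force simp: coset_def)

lemma coset_mult: assumes k: "k : H" shows "coset H (a ** k) = coset H a"
proof -
 have "k ** (transpose k ** h) = h" for h
  using SO_transpose(2)[of k] H_SO k by (simp add: mat_assoc subsetD)
 hence "h : (%h. k ** h) ` H" if "h : H" for h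
  using H_mult[OF H_inv[OF k] that] by (metis imageI)
 hence "(%h. k ** h) ` H = H" using H_mult[OF k] by blast
 hence "(%h. a ** h) ` (%h. k ** h) ` H = (%h. a ** h) ` H" by simp
 thus ?thesis by (simp add: coset_def image_image mat_assoc)
qed

lemma coset_eqI:
 assumes "a : SO" "transpose a ** b : H" shows "coset H a = coset H b"
 using coset_mult[OF assms(2), of a] SO_transpose(2)[OF assms(1)] by (simp add: mat_assoc)

text \<open>Right translation by an element of \<open>H\<close> preserves length, so the starting
  point may be moved to any chosen representative.\<close>

lemma path_from:
 assumes c: "is_path N c r" and a: "c 0 : coset H a" and b: "c 1 : coset H b"
 obtains c' where "is_path N c' r" "c' 0 = a" "c' 1 : coset H b"
proof -
 obtain k where k: "k : H" "c 0 = a ** k" using a by (auto simp: coset_def)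
 obtain h where h: "h : H" "c 1 = b ** h" using b by (auto simp: coset_def)
 have "is_path N (%t. mat 1 ** c t ** transpose k) r"
  by (rule path_transform[OF c]) (use N_Ad[OF H_inv[OF k(1)]] H_SO H_inv[OF k(1)] in "auto intro: SO_mult")
 moreover have "c 0 ** transpose k = a"
  using SO_transpose(2)[of k] H_SO k by (simp add: subsetD flip: mat_assoc)
 moreover have "c 1 ** transpose k : coset H b"
  unfolding h(2) coset_def using H_mult[OF h(1) H_inv[OF k(1)]] by (auto simp flip: mat_assoc)
 ultimately show ?thesis using that[of "%t. mat 1 ** c t ** transpose k"] by simp
qed

lemma d_le:
 assumes "is_path N c r" "c 0 : coset H a" "c 1 : coset H b" shows "d a b <= r"
proof -
 have "x >= 0" if "x : {r. EX c. is_path N c r & c 0 : coset H a & c 1 : coset H b}" for x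
  using that path_nonneg[of N _ x] N_nonneg by blast
 thus ?thesis
  unfolding gdist_def by (intro cInf_lower bdd_belowI[of _ 0]) (use assms in auto)
qed

lemma path_exists:
 assumes "a : SO" "b : SO" shows "EX c r. is_path N c r & c 0 = a & c 1 = b"
proof -
 have *: "ALL a:SO. EX c r. is_path N c r & c 0 = a & c 1 = a ** A" if "reach (planar UNIV) n s A" for n s and A :: "real^'n^'n"
  using that
 proof (induction rule: reach.induct)
  case zero
  have "gen (0 :: real^'n^'n)" by (simp add: gen_def so_iff tr_simps)
  from rot_path[OF this _ N_scale, of _ 0] show ?case by (auto intro!: exI)
 next
  case (step n r A X t)
  hence X: "gen X" and A: "A : SO" using planar_gen reach_SO[OF step.hyps(1) planar_gen] by auto
  show ?case
  proof
   fix a :: "real^'n^'n" assume a: "a : SO"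
   obtain c r where c: "is_path N c r" "c 0 = a" "c 1 = a ** A" using step.IH a by blast
   have "is_path N (c +++ (%s. (a ** A) ** rot X (t * s))) (r + abs t * N X)"
    by (rule path_join[OF c(1) rot_path[OF X SO_mult[OF a A] N_scale]]) (use c N_scale in auto)
   moreover have "(c +++ (%s. (a ** A) ** rot X (t * s))) 0 = a" "(c +++ (%s. (a ** A) ** rot X (t * s))) 1 = a ** (A ** rot X t)"
    using c(2) by (simp_all add: joinpaths_def mat_assoc)
   ultimately show "EX c r. is_path N c r & c 0 = a & c 1 = a ** (A ** rot X t)" by blast
  qed
 qed
 have "transpose a ** b : SO" using assms by (intro SO_mult SO_inv)
 then obtain n s where "reach (planar UNIV) n s (transpose a ** b)"
  using SO_reach[of "UNIV :: 'n set"] by (auto simp: fixes_off_def)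
 from *[OF this] assms(1) have "EX c r. is_path N c r & c 0 = a & c 1 = a ** (transpose a ** b)" by blast
 thus ?thesis using SO_transpose(2)[OF assms(1)] by (simp add: mat_assoc)
qed

lemma d_less:
 assumes "a : SO" "b : SO" "d a b < e"
 obtains c r where "is_path N c r" "c 0 = a" "c 1 : coset H b" "r < e"
proof -
 have "{r. EX c. is_path N c r & c 0 : coset H a & c 1 : coset H b} ~= {}"
  using path_exists[OF assms(1,2)] coset_refl[of a] coset_refl[of b] by fastforce
 from cInf_lessD[OF this assms(3)[unfolded gdist_def]] path_from that show ?thesis by blast
qed

lemma d_nonneg: assumes "a : SO" "b : SO" shows "d a b >= 0"
proof (rule ccontr)
 assume "~ d a b >= 0"
 then obtain c r where "is_path N c r" "r < 0" using d_less[OF assms, of 0] by (metis not_le)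
 thus False using path_nonneg[OF _ N_nonneg] by force
qed

lemma d_commute: "d a b = d b a"
proof -
 have "EX c. is_path N c r & c 0 : coset H b & c 1 : coset H a"
  if "is_path N c r" "c 0 : coset H a" "c 1 : coset H b" for c r a b
  using path_reverse[OF that(1)] N_scale[of "-1"] that(2,3) by (intro exI[of _ "%t. c (1 - t)"]) auto
 thus ?thesis unfolding gdist_def by (intro arg_cong[where f = Inf] Collect_cong) blast
qed

lemma d_triangle:
 assumes "a : SO" "b : SO" "c : SO" shows "d a c <= d a b + d b c"
proof (rule field_le_epsilon)
 fix e :: real assume "e > 0"
 hence e: "d b a < d b a + e/2" "d b c < d b c + e/2" by auto
 obtain f r where f: "is_path N f r" "f 0 = b" "f 1 : coset H a" "r < d b a + e/2" by (rule d_less[OF assms(2,1) e(1)])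
 obtain g s where g: "is_path N g s" "g 0 = b" "g 1 : coset H c" "s < d b c + e/2" by (rule d_less[OF assms(2,3) e(2)])
 have f': "is_path N (%t. f (1 - t)) r" by (rule path_reverse[OF f(1)]) (use N_scale[of "-1"] in auto)
 have "is_path N ((%t. f (1 - t)) +++ g) (r + s)"
  by (rule path_join[OF f' g(1)]) (use f g N_scale in auto)
 hence "d a c <= r + s" by (rule d_le) (use f g in "auto simp: joinpaths_def")
 thus "d a c <= d a b + d b c + e" using f(4) g(4) d_commute[of a b] by linarith
qed

lemma d_self: assumes "a : SO" shows "d a a = 0"
proof -
 have "gen (0 :: real^'n^'n)" by (simp add: gen_def so_iff tr_simps)
 from rot_path[OF this assms N_scale, of 0] have "is_path N (%s. a) 0" by simp
 hence "d a a <= 0" by (rule d_le) (rule coset_refl)+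
 thus ?thesis using d_nonneg[OF assms assms] by linarith
qed

lemma d_rot: assumes "gen X" "a : SO" shows "d a (a ** rot X t) <= abs t * N X"
 by (rule d_le[OF rot_path[OF assms N_scale]]) (auto simp: coset_refl)

lemma d_reach:
 assumes D: "D <= Collect gen" and cost: "!!X a t. X : D ==> a : SO ==> d a (a ** rot X t) <= al + be * abs t"
 shows "reach D n r A ==> a : SO ==> d a (a ** A) <= real n * al + be * r"
proof (induction rule: reach.induct)
 case zero thus ?case by (simp add: d_self)
next
 case (step n r A X t)
 have A: "A : SO" by (rule reach_SO[OF step.hyps(1) D])
 have X: "rot X t : SO" by (rule rot_SO) (use step.hyps(2) D in auto)
 have "d a (a ** (A ** rot X t)) <= d a (a ** A) + d (a ** A) (a ** A ** rot X t)"
  using d_triangle[of a "a ** A" "a ** A ** rot X t"] step.prems A X by (simp add: SO_mult mat_assoc)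
 also have "... <= (real n * al + be * r) + (al + be * abs t)"
  using step cost[of X "a ** A" t] A by (intro add_mono) (auto simp: SO_mult)
 finally show ?case by (simp add: algebra_simps)
qed

text \<open>The orbit map \<open>a \<mapsto> a Z a\<^sup>T\<close> embeds the homogeneous space when \<open>H\<close> is the stabilizer of \<open>Z\<close>.\<close>

lemma orbit_lipschitz:
 assumes Z: "!!k. k : H ==> k ** Z ** transpose k = Z" and c: "!!xi. xi : so ==> norm (bracket xi Z) <= C * N xi"
  and C: "C >= 0" and a: "a : SO" and b: "b : SO"
 shows "norm (a ** Z ** transpose a - b ** Z ** transpose b) <= C * d a b"
proof (rule field_le_epsilon)
 fix e :: real assume e: "e > 0"
 have inv: "x ** Z ** transpose x = b ** Z ** transpose b" if x: "x : coset H b" for x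
 proof -
  obtain k where k: "k : H" "x = b ** k" using x by (auto simp: coset_def)
  have "x ** Z ** transpose x = b ** (k ** Z ** transpose k) ** transpose b"
   by (simp add: k(2) tr_simps mat_assoc)
  thus ?thesis by (simp add: Z[OF k(1)])
 qed
 have "d a b < d a b + e / (C + 1)" using e C by simp
 then obtain f r where f: "is_path N f r" "f 0 = a" "f 1 : coset H b" "r < d a b + e / (C + 1)"
  by (rule d_less[OF a b])
 obtain S D where S: "finite S" "!!t. t : {0..1} - S ==> (f has_vector_derivative D t) (at t)"
  "!!t. t : {0..1} - S ==> vector_derivative f (at t) = D t"
  using path_C1[OF f(1)] by metis
 define F where "F t = f t ** Z ** transpose (f t)" for t
 define F' where "F' t = f t ** (Z ** transpose (D t)) + D t ** (Z ** transpose (f t))" for t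
 have F'_eq: "norm (F' t) <= C * N (transpose (f t) ** vector_derivative f (at t))" if t: "t : {0..1} - insert 0 (insert 1 S)" for t
 proof -
  define xi where "xi = transpose (f t) ** D t"
  have t': "t : {0..1} - S" using t by auto
  have ft: "f t : SO" using path_SO[OF f(1)] t by auto
  have xi: "xi : so" unfolding xi_def
   by (rule velocity_so[OF _ _ S(2)[OF t'], of 0 1]) (use path_SO[OF f(1)] t in auto)
  have D: "D t = f t ** xi" using SO_transpose(2)[OF ft] by (simp add: xi_def mat_assoc)
  have "transpose xi = - xi" using xi by (simp add: so_iff)
  hence "F' t = f t ** bracket xi Z ** transpose (f t)"
   by (simp add: F'_def D tr_simps bracket_def mat_lin mat_assoc)
  hence "norm (F' t) = norm (bracket xi Z)" by (simp add: norm_SO_mult[OF ft] norm_SO_mult[OF SO_inv[OF ft]])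
  thus ?thesis using c[OF xi] S(3)[OF t'] by (simp add: xi_def)
 qed
 have int: "(F' has_integral (F 1 - F 0)) {0..1}"
 proof (rule fundamental_theorem_of_calculus_strong[OF S(1)])
  show "continuous_on {0..1} F" unfolding F_def
   by (intro bounded_bilinear.continuous_on[OF bounded_bilinear_matrix] path_cont[OF f(1)] continuous_on_const
     continuous_on_compose2[OF bounded_linear.continuous_on[OF bounded_linear_transpose continuous_on_id] path_cont[OF f(1)]]) auto
  show "(F has_vector_derivative F' t) (at t)" if "t : {0..1} - S" for t
  proof -
   note d = S(2)[OF that]
   have "((%t. Z ** transpose (f t)) has_vector_derivative Z ** transpose (D t)) (at t)"
    using bounded_linear.has_vector_derivative[OF bounded_linear_matrix_mult[of Z "mat 1"]
      bounded_linear.has_vector_derivative[OF bounded_linear_transpose d]] by simp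
   from bounded_bilinear.has_vector_derivative[OF bounded_bilinear_matrix d this]
   show ?thesis unfolding F_def F'_def by (simp add: mat_assoc)
  qed
 qed simp
 have int': "((%t. C * N (transpose (f t) ** vector_derivative f (at t))) has_integral C * r) {0..1}"
  using f(1) by (intro has_integral_mult_right) (simp add: is_path_def)
 \<comment> \<open>Replacing the derivative by 0 at the finitely many exceptional points makes the
   bound by the speed valid on the whole interval.\<close>
 define G where "G t = (if t : insert 0 (insert 1 S) then 0 else F' t)" for t
 have G: "(G has_integral (F 1 - F 0)) {0..1}"
  by (rule has_integral_spike_finite[OF _ _ int, of "insert 0 (insert 1 S)"]) (use S(1) in "auto simp: G_def")
 have "norm (integral {0..1} G) <= integral {0..1} (%t. C * N (transpose (f t) ** vector_derivative f (at t)))"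
 proof (rule integral_norm_bound_integral)
  show "norm (G t) <= C * N (transpose (f t) ** vector_derivative f (at t))" if "t : {0..1}" for t
   using F'_eq[of t] that C N_nonneg by (auto simp: G_def)
 qed (use G int' in "auto simp: has_integral_integrable")
 hence "norm (F 1 - F 0) <= C * r" unfolding integral_unique[OF G] integral_unique[OF int'] .
 also have "... <= C * (d a b + e / (C + 1))" using f(4) C by (intro mult_left_mono) auto
 also have "C * (e / (C + 1)) <= e" using C e by (simp add: field_simps)
 hence "C * (d a b + e / (C + 1)) <= C * d a b + e" by (simp add: distrib_left)
 finally show "norm (a ** Z ** transpose a - b ** Z ** transpose b) <= C * d a b + e"
  using inv[OF f(3)] by (simp add: F_def f(2) norm_minus_commute)
qed

lemma d_eq_0:
 assumes Z: "!!k. k : SO ==> k : H \<longleftrightarrow> k ** Z = Z ** k" and c: "!!xi. xi : so ==> norm (bracket xi Z) <= C * N xi"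
  and C: "C >= 0" and a: "a : SO" and b: "b : SO"
 shows "d a b = 0 \<longleftrightarrow> coset H a = coset H b"
proof
 have "k ** Z ** transpose k = Z" if "k : H" for k
 proof -
  have "k : SO" using that H_SO by auto
  hence "k ** Z ** transpose k = Z ** (k ** transpose k)" using Z[of k] that by (simp add: mat_assoc)
  thus ?thesis using SO_transpose(2)[OF `k : SO`] by simp
 qed
 from orbit_lipschitz[OF this c C a b]
 have l: "norm (a ** Z ** transpose a - b ** Z ** transpose b) <= C * d a b" .
 assume "d a b = 0"
 hence e: "a ** Z ** transpose a = b ** Z ** transpose b" using l by simp
 have "transpose a ** (a ** Z ** transpose a) ** b = transpose a ** (b ** Z ** transpose b) ** b" by (simp add: e)
 hence "(transpose a ** a) ** Z ** (transpose a ** b) = (transpose a ** b) ** Z ** (transpose b ** b)"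
  by (simp add: mat_assoc)
 hence "(transpose a ** b) ** Z = Z ** (transpose a ** b)" by (simp add: SO_transpose a b)
 hence "transpose a ** b : H" using Z[of "transpose a ** b"] a b by (simp add: SO_mult SO_inv)
 thus "coset H a = coset H b" by (rule coset_eqI[OF a])
next
 assume "coset H a = coset H b"
 thus "d a b = 0" using d_self[OF a] by simp
qed

end

text \<open>The constant \<open>C\<close> depends on the size of the matrices only; the metric
  enters through the single bound \<open>c\<close> on generators. This gives estimates that are
  uniform along the flow.\<close>

lemma d_lipschitz:
 "EX C>=0. ALL N H c. hom_metric N (H :: (real^'n^'n) set) --> (ALL X. gen X --> N X <= c) -->
   (ALL a:SO. ALL b:SO. gdist N (coset H a) (coset H b) <= C * c * norm (a - b))"
proof -
 obtain n C where C: "C >= 0" "ALL A:SO. fixes_off (UNIV :: 'n set) A --> (EX r. reach (planar UNIV) n r A & r <= C * norm (A - mat 1))"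
  using SO_reach by blast
 have "gdist N (coset H a) (coset H b) <= C * c * norm (a - b)"
  if "hom_metric N H" "ALL X. gen X --> N X <= c" "a : SO" "b : SO" for N c a b and H :: "(real^'n^'n) set"
 proof -
  interpret hom_metric N H by fact
  have A: "transpose a ** b : SO" using that by (intro SO_mult SO_inv)
  then obtain r where r: "reach (planar UNIV) n r (transpose a ** b)" "r <= C * norm (transpose a ** b - mat 1)"
   using C(2) by (auto simp: fixes_off_def)
  have "gen (0 :: real^'n^'n)" by (simp add: gen_def so_iff tr_simps)
  hence c: "c >= 0" using that(2) N_nonneg[of 0] by force
  have "d a (a ** (transpose a ** b)) <= real n * 0 + c * r"
  proof (rule d_reach[OF planar_gen _ r(1) that(3)])
   fix X a t assume X: "X : planar (UNIV :: 'n set)" "a : (SO :: (real^'n^'n) set)"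
   hence "gen X" using planar_gen by auto
   hence "abs t * N X <= abs t * c" using that(2) by (intro mult_left_mono) auto
   thus "d a (a ** rot X t) <= 0 + c * abs t" using d_rot[OF `gen X` X(2), of t] by (simp add: mult.commute)
  qed
  moreover have "a ** (transpose a ** b) = b" using SO_transpose(2)[OF that(3)] by (simp add: mat_assoc)
  moreover have "norm (transpose a ** b - mat 1) = norm (a - b)"
  proof -
   have "transpose a ** b - mat 1 = transpose a ** (b - a)" using SO_transpose(1)[OF that(3)] by (simp add: mat_lin)
   thus ?thesis by (simp add: norm_SO_mult[OF SO_inv[OF that(3)]] norm_minus_commute)
  qed
  moreover have "c * r <= c * (C * norm (transpose a ** b - mat 1))" using r(2) c by (rule mult_left_mono)
  ultimately show ?thesis by (simp add: mult_ac)
 qed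
 thus ?thesis using C(1) by blast
qed

text \<open>The point is the existence of the second length. The speed for \<open>N'\<close> is
  continuous off finitely many points, hence measurable, and it is dominated by an integrable
  function.\<close>

lemma path_dominated:
 fixes N N' :: "real^'n^'n => real"
 assumes c: "is_path N c r" and cont: "continuous_on UNIV N'" and nn: "!!xi. N' xi >= 0" "!!xi. N xi >= 0"
  and le: "!!xi. xi : so ==> N' xi <= C * N xi"
 shows "EX r'<=C * r. is_path N' c r'"
proof -
 obtain S D where S: "finite S" "!!t. t : {0..1} - S ==> (c has_vector_derivative D t) (at t)"
  "continuous_on ({0..1} - S) D" "!!t. t : {0..1} - S ==> vector_derivative c (at t) = D t"
  using path_C1[OF c] by metis
 define E where "E = insert 0 (insert 1 S)"
 define T where "T = {0..1} - E"
 define f where "f t = N' (transpose (c t) ** vector_derivative c (at t))" for t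
 define g where "g t = C * N (transpose (c t) ** vector_derivative c (at t))" for t
 have E: "finite E" using S by (simp add: E_def)
 have T: "T : sets lebesgue" unfolding T_def using negligible_imp_sets[OF negligible_finite[OF E]] by (intro sets.Diff) auto
 have g: "(g has_integral C * r) {0..1}"
  unfolding g_def using c by (intro has_integral_mult_right) (simp add: is_path_def)
 have spike: "(f has_integral y) {0..1} \<longleftrightarrow> (f has_integral y) T" for f :: "real => real" and y
  by (rule has_integral_spike_set_eq; rule negligible_subset[OF negligible_finite[OF E]]) (auto simp: T_def)
 have fg: "norm (f t) <= g t" if "t : T" for t
 proof -
  have t: "t : {0..1} - S" "t : {0<..<1}" using that by (auto simp: T_def E_def)
  have "transpose (c t) ** vector_derivative c (at t) : so"
   unfolding S(4)[OF t(1)] by (rule velocity_so[OF _ t(2) S(2)[OF t(1)]]) (use path_SO[OF c] in auto)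
  thus ?thesis using le nn by (simp add: f_def g_def)
 qed
 have "continuous_on T (%t. transpose (c t) ** D t)"
  by (intro bounded_bilinear.continuous_on[OF bounded_bilinear_matrix]
    continuous_on_compose2[OF bounded_linear.continuous_on[OF bounded_linear_transpose continuous_on_id]])
    (use path_cont[OF c] S(3) in "auto simp: T_def E_def intro: continuous_on_subset")
 hence "continuous_on T (%t. N' (transpose (c t) ** D t))"
  by (intro continuous_on_compose2[OF cont]) auto
 hence "continuous_on T f"
  by (rule continuous_on_eq) (use S(4) in "auto simp: f_def T_def E_def")
 hence "f : borel_measurable (lebesgue_on T)" using T by (rule continuous_imp_measurable_on_sets_lebesgue)
 moreover have gT: "(g has_integral C * r) T" using g by (simp add: spike)
 ultimately have "f integrable_on T"
  using measurable_bounded_by_integrable_imp_integrable[of f T g] fg T by auto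
 then obtain r' where r': "(f has_integral r') T" by blast
 have "r' <= C * r" by (rule has_integral_le[OF r' gT]) (use fg in force)
 moreover have "(f has_integral r') {0..1}" using r' by (simp add: spike)
 ultimately show ?thesis using c unfolding is_path_def f_def by blast
qed

section \<open>Collapse of the fibres of a homogeneous fibration\<close>

lemma finite_net_SO:
 assumes "de > 0"
 obtains F :: "(real^'n^'n) set" where "finite F" "F <= SO" "!!a. a : SO ==> EX x:F. norm (a - x) < de"
proof -
 have "bounded (SO :: (real^'n^'n) set)" by (rule boundedI[of _ "sqrt (real CARD('n))"]) (simp add: SO_norm)
 hence "compact (closure (SO :: (real^'n^'n) set))" by simp
 moreover have "closure SO <= (UN x:(SO :: (real^'n^'n) set). ball x de)"
  using assms by (fastforce simp: closure_approachable)
 ultimately obtain F where F: "F <= (SO :: (real^'n^'n) set)" "finite F" "closure SO <= (UN x:F. ball x de)"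
  using compactE_image[of "closure SO" "SO" "%x :: real^'n^'n. ball x de"] by (metis open_ball)
 show ?thesis
 proof (rule that[OF F(2,1)])
  fix a :: "real^'n^'n" assume "a : SO"
  hence "a : (UN x:F. ball x de)" using F(3) closure_subset by blast
  thus "EX x:F. norm (a - x) < de" by (auto simp: dist_norm norm_minus_commute)
 qed
qed

lemma subpath:
 fixes N :: "real^'n^'n => real"
 assumes c: "!!t. t : {u..v} ==> c t : SO" and d: "!!t. t : {u..v} ==> (c has_vector_derivative D t) (at t)"
  and D: "continuous_on {u..v} D" and uv: "u < v" and N: "continuous_on UNIV N" and N_scale: "!!b xi. N (b *R xi) = abs b * N xi"
 shows "is_path N (%t. c (u + (v - u) * t)) (integral {u..v} (%t. N (transpose (c t) ** D t)))"
proof -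
 let ?h = "%t. u + (v - u) * t"
 have h: "?h t : {u..v}" if "t : {0..1}" for t
 proof -
  have "(v - u) * t <= v - u" using that uv by (intro mult_left_le) auto
  moreover have "(v - u) * t >= 0" using that uv by simp
  ultimately show ?thesis unfolding atLeastAtMost_iff by linarith
 qed
 have dh: "((%t. c (?h t)) has_vector_derivative (v - u) *R D (?h t)) (at t)" if "t : {0..1}" for t
 proof -
  have "(?h has_vector_derivative (v - u)) (at t)"
   by (auto intro!: derivative_eq_intros simp flip: has_real_derivative_iff_has_vector_derivative)
  from vector_diff_chain_at[OF this d[OF h[OF that]]] show ?thesis by (simp add: o_def)
 qed
 have "continuous_on {0..1} (%t. (v - u) *R D (?h t))"
 proof (intro continuous_on_scaleR continuous_on_const continuous_on_compose2[OF D])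
  show "continuous_on {0..1} ?h" by (intro continuous_intros)
  show "?h ` {0..1} <= {u..v}" using h by blast
 qed
 hence "(%t. c (?h t)) C1_differentiable_on {0..1}"
  unfolding C1_differentiable_on_def by (intro exI[of _ "%t. (v - u) *R D (?h t)"] conjI ballI dh)
 hence "(%t. c (?h t)) piecewise_C1_differentiable_on {0..1}"
  by (rule C1_differentiable_imp_piecewise)
 moreover have "((%t. N (transpose (c (?h t)) ** vector_derivative (%t. c (?h t)) (at t))) has_integral
   integral {u..v} (%t. N (transpose (c t) ** D t))) {0..1}"
 proof (rule has_integral_eq)
  have cc: "continuous_on {u..v} c"
   using d by (intro continuous_at_imp_continuous_on ballI) (metis has_vector_derivative_continuous)
  have "continuous_on {u..v} (%t. transpose (c t) ** D t)"
   by (intro bounded_bilinear.continuous_on[OF bounded_bilinear_matrix] D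
    continuous_on_compose2[OF bounded_linear.continuous_on[OF bounded_linear_transpose continuous_on_id] cc]) auto
  hence "continuous_on {u..v} (%t. N (transpose (c t) ** D t))"
   by (intro continuous_on_compose2[OF N]) auto
  hence "((%t. N (transpose (c t) ** D t)) has_integral integral {u..v} (%t. N (transpose (c t) ** D t))) (cbox u v)"
   using integrable_continuous_real by (auto simp: has_integral_integral)
  from has_integral_affinity'[OF this, of "v - u" u, THEN has_integral_mult_right, of "v - u"]
  show "((%t. (v - u) * N (transpose (c (?h t)) ** D (?h t))) has_integral integral {u..v} (%t. N (transpose (c t) ** D t))) {0..1}"
   using uv by (simp add: add.commute flip: mult.assoc)
  show "(v - u) * N (transpose (c (?h t)) ** D (?h t)) = N (transpose (c (?h t)) ** vector_derivative (%t. c (?h t)) (at t))"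
   if "t : {0..1}" for t
   using vector_derivative_at[OF dh[OF that]] uv by (simp add: mat_scaleR_right N_scale)
 qed
 ultimately show ?thesis using c h by (simp add: is_path_def)
qed

text \<open>\<open>N0\<close> is the length on the base with isotropy \<open>H0\<close>, and
  \<open>Nt\<close> are the lengths on the total space with isotropy \<open>K\<close>. The upper
  comparison has an additive error, because \<open>N0\<close> vanishes on fibre directions where
  \<open>Nt\<close> does not; \<open>fibre\<close> says that the fibres shrink, and \<open>M\<close>
  makes all distances uniformly Lipschitz.\<close>

locale collapsing =
 fixes N0 :: "real^'n^'n => real" and H0 :: "(real^'n^'n) set"
  and Nt :: "'a => real^'n^'n => real" and K :: "(real^'n^'n) set" and F :: "'a filter" and M :: real
 assumes h0: "hom_metric N0 H0" and ht: "!!t. hom_metric (Nt t) K" and KH: "K <= H0"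
  and cont0: "continuous_on UNIV N0" and contt: "!!t. continuous_on UNIV (Nt t)"
  and lower: "!!ep. ep > 0 ==> \<forall>\<^sub>F t in F. ALL xi:so. N0 xi <= (1 + ep) * Nt t xi"
  and upper: "!!ep. ep > 0 ==> \<forall>\<^sub>F t in F. ALL xi:so. Nt t xi <= N0 xi + ep * norm xi"
  and fibre: "!!ep. ep > 0 ==> \<forall>\<^sub>F t in F. ALL a:SO. ALL h:H0. gdist (Nt t) (coset K a) (coset K (a ** h)) <= ep"
  and bound0: "!!X. gen X ==> N0 X <= M" and boundt: "!!t X. gen X ==> Nt t X <= M"
begin

sublocale Z: hom_metric N0 H0 by (rule h0)

abbreviation dt where "dt t a b \<equiv> gdist (Nt t) (coset K a) (coset K b)"

lemma M_nonneg: "M >= 0"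
proof -
 have "gen (0 :: real^'n^'n)" by (simp add: gen_def so_iff tr_simps)
 from bound0[OF this] show ?thesis using Z.N_nonneg[of 0] by linarith
qed

lemma lip: "EX C>0. ALL a:SO. ALL b:SO. Z.d a b <= C * norm (a - b) & (ALL t. dt t a b <= C * norm (a - b))"
proof -
 obtain C where C: "C >= 0" "ALL N H c. hom_metric N (H :: (real^'n^'n) set) --> (ALL X. gen X --> N X <= c) -->
   (ALL a:SO. ALL b:SO. gdist N (coset H a) (coset H b) <= C * c * norm (a - b))"
  using d_lipschitz by blast
 have le: "C * M * x <= (C * M + 1) * x" if "x >= 0" for x using that by (simp add: mult_right_mono)
 have "Z.d a b <= (C * M + 1) * norm (a - b) & (ALL t. dt t a b <= (C * M + 1) * norm (a - b))"
  if "a : SO" "b : SO" for a b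
 proof (intro conjI allI)
  show "Z.d a b <= (C * M + 1) * norm (a - b)"
   by (rule order_trans[OF _ le]) (use C(2) h0 bound0 that in auto)
  show "dt t a b <= (C * M + 1) * norm (a - b)" for t
   by (rule order_trans[OF _ le]) (use C(2) ht boundt that in auto)
 qed
 moreover have "C * M + 1 > 0" using C(1) M_nonneg by (simp add: add_nonneg_pos)
 ultimately show ?thesis by blast
qed

lemma diam: "EX R>0. ALL a:SO. ALL b:SO. ALL t. dt t a b <= R"
proof -
 obtain C where C: "C > 0" "ALL a:SO. ALL b:SO. ALL t. dt t a b <= C * norm (a - b)" using lip by blast
 let ?R = "C * (2 * sqrt (real CARD('n)))"
 have "dt t a b <= ?R" if "a : SO" "b : SO" for a b t
 proof -
  have "norm (a - b) <= 2 * sqrt (real CARD('n))"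
   using norm_triangle_ineq4[of a b] SO_norm[OF that(1)] SO_norm[OF that(2)] by simp
  hence "C * norm (a - b) <= ?R" using C(1) by simp
  thus ?thesis using C(2) that by (meson order_trans)
 qed
 moreover have "?R > 0" using C(1) by simp
 ultimately show ?thesis by blast
qed

text \<open>Every path for \<open>Nt\<close> is also a path for \<open>N0\<close>, longer at most by
  the factor 1 + ep / R. The common diameter bound \<open>R\<close> turns this factor into an
  additive error.\<close>

lemma d_lower: assumes "ep > 0" shows "\<forall>\<^sub>F t in F. ALL a:SO. ALL b:SO. Z.d a b <= dt t a b + ep"
proof -
 obtain R where R: "R > 0" "ALL a:SO. ALL b:SO. ALL t. dt t a b <= R" using diam by blast
 have "ep / R > 0" using assms R by simp
 from lower[OF this] show ?thesis
 proof (rule eventually_mono, intro ballI)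
  fix t and a b :: "real^'n^'n" assume l: "ALL xi:so. N0 xi <= (1 + ep / R) * Nt t xi" and a: "a : SO" and b: "b : SO"
  interpret T: hom_metric "Nt t" K by (rule ht)
  have "Z.d a b <= (1 + ep / R) * dt t a b"
  proof (rule field_le_epsilon)
   fix e :: real assume "e > 0"
   define e' where "e' = e / (1 + ep / R)"
   have pos: "1 + ep / R > 0" using `ep / R > 0` by linarith
   have e': "e' > 0" "(1 + ep / R) * e' = e" using `e > 0` pos by (auto simp: e'_def)
   hence "dt t a b < dt t a b + e'" by simp
   then obtain c r where c: "is_path (Nt t) c r" "c 0 = a" "c 1 : coset K b" "r < dt t a b + e'"
    by (rule T.d_less[OF a b])
   obtain r' where r': "r' <= (1 + ep / R) * r" "is_path N0 c r'"
    using path_dominated[OF c(1) cont0 Z.N_nonneg T.N_nonneg, of "1 + ep / R"] l by blast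
   have "Z.d a b <= r'"
    by (rule Z.d_le[OF r'(2)]) (use c KH Z.coset_refl in "auto simp: coset_def")
   also have "... <= (1 + ep / R) * (dt t a b + e')"
    using r'(1) mult_left_mono[of r "dt t a b + e'" "1 + ep / R"] c(4) pos by linarith
   finally show "Z.d a b <= (1 + ep / R) * dt t a b + e" using e'(2) by (simp only: distrib_left)
  qed
  also have "... <= dt t a b + ep"
   using mult_left_mono[of "dt t a b" R "ep / R"] R a b `ep / R > 0` by (simp add: distrib_right)
  finally show "Z.d a b <= dt t a b + ep" .
 qed
qed

text \<open>On a closed interval with continuous derivative the velocity has a finite integral, so
  the additive error in \<open>upper\<close> can be chosen relative to it.\<close>

lemma piece_closed:
 assumes c: "!!t. t : {u..v} ==> c t : SO" and d: "!!t. t : {u..v} ==> (c has_vector_derivative D t) (at t)"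
  and D: "continuous_on {u..v} D" and uv: "u < v" and so: "!!t. t : {u..v} ==> transpose (c t) ** D t : so"
  and e: "ep > 0"
 shows "\<forall>\<^sub>F t in F. dt t (c u) (c v) <= integral {u..v} (%t. N0 (transpose (c t) ** D t)) + ep"
proof -
 let ?V = "%t. transpose (c t) ** D t"
 have cc: "continuous_on {u..v} c"
  using d by (intro continuous_at_imp_continuous_on ballI) (metis has_vector_derivative_continuous)
 have V: "continuous_on {u..v} ?V"
  by (intro bounded_bilinear.continuous_on[OF bounded_bilinear_matrix] D
   continuous_on_compose2[OF bounded_linear.continuous_on[OF bounded_linear_transpose continuous_on_id] cc]) auto
 have int: "(%t. f (?V t)) integrable_on {u..v}" if "continuous_on UNIV f" for f :: "_ => real"
  by (intro integrable_continuous_real continuous_on_compose2[OF that V]) auto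
 \<comment> \<open>The added 1 keeps the divisor positive for constant curves.\<close>
 define L where "L = integral {u..v} (%t. norm (?V t)) + 1"
 have "continuous_on UNIV (norm :: real^'n^'n => real)" by (intro continuous_intros)
 note intn = int[OF this]
 have L: "L > 0" using integral_nonneg[OF intn] by (simp add: L_def)
 hence "ep / L > 0" using e by simp
 from upper[OF this] show ?thesis
 proof (rule eventually_mono)
  fix t assume up: "ALL xi:so. Nt t xi <= N0 xi + ep / L * norm xi"
  interpret T: hom_metric "Nt t" K by (rule ht)
  have "dt t (c u) (c v) <= integral {u..v} (%s. Nt t (?V s))"
   by (rule T.d_le[OF subpath[OF c d D uv contt T.N_scale]]) (auto simp: T.coset_refl)
  also have "... <= integral {u..v} (%s. N0 (?V s) + ep / L * norm (?V s))"
   by (intro integral_le int contt integrable_add int[OF cont0] integrable_on_mult_right intn) (use up so in auto)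
  also have "... = integral {u..v} (%s. N0 (?V s)) + ep / L * integral {u..v} (%s. norm (?V s))"
   unfolding integral_add[OF int[OF cont0] integrable_on_mult_right[OF intn]] by (simp only: integral_mult_right)
  also have "ep / L * integral {u..v} (%s. norm (?V s)) <= ep / L * L"
   using `ep / L > 0` by (intro mult_left_mono) (auto simp: L_def)
  finally show "dt t (c u) (c v) <= integral {u..v} (%t. N0 (transpose (c t) ** D t)) + ep" using L by simp
 qed
qed

text \<open>Induction on the break points inside the interval. Without break points the derivative
  may still blow up at both ends; short end pieces are cut off and replaced by the Lipschitz bound
  for the distance.\<close>

lemma pieces:
 assumes c: "is_path N0 c r" and "finite S"
  and d: "!!t. t : {u<..<v} - S ==> (c has_vector_derivative D t) (at t)"
  and D: "continuous_on ({u<..<v} - S) D" and uv: "0 <= u" "u <= v" "v <= 1" and e: "ep > 0"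
 shows "\<forall>\<^sub>F t in F. dt t (c u) (c v) <= integral {u..v} (%t. N0 (transpose (c t) ** vector_derivative c (at t))) + ep"
 using assms(2-)
proof (induction S arbitrary: u v ep rule: finite_induct)
 case (insert s S)
 let ?f = "%t. N0 (transpose (c t) ** vector_derivative c (at t))"
 show ?case
 proof (cases "s : {u<..<v}")
  case True
  have 1: "\<forall>\<^sub>F t in F. dt t (c u) (c s) <= integral {u..s} ?f + ep/2"
   by (rule insert.IH[of u s "ep/2"])
    (use True insert.prems insert.hyps in "auto intro: continuous_on_subset[OF insert.prems(2)]")
  have 2: "\<forall>\<^sub>F t in F. dt t (c s) (c v) <= integral {s..v} ?f + ep/2"
   by (rule insert.IH[of s v "ep/2"])
    (use True insert.prems insert.hyps in "auto intro: continuous_on_subset[OF insert.prems(2)]")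
  have "?f integrable_on {0..1}" using c by (auto simp: is_path_def)
  hence "?f integrable_on {u..v}" by (rule integrable_on_subinterval) (use insert.prems in auto)
  hence "integral {u..s} ?f + integral {s..v} ?f = integral {u..v} ?f"
   by (intro Henstock_Kurzweil_Integration.integral_combine) (use True in auto)
  with eventually_conj[OF 1 2] show ?thesis
  proof (elim eventually_mono)
   fix t assume *: "dt t (c u) (c s) <= integral {u..s} ?f + ep/2 & dt t (c s) (c v) <= integral {s..v} ?f + ep/2"
   interpret T: hom_metric "Nt t" K by (rule ht)
   show "dt t (c u) (c v) <= integral {u..v} ?f + ep"
    using * T.d_triangle[of "c u" "c s" "c v"] path_SO[OF c, of u] path_SO[OF c, of s] path_SO[OF c, of v] True insert.prems
     `integral {u..s} ?f + integral {s..v} ?f = integral {u..v} ?f` by auto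
  qed
 next
  case False
  hence "{u<..<v} - insert s S = {u<..<v} - S" by auto
  thus ?thesis using insert.IH[of u v ep] insert.prems by simp
 qed
next
 case empty
 let ?f = "%t. N0 (transpose (c t) ** vector_derivative c (at t))"
 have int: "?f integrable_on {u..v}"
  by (rule integrable_on_subinterval[of _ "{0..1}"]) (use c empty.prems in "auto simp: is_path_def")
 have nn: "integral {u..v} ?f >= 0" by (rule integral_nonneg[OF int]) (rule Z.N_nonneg)
 have cS: "c t : SO" if "t : {u..v}" for t using path_SO[OF c] that empty.prems by auto
 show ?case
 proof (cases "u = v")
  case True
  have "dt t (c u) (c v) = 0" for t
  proof -
   interpret T: hom_metric "Nt t" K by (rule ht)
   show ?thesis using T.d_self[OF cS[of u]] True by simp
  qed
  thus ?thesis using nn empty.prems by simp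
 next
  case False
  hence uv: "u < v" using empty.prems by simp
  obtain C where C: "C > 0" "ALL a:SO. ALL b:SO. ALL t. dt t a b <= C * norm (a - b)" using lip by blast
  have cc: "continuous_on {u..v} c" by (rule continuous_on_subset[OF path_cont[OF c]]) (use empty.prems in auto)
  define et where "et = ep / (3 * C)"
  have et: "et > 0" "C * et = ep / 3" using empty.prems C by (auto simp: et_def)
  obtain de where de: "de > 0" "!!t. t : {u..v} ==> abs (t - u) < de ==> norm (c t - c u) < et"
   using cc[unfolded continuous_on_iff] uv et(1) unfolding dist_norm real_norm_def
   by (metis atLeastAtMost_iff less_imp_le order_refl)
  obtain de' where de': "de' > 0" "!!t. t : {u..v} ==> abs (t - v) < de' ==> norm (c t - c v) < et"
   using cc[unfolded continuous_on_iff] uv et(1) unfolding dist_norm real_norm_def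
   by (metis atLeastAtMost_iff less_imp_le order_refl)
  \<comment> \<open>Smaller than both moduli of continuity, and at most a third of the interval so
    that the middle piece is nondegenerate.\<close>
  define h where "h = min (min de de') (v - u) / 3"
  have h: "h > 0" "h < de" "h < de'" "3 * h <= v - u" using de de' uv by (auto simp: h_def min_def)
  let ?u = "u + h" and ?v = "v - h"
  have sub: "{?u..?v} <= {u<..<v}" "?u < ?v" "?u : {u..v}" "?v : {u..v}" using h by auto
  have d: "(c has_vector_derivative D t) (at t)" if "t : {?u..?v}" for t using empty.prems(1) sub that by auto
  have "\<forall>\<^sub>F t in F. dt t (c ?u) (c ?v) <= integral {?u..?v} (%t. N0 (transpose (c t) ** D t)) + ep/3"
  proof (rule piece_closed)
   show "transpose (c t) ** D t : so" if "t : {?u..?v}" for t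
    by (rule velocity_so[of u v]) (use sub that d cS in auto)
   show "continuous_on {?u..?v} D" by (rule continuous_on_subset[OF empty.prems(2)]) (use sub in auto)
  qed (use d sub cS empty.prems in auto)
  thus ?thesis
  proof (rule eventually_mono)
   fix t assume *: "dt t (c ?u) (c ?v) <= integral {?u..?v} (%t. N0 (transpose (c t) ** D t)) + ep/3"
   interpret T: hom_metric "Nt t" K by (rule ht)
   have "integral {?u..?v} (%t. N0 (transpose (c t) ** D t)) = integral {?u..?v} ?f"
    by (intro Henstock_Kurzweil_Integration.integral_cong) (simp add: vector_derivative_at[OF d])
   also have "... <= integral {u..v} ?f"
    by (intro integral_subset_le int integrable_on_subinterval[OF int]) (use h in "auto simp: Z.N_nonneg")
   finally have 1: "dt t (c ?u) (c ?v) <= integral {u..v} ?f + ep/3" using * by linarith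
   have "norm (c u - c ?u) <= et" "norm (c ?v - c v) <= et"
    using de(2)[of ?u] de'(2)[of ?v] sub h by (auto simp: norm_minus_commute)
   hence "C * norm (c u - c ?u) <= ep/3" "C * norm (c ?v - c v) <= ep/3"
    using et(2) C(1) by (metis mult_left_mono less_imp_le)+
   moreover have "dt t (c u) (c ?u) <= C * norm (c u - c ?u)" "dt t (c ?v) (c v) <= C * norm (c ?v - c v)"
    using C(2) cS sub uv by auto
   moreover have "dt t (c u) (c v) <= dt t (c u) (c ?u) + dt t (c ?u) (c v)" "dt t (c ?u) (c v) <= dt t (c ?u) (c ?v) + dt t (c ?v) (c v)"
    using cS sub uv by (auto intro!: T.d_triangle)
   ultimately show "dt t (c u) (c v) <= integral {u..v} ?f + ep" using 1 by linarith
  qed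
 qed
qed

text \<open>A nearly shortest path on the base, started at \<open>a\<close>, ends at some
  \<open>b ** k\<close> with \<open>k\<close> in \<open>H0\<close>. The remaining way to
  \<open>b\<close> runs inside a fibre and is short.\<close>

lemma d_upper_pointwise:
 assumes a: "a : SO" and b: "b : SO" and e: "ep > 0"
 shows "\<forall>\<^sub>F t in F. dt t a b <= Z.d a b + ep"
proof -
 have "Z.d a b < Z.d a b + ep/3" using e by simp
 then obtain c r where c: "is_path N0 c r" "c 0 = a" "c 1 : coset H0 b" "r < Z.d a b + ep/3"
  by (rule Z.d_less[OF a b])
 obtain k where k: "k : H0" "c 1 = b ** k" using c(3) by (auto simp: coset_def)
 obtain S D where S: "finite S" "!!t. t : {0..1} - S ==> (c has_vector_derivative D t) (at t)"
  "continuous_on ({0..1} - S) D"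
  using path_C1[OF c(1)] by metis
 have "\<forall>\<^sub>F t in F. dt t (c 0) (c 1) <= integral {0..1} (%t. N0 (transpose (c t) ** vector_derivative c (at t))) + ep/3"
  by (rule pieces[OF c(1) S(1), of 0 1 D]) (use S e in "auto intro: continuous_on_subset[OF S(3)]")
 moreover have r: "integral {0..1} (%t. N0 (transpose (c t) ** vector_derivative c (at t))) = r"
  using c(1) by (intro integral_unique) (simp add: is_path_def)
 moreover have "\<forall>\<^sub>F t in F. ALL a:SO. ALL h:H0. dt t a (a ** h) <= ep/3" using e by (intro fibre) simp
 ultimately have "\<forall>\<^sub>F t in F. dt t (c 0) (c 1) <= r + ep/3 & (ALL a:SO. ALL h:H0. dt t a (a ** h) <= ep/3)"
  by (simp add: eventually_conj)
 thus ?thesis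
 proof (rule eventually_mono)
  fix t assume *: "dt t (c 0) (c 1) <= r + ep/3 & (ALL a:SO. ALL h:H0. dt t a (a ** h) <= ep/3)"
  interpret T: hom_metric "Nt t" K by (rule ht)
  have "dt t a b <= dt t a (c 1) + dt t (c 1) b"
   using a b path_SO[OF c(1), of 1] by (intro T.d_triangle) auto
  moreover have "dt t (c 1) b <= ep/3" using * b k T.d_commute by auto
  ultimately show "dt t a b <= Z.d a b + ep" using * c(2,4) by simp
 qed
qed

text \<open>The estimate for two given points uses a path chosen for them, so it is not uniform. A
  finite net repairs this: four displacements to the net and one estimate between net points
  contribute \<open>ep / 5\<close> each.\<close>

lemma d_upper:
 assumes e: "ep > 0" shows "\<forall>\<^sub>F t in F. ALL a:SO. ALL b:SO. dt t a b <= Z.d a b + ep"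
proof -
 obtain C where C: "C > 0" "ALL a:SO. ALL b:SO. Z.d a b <= C * norm (a - b) & (ALL t. dt t a b <= C * norm (a - b))" using lip by blast
 define de where "de = ep / (5 * C)"
 have de: "de > 0" "C * de = ep / 5" using C e by (auto simp: de_def)
 obtain A :: "(real^'n^'n) set" where A: "finite A" "A <= SO" "!!a. a : SO ==> EX x:A. norm (a - x) < de"
  using finite_net_SO[OF de(1)] by metis
 have "\<forall>\<^sub>F t in F. ALL x:A. ALL y:A. dt t x y <= Z.d x y + ep/5"
  using A e by (intro eventually_ball_finite ballI d_upper_pointwise) auto
 thus ?thesis
 proof (rule eventually_mono, intro ballI)
  fix t and a b :: "real^'n^'n" assume *: "ALL x:A. ALL y:A. dt t x y <= Z.d x y + ep/5" and a: "a : SO" and b: "b : SO"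
  interpret T: hom_metric "Nt t" K by (rule ht)
  obtain x y where xy: "x : A" "norm (a - x) < de" "y : A" "norm (b - y) < de" using A(3)[OF a] A(3)[OF b] by blast
  have S: "x : SO" "y : SO" using xy A(2) by auto
  have "C * norm (a - x) <= ep/5" "C * norm (b - y) <= ep/5"
   using xy de(2) C(1) by (metis mult_left_mono less_imp_le)+
  hence "dt t a x <= ep/5" "dt t b y <= ep/5" "Z.d a x <= ep/5" "Z.d b y <= ep/5"
   using C(2) a b S by (meson order_trans)+
  moreover have "dt t a b <= dt t a x + dt t x b" "dt t x b <= dt t x y + dt t y b" "Z.d x y <= Z.d x a + Z.d a y" "Z.d a y <= Z.d a b + Z.d b y"
   using a b S by (auto intro!: T.d_triangle Z.d_triangle)
  moreover have "dt t x y <= Z.d x y + ep/5" using * xy by auto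
  ultimately show "dt t a b <= Z.d a b + ep"
   using T.d_commute[of y b] Z.d_commute[of x a] by linarith
 qed
qed

lemma d_uniform:
 assumes "ep > 0" shows "\<forall>\<^sub>F t in F. ALL a:SO. ALL b:SO. abs (dt t a b - Z.d a b) <= ep"
 using d_upper[OF assms] d_lower[OF assms]
proof eventually_elim
 case (elim t)
 thus ?case by (auto simp: abs_le_iff algebra_simps)
qed

end

section \<open>Einstein metrics\<close>

text \<open>The degrees of \<open>m1\<close>, \<open>m2\<close>, \<open>m3\<close> in this order;
  \<open>wt\<close> gives the metric parameter belonging to each.\<close>

definition Sg :: "(real * real) set" where "Sg = {(-1, -1), (-1, 1), (1, 1)}"

abbreviation Es :: "real * real => 'm::finite mat set" where "Es s \<equiv> Esp (fst s) (snd s)"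
abbreviation Ps :: "real * real => 'm::finite mat => 'm mat" where "Ps s \<equiv> Pr (fst s) (snd s)"

text \<open>The degree of a bracket. Two different degrees in \<open>Sg\<close> multiply to the
  third, and equal ones to \<open>(1, -1)\<close>, the degree of \<open>k_alg\<close>.\<close>

definition mul :: "real * real => real * real => real * real" where
 "mul s t = (fst s * fst t, - (snd s * snd t))"

definition wt :: "real * real => real * real => real" where
 "wt p s = (if fst s = 1 then 1 - fst p - snd p else if snd s = -1 then fst p else snd p)"

definition PM :: "'m::finite mat => 'm mat" where "PM X = (SUM s:Sg. Ps s X)"

lemma Sg_signs: "s : Sg ==> fst s : {1, -1}" "s : Sg ==> snd s : {1, -1}"
 by (auto simp: Sg_def)

lemma finite_Sg [simp]: "finite Sg" by (simp add: Sg_def)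

lemma sum_Sg: "(SUM s:Sg. f s) = f (-1, -1) + (f (-1, 1) + f (1, 1))"
 by (simp add: Sg_def)

lemma mul_Sg: "s : Sg ==> t : Sg ==> s ~= t ==> mul s t : Sg & mul s t ~= s & mul s t ~= t"
 by (auto simp: Sg_def mul_def)

lemma mul_commute: "mul s t = mul t s"
 by (simp add: mul_def mult.commute)

lemma mul_same: "s : Sg ==> mul s s = (1, -1)"
 by (auto simp: Sg_def mul_def)

lemma bracket_Es: "X : Es s ==> Y : Es t ==> bracket X Y : Es (mul s t)"
 using E_bracket[of X "fst s" "snd s" Y "fst t" "snd t"] by (simp add: mul_def)

lemma Ps_in: "s : Sg ==> Ps s X : Es s"
 by (rule Pr_in_E) (rule Sg_signs, assumption)+

lemma Ps_Es: "s : Sg ==> t : Sg ==> X : Es s ==> Ps t X = (if t = s then X else 0)"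
 using Pr_id[of "fst s" "snd s" X] Pr_other[of X "fst s" "snd s" "fst t" "snd t"] Sg_signs[of s] Sg_signs[of t]
 by (auto simp: prod_eq_iff)

lemma PM_Es: assumes "s : Sg" "X : Es s" shows "PM X = X"
proof -
 have "PM X = (SUM t:Sg. if t = s then X else 0)"
  unfolding PM_def by (rule sum.cong) (use Ps_Es[OF assms(1) _ assms(2)] in auto)
 thus ?thesis using assms(1) by simp
qed

lemma PM_k: assumes "X : Esp 1 (-1)" shows "PM X = 0"
 unfolding PM_def
proof (intro sum.neutral ballI)
 fix s assume "s : Sg"
 thus "Ps s X = 0"
  using Pr_other[OF assms, of "fst s" "snd s"] Sg_signs[of s] by (auto simp: Sg_def)
qed

lemma Pk_Es: assumes "s : Sg" "X : Es s" shows "Pr 1 (-1) X = 0"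
 using Pr_other[OF assms(2), of 1 "-1"] Sg_signs[of s] assms(1) by (auto simp: Sg_def)

lemma bracket_Es_PM:
 assumes "X : Es s" "Y : Es t" "s : Sg" "t : Sg"
 shows "PM (bracket X Y) = (if s = t then 0 else bracket X Y)"
  and "Pr 1 (-1) (bracket X Y) = (if s = t then bracket X Y else 0)"
proof -
 note b = bracket_Es[OF assms(1,2)]
 show "PM (bracket X Y) = (if s = t then 0 else bracket X Y)"
  using b PM_k[of "bracket X Y"] PM_Es[of "mul s t" "bracket X Y"] mul_Sg[OF assms(3,4)] mul_same[OF assms(3)] by auto
 show "Pr 1 (-1) (bracket X Y) = (if s = t then bracket X Y else 0)"
  using b Pr_id[of 1 "-1" "bracket X Y"] Pk_Es[of "mul s t" "bracket X Y"] mul_Sg[OF assms(3,4)] mul_same[OF assms(3)] by auto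
qed

lemma PM_linear: "linear (PM :: 'm::finite mat => _)"
 unfolding PM_def by (rule linear_compose_sum) (auto intro: Pr_linear)

lemma PM_selfadj: "PM X \<bullet> Y = X \<bullet> PM Y"
 by (simp add: PM_def inner_sum_left inner_sum_right Pr_selfadj)

lemma Es_sub_so: "X : Es s ==> X : so"
 by (rule E_sub_so)

lemma card_dim: "real CARD('m::finite option * bool) = 2 * real CARD('m option)"
 by (simp add: card_cartesian_product flip: UNIV_Times_UNIV)

lemma k_alg_orth:
 assumes "X : so" shows "(ALL Z:Esp 1 (-1). X \<bullet> Z = 0) \<longleftrightarrow> Pr 1 (-1) X = 0"
proof
 assume "ALL Z:Esp 1 (-1). X \<bullet> Z = 0"
 hence "X \<bullet> Pr 1 (-1) (Pr 1 (-1) X) = 0" using Pr_in_E[of 1 "-1"] by auto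
 hence "Pr 1 (-1) X \<bullet> Pr 1 (-1) X = 0" by (simp add: Pr_selfadj)
 thus "Pr 1 (-1) X = 0" by simp
next
 assume "Pr 1 (-1) X = 0"
 thus "ALL Z:Esp 1 (-1). X \<bullet> Z = 0"
  using Pr_selfadj[of 1 "-1" X] Pr_id[of 1 "-1"] by (metis inner_zero_left insertCI)
qed

context
 fixes l :: nat
 assumes card: "CARD('m::finite option) = l" and l4: "l >= 4"
begin

abbreviation (input) g :: "real * real => 'm mat => 'm mat => real" where "g \<equiv> flag_form"

lemma dim: "real CARD('m) = real l - 1" "real CARD('m option * bool) = 2 * real l"
proof -
 show "real CARD('m) = real l - 1" using card by auto
 thus "real CARD('m option * bool) = 2 * real l" by (simp add: card_dim)
qed

lemma m_sp_iff: "(X :: 'm mat) : m_sp \<longleftrightarrow> X : so & Pr 1 (-1) X = 0"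
proof -
 have "(ALL Z:k_alg. B X Z = 0) \<longleftrightarrow> (ALL Z:Esp 1 (-1). X \<bullet> Z = 0)" if "X : so"
  unfolding k_alg_E using B_so[OF that] E_sub_so l4 by (fastforce simp del: card_prod card_option simp add: dim(2))
 thus ?thesis using k_alg_orth by (auto simp: m_sp_def)
qed

lemma Es_m_sp: "s : Sg ==> (X :: 'm mat) : Es s ==> X : m_sp"
 using Pk_Es[of s X] Es_sub_so[of X s] by (simp add: m_sp_iff)

lemma subspace_m_sp: "subspace (m_sp :: 'm mat set)"
 using linear_0[OF Pr_linear] subspace_so
 by (auto simp: subspace_def m_sp_iff linear_add[OF Pr_linear] linear_scale[OF Pr_linear])

lemma PM_m_sp: "(X :: 'm mat) : m_sp ==> PM X = X"
 using so_decomp[of X] by (simp add: m_sp_iff PM_def sum_Sg add.assoc)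

lemma PM_in: "PM (X :: 'm mat) : m_sp"
 unfolding PM_def by (intro subspace_sum[OF subspace_m_sp] Es_m_sp[OF _ Ps_in])

lemma oproj_m_sp: "oproj (m_sp :: 'm mat set) = PM"
 by (rule oproj_projector[OF subspace_m_sp PM_in PM_m_sp PM_selfadj])

lemma oproj_k_alg: "oproj (k_alg :: 'm mat set) = Pr 1 (-1)"
 unfolding k_alg_E by (rule oproj_E) auto

lemma flag_form_eq: "flag_form p (X :: 'm mat) Y = (2 * real l - 2) * (SUM s:Sg. wt p s * (Ps s X \<bullet> Ps s Y))"
proof -
 have "oproj m1 = (Ps (-1, -1) :: 'm mat => _)" "oproj m2 = (Ps (-1, 1) :: 'm mat => _)" "oproj m3 = (Ps (1, 1) :: 'm mat => _)"
  unfolding m1_E m2_E m3_E by (simp_all add: oproj_E)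
 moreover have "B (Ps s X) (Ps s Y) = (2 * real l - 2) * (Ps s X \<bullet> Ps s Y)" if "s : Sg" for s
  using B_so[OF Es_sub_so[OF Ps_in[OF that]] Es_sub_so[OF Ps_in[OF that]], of X Y] unfolding dim .
 moreover have "(-1, -1) : Sg" "(-1, 1) : Sg" "(1, 1) : Sg" by (simp_all add: Sg_def)
 ultimately show ?thesis
  unfolding flag_form_def
  by (cases p) (simp only: prod.case sum_Sg wt_def, simp add: algebra_simps)
qed

lemma flag_form_add:
 "flag_form p (X + X') (Y :: 'm mat) = flag_form p X Y + flag_form p X' Y"
 "flag_form p (X :: 'm mat) (Y + Y') = flag_form p X Y + flag_form p X Y'"
 "flag_form p (c *R X) (Y :: 'm mat) = c * flag_form p X Y"
 "flag_form p (X :: 'm mat) (c *R Y) = c * flag_form p X Y"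
 unfolding flag_form_eq
 by (simp_all add: linear_add[OF Pr_linear] linear_scale[OF Pr_linear] inner_add_left inner_add_right sum.distrib
   sum_distrib_left algebra_simps)

lemma flag_form_Es: assumes "s : Sg" "(Y :: 'm mat) : Es s"
 shows "flag_form p X Y = (2 * real l - 2) * wt p s * (X \<bullet> Y)" "flag_form p Y X = (2 * real l - 2) * wt p s * (Y \<bullet> X)"
proof -
 have "(SUM t:Sg. wt p t * (Ps t X \<bullet> Ps t Y)) = (SUM t:Sg. if t = s then wt p s * (Ps s X \<bullet> Y) else 0)"
  by (rule sum.cong) (use Ps_Es[OF assms(1) _ assms(2)] in auto)
 also have "Ps s X \<bullet> Y = X \<bullet> Y"
  using Pr_selfadj[of "fst s" "snd s" X Y] Ps_Es[OF assms(1,1,2)] by simp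
 finally show *: "flag_form p X Y = (2 * real l - 2) * wt p s * (X \<bullet> Y)"
  using assms(1) by (simp add: flag_form_eq)
 show "flag_form p Y X = (2 * real l - 2) * wt p s * (Y \<bullet> X)"
  using * by (simp add: flag_form_eq inner_commute)
qed

section \<open>The Levi-Civita connection\<close>

lemma wt_pos: "p : osimplex ==> wt p s > 0"
 by (simp add: wt_def osimplex_def)

text \<open>The defining property of the symmetric part of the Nomizu operator. As a relation it is
  additive in all arguments, so it can be solved summand by summand before the description operator
  in \<open>LC\<close> is evaluated by uniqueness.\<close>

definition is_U :: "real * real => 'm mat => 'm mat => 'm mat => bool" where
 "is_U p X Y W \<longleftrightarrow> W : m_sp & (ALL Z:m_sp. 2 * flag_form p W Z = flag_form p (PM (bracket Z X)) Y + flag_form p X (PM (bracket Z Y)))"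

lemma is_U_unique:
 assumes p: "p : osimplex" and "is_U p X Y W" "is_U p X Y W'"
 shows "W = W'"
proof -
 have W: "W - W' : m_sp" using assms subspace_diff[OF subspace_m_sp] by (auto simp: is_U_def)
 have "2 * flag_form p W (W - W') = 2 * flag_form p W' (W - W')" using assms W by (auto simp: is_U_def)
 moreover have "flag_form p (W - W') (W - W') = flag_form p W (W - W') - flag_form p W' (W - W')"
  using flag_form_add(1)[of p W "- W'"] flag_form_add(3)[of p "-1" W'] by simp
 ultimately have "flag_form p (W - W') (W - W') = 0" by simp
 hence "(SUM s:Sg. wt p s * (Ps s (W - W') \<bullet> Ps s (W - W'))) = 0" using l4 by (simp add: flag_form_eq)
 hence "ALL s:Sg. wt p s * (Ps s (W - W') \<bullet> Ps s (W - W')) = 0"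
  by (subst (asm) sum_nonneg_eq_0_iff) (auto intro!: mult_nonneg_nonneg simp: less_imp_le[OF wt_pos[OF p]])
 hence "ALL s:Sg. Ps s (W - W') = 0" using wt_pos[OF p] by (auto simp: less_imp_neq[symmetric])
 hence "PM (W - W') = 0" by (simp add: PM_def)
 thus ?thesis using PM_m_sp[OF W] by simp
qed

lemma is_U_add: "is_U p X Y W ==> is_U p X' Y W' ==> is_U p (X + X') Y (W + W')"
 "is_U p X Y W ==> is_U p X Y' W' ==> is_U p X (Y + Y') (W + W')"
 unfolding is_U_def
 by (auto simp: subspace_add[OF subspace_m_sp] flag_form_add bracket_linear linear_add[OF PM_linear] algebra_simps)

lemma is_U_0: "is_U p 0 Y 0" "is_U p X 0 0"
proof -
 have z: "flag_form p 0 X = 0" "flag_form p X 0 = 0" for X :: "'m mat"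
  using flag_form_add(3)[of p 0 0 X] flag_form_add(4)[of p X 0 0] by simp_all
 show "is_U p 0 Y 0" "is_U p X 0 0"
  unfolding is_U_def by (simp_all add: z bracket_linear linear_0[OF PM_linear] subspace_0[OF subspace_m_sp])
qed

lemma is_U_sum:
 assumes "finite S" "finite T" "!!s t. s : S ==> t : T ==> is_U p (f s) (h t) (W s t)"
 shows "is_U p (SUM s:S. f s) (SUM t:T. h t) (SUM s:S. SUM t:T. W s t)"
proof -
 have "is_U p (f s) (SUM t:T. h t) (SUM t:T. W s t)" if "s : S" for s
  using assms(2) assms(3)[OF that] by (induction T rule: finite_induct) (auto simp: is_U_0 intro: is_U_add)
 with assms(1) show ?thesis
  by (induction S rule: finite_induct) (auto simp: is_U_0 intro: is_U_add)
qed

text \<open>On summands of degrees s and t the Nomizu operator is this multiple of the bracket: 1/2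
  plus (w_t - w_s) / (2 w_st). For equal degrees the bracket lies in \<open>k_alg\<close>, and the
  operator is 0.\<close>

definition cf :: "real * real => real * real => real * real => real" where
 "cf p s t = (if s = t then 0 else (wt p (mul s t) + wt p t - wt p s) / (2 * wt p (mul s t)))"

text \<open>By invariance of the inner product under brackets, both terms of the defining equation
  are multiples of \<open>bracket X Y \<bullet> Z\<close>. The subtracted half bracket is the skew
  part that \<open>LC\<close> adds again.\<close>

lemma is_U_Es:
 assumes p: "p : osimplex" and s: "s : Sg" "t : Sg" and X: "X : Es s" and Y: "Y : Es t"
 shows "is_U p X Y (cf p s t *R bracket X Y - (1/2) *R PM (bracket X Y))"
proof -
 define W where "W = cf p s t *R bracket X Y - (1/2) *R PM (bracket X Y)"
 define c where "c = (if s = t then 0 else (wt p t - wt p s) / (2 * wt p (mul s t)))"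
 have W: "W = c *R bracket X Y"
 proof (cases "s = t")
  case False
  have "cf p s t - 1/2 = c" using False wt_pos[OF p, of "mul s t"] by (simp add: c_def cf_def field_simps)
  thus ?thesis using False bracket_Es_PM(1)[OF X Y s] by (simp add: W_def flip: scaleR_left_diff_distrib)
 qed (use bracket_Es_PM(1)[OF X Y s] in "simp add: W_def c_def cf_def")
 have Wm: "W : m_sp"
  unfolding W using bracket_Es[OF X Y] mul_Sg[OF s] Es_m_sp[of "mul s t"] subspace_0[OF subspace_m_sp] subspace_scale[OF subspace_m_sp]
  by (cases "s = t") (auto simp: c_def)
 have key: "2 * flag_form p W Z = flag_form p (PM (bracket Z X)) Y + flag_form p X (PM (bracket Z Y))" if Z: "Z : m_sp" for Z
 proof -
  have Zso: "Z : so" using Z by (simp add: m_sp_iff)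
  have "PM (bracket Z X) \<bullet> Y = bracket Z X \<bullet> Y" using PM_selfadj[of "bracket Z X" Y] PM_Es[OF s(2) Y] by simp
  also have "... = bracket X Y \<bullet> Z"
   using inner_bracket[OF Es_sub_so[OF X], of Z Y] by (simp add: bracket_skew[of Z X] inner_commute)
  finally have 1: "flag_form p (PM (bracket Z X)) Y = (2 * real l - 2) * wt p t * (bracket X Y \<bullet> Z)"
   using flag_form_Es(1)[OF s(2) Y] by simp
  have "X \<bullet> PM (bracket Z Y) = X \<bullet> bracket Z Y" using PM_selfadj[of X "bracket Z Y"] PM_Es[OF s(1) X] by simp
  also have "... = bracket Y X \<bullet> Z"
   using inner_bracket[OF Es_sub_so[OF Y], of X Z] by (simp add: bracket_skew[of Z Y])
  also have "... = - (bracket X Y \<bullet> Z)" by (simp add: bracket_skew[of Y X])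
  finally have 2: "flag_form p X (PM (bracket Z Y)) = - (2 * real l - 2) * wt p s * (bracket X Y \<bullet> Z)"
   using flag_form_Es(2)[OF s(1) X, of p "PM (bracket Z Y)"] by (simp add: algebra_simps)
  show ?thesis
  proof (cases "s = t")
   case True
   hence "flag_form p W Z = 0" using flag_form_add(3)[of p 0 "bracket X Y" Z] by (simp add: W c_def)
   thus ?thesis unfolding 1 2 using True by (simp add: algebra_simps)
  next
   case False
   have "flag_form p W Z = c * ((2 * real l - 2) * wt p (mul s t) * (bracket X Y \<bullet> Z))"
    using flag_form_Es(2)[OF _ bracket_Es[OF X Y]] mul_Sg[OF s False] by (simp add: W flag_form_add)
   moreover have "c * wt p (mul s t) = (wt p t - wt p s) / 2" using False wt_pos[OF p, of "mul s t"] by (simp add: c_def)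
   ultimately have "2 * flag_form p W Z = (2 * real l - 2) * (bracket X Y \<bullet> Z) * (wt p t - wt p s)" by simp
   thus ?thesis unfolding 1 2 by (simp add: algebra_simps)
  qed
 qed
 show ?thesis unfolding is_U_def W_def[symmetric] using Wm key by blast
qed

definition Lam :: "real * real => 'm mat => 'm mat => 'm mat" where
 "Lam p X Y = (SUM s:Sg. SUM t:Sg. cf p s t *R bracket (Ps s X) (Ps t Y))"

lemma Lam_linear: "linear (%X. Lam p X Y)" "linear (%Y. Lam p X Y)"
 unfolding Lam_def
 by (rule linearI; simp add: linear_add[OF Pr_linear] linear_scale[OF Pr_linear] bracket_linear sum.distrib
   scaleR_sum_right scaleR_add_right mult.commute)+

lemma Lam_Es: assumes "s : Sg" "t : Sg" "X : Es s" "Y : Es t" shows "Lam p X Y = cf p s t *R bracket X Y"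
proof -
 have "Lam p X Y = (SUM s':Sg. SUM t':Sg. if t' = t then if s' = s then cf p s t *R bracket X Y else 0 else 0)"
  unfolding Lam_def
  by (intro sum.cong refl) (simp add: Ps_Es[OF assms(1) _ assms(3)] Ps_Es[OF assms(2) _ assms(4)] bracket_linear)
 thus ?thesis using assms(1,2) by simp
qed

lemma LC_eq:
 assumes p: "p : osimplex" and X: "X : m_sp" and Y: "Y : m_sp"
 shows "LC (flag_form p) X Y = Lam p X Y"
proof -
 let ?W = "SUM s:Sg. SUM t:Sg. cf p s t *R bracket (Ps s X) (Ps t Y) - (1/2) *R PM (bracket (Ps s X) (Ps t Y))"
 have "is_U p (SUM s:Sg. Ps s X) (SUM t:Sg. Ps t Y) ?W"
  by (intro is_U_sum is_U_Es[OF p] Ps_in) simp_all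
 hence U: "is_U p X Y ?W" using PM_m_sp[OF X] PM_m_sp[OF Y] by (simp add: PM_def)
 have "(THE W. W : m_sp & (ALL Z:m_sp. 2 * flag_form p W Z = flag_form p (oproj m_sp (bracket Z X)) Y + flag_form p X (oproj m_sp (bracket Z Y)))) = ?W"
  unfolding oproj_m_sp is_U_def[symmetric] by (rule the_equality, rule U, rule is_U_unique[OF p _ U])
 moreover have "PM (bracket X Y) = (SUM s:Sg. SUM t:Sg. PM (bracket (Ps s X) (Ps t Y)))"
 proof -
  have "bracket (SUM s:S. f s) V = (SUM s:S. bracket (f s) V)" "bracket V (SUM s:S. f s) = (SUM s:S. bracket V (f s))"
   if "finite S" for S :: "(real * real) set" and f and V :: "'m mat"
   using that by (induction S rule: finite_induct) (auto simp: bracket_linear)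
  note sums = this
  have "bracket (PM X) (PM Y) = (SUM s:Sg. SUM t:Sg. bracket (Ps s X) (Ps t Y))"
   unfolding PM_def sums(1)[OF finite_Sg] by (simp add: sums(2))
  thus ?thesis using PM_m_sp[OF X] PM_m_sp[OF Y] by (simp add: linear_sum[OF PM_linear])
 qed
 ultimately show ?thesis
  unfolding LC_def oproj_m_sp Lam_def
  by (simp add: sum_subtractf scaleR_sum_right)
qed

lemma Lam_m_sp: "Lam p X Y : m_sp"
proof -
 have "cf p s t *R bracket (Ps s X) (Ps t Y) : m_sp" if "s : Sg" "t : Sg" for s t
  using bracket_Es[OF Ps_in[OF that(1)] Ps_in[OF that(2)], of X Y] mul_Sg[OF that] Es_m_sp[of "mul s t"]
   subspace_0[OF subspace_m_sp] subspace_scale[OF subspace_m_sp]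
  by (cases "s = t") (auto simp: cf_def)
 thus ?thesis unfolding Lam_def by (intro subspace_sum[OF subspace_m_sp]) auto
qed

section \<open>Curvature and the Ricci form\<close>

definition curvL :: "real * real => 'm mat => 'm mat => 'm mat => 'm mat" where
 "curvL p X Y Z = Lam p X (Lam p Y Z) - Lam p Y (Lam p X Z) - Lam p (PM (bracket X Y)) Z
   - bracket (Pr 1 (-1) (bracket X Y)) Z"

lemma curv_eq:
 assumes "p : osimplex" "X : m_sp" "Y : m_sp" "Z : m_sp"
 shows "curv (flag_form p) X Y Z = curvL p X Y Z"
 unfolding curv_def curvL_def oproj_m_sp oproj_k_alg using assms by (simp add: LC_eq Lam_m_sp PM_in)

lemma curvL_linear: "linear (%X. curvL p X Y Z)" "linear (%Y. curvL p X Y Z)" "linear (%Z. curvL p X Y Z)"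
 unfolding curvL_def
 by (rule linearI; simp add: linear_add[OF Lam_linear(1)] linear_scale[OF Lam_linear(1)] linear_add[OF Lam_linear(2)]
   linear_scale[OF Lam_linear(2)] linear_add[OF PM_linear] linear_scale[OF PM_linear] linear_add[OF Pr_linear]
   linear_scale[OF Pr_linear] bracket_linear algebra_simps)+

lemma tr_op_sum: "finite S ==> tr_op (%b. SUM s:S. f s b) = (SUM s:S. tr_op (f s))"
 by (induction S rule: finite_induct) (simp_all add: tr_op_zero tr_op_add)

lemma ricci_eq:
 assumes "p : osimplex" "Y : m_sp" "Z : m_sp"
 shows "ricci (flag_form p) Y Z = (SUM s:Sg. tr_op (%b. curvL p (Ps s b) Y Z))"
proof -
 have "ricci (flag_form p) Y Z = tr_op (%b. curvL p (PM b) Y Z)"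
  unfolding ricci_def trace_on_def tr_op_def oproj_m_sp using assms by (simp add: curv_eq PM_in)
 also have "... = tr_op (%b. SUM s:Sg. curvL p (Ps s b) Y Z)"
  unfolding PM_def by (simp add: linear_sum[OF curvL_linear(1)])
 finally show ?thesis by (simp add: tr_op_sum)
qed

lemma Es_linear: "0 : Es s" "X : Es s ==> c *R X : Es s" "X : Es s ==> Y : Es s ==> X - Y : Es s"
 by (rule subspace_0[OF subspace_E] subspace_scale[OF subspace_E] subspace_diff[OF subspace_E]; assumption)+

lemma Lam_degree:
 assumes "s : Sg" "t : Sg" "X : Es s" "Y : Es t" shows "Lam p X Y : Es (mul s t)"
 unfolding Lam_Es[OF assms] using bracket_Es[OF assms(3,4)] by (rule Es_linear)

text \<open>The degree of an intermediate result may be that of \<open>k_alg\<close> and thus lie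
  outside \<open>Sg\<close>; by \<open>Lam_Sg_or_zero\<close> that result is then 0, because
  \<open>cf\<close> vanishes for equal degrees.\<close>

lemma Lam_degree':
 assumes "s : Sg" "X : Es s" "Y : Es t" "t : Sg | Y = 0" shows "Lam p X Y : Es (mul s t)" "Lam p Y X : Es (mul t s)"
 using assms Lam_degree[of s t X Y p] Lam_degree[of t s Y X p] Es_linear(1) linear_0[OF Lam_linear(1)] linear_0[OF Lam_linear(2)]
 by (cases "t : Sg"; auto)+

lemma Lam_Sg_or_zero:
 assumes "s : Sg" "t : Sg" "X : Es s" "Y : Es t" shows "mul s t : Sg | Lam p X Y = 0"
 using Lam_Es[OF assms] mul_Sg[OF assms(1,2)] by (cases "s = t") (auto simp: cf_def)

lemma mul_assoc: "mul (mul s t) u = mul s (mul t u)"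
 by (simp add: mul_def)

lemma curvL_degree:
 assumes "s : Sg" "i : Sg" "j : Sg" "X : Es s" "Y : Es i" "Z : Es j"
 shows "curvL p X Y Z : Es (mul s (mul i j))"
proof -
 have 1: "Lam p X (Lam p Y Z) : Es (mul s (mul i j))"
  by (rule Lam_degree'(1)[OF assms(1,4) Lam_degree[OF assms(2,3,5,6)] Lam_Sg_or_zero[OF assms(2,3,5,6)]])
 have "Lam p Y (Lam p X Z) : Es (mul i (mul s j))"
  by (rule Lam_degree'(1)[OF assms(2,5) Lam_degree[OF assms(1,3,4,6)] Lam_Sg_or_zero[OF assms(1,3,4,6)]])
 hence 2: "Lam p Y (Lam p X Z) : Es (mul s (mul i j))"
  by (metis mul_assoc mul_commute)
 have b: "bracket X Y : Es (mul s i)" by (rule bracket_Es[OF assms(4,5)])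
 have "PM (bracket X Y) : Es (mul s i)" "mul s i : Sg | PM (bracket X Y) = 0"
  unfolding bracket_Es_PM(1)[OF assms(4,5,1,2)] using b Es_linear(1) mul_Sg[OF assms(1,2)] by auto
 from Lam_degree'(2)[OF assms(3,6) this] have 3: "Lam p (PM (bracket X Y)) Z : Es (mul s (mul i j))"
  by (simp add: mul_assoc)
 have "Pr 1 (-1) (bracket X Y) : Es (mul s i)"
  unfolding bracket_Es_PM(2)[OF assms(4,5,1,2)] using b Es_linear(1) by auto
 from bracket_Es[OF this assms(6)] have 4: "bracket (Pr 1 (-1) (bracket X Y)) Z : Es (mul s (mul i j))"
  by (simp add: mul_assoc)
 show ?thesis unfolding curvL_def by (intro Es_linear(3) 1 2 3 4)
qed

text \<open>The map b \<mapsto> R(b, Y) Z shifts degrees by the product of those of \<open>Y\<close>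
  and \<open>Z\<close>. For different degrees this is a genuine shift, so each partial trace
  vanishes by cyclicity.\<close>

lemma ricci_mixed:
 assumes p: "p : osimplex" and ij: "i : Sg" "j : Sg" "i ~= j" and Y: "(Y :: 'm mat) : Es i" and Z: "Z : Es j"
 shows "ricci (flag_form p) Y Z = 0"
proof -
 have "tr_op (%b. curvL p (Ps s b) Y Z) = 0" if s: "s : Sg" for s
 proof -
  let ?u = "mul s (mul i j)"
  have u: "?u ~= s" "fst ?u : {1, -1}" "snd ?u : {1, -1}"
   using s ij by (auto simp: Sg_def mul_def)
  have id: "curvL p (Ps s b) Y Z = Ps ?u (curvL p (Ps s b) Y Z)" for b
   by (rule Pr_id[symmetric, OF u(2,3) curvL_degree[OF s ij(1,2) Ps_in[OF s] Y Z]])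
  have "linear (%b. curvL p (Ps s b) Y Z)"
   using linear_compose[OF Pr_linear curvL_linear(1)] by (simp add: o_def)
  hence "tr_op (%b. Ps ?u (curvL p (Ps s b) Y Z)) = tr_op (%b. curvL p (Ps s (Ps ?u b)) Y Z)"
   by (intro tr_op_comp_commute Pr_linear)
  moreover have "Ps s (Ps ?u b) = 0" for b :: "'m mat"
   by (rule Pr_other[OF Pr_in_E[OF u(2,3)]]) (use u Sg_signs[OF s] in "auto simp: prod_eq_iff")
  ultimately have "tr_op (%b. Ps ?u (curvL p (Ps s b) Y Z)) = 0"
   by (simp add: linear_0[OF curvL_linear(1)] tr_op_zero)
  thus ?thesis by (simp flip: id)
 qed
 thus ?thesis using ricci_eq[OF p Es_m_sp[OF ij(1) Y] Es_m_sp[OF ij(2) Z]] by simp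
qed

definition tau :: "real * real => 'm mat => 'm mat => real" where
 "tau s Y Z = tr_op (%b. bracket Y (bracket Z (Ps s b)))"

text \<open>The four terms of the projection each give a product of traces, from \<open>b\<close>,
  and an inner product, from its transpose.\<close>

lemma trace_sandwich_Pr:
 "8 * tr_op (%b. U ** Pr a c b ** (W :: 'm mat)) =
   (trace U * trace W - U \<bullet> W)
   + a * (trace (U ** Dmat) * trace (Dmat ** W) - (U ** Dmat) \<bullet> (Dmat ** W))
   + c * (trace (U ** Jmat) * trace (Jmat ** W) - (U ** Jmat) \<bullet> (Jmat ** W))
   + a * c * (trace (U ** Jmat ** Dmat) * trace (Dmat ** Jmat ** W) - (U ** Jmat ** Dmat) \<bullet> (Dmat ** Jmat ** W))"
proof -
 have "U ** Pr a c b ** W = (1/8) *R ((U ** b ** W - U ** transpose b ** W)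
   + a *R ((U ** Dmat) ** b ** (Dmat ** W) - (U ** Dmat) ** transpose b ** (Dmat ** W))
   + c *R ((U ** Jmat) ** b ** (Jmat ** W) - (U ** Jmat) ** transpose b ** (Jmat ** W))
   + (a * c) *R ((U ** Jmat ** Dmat) ** b ** (Dmat ** Jmat ** W) - (U ** Jmat ** Dmat) ** transpose b ** (Dmat ** Jmat ** W)))" for b
  by (simp add: Pr_def mat_lin mat_assoc)
 thus ?thesis
  by (simp only: tr_op_add tr_op_diff tr_op_scaleR tr_op_sandwich tr_op_sandwich_transpose) simp
qed

lemma Es_traces:
 assumes i: "i : Sg" and Y: "(Y :: 'm mat) : Es i"
 shows "trace Y = 0" "trace (Y ** Dmat) = 0" "trace (Dmat ** Y) = 0" "trace (Y ** Jmat) = 0" "trace (Jmat ** Y) = 0"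
  "trace (Y ** Jmat ** Dmat) = 0" "trace (Dmat ** Jmat ** Y) = 0"
proof -
 have Y': "transpose Y = - Y" "Dmat ** Y ** Dmat = fst i *R Y" "Jmat ** Y ** Jmat = snd i *R Y"
  using Y by (auto simp: Esp_def so_iff)
 show "trace Y = 0" using trace_skew Es_sub_so[OF Y] by blast
 show D: "trace (Y ** Dmat) = 0"
  using trace_transpose[of "Y ** Dmat"] trace_mul_sym[of Y Dmat]
  by (simp add: tr_simps tr_Dmat Y' mat_lin trace_neg)
 thus "trace (Dmat ** Y) = 0" using trace_mul_sym[of Dmat Y] by simp
 \<comment> \<open>\<open>W\<close> has the degree of \<open>k_alg\<close> and \<open>Y\<close> does
   not. Cyclicity under the two conjugations therefore shows, for at least one of them, that the
   trace equals its own negative.\<close>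
 have z: "trace (Y ** W) = 0" if W: "Dmat ** W ** Dmat = W" "Jmat ** W ** Jmat = - W" for W
 proof -
  have "fst i * trace (Y ** W) = trace (Dmat ** Y ** Dmat ** W)" by (simp add: Y' mat_lin trace_scaleR)
  also have "... = trace (Dmat ** (Y ** Dmat ** W))" by (simp add: mat_assoc)
  also have "... = trace ((Y ** Dmat ** W) ** Dmat)" by (rule trace_mul_sym)
  also have "... = trace (Y ** (Dmat ** W ** Dmat))" by (simp add: mat_assoc)
  finally have 1: "fst i * trace (Y ** W) = trace (Y ** W)" by (simp add: W)
  have "snd i * trace (Y ** W) = trace (Jmat ** Y ** Jmat ** W)" by (simp add: Y' mat_lin trace_scaleR)
  also have "... = trace (Jmat ** (Y ** Jmat ** W))" by (simp add: mat_assoc)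
  also have "... = trace ((Y ** Jmat ** W) ** Jmat)" by (rule trace_mul_sym)
  also have "... = trace (Y ** (Jmat ** W ** Jmat))" by (simp add: mat_assoc)
  finally have "snd i * trace (Y ** W) = - trace (Y ** W)" by (simp add: W mat_lin trace_neg)
  with 1 show ?thesis using i by (auto simp: Sg_def)
 qed
 have YJ: "trace (Y ** Jmat) = 0"
  by (rule z) (simp_all add: mat_assoc DJ_simps mat_lin)
 have YJD: "trace (Y ** (Jmat ** Dmat)) = 0"
  by (rule z) (simp_all add: mat_assoc DJ_simps mat_lin)
 show "trace (Y ** Jmat) = 0" "trace (Y ** Jmat ** Dmat) = 0" using YJ YJD by (simp_all add: mat_assoc)
 show "trace (Jmat ** Y) = 0" using YJ trace_mul_sym[of Jmat Y] by simp
 show "trace (Dmat ** Jmat ** Y) = 0" using YJD trace_mul_sym[of "Jmat ** Dmat" Y] unfolding Dmat_Jmat by simp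
qed

text \<open>A skew matrix on the 2-dimensional first block is a multiple of J there and so commutes
  with J; an element of \<open>m3\<close> anticommutes with J and must vanish on that block.\<close>

lemma m3_Dmat:
 assumes "(X :: 'm mat) : Esp 1 1" shows "X ** Dmat = X"
proof -
 have X: "transpose X = - X" "Dmat ** X ** Dmat = X" "Jmat ** X ** Jmat = X"
  using assms by (auto simp: Esp_def so_iff)
 have skew: "X $ q $ p = - X $ p $ q" for p q
 proof -
  have "transpose X $ p $ q = (- X) $ p $ q" using X(1) by simp
  thus ?thesis by (simp add: transpose_def)
 qed
 have "X $ (None, False) $ (None, True) = (Jmat ** X ** Jmat) $ (None, False) $ (None, True)" using X(3) by simp
 also have "... = X $ (None, True) $ (None, False)" by (simp add: Jmat_right Jmat_left)
 finally have N: "X $ (None, False) $ (None, True) = 0" "X $ (None, True) $ (None, False) = 0"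
  using skew[of "(None, False)" "(None, True)"] by auto
 have "X $ p $ q = 0" if "fst q = None" for p q
 proof (cases "fst p = None")
  case True
  have dg: "X $ r $ r = 0" for r using skew[of r r] by simp
  have "p = (None, snd p)" "q = (None, snd q)" using True that by (metis prod.collapse)+
  thus ?thesis using N dg by (cases "snd p"; cases "snd q") metis+
 next
  case False
  have "X $ p $ q = (Dmat ** X ** Dmat) $ p $ q" using X(2) by simp
  thus ?thesis unfolding Dmat_conj using False that by simp
 qed
 thus ?thesis by (auto simp: vec_eq_iff Dmat_right)
qed

lemma trace_YZD:
 assumes i: "i : Sg" and Y: "(Y :: 'm mat) : Es i" and Z: "Z : Es i"
 shows "trace (Dmat ** (Z ** Y)) = trace (Y ** Z ** Dmat)"
  "trace (Y ** Z ** Dmat) = (if i = (1, 1) then trace (Y ** Z) else 0)"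
proof -
 have t: "transpose Y = - Y" "transpose Z = - Z" using Y Z by (auto simp: Esp_def so_iff)
 have "transpose (Dmat ** (Z ** Y)) = Y ** Z ** Dmat"
  by (simp add: tr_simps t tr_Dmat mat_lin)
 thus e: "trace (Dmat ** (Z ** Y)) = trace (Y ** Z ** Dmat)" by (metis trace_transpose)
 show "trace (Y ** Z ** Dmat) = (if i = (1, 1) then trace (Y ** Z) else 0)"
 proof (cases "i = (1, 1)")
  case True
  hence "Y ** Z ** Dmat = Y ** Z" using m3_Dmat[of Z] Z by (simp flip: mat_assoc)
  thus ?thesis using True by simp
 next
  case False
  hence "Dmat ** Z ** Dmat = - Z" using Z i by (auto simp: Esp_def Sg_def)
  hence "Dmat ** (Dmat ** Z ** Dmat) = - (Dmat ** Z)" by (simp add: mat_lin)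
  hence ZD: "Z ** Dmat = - (Dmat ** Z)" by (simp add: mat_assoc DJ_simps)
  have "trace (Y ** Z ** Dmat) = - trace ((Y ** Dmat) ** Z)"
   by (simp add: ZD mat_lin trace_neg flip: mat_assoc)
  also have "trace ((Y ** Dmat) ** Z) = trace ((Z ** Y) ** Dmat)" by (subst trace_mul_sym) (simp add: mat_assoc)
  also have "... = trace (Dmat ** (Z ** Y))" by (rule trace_mul_sym)
  finally show ?thesis using e False by simp
 qed
qed

text \<open>The coefficient of the partial Killing form of the summand of degree s, evaluated on
  degree i. The term with \<open>2 * real l - 4\<close> is the trace of \<open>Dmat\<close>; it is
  felt only by \<open>m3\<close>, where \<open>Dmat\<close> acts trivially.\<close>

definition tcf :: "real * real => real * real => real" where
 "tcf s i = ((2 * real l - 1 - fst s - snd s - fst s * snd s) - (1 + fst s * fst i) * (1 - snd s * snd i)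
   + (if i = (1, 1) then fst s * (2 * real l - 4) else 0)) / 4"

lemma tau_eq:
 assumes i: "i : Sg" and Y: "(Y :: 'm mat) : Es i" and Z: "Z : Es i"
 shows "tau s Y Z = - tcf s i * (Y \<bullet> Z)"
proof -
 define a c t where "a = fst s" and "c = snd s" and "t = trace (Y ** Z)"
 define n d where "n = 2 * real l" and "d = trace (Y ** Z ** Dmat)"
 note trY = Es_traces[OF i Y] and trZ = Es_traces[OF i Z]
 have Z': "Dmat ** Z ** Dmat = fst i *R Z" "Jmat ** Z ** Jmat = snd i *R Z" using Z by (auto simp: Esp_def)
 have Y': "Dmat ** Y ** Dmat = fst i *R Y" "Jmat ** Y ** Jmat = snd i *R Y" using Y by (auto simp: Esp_def)
 have YZ: "Y \<bullet> Z = - t" "Z \<bullet> Y = - t" using inner_so[OF Es_sub_so[OF Y], of Z] by (simp_all add: t_def inner_commute)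
 have tZ: "transpose Z = - Z" using Z by (simp add: Esp_def so_iff)
 have ZY: "trace (Z ** Y) = t" unfolding t_def by (rule trace_mul_sym)
 have tr1: "trace (mat 1 :: 'm mat) = n" using dim(2) by (simp only: trace_I n_def)
 have trD: "trace (Dmat :: 'm mat) = n - 4" using dim(2) by (simp only: trace_Dmat n_def)
 have right: "(U ** W) \<bullet> V = U \<bullet> (V ** transpose W)" for U V W :: "'m mat" by (rule inner_matrix_right)
 have left: "V \<bullet> (W ** U) = (transpose W ** V) \<bullet> U" for U V W :: "'m mat"
  using inner_matrix_left[of W U V] by (simp add: inner_commute)
 have 1: "8 * tr_op (%b. (Y ** Z) ** Pr a c b ** mat 1) = n * t - t + a * (d * (n - 4) - t) - c * t - a * c * t"
  unfolding trace_sandwich_Pr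
  by (simp add: tr1 trD trace_Jmat trace_Dmat_Jmat right tr_simps tr_Dmat tr_Jmat
    mat_lin mat_assoc DJ_simps inner_mat1)
    (simp add: t_def d_def algebra_simps)
 have 2: "8 * tr_op (%b. mat 1 ** Pr a c b ** (Z ** Y)) = n * t - t + a * (d * (n - 4) - t) - c * t - a * c * t"
 proof -
  have "Dmat \<bullet> (Dmat ** (Z ** Y)) = t" "Jmat \<bullet> (Jmat ** (Z ** Y)) = t"
   "(Jmat ** Dmat) \<bullet> (Dmat ** Jmat ** (Z ** Y)) = t"
   unfolding left
   by (simp_all add: tr_simps tr_Dmat tr_Jmat mat_lin mat_assoc DJ_simps inner_mat1 ZY tZ YZ)
  thus ?thesis
   unfolding trace_sandwich_Pr
   by (simp add: tr1 trD trace_Jmat trace_Dmat_Jmat inner_mat1 ZY trace_YZD(1)[OF i Y Z] flip: d_def)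
 qed
 have 3: "8 * tr_op (%b. U ** Pr a c b ** V) = t + a * fst i * t - c * snd i * t - a * c * fst i * snd i * t"
  if U: "U : Es i" and V: "V : Es i" and UV: "U \<bullet> V = - t" for U V :: "'m mat"
 proof -
  have V': "Dmat ** V ** Dmat = fst i *R V" "Jmat ** V ** Jmat = snd i *R V" using V by (auto simp: Esp_def)
  have "(U ** Dmat) \<bullet> (Dmat ** V) = - fst i * t"
   by (simp add: right tr_Dmat V' UV)
  moreover have "(U ** Jmat) \<bullet> (Jmat ** V) = snd i * t"
   by (simp add: right tr_Jmat V' UV mat_lin)
  moreover have "(U ** Jmat ** Dmat) \<bullet> (Dmat ** Jmat ** V) = fst i * snd i * t"
  proof -
   have "Dmat ** Jmat ** V ** Dmat ** Jmat = Jmat ** (Dmat ** V ** Dmat) ** Jmat"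
    by (simp add: mat_assoc DJ_simps)
   thus ?thesis
    by (simp add: right tr_Jmat tr_Dmat V' UV mat_lin mat_assoc)
  qed
  ultimately show ?thesis
   unfolding trace_sandwich_Pr using Es_traces[OF i U] Es_traces[OF i V] UV by (simp add: algebra_simps)
 qed
 have "tau s Y Z = tr_op (%b. (Y ** Z) ** Pr a c b ** mat 1) - tr_op (%b. Y ** Pr a c b ** Z)
   - tr_op (%b. Z ** Pr a c b ** Y) + tr_op (%b. mat 1 ** Pr a c b ** (Z ** Y))"
  unfolding tau_def tr_op_add[symmetric] tr_op_diff[symmetric] a_def c_def
  by (simp add: bracket_def mat_lin mat_assoc algebra_simps)
 hence "8 * tau s Y Z = 2 * (n * t - t + a * (d * (n - 4) - t) - c * t - a * c * t)
   - 2 * (t + a * fst i * t - c * snd i * t - a * c * fst i * snd i * t)"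
  using 1 2 3[OF Y Z YZ(1)] 3[OF Z Y YZ(2)] by simp
 moreover have "d = (if i = (1, 1) then t else 0)" unfolding d_def t_def by (rule trace_YZD(2)[OF i Y Z])
 ultimately show ?thesis
  unfolding YZ tcf_def n_def a_def[symmetric] c_def[symmetric] by (auto simp: field_simps)
qed

definition rho :: "real * real => real * real => real" where
 "rho p i = tcf i i - (SUM s:Sg - {i}. (cf p i (mul s i) * cf p s i - cf p (mul s i) i) * tcf s i)"

text \<open>For s = i only the isotropy term of the curvature survives; for s different from i the
  terms that survive are the composition of two Nomizu operators and the operator of the bracket.
  All are multiples of ad Y ad Z or ad Z ad Y, which have equal traces over the summand.\<close>

lemma ricci_same:
 assumes p: "p : osimplex" and i: "i : Sg" and Y: "(Y :: 'm mat) : Es i" and Z: "Z : Es i"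
 shows "ricci (flag_form p) Y Z = rho p i * (Y \<bullet> Z)"
proof -
 have sym: "tau s Z Y = tau s Y Z" for s using tau_eq[OF i Y Z] tau_eq[OF i Z Y] by (simp add: inner_commute)
 have "tr_op (%b. curvL p (Ps i b) Y Z) = - tau i Y Z"
 proof -
  have "curvL p (Ps i b) Y Z = - bracket Z (bracket Y (Ps i b))" for b
  proof -
   note b = Ps_in[OF i, of b]
   have "Lam p Y Z = 0" "Lam p (Ps i b) Z = 0" using Lam_Es[OF i i Y Z] Lam_Es[OF i i b Z] by (simp_all add: cf_def)
   thus ?thesis
    unfolding curvL_def bracket_Es_PM[OF b Y i i]
    using bracket_skew[of "bracket (Ps i b) Y" Z] bracket_skew[of "Ps i b" Y]
    by (simp add: linear_0[OF Lam_linear(1)] linear_0[OF Lam_linear(2)] bracket_linear)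
  qed
  thus ?thesis using sym[of i] by (simp add: tau_def tr_op_minus)
 qed
 moreover have "tr_op (%b. curvL p (Ps s b) Y Z) = (cf p i (mul s i) * cf p s i - cf p (mul s i) i) * tau s Y Z"
  if s: "s : Sg" "s ~= i" for s
 proof -
  note r = mul_Sg[OF s(1) i s(2)]
  have "curvL p (Ps s b) Y Z = (cf p i (mul s i) * cf p s i) *R bracket Y (bracket Z (Ps s b))
    - cf p (mul s i) i *R bracket Z (bracket Y (Ps s b))" for b
  proof -
   note b = Ps_in[OF s(1), of b]
   have bY: "bracket (Ps s b) Y : Es (mul s i)" and bZ: "bracket (Ps s b) Z : Es (mul s i)"
    by (rule bracket_Es[OF b Y] bracket_Es[OF b Z])+
   have "Lam p Y Z = 0" using Lam_Es[OF i i Y Z] by (simp add: cf_def)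
   moreover have "Lam p Y (Lam p (Ps s b) Z) = (cf p i (mul s i) * cf p s i) *R bracket Y (bracket (Ps s b) Z)"
    using Lam_Es[OF i _ Y bZ] r by (simp add: Lam_Es[OF s(1) i b Z] linear_scale[OF Lam_linear(2)])
   moreover have "Lam p (bracket (Ps s b) Y) Z = cf p (mul s i) i *R bracket (bracket (Ps s b) Y) Z"
    using Lam_Es[OF _ i bY Z] r by simp
   ultimately show ?thesis
    unfolding curvL_def bracket_Es_PM[OF b Y s(1) i]
    using s(2) bracket_skew[of "Ps s b" Z] bracket_skew[of "bracket (Ps s b) Y" Z] bracket_skew[of "Ps s b" Y]
     bracket_skew[of "bracket Y (Ps s b)" Z]
    by (simp add: linear_0[OF Lam_linear(2)] bracket_linear)
  qed
  hence "tr_op (%b. curvL p (Ps s b) Y Z) = tr_op (%b. (cf p i (mul s i) * cf p s i) *R bracket Y (bracket Z (Ps s b))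
    - cf p (mul s i) i *R bracket Z (bracket Y (Ps s b)))" by presburger
  also have "... = cf p i (mul s i) * cf p s i * tau s Y Z - cf p (mul s i) i * tau s Z Y"
   by (simp only: tr_op_diff tr_op_scaleR tau_def)
  finally show ?thesis using sym[of s] by (simp add: algebra_simps)
 qed
 ultimately have "ricci (flag_form p) Y Z = - tau i Y Z + (SUM s:Sg - {i}. (cf p i (mul s i) * cf p s i - cf p (mul s i) i) * tau s Y Z)"
  unfolding ricci_eq[OF p Es_m_sp[OF i Y] Es_m_sp[OF i Z]] using i by (simp add: sum.remove[of Sg i])
 also have "... = rho p i * (Y \<bullet> Z)"
  unfolding tau_eq[OF i Y Z] rho_def by (simp add: left_diff_distrib mult_ac sum_distrib_left right_diff_distrib flip: sum_negf)
 finally show ?thesis .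
qed

text \<open>\<open>rho\<close> is taken relative to the Euclidean product. Dividing by the weight of
  the summand gives the Ricci eigenvalues, which are \<open>ric1\<close>, its mirror image and
  \<open>ric3\<close> over x y z up to a common factor.\<close>

lemma rho_values:
 assumes p: "(x, y) : osimplex" and z: "z = 1 - x - y"
 shows "rho (x, y) (-1, -1) = ric1 l x y z / (y * z)" "rho (x, y) (-1, 1) = ric1 l y x z / (x * z)"
  "rho (x, y) (1, 1) = ric3 l x y z / (x * y)"
proof -
 have pos: "x > 0" "y > 0" "z > 0" using p by (auto simp: osimplex_def z)
 have S: "Sg - {(-1, -1)} = {(-1, 1), (1, 1)}" "Sg - {(-1, 1)} = {(-1, -1), (1, 1)}" "Sg - {(1, 1)} = {(-1, -1), (-1, 1)}"
  by (auto simp: Sg_def)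
 have w: "wt (x, y) (-1, -1) = x" "wt (x, y) (-1, 1) = y" "wt (x, y) (1, 1) = z" by (simp_all add: wt_def z)
 have m: "mul (-1, 1) (-1, -1) = (1, 1)" "mul (1, 1) (-1, -1) = (-1, 1)" "mul (-1, -1) (-1, 1) = (1, 1)"
  "mul (1, 1) (-1, 1) = (-1, -1)" "mul (-1, -1) (1, 1) = (-1, 1)" "mul (-1, 1) (1, 1) = (-1, -1)"
  by (simp_all add: mul_def)
 show "rho (x, y) (-1, -1) = ric1 l x y z / (y * z)"
  unfolding rho_def S using pos
  by (simp add: cf_def m w tcf_def ric1_def) (simp add: field_simps power2_eq_square)
 show "rho (x, y) (-1, 1) = ric1 l y x z / (x * z)"
  unfolding rho_def S using pos
  by (simp add: cf_def m w tcf_def ric1_def) (simp add: field_simps power2_eq_square)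
 show "rho (x, y) (1, 1) = ric3 l x y z / (x * y)"
  unfolding rho_def S using pos
  by (simp add: cf_def m w tcf_def ric3_def) (simp add: field_simps power2_eq_square)
qed

lemma ricci_bilinear:
 assumes p: "p : osimplex" and Y: "(Y :: 'm mat) : m_sp" and Z: "Z : m_sp"
 shows "ricci (flag_form p) Y Z = (SUM i:Sg. rho p i * (Ps i Y \<bullet> Ps i Z))"
proof -
 define f where "f Y Z = (SUM s:Sg. tr_op (%b. curvL p (Ps s b) Y Z))" for Y Z
 have f: "f Y Z = ricci (flag_form p) Y Z" if "Y : m_sp" "Z : m_sp" for Y Z
  using ricci_eq[OF p that] by (simp add: f_def)
 have l1: "f (SUM s:Sg. u s) Z = (SUM s:Sg. f (u s) Z)" for u Z
  unfolding f_def by (simp add: linear_sum[OF curvL_linear(2)] tr_op_sum) (rule sum.swap)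
 have l2: "f Y (SUM s:Sg. u s) = (SUM s:Sg. f Y (u s))" for u Y
  unfolding f_def by (simp add: linear_sum[OF curvL_linear(3)] tr_op_sum) (rule sum.swap)
 have "f Y Z = f (SUM s:Sg. Ps s Y) (SUM s:Sg. Ps s Z)" using PM_m_sp[OF Y] PM_m_sp[OF Z] by (simp add: PM_def)
 also have "... = (SUM i:Sg. SUM j:Sg. f (Ps i Y) (Ps j Z))" unfolding l1 by (simp add: l2)
 also have "... = (SUM i:Sg. SUM j:Sg. if j = i then rho p i * (Ps i Y \<bullet> Ps i Z) else 0)"
 proof (intro sum.cong refl)
  fix i j assume ij: "i : Sg" "j : Sg"
  have "f (Ps i Y) (Ps j Z) = ricci (flag_form p) (Ps i Y) (Ps j Z)"
   by (rule f) (use ij in "auto intro: Es_m_sp Ps_in")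
  thus "f (Ps i Y) (Ps j Z) = (if j = i then rho p i * (Ps i Y \<bullet> Ps i Z) else 0)"
   using ricci_same[OF p ij(1) Ps_in[OF ij(1)], of "Ps i Z" Y] ricci_mixed[OF p ij _ Ps_in[OF ij(1)] Ps_in[OF ij(2)], of Y Z] Ps_in[OF ij(1)]
   by auto
 qed
 also have "... = (SUM i:Sg. rho p i * (Ps i Y \<bullet> Ps i Z))" by simp
 finally show ?thesis using f[OF Y Z] by simp
qed

lemma two_indices: "EX a b :: 'm. a ~= b"
proof (rule ccontr)
 assume "~ ?thesis"
 hence "card (UNIV :: 'm set) <= 1" by (intro card_le_Suc0_iff_eq[THEN iffD2, unfolded One_nat_def[symmetric]]) auto
 thus False using dim(1) l4 by linarith
qed

lemma Es_nonzero: assumes "i : Sg" shows "EX X :: 'm mat. X : Es i & X ~= 0"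
proof -
 obtain u v :: 'm where uv: "u ~= v" using two_indices by blast
 \<comment> \<open>\<open>m3\<close> lives in the second block, whereas \<open>m1\<close> and
   \<open>m2\<close> join the first block to the second.\<close>
 define q where "q = (if i = (1, 1) then Some u else None)"
 define U :: "'m mat" where "U = axis (q, False) (axis (Some v, False) 1)"
 have mul_JD: "Jmat ** Dmat ** V = Jmat ** (Dmat ** V)" for V :: "'m mat" by (simp add: mat_assoc)
 have qv: "q ~= Some v" using uv by (simp add: q_def)
 have U: "U $ r $ s = (if r = (q, False) & s = (Some v, False) then 1 else 0)" for r s
  by (auto simp: U_def axis_def)
 have UT: "transpose U $ r $ s = (if s = (q, False) & r = (Some v, False) then 1 else 0)" for r s
  by (simp add: transpose_def U)
 have "Ps i U $ (q, False) $ (Some v, False) = (1 + fst i * (if q = None then - 1 else 1)) / 8"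
  unfolding Pr_def using qv
  by (simp add: Dmat_conj Jmat_left Jmat_right Dmat_left Dmat_right Dmat_Jmat_right U UT mul_JD)
 also have "... ~= 0" using assms by (auto simp: q_def Sg_def)
 finally have "Ps i U ~= 0" by auto
 thus ?thesis using Ps_in[OF assms] by blast
qed

theorem einstein_iff:
 assumes p: "p : osimplex"
 shows "einstein (flag_form p :: 'm mat => 'm mat => real) \<longleftrightarrow> p : {ptN l, ptR, ptS l, ptT l}"
proof -
 obtain x y where pxy: "p = (x, y)" by fastforce
 define z where "z = 1 - x - y"
 have pos: "x > 0" "y > 0" "z > 0" using p by (auto simp: osimplex_def z_def pxy)
 have w: "wt p (-1, -1) = x" "wt p (-1, 1) = y" "wt p (1, 1) = z" by (simp_all add: wt_def z_def pxy)
 note rho = rho_values[OF p[unfolded pxy] z_def, folded pxy]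
 have L: "2 * real l - 2 > 0" using l4 by simp
 have sg: "(-1, -1) : Sg" "(-1, 1) : Sg" "(1, 1) : Sg" by (simp_all add: Sg_def)
 show ?thesis
 proof
  assume "einstein (flag_form p :: 'm mat => 'm mat => real)"
  then obtain mu where mu: "!!Y Z :: 'm mat. Y : m_sp ==> Z : m_sp ==> ricci (flag_form p) Y Z = mu * flag_form p Y Z"
   unfolding einstein_def by blast
  have "rho p i = mu * (2 * real l - 2) * wt p i" if i: "i : Sg" for i
  proof -
   obtain X :: "'m mat" where X: "X : Es i" "X ~= 0" using Es_nonzero[OF i] by blast
   have "rho p i * (X \<bullet> X) = mu * ((2 * real l - 2) * wt p i * (X \<bullet> X))"
    using mu[OF Es_m_sp[OF i X(1)] Es_m_sp[OF i X(1)]] ricci_same[OF p i X(1) X(1)] flag_form_Es(1)[OF i X(1)] by simp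
   thus ?thesis using X(2) by (simp add: mult.assoc)
  qed
  from this[OF sg(1)] this[OF sg(2)] this[OF sg(3)]
  have "ric1 l x y z = mu * (2 * real l - 2) * (x * y * z)" "ric1 l y x z = mu * (2 * real l - 2) * (x * y * z)"
   "ric3 l x y z = mu * (2 * real l - 2) * (x * y * z)"
   unfolding rho w using pos by (simp_all add: field_simps)
  thus "p : {ptN l, ptR, ptS l, ptT l}"
   unfolding pxy by (intro ric_equal[OF l4 pos]) (simp_all add: z_def)
 next
  assume pts: "p : {ptN l, ptR, ptS l, ptT l}"
  have n: "real l - 1 > 0" "6 * real l - 8 > 0" using l4 by auto
  have "ric1 l x y z = ric1 l y x z & ric1 l x y z = ric3 l x y z"
  proof -
   have u: "ric1 l s s (1 - 2 * s) = ric3 l s s (1 - 2 * s)" if "4 * (real l - 1) * s = real l" for s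
    using that unfolding ric1_def ric3_def by (simp add: field_simps) algebra
   have v: "ric1 l s (1/2) (1 - s - 1/2) = ric1 l (1/2) s (1 - s - 1/2) & ric1 l s (1/2) (1 - s - 1/2) = ric3 l s (1/2) (1 - s - 1/2)"
    if "(6 * real l - 8) * s = real l" for s
    using that unfolding ric1_def ric3_def by (intro conjI) (simp add: field_simps power2_eq_square, algebra?)+
   have sym: "ric3 l a b c = ric3 l b a c" for a b c by (simp add: ric3_def algebra_simps)
   from pts consider "p = ptN l" | "p = ptR" | "p = ptS l" | "p = ptT l" by blast
   thus ?thesis
   proof cases
    case 1
    define s where "s = real l / (4 * (real l - 1))"
    have "x = s" "y = s" "z = 1 - 2 * s" using 1 pxy by (auto simp: ptN_def s_def z_def)
    thus ?thesis using u[of s] n by (simp add: s_def)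
   next
    case 2
    hence "x = 1/4" "y = 1/4" "z = 1/2" using pxy by (auto simp: ptR_def z_def)
    thus ?thesis unfolding ric1_def ric3_def by (simp only:) (simp add: power2_eq_square field_simps)
   next
    case 3
    define s where "s = real l / (6 * real l - 8)"
    have e: "x = s" "y = 1/2" "z = 1 - s - 1/2" using 3 pxy by (auto simp: ptS_def s_def z_def)
    show ?thesis unfolding e by (rule v) (use n in "simp add: s_def")
   next
    case 4
    define s where "s = real l / (6 * real l - 8)"
    have e: "x = 1/2" "y = s" "z = 1 - s - 1/2" using 4 pxy by (auto simp: ptT_def s_def z_def)
    have "(6 * real l - 8) * s = real l" using n by (simp add: s_def)
    thus ?thesis unfolding e using v[of s] sym[of "1/2" s] by metis
   qed
  qed
  define mu where "mu = ric1 l x y z / (x * y * z * (2 * real l - 2))"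
  have r: "rho p i = mu * (2 * real l - 2) * wt p i" if "i : Sg" for i
  proof -
   have "i = (-1, -1) | i = (-1, 1) | i = (1, 1)" using that by (auto simp: Sg_def)
   thus ?thesis
    using `ric1 l x y z = ric1 l y x z & ric1 l x y z = ric3 l x y z` pos L
    by (elim disjE) (simp_all add: rho w mu_def)
  qed
  have "ricci (flag_form p) Y Z = mu * flag_form p Y Z" if "Y : m_sp" "Z : m_sp" for Y Z :: "'m mat"
   unfolding ricci_bilinear[OF p that] flag_form_eq by (simp add: r sum_distrib_left mult_ac)
  thus "einstein (flag_form p :: 'm mat => 'm mat => real)" unfolding einstein_def by blast
 qed
qed

end

section \<open>Kaehler metrics\<close>

text \<open>Left multiplication by J makes skew matrices of \<open>m2\<close> and \<open>m3\<close>
  skew again, since they anticommute with J. Elements of \<open>m1\<close> commute with J, and there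
  the factor D, with which they anticommute, restores skewness. The sign is chosen to fit
  \<open>hw\<close> in \<open>bracket_Hmat\<close>.\<close>

definition Is :: "real * real => 'm::finite mat => 'm mat" where
 "Is s X = (if s = (-1, -1) then - (Dmat ** Jmat ** X) else Jmat ** X)"

text \<open>The general element of the centre of \<open>k_alg\<close>: a J on the first block and b
  J on the second.\<close>

definition Hmat :: "real => real => 'm::finite mat" where
 "Hmat a b = (a/2) *R (Jmat - Dmat ** Jmat) + (b/2) *R (Jmat + Dmat ** Jmat)"

text \<open>The values on that centre of the roots e_1 - e_j, e_1 + e_j and e_j + e_k, which belong
  to \<open>m1\<close>, \<open>m2\<close> and \<open>m3\<close>.\<close>

definition hw :: "real => real => real * real => real" where
 "hw a b s = (if fst s = 1 then 2 * b else if snd s = -1 then a - b else a + b)"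

lemma Is_linear: "linear (Is s)"
 by (rule linearI) (simp_all add: Is_def mat_lin)

lemma EspD:
 fixes W X :: "'m::finite mat"
 assumes "X : Esp a b" "a : {1, -1}" "b : {1, -1}"
 shows "transpose X = - X" "X ** Jmat = (- b) *R (Jmat ** X)" "X ** Dmat = a *R (Dmat ** X)"
  "W ** X ** Jmat = (- b) *R (W ** Jmat ** X)" "W ** X ** Dmat = a *R (W ** Dmat ** X)"
proof -
 have X: "Dmat ** X ** Dmat = a *R X" "Jmat ** X ** Jmat = b *R X" and "transpose X = - X"
  using assms by (auto simp: Esp_def so_iff)
 thus "transpose X = - X" by simp
 have "Jmat ** (Jmat ** X ** Jmat) = b *R (Jmat ** X)" unfolding X by (simp add: mat_lin)
 hence "- (X ** Jmat) = b *R (Jmat ** X)" by (simp add: mat_assoc DJ_simps mat_lin)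
 thus J: "X ** Jmat = (- b) *R (Jmat ** X)" by (metis minus_minus scaleR_minus_left)
 have "Dmat ** (Dmat ** X ** Dmat) = a *R (Dmat ** X)" unfolding X by (simp add: mat_lin)
 thus D: "X ** Dmat = a *R (Dmat ** X)" by (simp add: mat_assoc DJ_simps)
 show "W ** X ** Jmat = (- b) *R (W ** Jmat ** X)" using arg_cong[OF J, of "%V. W ** V"] by (simp add: mat_assoc mat_lin)
 show "W ** X ** Dmat = a *R (W ** Dmat ** X)" using arg_cong[OF D, of "%V. W ** V"] by (simp add: mat_assoc mat_lin)
qed

lemma Jmat_sq_left: "Jmat ** (Jmat ** X) = - X" and Dmat_sq_left: "Dmat ** (Dmat ** X) = X"
 by (simp_all add: mat_assoc DJ_simps mat_lin)

lemma Is_Es: assumes "s : Sg" "X : Es s" shows "Is s X : Es s" "Is s (Is s X) = - X"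
proof -
 note sg = Sg_signs[OF assms(1)]
 note X = EspD[OF assms(2) sg]
 have D: "Dmat ** X ** Dmat = fst s *R X" and J: "Jmat ** X ** Jmat = snd s *R X" using assms(2) by (auto simp: Esp_def)
 show "Is s (Is s X) = - X" by (simp add: Is_def mat_lin mat_assoc DJ_simps)
 have c: "Dmat ** (Jmat ** X) ** Dmat = fst s *R (Jmat ** X)" "Jmat ** (Jmat ** X) ** Jmat = snd s *R (Jmat ** X)"
  using arg_cong[OF D, of "%V. Jmat ** V"] arg_cong[OF J, of "%V. Jmat ** V"]
  by (simp_all add: mat_assoc DJ_simps mat_lin)
 have c': "Dmat ** (Dmat ** Jmat ** X) ** Dmat = fst s *R (Dmat ** Jmat ** X)" "Jmat ** (Dmat ** Jmat ** X) ** Jmat = snd s *R (Dmat ** Jmat ** X)"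
  using arg_cong[OF c(1), of "%V. Dmat ** V"] arg_cong[OF c(2), of "%V. Dmat ** V"]
  by (simp_all add: mat_assoc DJ_simps mat_lin)
 have t: "transpose (Is s X) = - Is s X"
  using assms(1) unfolding Is_def Sg_def
  by (auto simp: tr_simps tr_Jmat tr_Dmat X(1) mat_lin) (auto simp: X mat_assoc DJ_simps mat_lin)
 show "Is s X : Es s"
  unfolding Esp_def using t c c' by (auto simp: so_iff Is_def mat_lin)
qed

lemma m3_Dmat_left:
 fixes X :: "'m::finite mat"
 assumes "X ** Dmat = X" "transpose X = - X" shows "Dmat ** X = X"
proof -
 have "Dmat ** transpose X = transpose (X ** Dmat)" by (simp add: matrix_transpose_mul tr_Dmat)
 thus ?thesis using assms by (simp add: mat_lin)
qed

lemma Is_inner: "Is s X \<bullet> Is s Y = X \<bullet> Y"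
 by (simp add: Is_def inner_matrix_left[of Jmat X] inner_matrix_left[of "Jmat ** Dmat" X] tr_simps tr_Jmat
   tr_Dmat mat_lin mat_assoc DJ_simps)

lemma Hmat_k: "Hmat a b : Esp 1 (-1)"
 unfolding Hmat_def Esp_def so_iff
 by (simp add: tr_simps tr_Jmat tr_Dmat mat_lin mat_assoc DJ_simps algebra_simps)

section \<open>Explicit elements of the isotropy group\<close>

lemma rotation_SO:
 fixes W :: "real^'n^'n"
 assumes "W ** W = - mat 1" "transpose W = - W"
 shows "cos t *R mat 1 + sin t *R W : SO"
proof -
 define R where "R t = cos t *R mat 1 + sin t *R W" for t
 have o: "transpose (R t) ** R t = mat 1" "R t ** transpose (R t) = mat 1" for t
 proof -
  have "(cos t * cos t) *R (mat 1 :: real^'n^'n) + (sin t * sin t) *R mat 1 = mat 1"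
   by (simp flip: scaleR_left_distrib power2_eq_square)
  thus "transpose (R t) ** R t = mat 1" "R t ** transpose (R t) = mat 1"
   unfolding R_def by (simp_all add: tr_simps assms mat_lin algebra_simps)
 qed
 \<comment> \<open>A square of an orthogonal matrix has determinant 1.\<close>
 have sq: "R t = R (t/2) ** R (t/2)" for t
 proof -
  define c s where "c = cos (t/2)" and "s = sin (t/2)"
  have cs: "cos t = c * c - s * s" "sin t = s * c + c * s"
   using cos_add[of "t/2" "t/2"] sin_add[of "t/2" "t/2"] by (simp_all add: c_def s_def)
  show ?thesis
   unfolding R_def c_def[symmetric] s_def[symmetric] cs
   by (simp add: mat_lin assms vec_eq_iff algebra_simps)
 qed
 have "orthogonal_matrix (R t)" for t using o by (simp add: orthogonal_matrix_def)
 hence "det (R (t/2)) = 1 | det (R (t/2)) = - 1" by (rule det_orthogonal_matrix)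
 hence "det (R t) = 1" unfolding sq[of t] det_mul by auto
 thus ?thesis using `orthogonal_matrix (R t)` by (simp add: SO_def rotation_matrix_def R_def)
qed

text \<open>The torus elements that are -1 on one complex coordinate. They belong to the isotropy
  group, and their common eigenspaces separate the root spaces.\<close>

definition Dcoord :: "'m option => 'm::finite mat" where
 "Dcoord i = (\<chi> p q. if p = q then if fst p = i then - 1 else 1 else 0)"

lemma Dmat_Dcoord: "Dmat = Dcoord None"
 by (simp add: Dmat_def Dcoord_def)

lemma Dcoord_left:
 fixes X :: "'m::finite mat"
 shows "(Dcoord i ** X) $ p $ q = (if fst p = i then - 1 else 1) * X $ p $ q"
proof -
 have "(SUM k:UNIV. (Dcoord i :: 'm mat) $ p $ k * X $ k $ q) = (SUM k:UNIV. if k = p then (if fst p = i then - 1 else 1) * X $ p $ q else 0)"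
  by (rule sum.cong) (auto simp: Dcoord_def)
 thus ?thesis by (simp add: matrix_matrix_mult_def)
qed

lemma transpose_Dcoord: "transpose (Dcoord i) = Dcoord i"
 by (auto simp: vec_eq_iff transpose_def Dcoord_def)

lemma Dcoord_right:
 fixes X :: "'m::finite mat"
 shows "(X ** Dcoord i) $ p $ q = (if fst q = i then - 1 else 1) * X $ p $ q"
proof -
 have "X ** Dcoord i = transpose (Dcoord i ** transpose X)"
  by (simp add: tr_simps transpose_Dcoord)
 hence "(X ** Dcoord i) $ p $ q = (Dcoord i ** transpose X) $ q $ p" by (simp add: transpose_def)
 thus ?thesis by (simp add: Dcoord_left transpose_def)
qed

lemma Dcoord_conj: "(Dcoord i ** (X::'m::finite mat) ** Dcoord i) $ p $ q = (if (fst p = i) = (fst q = i) then 1 else - 1) * X $ p $ q"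
 unfolding Dcoord_right Dcoord_left by auto

lemma Dcoord_commutes: "Dcoord i ** Jmat = Jmat ** Dcoord i" "Dcoord i ** Dmat = Dmat ** Dcoord i"
proof -
 have "(Dcoord i ** Jmat :: 'a mat) $ p $ q = (Jmat ** Dcoord i) $ p $ q" for p q
  unfolding Dcoord_left Dcoord_right by (cases "fst p = fst q") (auto simp: Jmat_def)
 thus "Dcoord i ** Jmat = Jmat ** Dcoord i" by (simp add: vec_eq_iff)
 have "(Dcoord i ** Dmat :: 'a mat) $ p $ q = (Dmat ** Dcoord i) $ p $ q" for p q
  unfolding Dcoord_left Dcoord_right by (cases "p = q") (auto simp: Dmat_def)
 thus "Dcoord i ** Dmat = Dmat ** Dcoord i" by (simp add: vec_eq_iff)
qed

lemma Dcoord_sq: "Dcoord i ** Dcoord i = mat 1"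
proof -
 have "(Dcoord i ** Dcoord i) $ p $ q = (mat 1 :: 'a mat) $ p $ q" for p q
  unfolding Dcoord_left by (simp add: Dcoord_def mat_def)
 thus ?thesis by (simp add: vec_eq_iff)
qed

lemma Dcoord_SO: "(Dcoord i :: 'm::finite mat) : SO"
proof -
 have "det (Dcoord i :: 'm mat) = (PROD p:UNIV. (Dcoord i :: 'm mat) $ p $ p)"
  by (rule det_diagonal) (simp add: Dcoord_def)
 also have "... = (PROD p:(UNIV \<times> UNIV :: ('m option * bool) set). if fst p = i then - 1 else 1)"
  by (intro prod.cong) (simp_all add: Dcoord_def)
 also have "... = (PROD k:(UNIV::'m option set). PROD b:(UNIV :: bool set). if k = i then - 1 else 1)"
  by (simp only: prod.cartesian_product split_def)
 also have "... = 1" by (intro prod.neutral) auto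
 finally show ?thesis
  by (simp add: SO_def rotation_matrix_def orthogonal_matrix_def transpose_Dcoord Dcoord_sq)
qed

lemma U1U_iff: "A : U1U_grp \<longleftrightarrow> A : SO & A ** Jmat = Jmat ** A & A ** Dmat = Dmat ** A"
proof -
 have "Dmat ** A ** Dmat = A \<longleftrightarrow> A ** Dmat = Dmat ** A"
 proof
  assume "Dmat ** A ** Dmat = A"
  hence "Dmat ** (Dmat ** A ** Dmat) = Dmat ** A" by simp
  thus "A ** Dmat = Dmat ** A" by (simp add: mat_assoc DJ_simps)
 next
  assume "A ** Dmat = Dmat ** A"
  hence "Dmat ** (A ** Dmat) = Dmat ** (Dmat ** A)" by simp
  thus "Dmat ** A ** Dmat = A" by (simp add: mat_assoc DJ_simps)
 qed
 thus ?thesis by (auto simp: U1U_grp_def U_grp_def blockdiag_iff)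
qed

lemma Dcoord_U1U: "Dcoord i : U1U_grp"
 by (simp add: U1U_iff Dcoord_SO Dcoord_commutes)

lemma Jmat_U1U: "Jmat : U1U_grp"
 using rotation_SO[OF Jmat_sq tr_Jmat, of "pi/2"] by (simp add: U1U_iff Dmat_Jmat)

lemma kappa_U1U: "(1 / sqrt 2) *R (mat 1 + Jmat) : U1U_grp" "(1 / sqrt 2) *R (mat 1 + Dmat ** Jmat) : U1U_grp"
proof -
 have "cos (pi/4) = 1 / sqrt 2" "sin (pi/4) = 1 / sqrt 2"
  by (simp_all add: cos_45 sin_45 real_div_sqrt field_simps)
 moreover have "Dmat ** Jmat ** (Dmat ** Jmat) = - mat 1" "transpose (Dmat ** Jmat) = - (Dmat ** Jmat)"
  by (simp_all add: tr_simps tr_Jmat tr_Dmat mat_lin mat_assoc DJ_simps)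
 ultimately show "(1 / sqrt 2) *R (mat 1 + Jmat) : U1U_grp" "(1 / sqrt 2) *R (mat 1 + Dmat ** Jmat) : U1U_grp"
  using rotation_SO[OF Jmat_sq tr_Jmat, of "pi/4"] rotation_SO[of "Dmat ** Jmat" "pi/4"]
  by (simp_all add: U1U_iff mat_lin mat_assoc DJ_simps scaleR_add_right)
qed

text \<open>Elements of \<open>m2\<close> and \<open>m3\<close> anticommute with J, so conjugation
  by the square root (1 + J) / sqrt 2 of J is left multiplication by J; on \<open>m1\<close> the
  same works with D J. Hence an invariant complex structure must commute with
  \<open>Is s\<close>.\<close>

lemma kappa_conj:
 assumes "s : Sg"
 obtains a :: "'m::finite mat" and c where "a : U1U_grp" "c : {1, -1 :: real}" "!!Y. Y : Es s ==> a ** Y ** transpose a = c *R Is s Y"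
proof (cases "s = (-1, -1)")
 case True
 have "((1 / sqrt 2) *R (mat 1 + Dmat ** Jmat)) ** Y ** transpose ((1 / sqrt 2) *R (mat 1 + Dmat ** Jmat)) = (-1) *R Is s Y"
  if "Y : Es s" for Y :: "'m mat"
  using EspD[of Y "-1" "-1"] that True
  by (simp add: Is_def tr_simps tr_Jmat tr_Dmat mat_lin mat_assoc DJ_simps algebra_simps
    flip: scaleR_left_distrib)
 thus ?thesis by (intro that[OF kappa_U1U(2), of "-1"]) auto
next
 case False
 have "((1 / sqrt 2) *R (mat 1 + Jmat)) ** Y ** transpose ((1 / sqrt 2) *R (mat 1 + Jmat)) = 1 *R Is s Y"
  if "Y : Es s" for Y :: "'m mat"
  using EspD[of Y "fst s" "1"] that False assms(1)
  by (auto simp: Sg_def Is_def tr_simps tr_Jmat tr_Dmat mat_lin mat_assoc DJ_simps algebra_simps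
    simp flip: scaleR_left_distrib)
 thus ?thesis by (intro that[OF kappa_U1U(1), of "1"]) auto
qed

context
 fixes l :: nat
 assumes card: "CARD('m::finite option) = l" and l4: "l >= 4"
begin

lemma bracket_Hmat: assumes "s : Sg" "(X :: 'm mat) : Es s" shows "bracket (Hmat a b) X = hw a b s *R Is s X"
proof -
 consider "s = (-1, -1)" | "s = (-1, 1)" | "s = (1, 1)" using assms(1) by (auto simp: Sg_def)
 thus ?thesis
 proof cases
  case 1
  thus ?thesis using EspD[of X "-1" "-1"] assms(2)
   by (simp add: bracket_def Hmat_def hw_def Is_def mat_lin mat_assoc DJ_simps algebra_simps
     flip: scaleR_left_distrib)
     (simp add: vec_eq_iff field_simps)
 next
  case 2
  thus ?thesis using EspD[of X "-1" "1"] assms(2)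
   by (simp add: bracket_def Hmat_def hw_def Is_def mat_lin mat_assoc DJ_simps algebra_simps
     flip: scaleR_left_distrib)
 next
  case 3
  hence X: "X : Esp 1 1" using assms(2) by simp
  have D: "X ** Dmat = X" "Dmat ** X = X"
   using m3_Dmat[OF card l4 X] m3_Dmat_left[of X] EspD(1)[OF X] by auto
  have D': "W ** X ** Dmat = W ** X" "W ** Dmat ** X = W ** X" for W :: "'m mat" using D by (simp_all flip: mat_assoc)
  have J: "X ** Jmat = - (Jmat ** X)" "W ** X ** Jmat = - (W ** Jmat ** X)" for W :: "'m mat"
   using EspD(2,4)[of X 1 1] X by simp_all
  show ?thesis using 3
   by (simp add: bracket_def Hmat_def hw_def Is_def mat_lin mat_assoc DJ_simps D D' J)
     (simp add: vec_eq_iff field_simps)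
 qed
qed

lemma inner_k_m_sp: "(K :: 'm mat) : Esp 1 (-1) ==> Z : m_sp ==> K \<bullet> Z = 0"
 using Pr_selfadj[of 1 "-1" K Z] Pr_id[of 1 "-1" K] by (simp add: m_sp_iff[OF card l4])

lemma bracket_H_m_sp:
 assumes "(V :: 'm mat) : so" "Z : m_sp"
 shows "bracket (Hmat a b) V \<bullet> Z = (SUM s:Sg. hw a b s * (Is s (Ps s V) \<bullet> Ps s Z))"
proof -
 have V: "V = Pr 1 (-1) V + (SUM s:Sg. Ps s V)" using so_decomp[OF assms(1)] by (simp add: sum_Sg add.assoc)
 have sum: "bracket K (SUM s:S. f s) = (SUM s:S. bracket K (f s))" if "finite S" for S :: "(real * real) set" and f and K :: "'m mat"
  using that by (induction S rule: finite_induct) (auto simp: bracket_linear)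
 have k: "bracket (Hmat a b) (Pr 1 (-1) V) : Esp 1 (-1)"
  using E_bracket[OF Hmat_k Pr_in_E[of 1 "-1" V]] by simp
 have "bracket (Hmat a b) V = bracket (Hmat a b) (Pr 1 (-1) V) + (SUM s:Sg. hw a b s *R Is s (Ps s V))"
  by (subst V) (simp only: bracket_linear sum[OF finite_Sg], simp add: bracket_Hmat Ps_in)
 hence "bracket (Hmat a b) V \<bullet> Z = (SUM s:Sg. hw a b s * (Is s (Ps s V) \<bullet> Z))"
  using inner_k_m_sp[OF k assms(2)] by (simp add: inner_add_left inner_sum_left)
 also have "... = (SUM s:Sg. hw a b s * (Is s (Ps s V) \<bullet> Ps s Z))"
 proof (intro sum.cong refl)
  fix s assume s: "s : Sg"
  have "Ps s (Is s (Ps s V)) = Is s (Ps s V)"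
   using Ps_Es[OF s s Is_Es(1)[OF s Ps_in[OF s]], of V] by simp
  thus "hw a b s * (Is s (Ps s V) \<bullet> Z) = hw a b s * (Is s (Ps s V) \<bullet> Ps s Z)"
   using Pr_selfadj[of "fst s" "snd s" "Is s (Ps s V)" Z] by simp
 qed
 finally show ?thesis .
qed

section \<open>Integrable structures and closed fundamental forms\<close>

definition Jop :: "(real * real => real) => 'm mat => 'm mat" where
 "Jop e X = (SUM s:Sg. e s *R Is s (Ps s X))"

lemma Jop_linear: "linear (Jop e)"
 unfolding Jop_def
 by (rule linear_compose_sum) (auto intro!: linear_compose_scale_right linear_compose[OF Pr_linear Is_linear, unfolded o_def])

lemma Jop_Es: assumes "s : Sg" "X : Es s" shows "Jop e X = e s *R Is s X"
proof -
 have "Jop e X = (SUM t:Sg. if t = s then e s *R Is s X else 0)"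
  unfolding Jop_def
  by (rule sum.cong) (use Ps_Es[OF assms(1) _ assms(2)] linear_0[OF Is_linear] in auto)
 thus ?thesis using assms(1) by simp
qed

lemma Jop_in_Es: "s : Sg ==> X : Es s ==> Jop e X : Es s"
 using Jop_Es[of s X e] Is_Es(1)[of s X] subspace_scale[OF subspace_E] by simp

lemma Ps_Jop: assumes "s : Sg" shows "Ps s (Jop e X) = e s *R Is s (Ps s X)"
proof -
 have "Ps s (Jop e X) = (SUM t:Sg. if t = s then e s *R Is s (Ps s X) else 0)"
  unfolding Jop_def linear_sum[OF Pr_linear]
  by (rule sum.cong) (auto simp: linear_scale[OF Pr_linear] Ps_Es[OF _ assms Is_Es(1)[OF _ Ps_in]])
 thus ?thesis using assms by simp
qed

text \<open>The condition on \<open>e\<close> says that the set of roots on which \<open>J\<close> has the eigenvalue \<open>\<i>\<close> is closed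
  under addition.\<close>

lemma Jop_nijenhuis_Es:
 assumes e: "e (-1, -1) * e (-1, 1) - 1 - e (-1, -1) * e (1, 1) + e (-1, 1) * e (1, 1) = 0"
  and s: "s : Sg" "t : Sg" and X: "X : Es s" and Y: "Y : Es t"
 shows "PM (bracket (Jop e X) (Jop e Y)) - PM (bracket X Y) - Jop e (PM (bracket (Jop e X) Y)) - Jop e (PM (bracket X (Jop e Y))) = 0"
proof -
 note JX = Jop_in_Es[OF s(1) X, of e] and JY = Jop_in_Es[OF s(2) Y, of e]
 have main: "bracket (Jop e X) (Jop e Y) - bracket X Y - Jop e (bracket (Jop e X) Y) - Jop e (bracket X (Jop e Y)) = 0"
  if XY: "X : Es s" "Y : Es t" and st: "(s, t) : {((-1, -1), (-1, 1)), ((-1, -1), (1, 1)), ((-1, 1), (1, 1))}" for s t X Y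
 proof -
  have sg: "s : Sg" "t : Sg" "s ~= t" using st by (auto simp: Sg_def)
  let ?r = "mul s t"
  note r = mul_Sg[OF sg]
  have J: "Jop e X = e s *R Is s X" "Jop e Y = e t *R Is t Y" using XY sg by (auto simp: Jop_Es)
  have IX: "Is s X : Es s" "Is t Y : Es t" by (rule Is_Es(1)[OF sg(1) XY(1)], rule Is_Es(1)[OF sg(2) XY(2)])
  have b: "bracket (Is s X) Y : Es ?r" "bracket X (Is t Y) : Es ?r" "bracket X Y : Es ?r"
   using bracket_Es[OF IX(1) XY(2)] bracket_Es[OF XY(1) IX(2)] bracket_Es[OF XY] by auto
  define P1 where "P1 = Is ?r (bracket (Is s X) Y)"
  define P2 where "P2 = Is ?r (bracket X (Is t Y))"
  define P0 where "P0 = bracket (Is s X) (Is t Y)"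
  \<comment> \<open>By the Jacobi identity the central elements act as derivations. Two independent
    choices of \<open>a\<close> and \<open>b\<close> then express the brackets with
    \<open>Is s X\<close> or \<open>Is t Y\<close> through \<open>bracket X Y\<close> alone.\<close>
  have j: "bracket (Hmat a b) (bracket X Y) = bracket (bracket (Hmat a b) X) Y + bracket X (bracket (Hmat a b) Y)" for a b
   by (rule bracket_jacobi)
  have h: "hw a b ?r *R Is ?r (bracket X Y) = hw a b s *R bracket (Is s X) Y + hw a b t *R bracket X (Is t Y)" for a b
   using j[of a b] bracket_Hmat[OF sg(1) XY(1)] bracket_Hmat[OF sg(2) XY(2)] bracket_Hmat[OF conjunct1[OF r] b(3)]
   by (simp add: bracket_linear)
  have h1: "Is ?r (hw a b ?r *R Is ?r (bracket X Y)) = Is ?r (hw a b s *R bracket (Is s X) Y + hw a b t *R bracket X (Is t Y))" for a b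
   using h[of a b] by simp
  have k1: "- (hw a b ?r *R bracket X Y) = hw a b s *R P1 + hw a b t *R P2" for a b
   using h1[of a b] Is_Es(2)[OF conjunct1[OF r] b(3)]
   by (simp add: linear_add[OF Is_linear] linear_scale[OF Is_linear] P1_def P2_def)
  have h2: "hw a b ?r *R P1 = - hw a b s *R bracket X Y + hw a b t *R P0" for a b
  proof -
   have "bracket (Hmat a b) (bracket (Is s X) Y) = bracket (bracket (Hmat a b) (Is s X)) Y + bracket (Is s X) (bracket (Hmat a b) Y)"
    by (rule bracket_jacobi)
   thus ?thesis
    using bracket_Hmat[OF sg(1) IX(1)] bracket_Hmat[OF sg(2) XY(2)] bracket_Hmat[OF conjunct1[OF r] b(1)] Is_Es(2)[OF sg(1) XY(1)]
    by (simp add: bracket_linear P1_def P0_def)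
  qed
  have Jr: "Jop e (bracket (Is s X) Y) = e ?r *R P1" "Jop e (bracket X (Is t Y)) = e ?r *R P2"
   using Jop_Es[OF conjunct1[OF r] b(1), of e] Jop_Es[OF conjunct1[OF r] b(2), of e] by (simp_all add: P1_def P2_def)
  have goal: "bracket (Jop e X) (Jop e Y) - bracket X Y - Jop e (bracket (Jop e X) Y) - Jop e (bracket X (Jop e Y))
    = (e s * e t) *R P0 - bracket X Y - (e s * e ?r) *R P1 - (e t * e ?r) *R P2"
   by (simp add: J bracket_linear linear_scale[OF Jop_linear] Jr P0_def)
  have "((e s * e t) *R P0 - bracket X Y - (e s * e ?r) *R P1 - (e t * e ?r) *R P2) $ p $ q = 0" for p q
  proof -
   define v p0 p1 p2 where "v = bracket X Y $ p $ q" and "p0 = P0 $ p $ q" and "p1 = P1 $ p $ q" and "p2 = P2 $ p $ q"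
   define e1 e2 e3 where "e1 = e (-1, -1)" and "e2 = e (-1, 1)" and "e3 = e (1, 1)"
   have e123: "e1 * e2 - 1 - e1 * e3 + e2 * e3 = 0" using e by (simp add: e1_def e2_def e3_def)
   have ev: "e1 * e2 * v - v - e1 * e3 * v + e2 * e3 * v = 0"
    using arg_cong[OF e123, of "%z. z * v"] by (simp add: algebra_simps)
   have K: "- (hw a b ?r * v) = hw a b s * p1 + hw a b t * p2" for a b
    using arg_cong[OF k1[of a b], of "%M. M $ p $ q"] by (simp add: v_def p1_def p2_def)
   have H: "hw a b ?r * p1 = - hw a b s * v + hw a b t * p0" for a b
    using arg_cong[OF h2[of a b], of "%M. M $ p $ q"] by (simp add: v_def p1_def p0_def)
   from st consider "s = (-1, -1)" "t = (-1, 1)" | "s = (-1, -1)" "t = (1, 1)" | "s = (-1, 1)" "t = (1, 1)" by auto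
   hence "(e s * e t) * p0 - v - (e s * e ?r) * p1 - (e t * e ?r) * p2 = 0"
   proof cases
    case 1
    hence "p0 = v" "p1 = v" "p2 = - v" using K[of 1 0] K[of 0 1] H[of 1 0] by (simp_all add: hw_def mul_def)
    thus ?thesis using ev 1 by (simp add: mul_def algebra_simps flip: e1_def e2_def e3_def)
   next
    case 2
    hence "p0 = - v" "p1 = - v" "p2 = - v" using K[of 1 0] K[of 0 1] H[of 0 1] by (simp_all add: hw_def mul_def)
    thus ?thesis using ev 2 by (simp add: mul_def algebra_simps flip: e1_def e2_def e3_def)
   next
    case 3
    hence "p0 = v" "p1 = - v" "p2 = v" using K[of 1 0] K[of 0 1] H[of 0 1] by (simp_all add: hw_def mul_def)
    thus ?thesis using ev 3 by (simp add: mul_def algebra_simps flip: e1_def e2_def e3_def)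
   qed
   thus ?thesis by (simp add: v_def p0_def p1_def p2_def)
  qed
  thus ?thesis unfolding goal by (simp add: vec_eq_iff)
 qed
 show ?thesis
 proof (cases "s = t")
  case True
  thus ?thesis
   using bracket_Es_PM(1)[OF JX JY s] bracket_Es_PM(1)[OF X Y s] bracket_Es_PM(1)[OF JX Y s] bracket_Es_PM(1)[OF X JY s]
   by (simp add: linear_0[OF Jop_linear])
 next
  case False
  have PM: "PM (bracket (Jop e X) (Jop e Y)) = bracket (Jop e X) (Jop e Y)" "PM (bracket X Y) = bracket X Y"
   "PM (bracket (Jop e X) Y) = bracket (Jop e X) Y" "PM (bracket X (Jop e Y)) = bracket X (Jop e Y)"
   using False bracket_Es_PM(1)[OF JX JY s] bracket_Es_PM(1)[OF X Y s] bracket_Es_PM(1)[OF JX Y s] bracket_Es_PM(1)[OF X JY s]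
   by auto
  consider "(s, t) : {((-1, -1), (-1, 1)), ((-1, -1), (1, 1)), ((-1, 1), (1, 1))}"
   | "(t, s) : {((-1, -1), (-1, 1)), ((-1, -1), (1, 1)), ((-1, 1), (1, 1))}"
   using s False by (auto simp: Sg_def)
  thus ?thesis
  proof cases
   case 1
   thus ?thesis unfolding PM by (rule main[OF X Y])
  next
   case 2
   have "bracket (Jop e Y) (Jop e X) - bracket Y X - Jop e (bracket (Jop e Y) X) - Jop e (bracket Y (Jop e X)) = 0"
    by (rule main[OF Y X 2])
   hence "- (bracket (Jop e X) (Jop e Y)) + bracket X Y + Jop e (bracket X (Jop e Y)) + Jop e (bracket (Jop e X) Y) = 0"
    using bracket_skew[of "Jop e Y" "Jop e X"] bracket_skew[of Y X] bracket_skew[of "Jop e Y" X] bracket_skew[of Y "Jop e X"]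
    by (simp add: linear_neg[OF Jop_linear])
   thus ?thesis unfolding PM by (simp add: algebra_simps add_eq_0_iff2)
  qed
 qed
qed

lemma Jop_m_sp: "Jop e X : m_sp"
 unfolding Jop_def
 by (intro subspace_sum[OF subspace_m_sp[OF card l4]] subspace_scale[OF subspace_m_sp[OF card l4]])
   (rule Es_m_sp[OF card l4 _ Is_Es(1)[OF _ Ps_in]])

lemma U1U_conj_Ps:
 assumes "a : U1U_grp" shows "Ps s (a ** X ** transpose a) = a ** Ps s (X :: 'm mat) ** transpose a"
proof -
 have a: "a ** Jmat = Jmat ** a" "a ** Dmat = Dmat ** a" using assms by (auto simp: U1U_iff)
 have "transpose (a ** Jmat) = transpose (Jmat ** a)" "transpose (a ** Dmat) = transpose (Dmat ** a)" using a by auto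
 hence at: "Jmat ** transpose a = transpose a ** Jmat" "Dmat ** transpose a = transpose a ** Dmat"
  by (simp_all add: tr_simps tr_Jmat tr_Dmat mat_lin)
 have J: "Jmat ** (a ** Y ** transpose a) ** Jmat = a ** (Jmat ** Y ** Jmat) ** transpose a" for Y
 proof -
  have "Jmat ** (a ** Y ** transpose a) ** Jmat = (Jmat ** a) ** Y ** (transpose a ** Jmat)" by (simp add: mat_assoc)
  also have "... = a ** (Jmat ** Y ** Jmat) ** transpose a" by (simp add: mat_assoc flip: a at)
  finally show ?thesis .
 qed
 have D: "Dmat ** (a ** Y ** transpose a) ** Dmat = a ** (Dmat ** Y ** Dmat) ** transpose a" for Y
 proof -
  have "Dmat ** (a ** Y ** transpose a) ** Dmat = (Dmat ** a) ** Y ** (transpose a ** Dmat)" by (simp add: mat_assoc)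
  also have "... = a ** (Dmat ** Y ** Dmat) ** transpose a" by (simp add: mat_assoc flip: a at)
  finally show ?thesis .
 qed
 have S: "a ** X ** transpose a - transpose (a ** X ** transpose a) = a ** (X - transpose X) ** transpose a"
  by (simp add: tr_simps mat_lin mat_assoc)
 have JD: "Jmat ** Dmat ** Y ** Dmat ** Jmat = Jmat ** (Dmat ** Y ** Dmat) ** Jmat" for Y :: "'m mat"
  by (simp add: mat_assoc)
 show ?thesis unfolding Pr_def S JD D J by (simp add: mat_lin)
qed

lemma U1U_conj_Is:
 assumes "a : U1U_grp" shows "Is s (a ** X ** transpose a) = a ** Is s X ** transpose a"
proof -
 have a: "a ** Jmat = Jmat ** a" "a ** Dmat = Dmat ** a" using assms by (auto simp: U1U_iff)
 have "Jmat ** (a ** X ** transpose a) = a ** (Jmat ** X) ** transpose a" for X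
  by (simp add: mat_assoc a)
 moreover have "Dmat ** Jmat ** (a ** X ** transpose a) = a ** (Dmat ** Jmat ** X) ** transpose a"
 proof -
  have "Dmat ** Jmat ** (a ** X ** transpose a) = Dmat ** (Jmat ** a) ** X ** transpose a" by (simp add: mat_assoc)
  also have "... = (Dmat ** a) ** Jmat ** X ** transpose a" by (simp add: mat_assoc flip: a(1))
  also have "... = a ** (Dmat ** Jmat ** X) ** transpose a" by (simp add: mat_assoc flip: a(2))
  finally show ?thesis .
 qed
 ultimately show ?thesis by (simp add: Is_def mat_lin)
qed

lemma flag_form_split: "flag_form p X (Z :: 'm mat) = (2 * real l - 2) * (SUM s:Sg. wt p s * (Ps s X \<bullet> Ps s Z))"
 by (rule flag_form_eq[OF card l4])

text \<open>\<open>a\<close> and \<open>b\<close> are chosen with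
  \<open>hw a b s = e s * wt (x, y) s\<close>; this is possible because the three roots are linearly
  dependent, which is the relation assumed for x, y, z. The fundamental form is then a multiple of
  the pairing of \<open>Hmat a b\<close> with the bracket, and it is closed by the Jacobi identity.
  The sign on \<open>m2\<close> is normalized to 1; one of the other two must be 1 for
  integrability.\<close>

lemma kaehler_sufficient:
 assumes p: "(x, y) : osimplex" and z: "z = 1 - x - y"
  and e: "e1 : {1, -1}" "e3 : {1, -1}" "e1 = 1 | e3 = 1" and xyz: "y = e1 * x + e3 * z"
 shows "kaehler (flag_form (x, y) :: 'm mat => 'm mat => real)"
proof -
 define e where "e s = (if s = (-1, -1) then e1 else if s = (-1, 1) then 1 else e3)" for s :: "real * real"
 have ee: "e s * e s = 1" for s using e by (auto simp: e_def)
 have cond: "e (-1, -1) * e (-1, 1) - 1 - e (-1, -1) * e (1, 1) + e (-1, 1) * e (1, 1) = 0"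
  using e by (auto simp: e_def)
 define a b where "a = (y + e1 * x) / 2" and "b = (y - e1 * x) / 2"
 have hw: "hw a b s = e s * wt (x, y) s" if "s : Sg" for s
  using that e xyz by (auto simp: Sg_def hw_def e_def wt_def a_def b_def z field_simps)
 let ?g = "flag_form (x, y) :: 'm mat => 'm mat => real"
 have JJ: "Jop e (Jop e X) = - X" if X: "X : m_sp" for X
 proof -
  have "Jop e (Jop e X) = (SUM s:Sg. e s *R Is s (e s *R Is s (Ps s X)))"
   unfolding Jop_def[of e "Jop e X"] by (intro sum.cong refl) (simp add: Ps_Jop)
  also have "... = (SUM s:Sg. - Ps s X)"
   by (intro sum.cong refl) (simp add: linear_scale[OF Is_linear] ee Is_Es(2)[OF _ Ps_in])
  also have "... = - X" using PM_m_sp[OF card l4 X] by (simp add: PM_def sum_negf)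
  finally show ?thesis .
 qed
 have eq: "Jop e (a ** X ** transpose a) = a ** Jop e X ** transpose a" if "a : U1U_grp" for a X
 proof -
  have sum: "a ** (SUM s:S. f s) ** transpose a = (SUM s:S. a ** f s ** transpose a)" if "finite S" for S :: "(real * real) set" and f
   using that by (induction S rule: finite_induct) (auto simp: mat_lin)
  show ?thesis unfolding Jop_def sum[OF finite_Sg]
   by (simp add: U1U_conj_Ps[OF that] U1U_conj_Is[OF that] mat_lin)
 qed
 define Nij where "Nij X Y = PM (bracket (Jop e X) (Jop e Y)) - PM (bracket X Y) - Jop e (PM (bracket (Jop e X) Y)) - Jop e (PM (bracket X (Jop e Y)))" for X Y
 have Nlin: "linear (%X. Nij X Y)" "linear (%Y. Nij X Y)" for X Y
  unfolding Nij_def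
  by (rule linearI; simp add: linear_add[OF PM_linear] linear_scale[OF PM_linear] linear_add[OF Jop_linear]
    linear_scale[OF Jop_linear] bracket_linear algebra_simps)+
 have Nzero: "Nij X Y = 0" if XY: "X : m_sp" "Y : m_sp" for X Y
 proof -
  have "Nij X Y = Nij (SUM s:Sg. Ps s X) (SUM t:Sg. Ps t Y)"
   using PM_m_sp[OF card l4 XY(1)] PM_m_sp[OF card l4 XY(2)] by (simp add: PM_def)
  also have "... = (SUM s:Sg. SUM t:Sg. Nij (Ps s X) (Ps t Y))"
   unfolding linear_sum[OF Nlin(1)] by (simp add: linear_sum[OF Nlin(2)])
  also have "... = 0"
   by (intro sum.neutral ballI) (simp add: Nij_def Jop_nijenhuis_Es[OF cond _ _ Ps_in Ps_in])
  finally show ?thesis .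
 qed
 have "inv_complex_structure (Jop e)"
  unfolding inv_complex_structure_def oproj_m_sp[OF card l4]
  using Jop_linear Jop_m_sp JJ eq Nzero by (auto simp: Nij_def)
 moreover have "?g (Jop e X) (Jop e Y) = ?g X Y" for X Y
  unfolding flag_form_split Ps_Jop
  by (intro arg_cong2[where f = "(*)"] refl sum.cong) (simp add: Ps_Jop Is_inner ee mult.assoc[symmetric])
 moreover have "?g (Jop e (PM (bracket X Y))) Z + ?g (Jop e (PM (bracket Y Z))) X + ?g (Jop e (PM (bracket Z X))) Y = 0"
  if XYZ: "X : m_sp" "Y : m_sp" "Z : m_sp" for X Y Z
 proof -
  have so: "X : so" "Y : so" "Z : so" using XYZ by (auto simp: m_sp_iff[OF card l4])
  have key: "?g (Jop e (PM V)) Z = (2 * real l - 2) * (Hmat a b \<bullet> bracket V Z)" if V: "V : so" and Z: "Z : m_sp" for V Z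
  proof -
   have "Ps s (PM V) = Ps s V" if s: "s : Sg" for s
   proof -
    have "Ps s (PM V) = (SUM t:Sg. if t = s then Ps s V else 0)"
     unfolding PM_def linear_sum[OF Pr_linear] by (rule sum.cong) (auto simp: Ps_Es[OF _ s Ps_in])
    thus ?thesis using s by simp
   qed
   hence "?g (Jop e (PM V)) Z = (2 * real l - 2) * (SUM s:Sg. hw a b s * (Is s (Ps s V) \<bullet> Ps s Z))"
    unfolding flag_form_split
    by (intro arg_cong[where f = "%c. (2 * real l - 2) * c"] sum.cong refl) (simp add: Ps_Jop hw mult_ac)
   also have "... = (2 * real l - 2) * (bracket (Hmat a b) V \<bullet> Z)" using bracket_H_m_sp[OF V Z] by simp
   also have "bracket (Hmat a b) V \<bullet> Z = Hmat a b \<bullet> bracket V Z"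
    using inner_bracket[OF V, of "Hmat a b" Z] by (simp add: bracket_skew[of "Hmat a b" V])
   finally show ?thesis .
  qed
  have "bracket (bracket X Y) Z + bracket (bracket Y Z) X + bracket (bracket Z X) Y = 0"
   by (simp add: bracket_def mat_lin mat_assoc)
  hence "Hmat a b \<bullet> bracket (bracket X Y) Z + Hmat a b \<bullet> bracket (bracket Y Z) X + Hmat a b \<bullet> bracket (bracket Z X) Y = 0"
   by (metis inner_add_right inner_zero_right)
  thus ?thesis
   using key[OF bracket_so[OF so(1,2)] XYZ(3)] key[OF bracket_so[OF so(2,3)] XYZ(1)] key[OF bracket_so[OF so(3,1)] XYZ(2)]
   by (simp flip: distrib_left)
 qed
 ultimately show ?thesis unfolding kaehler_def oproj_m_sp[OF card l4] by blast
qed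

section \<open>Root spaces and the necessary condition for Kaehler metrics\<close>

definition Vsp :: "real * real => 'm option => 'm option => 'm mat set" where
 "Vsp s i j = {X : Es s. Dcoord i ** X ** Dcoord i = - X & Dcoord j ** X ** Dcoord j = - X}"

text \<open>Being odd under both half turns leaves only the entries that join the coordinates
  \<open>i\<close> and \<open>j\<close>; within a fixed degree this is the real root plane.\<close>

lemma Vsp_support:
 assumes "X : Vsp s i j" "X $ p $ q ~= 0" "i ~= j"
 shows "{fst p, fst q} = {i, j}"
proof -
 have "(Dcoord i ** X ** Dcoord i) $ p $ q = - X $ p $ q" "(Dcoord j ** X ** Dcoord j) $ p $ q = - X $ p $ q"
  using assms(1) by (auto simp: Vsp_def)
 thus ?thesis using assms(2,3) unfolding Dcoord_conj by (auto split: if_splits)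
qed

lemma Vsp_fix:
 assumes "X : Vsp s i j" "k ~= i" "k ~= j" "i ~= j"
 shows "Dcoord k ** X ** Dcoord k = X"
proof -
 have "(Dcoord k ** X ** Dcoord k) $ p $ q = X $ p $ q" for p q
 proof (cases "X $ p $ q = 0")
  case False
  hence "{fst p, fst q} = {i, j}" using Vsp_support assms by blast
  hence "fst p ~= k" "fst q ~= k" using assms(2,3) by (metis insertE insertI1 insert_commute singletonD)+
  thus ?thesis by (simp add: Dcoord_conj)
 qed (simp add: Dcoord_conj)
 thus ?thesis by (simp add: vec_eq_iff)
qed

lemma Es_entries:
 assumes "(X :: 'm mat) : Esp a b"
 shows "X $ (i, True) $ (j, True) = - b * X $ (i, False) $ (j, False)" "X $ (i, True) $ (j, False) = b * X $ (i, False) $ (j, True)"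
  "X $ q $ p = - X $ p $ q"
proof -
 have J: "Jmat ** X ** Jmat = b *R X" and t: "transpose X = - X" using assms by (auto simp: Esp_def so_iff)
 have "(Jmat ** X ** Jmat) $ (i, False) $ (j, False) = b * X $ (i, False) $ (j, False)"
  "(Jmat ** X ** Jmat) $ (i, False) $ (j, True) = b * X $ (i, False) $ (j, True)" unfolding J by simp_all
 thus "X $ (i, True) $ (j, True) = - b * X $ (i, False) $ (j, False)" "X $ (i, True) $ (j, False) = b * X $ (i, False) $ (j, True)"
  by (simp_all add: Jmat_right Jmat_left)
 have "transpose X $ p $ q = - X $ p $ q" unfolding t by simp
 thus "X $ q $ p = - X $ p $ q" by (simp add: transpose_def)
qed

lemma Vsp_zero:
 assumes X: "X : Vsp s i j" and "i ~= j" and "X $ (i, False) $ (j, False) = 0" "X $ (i, False) $ (j, True) = 0"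
 shows "X = 0"
proof -
 have XE: "X : Esp (fst s) (snd s)" using X by (simp add: Vsp_def)
 have ij: "X $ (i, c) $ (j, d) = 0" for c d
  using Es_entries(1,2)[OF XE, of i j] assms(3,4) by (cases c; cases d) simp_all
 have ji: "X $ (j, c) $ (i, d) = 0" for c d
  using Es_entries(3)[OF XE, of "(j, c)" "(i, d)"] ij by simp
 have "X $ p $ q = 0" for p q
 proof (rule ccontr)
  assume *: "X $ p $ q ~= 0"
  hence "{fst p, fst q} = {i, j}" using Vsp_support X assms(2) by blast
  hence "fst p = i & fst q = j | fst p = j & fst q = i" by (auto simp: doubleton_eq_iff)
  thus False using ij[of "snd p" "snd q"] ji[of "snd p" "snd q"] * by (metis prod.collapse)
 qed
 thus ?thesis by (simp add: vec_eq_iff)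
qed

lemma Vsp_linear: "X : Vsp s i j ==> c *R X : Vsp s i j" "X : Vsp s i j ==> Y : Vsp s i j ==> X - Y : Vsp s i j"
 by (auto simp: Vsp_def mat_lin subspace_scale[OF subspace_E] subspace_diff[OF subspace_E])

lemma Is_Vsp: assumes "s : Sg" "X : Vsp s i j" shows "Is s X : Vsp s i j"
proof -
 have "Dcoord k ** Is s X ** Dcoord k = Is s (Dcoord k ** X ** Dcoord k)" for k
  using U1U_conj_Is[OF Dcoord_U1U, of s k X] by (simp add: transpose_Dcoord)
 thus ?thesis using assms Is_Es(1)[OF assms(1), of X] by (simp add: Vsp_def linear_neg[OF Is_linear])
qed

lemma Vsp_base:
 assumes s: "s : Sg" and i: "(i = None) = (fst s = -1)" and j: "j = Some v" "i ~= j"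
 shows "EX X : Vsp s i j. X $ (i, False) $ (j, False) = 1 & X $ (i, False) $ (j, True) = 0"
proof -
 define U :: "'m mat" where "U = axis (i, False) (axis (j, False) 1)"
 have mul_JD: "Jmat ** Dmat ** V = Jmat ** (Dmat ** V)" for V :: "'m mat" by (simp add: mat_assoc)
 have U: "U $ r $ s = (if r = (i, False) & s = (j, False) then 1 else 0)" for r s
  by (auto simp: U_def axis_def)
 have UT: "transpose U $ r $ s = (if s = (i, False) & r = (j, False) then 1 else 0)" for r s
  by (simp add: transpose_def U)
 have conj: "Dcoord k ** U ** Dcoord k = - U" if "k : {i, j}" for k
  unfolding vec_eq_iff Dcoord_conj using that j(2) by (auto simp: U)
 have "Dcoord k ** Ps s U ** Dcoord k = - Ps s U" if "k : {i, j}" for k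
  using U1U_conj_Ps[OF Dcoord_U1U, of s k U] conj[OF that] by (simp add: transpose_Dcoord linear_neg[OF Pr_linear])
 hence V: "Ps s U : Vsp s i j" using Ps_in[OF s] by (auto simp: Vsp_def)
 have e1: "Ps s U $ (i, False) $ (j, False) = (1 + fst s * (if i = None then - 1 else 1)) / 8"
  unfolding Pr_def using j
  by (simp add: Dmat_conj Jmat_left Jmat_right Dmat_left Dmat_right Dmat_Jmat_right U UT mul_JD)
 have e2: "Ps s U $ (i, False) $ (j, True) = 0"
  unfolding Pr_def using j
  by (simp add: Dmat_conj Jmat_left Jmat_right Dmat_left Dmat_right Dmat_Jmat_right U UT mul_JD)
 \<comment> \<open>The projection of an elementary matrix has the entry 1/4, which explains the
   factor 4 in the witness.\<close>
 have "(1 + fst s * (if i = None then - 1 else 1)) / 8 = (1/4 :: real)" using i s by (auto simp: Sg_def)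
 thus ?thesis using e1 e2 Vsp_linear(1)[OF V, of 4] by (intro bexI[of _ "4 *R Ps s U"]) simp_all
qed

text \<open>An invariant complex structure preserves the root spaces \<open>Vsp s i j\<close>, as these are common
  eigenspaces of the isotropy representation; a root space being a plane on which the structure
  commutes with \<open>Is s\<close>, it is \<open>\<plusminus> Is s\<close> there.\<close>

lemma invariant_complex_structure_root:
 assumes J: "inv_complex_structure (J :: 'm mat => 'm mat)"
  and s: "s : Sg" and i: "(i = None) = (fst s = -1)" and j: "j = Some v" "i ~= j"
 shows "EX sg:{1, -1}. ALL X:Vsp s i j. J X = sg *R Is s X"
proof -
 have Jlin: "linear J" and JJ: "!!X. X : m_sp ==> J X : m_sp & J (J X) = - X"
  and Jeq: "!!a X. a : U1U_grp ==> X : m_sp ==> J (a ** X ** transpose a) = a ** J X ** transpose a"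
  using J unfolding inv_complex_structure_def by auto
 note mE = Es_m_sp[OF card l4 s]
 have JE: "J X : Es s" if X: "X : Es s" for X
 proof -
  have D: "Dmat ** X ** Dmat = fst s *R X" and Jm: "Jmat ** X ** Jmat = snd s *R X" using X by (auto simp: Esp_def)
  have "Dmat ** J X ** Dmat = J (Dmat ** X ** Dmat)"
   using Jeq[OF Dcoord_U1U mE[OF X], of None] by (simp add: transpose_Dcoord Dmat_Dcoord)
  hence 1: "Dmat ** J X ** Dmat = fst s *R J X" by (simp add: D linear_scale[OF Jlin])
  have "- (Jmat ** J X ** Jmat) = J (- (Jmat ** X ** Jmat))"
   using Jeq[OF Jmat_U1U mE[OF X]] by (simp add: tr_Jmat mat_lin)
  hence 2: "Jmat ** J X ** Jmat = snd s *R J X" by (simp add: Jm linear_scale[OF Jlin] linear_neg[OF Jlin])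
  show ?thesis using 1 2 JJ[OF mE[OF X]] by (simp add: Esp_def m_sp_iff[OF card l4])
 qed
 have JV: "J X : Vsp s i j" if X: "X : Vsp s i j" for X
 proof -
  have XE: "X : Es s" using X by (simp add: Vsp_def)
  have "Dcoord k ** J X ** Dcoord k = J (Dcoord k ** X ** Dcoord k)" for k
   using Jeq[OF Dcoord_U1U mE[OF XE], of k] by (simp add: transpose_Dcoord)
  thus ?thesis using JE[OF XE] X by (simp add: Vsp_def linear_neg[OF Jlin])
 qed
 have JI: "J (Is s X) = Is s (J X)" if X: "X : Es s" for X
 proof -
  obtain a :: "'m mat" and c where a: "a : U1U_grp" "c : {1, -1 :: real}" "!!Y. Y : Es s ==> a ** Y ** transpose a = c *R Is s Y"
   using kappa_conj[OF s] by metis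
  have "J (c *R Is s X) = c *R Is s (J X)" using Jeq[OF a(1) mE[OF X]] by (simp add: a(3) X JE)
  thus ?thesis using a(2) by (auto simp: linear_scale[OF Jlin])
 qed
 obtain A where A: "A : Vsp s i j" "A $ (i, False) $ (j, False) = 1" "A $ (i, False) $ (j, True) = 0"
  using Vsp_base[OF s i j] by blast
 have AE: "A : Es s" using A by (simp add: Vsp_def)
 define ta where "ta = Is s A $ (i, False) $ (j, True)"
 have I1: "Is s A $ (i, False) $ (j, False) = 0" and ta: "ta ~= 0"
  using Es_entries(1,2)[OF AE, of i j] A(2,3) s
  by (auto simp: ta_def Is_def Jmat_left Dmat_left Sg_def simp flip: mat_assoc)
 have dec: "EX al be. X = al *R A + be *R Is s A" if X: "X : Vsp s i j" for X
 proof -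
  define al be where "al = X $ (i, False) $ (j, False)" and "be = X $ (i, False) $ (j, True) / ta"
  have "X - al *R A - be *R Is s A = 0"
   by (rule Vsp_zero[OF _ j(2)])
     (use X A I1 ta Is_Vsp[OF s A(1)] in "auto simp: al_def be_def ta_def[symmetric] intro!: Vsp_linear")
  thus ?thesis by (intro exI[of _ al] exI[of _ be]) (simp add: algebra_simps)
 qed
 obtain al be where ab: "J A = al *R A + be *R Is s A" using dec[OF JV[OF A(1)]] by blast
 have II: "Is s (Is s A) = - A" by (rule Is_Es(2)[OF s AE])
 have JIA: "J (Is s A) = al *R Is s A - be *R A"
  using JI[OF AE] by (simp add: ab linear_add[OF Is_linear] linear_scale[OF Is_linear] II)
 have "- A = al *R J A + be *R J (Is s A)"
  using JJ[OF mE[OF AE]] by (simp add: ab linear_add[OF Jlin] linear_scale[OF Jlin])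
 hence e: "- A = (al * al - be * be) *R A + (2 * al * be) *R Is s A"
  by (simp add: ab JIA vec_eq_iff algebra_simps)
 have "-1 = al * al - be * be" using arg_cong[OF e, of "%M. M $ (i, False) $ (j, False)"] A I1 by simp
 moreover have "2 * al * be * ta = 0" using arg_cong[OF e, of "%M. M $ (i, False) $ (j, True)"] A by (simp add: ta_def)
 ultimately have "al * be = 0" and sq: "-1 = al * al - be * be" using ta by auto
 moreover have "be ~= 0"
 proof
  assume "be = 0"
  hence "-1 = al * al" using sq by simp
  thus False using zero_le_square[of al] by linarith
 qed
 ultimately have "al = 0" and "be * be = 1" by auto
 hence be: "be : {1, -1}" by (simp add: square_eq_1_iff)
 have "J X = be *R Is s X" if X: "X : Vsp s i j" for X
 proof -
  obtain c d where cd: "X = c *R A + d *R Is s A" using dec[OF X] by blast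
  show ?thesis unfolding cd
   by (simp add: linear_add[OF Jlin] linear_scale[OF Jlin] linear_add[OF Is_linear] linear_scale[OF Is_linear] II ab JIA `al = 0`
     algebra_simps)
 qed
 thus ?thesis using be by blast
qed

text \<open>One triple of root vectors in \<open>m1\<close>, \<open>m2\<close>, \<open>m3\<close>
  suffices, with the third chosen as \<open>Is s3\<close> of the bracket of the first two.
  Closedness on this triple is a relation between x, y, z with signs and three coefficients, and the
  coefficients agree up to sign.\<close>

lemma kaehler_necessary:
 assumes p: "(x, y) : osimplex" and z: "z = 1 - x - y"
  and K: "kaehler (flag_form (x, y) :: 'm mat => 'm mat => real)"
 shows "EX a:{1, -1}. EX b:{1, -1}. EX c:{1, -1}. a * x + b * y + c * z = (0 :: real)"
proof -
 let ?g = "flag_form (x, y) :: 'm mat => 'm mat => real"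
 obtain J where J: "inv_complex_structure J" and
  cl: "!!X Y Z. X : m_sp ==> Y : m_sp ==> Z : m_sp ==> ?g (J (PM (bracket X Y))) Z + ?g (J (PM (bracket Y Z))) X + ?g (J (PM (bracket Z X))) Y = 0"
  using K unfolding kaehler_def oproj_m_sp[OF card l4] by blast
 obtain u v :: 'm where uv: "u ~= v" using two_indices[OF card l4] by blast
 define s1 s2 s3 where s: "s1 = (-1 :: real, -1 :: real)" "s2 = (-1 :: real, 1 :: real)" "s3 = (1 :: real, 1 :: real)"
 have sg: "s1 : Sg" "s2 : Sg" "s3 : Sg" by (auto simp: s Sg_def)
 have m: "mul s1 s2 = s3" "mul s2 s3 = s1" "mul s3 s1 = s2" by (auto simp: s mul_def)
 let ?u = "Some u" and ?v = "Some v"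
 obtain X where X: "X : Vsp s1 None ?u" "X $ (None, False) $ (?u, False) = 1" "X $ (None, False) $ (?u, True) = 0"
  using Vsp_base[OF sg(1), of None ?u u] by (auto simp: s)
 obtain Y where Y: "Y : Vsp s2 None ?v" "Y $ (None, False) $ (?v, False) = 1"
  using Vsp_base[OF sg(2), of None ?v v] by (auto simp: s)
 have XE: "X : Es s1" and YE: "Y : Es s2" using X Y by (auto simp: Vsp_def)
 define W where "W = bracket X Y"
 have Dbr: "Dcoord k ** bracket P Q ** Dcoord k = bracket (Dcoord k ** P ** Dcoord k) (Dcoord k ** Q ** Dcoord k)" for k and P Q :: "'m mat"
 proof -
  have "W ** Dcoord k ** Dcoord k = W" for W :: "'m mat" by (simp add: Dcoord_sq flip: mat_assoc)
  thus ?thesis by (simp add: bracket_def mat_lin mat_assoc)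
 qed
 have Xv: "Dcoord ?v ** X ** Dcoord ?v = X" by (rule Vsp_fix[OF X(1)]) (use uv in auto)
 have Yu: "Dcoord ?u ** Y ** Dcoord ?u = Y" by (rule Vsp_fix[OF Y(1)]) (use uv in auto)
 have Xu: "Dcoord ?u ** X ** Dcoord ?u = - X" and Yv: "Dcoord ?v ** Y ** Dcoord ?v = - Y" using X Y by (auto simp: Vsp_def)
 have WE: "W : Es s3" using bracket_Es[OF XE YE] m by (simp add: W_def)
 have W: "W : Vsp s3 ?u ?v" using WE by (simp add: Vsp_def W_def Dbr Xu Yu Xv Yv bracket_linear)
 define Z where "Z = Is s3 W"
 have Z: "Z : Vsp s3 ?u ?v" unfolding Z_def by (rule Is_Vsp[OF sg(3) W])
 have ZE: "Z : Es s3" and Zu: "Dcoord ?u ** Z ** Dcoord ?u = - Z" and Zv: "Dcoord ?v ** Z ** Dcoord ?v = - Z"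
  using Z by (auto simp: Vsp_def)
 have YZE: "bracket Y Z : Es s1" and ZXE: "bracket Z X : Es s2" using bracket_Es[OF YE ZE] bracket_Es[OF ZE XE] m by auto
 have YZ: "bracket Y Z : Vsp s1 None ?u"
  using YZE by (auto simp: Vsp_def Dbr Yu Zu bracket_linear) (auto simp: Esp_def s Dmat_Dcoord Dbr)
 have ZX: "bracket Z X : Vsp s2 None ?v"
  using ZXE by (auto simp: Vsp_def Dbr Zv Xv bracket_linear) (auto simp: Esp_def s Dmat_Dcoord Dbr)
 obtain sg1 where sg1: "sg1 : {1, -1}" "!!X. X : Vsp s1 None ?u ==> J X = sg1 *R Is s1 X"
 proof -
  have "EX sg:{1, -1}. ALL X:Vsp s1 None ?u. J X = sg *R Is s1 X"
   by (rule invariant_complex_structure_root[OF J sg(1)]) (auto simp: s)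
  thus thesis using that by blast
 qed
 obtain sg2 where sg2: "sg2 : {1, -1}" "!!X. X : Vsp s2 None ?v ==> J X = sg2 *R Is s2 X"
 proof -
  have "EX sg:{1, -1}. ALL X:Vsp s2 None ?v. J X = sg *R Is s2 X"
   by (rule invariant_complex_structure_root[OF J sg(2)]) (auto simp: s)
  thus thesis using that by blast
 qed
 obtain sg3 where sg3: "sg3 : {1, -1}" "!!X. X : Vsp s3 ?u ?v ==> J X = sg3 *R Is s3 X"
 proof -
  have "EX sg:{1, -1}. ALL X:Vsp s3 ?u ?v. J X = sg *R Is s3 X"
   by (rule invariant_complex_structure_root[OF J sg(3)]) (use uv in "auto simp: s")
  thus thesis using that by blast
 qed
 define p1 p2 p3 where "p1 = Is s1 (bracket Y Z) \<bullet> X" and "p2 = Is s2 (bracket Z X) \<bullet> Y" and "p3 = Is s3 W \<bullet> Z"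
 have PMs: "PM (bracket X Y) = W" "PM (bracket Y Z) = bracket Y Z" "PM (bracket Z X) = bracket Z X"
  using PM_Es[OF sg(3) WE] PM_Es[OF sg(1) YZE] PM_Es[OF sg(2) ZXE] by (simp_all add: W_def)
 note mm = Es_m_sp[OF card l4]
 have "?g (J W) Z + ?g (J (bracket Y Z)) X + ?g (J (bracket Z X)) Y = 0"
  using cl[OF mm[OF sg(1) XE] mm[OF sg(2) YE] mm[OF sg(3) ZE]] by (simp add: PMs)
 moreover have "?g (J W) Z = (2 * real l - 2) * (sg3 * z * p3)"
  using flag_form_Es(1)[OF card l4 sg(3) ZE] by (simp add: sg3(2)[OF W] p3_def s wt_def z)
 moreover have "?g (J (bracket Y Z)) X = (2 * real l - 2) * (sg1 * x * p1)"
  using flag_form_Es(1)[OF card l4 sg(1) XE] by (simp add: sg1(2)[OF YZ] p1_def s wt_def)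
 moreover have "?g (J (bracket Z X)) Y = (2 * real l - 2) * (sg2 * y * p2)"
  using flag_form_Es(1)[OF card l4 sg(2) YE] by (simp add: sg2(2)[OF ZX] p2_def s wt_def)
 ultimately have "(2 * real l - 2) * (sg3 * z * p3 + sg1 * x * p1 + sg2 * y * p2) = 0" by (simp only: distrib_left)
 hence eq: "sg3 * z * p3 + sg1 * x * p1 + sg2 * y * p2 = 0" using l4 by simp
 \<comment> \<open>The forms given by \<open>Hmat a b\<close> are closed as well; comparing with
   them for two choices of \<open>a\<close> and \<open>b\<close> determines the ratio of the
   coefficients.\<close>
 have jac: "2 * b * p3 + (a - b) * p1 + (a + b) * p2 = 0" for a b
 proof -
  have h: "Hmat a b \<bullet> bracket V U = bracket (Hmat a b) V \<bullet> U" if "V : so" for V U :: "'m mat"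
   using inner_bracket[OF that, of "Hmat a b" U] by (simp add: bracket_skew[of "Hmat a b" V])
  have "bracket W Z + bracket (bracket Y Z) X + bracket (bracket Z X) Y = 0"
   by (simp add: W_def bracket_def mat_lin mat_assoc)
  hence "Hmat a b \<bullet> bracket W Z + Hmat a b \<bullet> bracket (bracket Y Z) X + Hmat a b \<bullet> bracket (bracket Z X) Y = 0"
   by (metis inner_add_right inner_zero_right)
  thus ?thesis
   using h[OF Es_sub_so[OF WE], of Z] h[OF Es_sub_so[OF YZE], of X] h[OF Es_sub_so[OF ZXE], of Y]
    bracket_Hmat[OF sg(3) WE, of a b] bracket_Hmat[OF sg(1) YZE, of a b] bracket_Hmat[OF sg(2) ZXE, of a b]
   by (simp add: p1_def p2_def p3_def s hw_def)
 qed
 have p12: "p1 = p3" "p2 = - p3" using jac[of 0 1] jac[of 1 0] by auto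
 \<comment> \<open>A single entry is enough to see that the bracket does not vanish.\<close>
 have "W $ (?u, False) $ (?v, False) = -1"
 proof -
  have "(X ** Y) $ (?u, False) $ (?v, False) = (SUM k:UNIV. X $ (?u, False) $ k * Y $ k $ (?v, False))"
   by (simp add: matrix_matrix_mult_def)
  also have "... = (SUM k:(UNIV :: ('m option * bool) set). if k = (None, False) then -1 else 0)"
  proof (rule sum.cong)
   fix k
   show "X $ (?u, False) $ k * Y $ k $ (?v, False) = (if k = (None, False) then -1 else 0)"
   proof (cases "X $ (?u, False) $ k = 0")
    case True
    have "X $ (?u, False) $ (None, False) = -1" using Es_entries(3)[OF XE, of "(?u, False)" "(None, False)"] X(2) by simp
    thus ?thesis using True by auto
   next
    case False
    hence "{?u, fst k} = {None, ?u}" using Vsp_support[OF X(1) False] by simp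
    hence k: "fst k = None" by auto
    have "X $ (?u, False) $ (None, True) = 0"
     using Es_entries(3)[OF XE, of "(?u, False)" "(None, True)"] Es_entries(2)[OF XE, of None ?u] X(3) by simp
    hence "k = (None, False)" using False k by (cases k; cases "snd k") auto
    thus ?thesis using Es_entries(3)[OF XE, of "(?u, False)" "(None, False)"] X(2) Y(2) by simp
   qed
  qed simp
  finally have 1: "(X ** Y) $ (?u, False) $ (?v, False) = -1" by simp
  have "Y $ (?u, False) $ k = 0" for k
   using Vsp_support[OF Y(1), of "(?u, False)" k] uv by (auto simp: doubleton_eq_iff)
  hence "(Y ** X) $ (?u, False) $ (?v, False) = 0" by (simp add: matrix_matrix_mult_def)
  thus ?thesis using 1 by (simp add: W_def bracket_def)
 qed
 hence "W ~= 0" by auto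
 have "p3 = W \<bullet> W" unfolding p3_def Z_def by (rule Is_inner)
 hence "p3 ~= 0" using `W ~= 0` by simp
 have "p3 * (sg1 * x + (- sg2) * y + sg3 * z) = 0" using eq unfolding p12 by (simp add: algebra_simps)
 hence "sg1 * x + (- sg2) * y + sg3 * z = 0" using `p3 ~= 0` by simp
 thus ?thesis using sg1(1) sg2(1) sg3(1) by (intro bexI[of _ sg1] bexI[of _ "- sg2"] bexI[of _ sg3]) auto
qed

theorem einstein_kaehler_sets:
 "{p : interior simplex2. einstein (flag_form p :: 'm mat => 'm mat => real) &
    kaehler (flag_form p :: 'm mat => 'm mat => real)} = {ptR, ptS l, ptT l}"
 "{p : interior simplex2. einstein (flag_form p :: 'm mat => 'm mat => real) &
    ~ kaehler (flag_form p :: 'm mat => 'm mat => real)} = {ptN l}"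
proof -
 let ?E = "%p. einstein (flag_form p :: 'm mat => 'm mat => real)" and ?K = "%p. kaehler (flag_form p :: 'm mat => 'm mat => real)"
 have inn: "ptN l : osimplex" "ptR : osimplex" "ptS l : osimplex" "ptT l : osimplex"
  using ptS_in[OF l4] ptN_in[OF l4] by (auto simp: ptR_def ptS_def ptT_def osimplex_def)
 have N: "~ ?K (ptN l)"
 proof
  define s where "s = real l / (4 * (real l - 1))"
  have s: "1/4 < s" "s < 1/2" using ptN_bounds[OF l4] by (auto simp: s_def)
  assume "?K (ptN l)"
  hence "EX a:{1, -1}. EX b:{1, -1}. EX c:{1, -1}. a * s + b * s + c * (1 - s - s) = (0 :: real)"
   using kaehler_necessary[of s s] inn(1) by (simp add: ptN_def s_def)
  thus False using s by auto
 qed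
 \<comment> \<open>The signs come from the relations z = x + y at \<open>R\<close>, y = x + z at
   \<open>S\<close> and x = y + z at \<open>T\<close>.\<close>
 have R: "?K ptR"
  unfolding ptR_def by (rule kaehler_sufficient[of _ _ "1 - 1/4 - 1/4" "-1" 1]) (use inn in "auto simp: ptR_def")
 have S: "?K (ptS l)"
  unfolding ptS_def by (rule kaehler_sufficient[OF _ refl, of _ _ 1 1]) (use inn in "auto simp: ptS_def")
 have T: "?K (ptT l)"
  unfolding ptT_def by (rule kaehler_sufficient[OF _ refl, of _ _ 1 "-1"]) (use inn in "auto simp: ptT_def")
 note ei = einstein_iff[OF card l4]
 show "{p : interior simplex2. ?E p & ?K p} = {ptR, ptS l, ptT l}" "{p : interior simplex2. ?E p & ~ ?K p} = {ptN l}"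
  unfolding interior_simplex2 using ei inn N R S T by blast+
qed

end

section \<open>Limits of the flag manifold\<close>

definition fn :: "real * real => 'm::finite mat => real" where
 "fn p X = sqrt (flag_form p X X)"

definition stab :: "real^'n^'n => (real^'n^'n) set" where
 "stab Z = {A : SO. A ** Z = Z ** A}"

lemma stab_group:
 "stab Z <= SO" "mat 1 : stab Z" "A : stab Z ==> C : stab Z ==> A ** C : stab Z" "A : stab Z ==> transpose A : stab Z"
proof -
 show "stab Z <= SO" "mat 1 : stab Z" by (auto simp: stab_def SO_id)
 assume A: "A : stab Z"
 hence AZ: "A : SO" "A ** Z = Z ** A" by (auto simp: stab_def)
 show "A ** C : stab Z" if "C : stab Z"
 proof -
  have C: "C : SO" "C ** Z = Z ** C" using that by (auto simp: stab_def)
  have "(A ** C) ** Z = A ** (C ** Z)" by (simp add: mat_assoc)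
  also have "... = (A ** Z) ** C" by (simp add: C mat_assoc)
  also have "... = Z ** (A ** C)" by (simp add: AZ mat_assoc)
  finally show ?thesis using AZ C by (simp add: stab_def SO_mult)
 qed
 have "transpose A ** Z = transpose A ** (Z ** A) ** transpose A"
  using SO_transpose(2)[OF AZ(1)] by (simp flip: mat_assoc)
 also have "... = (transpose A ** A) ** Z ** transpose A" by (simp add: mat_assoc flip: AZ(2))
 finally show "transpose A : stab Z" using AZ SO_transpose(1)[OF AZ(1)] by (simp add: stab_def SO_inv)
qed

lemma hom_metricI:
 assumes "!!xi. N xi >= 0" "!!b xi. N (b *R xi) = abs b * N xi"
  "!!k xi. k : stab Z ==> xi : so ==> N (transpose k ** xi ** k) = N xi"
 shows "hom_metric N (stab Z)"
 by (rule hom_metric.intro) (rule assms stab_group; assumption?)+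

lemma SO_orth_rows: "A : SO ==> (SUM k:UNIV. A $ i $ k * A $ j $ k) = (if i = j then 1 else 0)"
 using arg_cong[OF SO_transpose(2)[of A], of "%M. M $ i $ j"]
 by (simp add: matrix_matrix_mult_def transpose_def mat_def)

lemma Hmat_left:
 fixes X :: "'m::finite mat"
 shows "(Hmat a b ** X) $ p $ q = (if fst p = None then a else b) * (Jmat ** X) $ p $ q"
 by (simp add: Hmat_def mat_lin Dmat_left flip: mat_assoc)

lemma Hmat_right:
 fixes X :: "'m::finite mat"
 shows "(X ** Hmat a b) $ p $ q = (if fst q = None then a else b) * (X ** Jmat) $ p $ q"
proof -
 have "X ** Hmat a b = (a/2) *R (X ** Jmat - X ** Jmat ** Dmat) + (b/2) *R (X ** Jmat + X ** Jmat ** Dmat)"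
  by (simp add: Hmat_def mat_lin Dmat_Jmat mat_assoc)
 thus ?thesis by (simp add: Dmat_right)
qed

lemma U_grp_stab: "U_grp = stab (Hmat 1 1)"
proof -
 have "Hmat 1 1 = (Jmat :: 'a mat)" by (simp add: Hmat_def vec_eq_iff field_simps)
 thus ?thesis by (simp add: U_grp_def stab_def)
qed

text \<open>The square of \<open>Hmat a b\<close> is a combination of the identity and
  \<open>Dmat\<close> in which \<open>Dmat\<close> has a nonzero coefficient.\<close>

lemma commutes_Dmat:
 assumes "A ** Hmat a b = Hmat a b ** A" "a^2 ~= b^2" shows "A ** Dmat = Dmat ** (A :: 'm::finite mat)"
proof -
 let ?Z = "Hmat a b :: 'm mat"
 have sq: "?Z ** ?Z = (- (a^2 + b^2) / 2) *R mat 1 + ((a^2 - b^2) / 2) *R Dmat"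
 proof -
  have "(?Z ** ?Z) $ p $ q = ((- (a^2 + b^2) / 2) *R mat 1 + ((a^2 - b^2) / 2) *R Dmat) $ p $ q" for p q
  proof -
   obtain i c where p: "p = (i, c)" by (metis surj_pair)
   have "(?Z ** ?Z) $ p $ q = (if fst p = None then a else b) * (if fst p = None then a else b) * (Jmat ** Jmat) $ p $ q"
    unfolding Hmat_left p by (cases c) (simp_all add: Jmat_left Hmat_left[of a b "mat 1", simplified])
   thus ?thesis by (auto simp: Jmat_sq mat_def Dmat_def power2_eq_square field_simps)
  qed
  thus ?thesis by (simp add: vec_eq_iff)
 qed
 have "A ** (?Z ** ?Z) = (?Z ** ?Z) ** A"
  by (metis assms(1) mat_assoc)
 hence "((a^2 - b^2) / 2) *R (A ** Dmat) = ((a^2 - b^2) / 2) *R (Dmat ** A)"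
  unfolding sq by (simp add: mat_lin)
 thus ?thesis using assms(2) by simp
qed

text \<open>A generic central element: its square recovers \<open>Dmat\<close> and the element
  itself then recovers \<open>Jmat\<close>.\<close>

lemma U1U_stab: "U1U_grp = stab (Hmat 1 2)"
proof -
 let ?Z = "Hmat 1 2 :: 'a mat"
 \<comment> \<open>On the first block the coefficients add up to 3/4 + 1/4, on the second to 2 (3/4
   - 1/4).\<close>
 have J: "Jmat = (3/4) *R ?Z - (1/4) *R (Dmat ** ?Z)"
  by (simp add: Hmat_def mat_lin mat_assoc DJ_simps vec_eq_iff field_simps)
 have iff: "A ** ?Z = ?Z ** A \<longleftrightarrow> A ** Jmat = Jmat ** A & A ** Dmat = Dmat ** A" for A
 proof
  assume Z: "A ** ?Z = ?Z ** A"
  hence D: "A ** Dmat = Dmat ** A" by (rule commutes_Dmat) simp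
  have "A ** (Dmat ** ?Z) = Dmat ** ?Z ** A" by (metis Z D mat_assoc)
  hence "A ** ((3/4) *R ?Z - (1/4) *R (Dmat ** ?Z)) = ((3/4) *R ?Z - (1/4) *R (Dmat ** ?Z)) ** A"
   by (simp add: mat_lin Z)
  thus "A ** Jmat = Jmat ** A & A ** Dmat = Dmat ** A" using D unfolding J by blast
 next
  assume *: "A ** Jmat = Jmat ** A & A ** Dmat = Dmat ** A"
  hence "A ** (Dmat ** Jmat) = Dmat ** Jmat ** A" by (metis mat_assoc)
  thus "A ** ?Z = ?Z ** A" using * by (simp add: Hmat_def mat_lin)
 qed
 show ?thesis unfolding stab_def iff by (intro set_eqI) (simp only: U1U_iff mem_Collect_eq)
qed

lemma sum_None:
 fixes f :: "'m::finite option * bool => real"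
 assumes "!!i c. i ~= None ==> f (i, c) = 0"
 shows "(SUM k:(UNIV :: ('m::finite option * bool) set). f k) = f (None, False) + f (None, True :: bool)"
proof -
 have "(SUM k:(UNIV :: ('m option * bool) set). f k) = (SUM k:{(None, False), (None, True)}. f k)"
 proof (rule sum.mono_neutral_right)
  show "ALL k:UNIV - {(None, False), (None, True)}. f k = 0"
  proof
   fix k :: "'m option * bool" assume "k : UNIV - {(None, False), (None, True)}"
   hence "fst k ~= None" by (cases k; cases "snd k") auto
   thus "f k = 0" using assms[of "fst k" "snd k"] by simp
  qed
 qed auto
 thus ?thesis by simp
qed

text \<open>As both rows have length 1 and the determinant is 1, the sum of squares (a - d)^2 + (b +
  c)^2 equals 1 + 1 - 2 = 0.\<close>

lemma SO2SO_block:
 assumes "A : SO2SO_grp"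
 shows "A $ (None, True) $ (None, True) = A $ (None, False) $ (None, False)" (is "?d = ?a")
  "A $ (None, False) $ (None, True) = - A $ (None, True) $ (None, False)" (is "?c = - ?b")
  "(A $ (None, False) $ (None, False))^2 + (A $ (None, True) $ (None, False))^2 = 1"
proof -
 have A: "A : SO" "blockdiag A" "?a * ?d - ?c * ?b = 1" using assms by (auto simp: SO2SO_grp_def)
 have z: "A $ (None, b) $ (i, c) = 0" if "i ~= None" for b i c
  using A(2) that by (auto simp: blockdiag_def)
 have "?a * ?a + ?c * ?c = 1"
  using SO_orth_rows[OF A(1), of "(None, False)" "(None, False)"] by (subst (asm) sum_None) (auto simp: z)
 moreover have "?b * ?b + ?d * ?d = 1"
  using SO_orth_rows[OF A(1), of "(None, True)" "(None, True)"] by (subst (asm) sum_None) (auto simp: z)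
 ultimately have "(?a - ?d)^2 + (?b + ?c)^2 = 0" using A(3) by (simp add: power2_eq_square algebra_simps)
 thus "?d = ?a" "?c = - ?b" by (auto simp: sum_power2_eq_zero_iff)
 thus "?a^2 + ?b^2 = 1" using `?b * ?b + ?d * ?d = 1` by (simp add: power2_eq_square)
qed

lemma SO2SO_stab: "SO2SO_grp = stab (Hmat 1 0)"
proof (intro equalityI subsetI)
 fix A :: "'a mat" assume A: "A : SO2SO_grp"
 note b = SO2SO_block[OF A]
 have z: "A $ p $ q = 0" if "(fst p = None) ~= (fst q = None)" for p q
  using A that unfolding SO2SO_grp_def blockdiag_def by blast
 have "(A ** Hmat 1 0) $ p $ q = (Hmat 1 0 ** A) $ p $ q" for p q
 proof -
  obtain i c j d where pq: "p = (i, c)" "q = (j, d)" by (metis surj_pair)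
  show ?thesis unfolding Hmat_left Hmat_right pq
   by (cases c; cases d; cases i; cases j) (auto simp: Jmat_left Jmat_right b z)
 qed
 thus "A : stab (Hmat 1 0)" using A by (simp add: stab_def SO2SO_grp_def vec_eq_iff)
next
 fix A :: "'a mat" assume "A : stab (Hmat 1 0)"
 hence A: "A : SO" "A ** Hmat 1 0 = Hmat 1 0 ** A" by (auto simp: stab_def)
 have D: "A ** Dmat = Dmat ** A" by (rule commutes_Dmat[OF A(2)]) simp
 hence "Dmat ** A ** Dmat = A" by (metis Dmat_sq_left mat_assoc)
 hence bd: "blockdiag A" by (simp add: blockdiag_iff)
 have z: "A $ (None, b) $ (i, c) = 0" if "i ~= None" for b i c
  using bd that by (auto simp: blockdiag_def)
 have e: "(A ** Hmat 1 0) $ p $ q = (Hmat 1 0 ** A) $ p $ q" for p q using A(2) by simp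
 have 1: "A $ (None, False) $ (None, True) = - A $ (None, True) $ (None, False)"
  "A $ (None, True) $ (None, True) = A $ (None, False) $ (None, False)"
  using e[of "(None, False)" "(None, False)"] e[of "(None, True)" "(None, False)"]
  unfolding Hmat_left Hmat_right by (simp_all add: Jmat_left Jmat_right)
 have "A $ (None, False) $ (None, False) * A $ (None, False) $ (None, False) + A $ (None, False) $ (None, True) * A $ (None, False) $ (None, True) = 1"
  using SO_orth_rows[OF A(1), of "(None, False)" "(None, False)"] by (subst (asm) sum_None) (auto simp: z)
 thus "A : SO2SO_grp" using A(1) bd 1 by (simp add: SO2SO_grp_def)
qed

lemma U1U_sub: "U1U_grp <= (U_grp :: 'a::finite mat set)" "U1U_grp <= (SO2SO_grp :: 'a mat set)"
proof -
 show "U1U_grp <= (U_grp :: 'a mat set)" by (auto simp: U1U_grp_def)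
 show "U1U_grp <= (SO2SO_grp :: 'a mat set)"
 proof
  fix A :: "'a mat" assume "A : U1U_grp"
  hence A: "A : SO" "A ** Jmat = Jmat ** A" "A ** Dmat = Dmat ** A" by (auto simp: U1U_iff)
  hence "A ** (Dmat ** Jmat) = Dmat ** Jmat ** A" by (metis mat_assoc)
  hence "A ** Hmat 1 0 = Hmat 1 0 ** A" using A by (simp add: Hmat_def mat_lin)
  thus "A : SO2SO_grp" using A(1) by (simp add: SO2SO_stab stab_def)
 qed
qed

lemma wt_nonneg: "p : simplex2 ==> wt p s >= 0"
 by (auto simp: wt_def simplex2_def)

lemma wt_le_1: "p : simplex2 ==> wt p s <= 1"
 by (auto simp: wt_def simplex2_def)

lemma Pr_idem: "s : Sg ==> Ps s (Ps s X) = Ps s X"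
 using Ps_Es[of s s "Ps s X"] Ps_in[of s X] by simp

lemma Pr_mid:
 assumes "X : so"
 shows "Ps (-1, 1) X + Ps (1, 1) X = (1/2) *R (X + Jmat ** X ** Jmat)"
  "Ps (-1, -1) X + Ps (-1, 1) X = (1/2) *R (X - Dmat ** X ** Dmat)"
proof -
 have S: "X - transpose X = 2 *R X" using assms by (simp add: so_iff scaleR_2)
 show "Ps (-1, 1) X + Ps (1, 1) X = (1/2) *R (X + Jmat ** X ** Jmat)"
  "Ps (-1, -1) X + Ps (-1, 1) X = (1/2) *R (X - Dmat ** X ** Dmat)"
  unfolding Pr_def S by (simp_all add: mat_lin vec_eq_iff field_simps)
qed

lemma ptKL_in: "ptK : simplex2" "ptL : simplex2"
 by (auto simp: ptK_def ptL_def simplex2_def)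

section \<open>The length functional of a metric and its degeneration at \<open>K\<close> and
  \<open>L\<close>\<close>

context
 fixes l :: nat
 assumes card: "CARD('m::finite option) = l" and l4: "l >= 4"
begin

lemma fn_eq: "fn p (X :: 'm mat) = sqrt ((2 * real l - 2) * (SUM s:Sg. wt p s * (norm (Ps s X))^2))"
 by (simp add: fn_def flag_form_eq[OF card l4] power2_norm_eq_inner)

lemma l_pos: "2 * real l - 2 > 0"
 using l4 by simp

lemma sum_Ps_le: "(SUM s:Sg. (norm (Ps s X))^2) <= (norm (X :: 'm mat))^2"
proof -
 have "(SUM s:Sg. (norm (Ps s X))^2) = (SUM s:Sg. X \<bullet> Ps s X)"
  by (intro sum.cong) (simp_all add: power2_norm_eq_inner Pr_selfadj Pr_idem)
 also have "... = X \<bullet> PM X" by (simp add: PM_def inner_sum_right)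
 also have "... = (norm (PM X))^2"
  using PM_selfadj[of X "PM X"] PM_m_sp[OF card l4 PM_in[OF card l4], of X] by (simp add: power2_norm_eq_inner)
 finally have e: "(SUM s:Sg. (norm (Ps s X))^2) = (norm (PM X))^2" "X \<bullet> PM X = (norm (PM X))^2"
  using `X \<bullet> PM X = (norm (PM X))^2` by auto
 have "norm (PM X) * norm (PM X) <= norm X * norm (PM X)"
  using norm_cauchy_schwarz[of X "PM X"] e(2) by (simp add: power2_eq_square)
 hence "norm (PM X) <= norm X" by (cases "PM X = 0") auto
 thus ?thesis using e(1) by (simp add: power_mono)
qed

lemma fn_nonneg: "p : simplex2 ==> fn p (X :: 'm mat) >= 0"
 unfolding fn_eq using l_pos wt_nonneg by (intro real_sqrt_ge_zero mult_nonneg_nonneg sum_nonneg) auto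

lemma fn_scale: "fn p (b *R X :: 'm mat) = abs b * fn p X"
 by (simp add: fn_def flag_form_add[OF card l4] real_sqrt_mult flip: mult.assoc)

lemma fn_continuous: "continuous_on UNIV (fn p :: 'm mat => real)"
 unfolding fn_eq
 by (intro continuous_intros linear_continuous_on linear_conv_bounded_linear[THEN iffD1] Pr_linear)

lemma fn_le:
 assumes "!!s. s : Sg ==> Ps s X ~= 0 ==> wt p s <= w" "w >= 0"
 shows "fn p (X :: 'm mat) <= sqrt ((2 * real l - 2) * w) * norm X"
proof -
 have "(SUM s:Sg. wt p s * (norm (Ps s X))^2) <= (SUM s:Sg. w * (norm (Ps s X))^2)"
  using assms by (intro sum_mono) (metis mult_right_mono zero_le_power2 norm_zero power_zero_numeral mult_zero_right order_refl)
 also have "... <= w * (norm X)^2" using sum_Ps_le[of X] assms(2) by (simp add: mult_left_mono flip: sum_distrib_left)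
 finally have "fn p X <= sqrt ((2 * real l - 2) * (w * (norm X)^2))"
  unfolding fn_eq using l_pos by (simp add: mult_left_mono)
 thus ?thesis by (simp add: real_sqrt_mult)
qed

text \<open>Only the weights of summands that the generator meets matter, and
  \<open>gen_norm\<close> bounds its squared norm by 2 l. This turns small parameters into cheap
  rotations.\<close>

lemma fn_gen_le:
 assumes "gen X" "!!s. s : Sg ==> Ps s X ~= 0 ==> wt p s <= w" "w >= 0"
 shows "fn p (X :: 'm mat) <= sqrt ((2 * real l - 2) * (2 * real l) * w)"
proof -
 have "norm X <= sqrt (2 * real l)"
  using gen_norm[OF assms(1)] unfolding dim(2)[OF card l4] by (intro real_le_rsqrt) simp
 hence "sqrt ((2 * real l - 2) * w) * norm X <= sqrt ((2 * real l - 2) * w) * sqrt (2 * real l)"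
  using l_pos assms(3) by (intro mult_left_mono) auto
 moreover have "fn p X <= sqrt ((2 * real l - 2) * w) * norm X" by (rule fn_le) (use assms in auto)
 ultimately show ?thesis by (simp add: mult_ac flip: real_sqrt_mult)
qed

lemma hom_metric_fn: assumes "p : simplex2" shows "hom_metric (fn p) (U1U_grp :: 'm mat set)"
 unfolding U1U_stab
proof (rule hom_metricI)
 fix k xi :: "'m mat" assume "k : stab (Hmat 1 2)"
 hence "transpose k : U1U_grp" unfolding U1U_stab by (rule stab_group)
 from U1U_conj_Ps[OF card l4 this] have e: "Ps s (transpose k ** xi ** k) = transpose k ** Ps s xi ** k" for s by simp
 have "k : SO" using `k : stab _` stab_group by blast
 thus "fn p (transpose k ** xi ** k) = fn p xi"
  unfolding fn_eq e by (simp add: norm_SO_mult SO_inv)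
qed (use assms fn_nonneg fn_scale in auto)

text \<open>At \<open>K\<close> and \<open>L\<close> two summands have weight 1/2 and the third has
  weight 0. The two surviving summands form an eigenspace of one of the involutions, so the length
  is a multiple of the norm of a projection that is invariant under the larger isotropy
  group.\<close>

lemma fn_ptK: "X : so ==> fn ptK (X :: 'm mat) = sqrt (real l - 1) * norm ((1/2) *R (X + Jmat ** X ** Jmat))"
 and fn_ptL: "X : so ==> fn ptL (X :: 'm mat) = sqrt (real l - 1) * norm ((1/2) *R (X - Dmat ** X ** Dmat))"
proof -
 have o: "Ps s X \<bullet> Ps t X = 0" if "s : Sg" "t : Sg" "s ~= t" for s t :: "real * real"
  by (rule E_orth[OF Ps_in[OF that(1)] Ps_in[OF that(2)]]) (use that Sg_signs in "auto simp: prod_eq_iff")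
 have m: "(-1, -1) : Sg" "(-1, 1) : Sg" "(1, 1) : Sg" by (auto simp: Sg_def)
 have s: "sqrt ((2 * real l - 2) * ((1/2) * a + (1/2) * b)) = sqrt (real l - 1) * sqrt (a + b)" for a b
  by (simp add: field_simps flip: real_sqrt_mult)
 show "fn ptK X = sqrt (real l - 1) * norm ((1/2) *R (X + Jmat ** X ** Jmat))" if "X : so"
 proof -
  have "(norm (Ps (-1, 1) X + Ps (1, 1) X))^2 = (norm (Ps (-1, 1) X))^2 + (norm (Ps (1, 1) X))^2"
   using o[of "(-1, 1)" "(1, 1)"] m by (intro norm_add_Pythagorean) (simp add: orthogonal_def)
  thus ?thesis
   unfolding fn_eq sum_Sg Pr_mid(1)[OF that, symmetric] using s[of "(norm (Ps (-1, 1) X))^2" "(norm (Ps (1, 1) X))^2"]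
   by (simp add: wt_def ptK_def) (metis norm_ge_zero real_sqrt_unique)
 qed
 show "fn ptL X = sqrt (real l - 1) * norm ((1/2) *R (X - Dmat ** X ** Dmat))" if "X : so"
 proof -
  have "(norm (Ps (-1, -1) X + Ps (-1, 1) X))^2 = (norm (Ps (-1, -1) X))^2 + (norm (Ps (-1, 1) X))^2"
   using o[of "(-1, -1)" "(-1, 1)"] m by (intro norm_add_Pythagorean) (simp add: orthogonal_def)
  thus ?thesis
   unfolding fn_eq sum_Sg Pr_mid(2)[OF that, symmetric] using s[of "(norm (Ps (-1, -1) X))^2" "(norm (Ps (-1, 1) X))^2"]
   by (simp add: wt_def ptL_def) (metis norm_ge_zero real_sqrt_unique)
 qed
qed

lemma hom_metric_involution:
 fixes M :: "'m mat"
 assumes p: "p : simplex2" and fn: "!!X. X : so ==> fn p X = c * norm ((1/2) *R (X + e *R (M ** X ** M)))"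
  and M: "!!k. k : stab Z ==> k ** M = M ** k"
 shows "hom_metric (fn p) (stab (Z :: 'm mat))"
proof (rule hom_metricI)
 fix k xi :: "'m mat" assume k: "k : stab Z" and xi: "xi : so"
 note kM = M[OF k] M[OF stab_group(4)[OF k]]
 have kS: "k : SO" "transpose k : SO" using k SO_inv[of k] by (auto simp: stab_def)
 have s: "transpose k ** xi ** k : so" using xi by (simp add: so_iff tr_simps mat_lin mat_assoc)
 have "M ** (transpose k ** xi ** k) ** M = (M ** transpose k) ** xi ** (k ** M)" by (simp add: mat_assoc)
 also have "... = transpose k ** (M ** xi ** M) ** k" unfolding kM(1) by (simp add: mat_assoc flip: kM(2))
 finally have "(1/2) *R (transpose k ** xi ** k + e *R (M ** (transpose k ** xi ** k) ** M)) = transpose k ** ((1/2) *R (xi + e *R (M ** xi ** M))) ** k"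
  by (simp add: mat_lin)
 thus "fn p (transpose k ** xi ** k) = fn p xi"
  unfolding fn[OF s] fn[OF xi] by (simp only: norm_SO_mult kS)
qed (use p fn_nonneg fn_scale in auto)

lemma hom_metric_K: "hom_metric (fn ptK) (U_grp :: 'm mat set)"
 unfolding U_grp_stab
 by (rule hom_metric_involution[of _ "sqrt (real l - 1)" 1 Jmat]) (use ptKL_in fn_ptK U_grp_stab in "auto simp: U_grp_def")

lemma hom_metric_L: "hom_metric (fn ptL) (SO2SO_grp :: 'm mat set)"
 unfolding SO2SO_stab
 by (rule hom_metric_involution[of _ "sqrt (real l - 1)" "- 1" Dmat]) (use ptKL_in fn_ptL commutes_Dmat[of _ 1 0] in "auto simp: stab_def")

text \<open>The sign \<open>e\<close> covers both limits: \<open>e = 1\<close> for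
  \<open>Jmat\<close> with algebra \<open>u_alg\<close> and \<open>e = - 1\<close> for
  \<open>Dmat\<close> with algebra \<open>so2so_alg\<close>. In either case the complement of
  \<open>h\<close> is the other eigenspace of X \<mapsto> M X M.\<close>

lemma normal_form_involution:
 fixes M X :: "'m mat"
 assumes M: "transpose M = (- e) *R M" "M ** M = (- e) *R mat 1" "e : {1, -1}"
  and h: "h = {X : so. M ** X ** M = (- e) *R X}" and X: "X : so"
 shows "normal_form (1/2) h X X = (sqrt (real l - 1) * norm ((1/2) *R (X + e *R (M ** X ** M))))^2"
proof -
 let ?Q = "(1/2) *R (X + e *R (M ** X ** M))"
 have tX: "transpose X = - X" using X by (simp add: so_iff)
 have MM: "W ** M ** M = (- e) *R W" for W :: "'m mat" using M(2) by (simp add: mat_lin flip: mat_assoc)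
 have ee: "e * e = 1" "e * (e * c) = c" for c using M(3) by auto
 have "M ** X ** M : so"
  using M(3) by (auto simp: so_iff tr_simps M(1) tX mat_lin mat_assoc)
 hence Q: "?Q : so" by (rule subspace_scale[OF subspace_so subspace_add[OF subspace_so X subspace_scale[OF subspace_so]]])
 have "oproj h X = X - ?Q"
 proof (rule oproj_eqI)
  show "subspace h" using subspace_so unfolding h by (auto simp: subspace_def mat_lin scaleR_add_right)
  have "X - ?Q : so" using X Q subspace_so by (auto intro: subspace_diff)
  thus "X - ?Q : h"
   by (simp add: h mat_lin mat_assoc M(2) MM ee) (simp add: vec_eq_iff ee field_simps)
  show "(X - (X - ?Q)) \<bullet> Z = 0" if "Z : h" for Z
  proof -
   have "(M ** X ** M) \<bullet> Z = X \<bullet> (M ** Z ** M)" by (simp add: inner_conj M(1) mat_lin ee)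
   also have "M ** Z ** M = (- e) *R Z" using that by (simp add: h)
   finally show ?thesis by (simp add: inner_add_left ee)
  qed
 qed
 moreover have "B ?Q ?Q = (2 * real l - 2) * (?Q \<bullet> ?Q)" using B_so[OF Q Q] unfolding dim(2)[OF card l4] .
 moreover have "X - (X - ?Q) = ?Q" by (simp only: diff_diff_eq2 add_diff_cancel_left')
 moreover have "1/2 * ((2 * real l - 2) * q) = (real l - 1) * q" for q by (simp add: algebra_simps)
 ultimately have "normal_form (1/2) h X X = (real l - 1) * (norm ?Q)^2"
  unfolding normal_form_def power2_norm_eq_inner by (simp only:)
 thus ?thesis unfolding power_mult_distrib using l4 by simp
qed

lemma sqrt_normal_form:
 assumes X: "(X :: 'm mat) : so"
 shows "sqrt (normal_form (1/2) u_alg X X) = fn ptK X" "sqrt (normal_form (1/2) so2so_alg X X) = fn ptL X"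
proof -
 show "sqrt (normal_form (1/2) u_alg X X) = fn ptK X"
  by (subst normal_form_involution[of Jmat 1, OF _ _ _ _ X])
    (use X l4 in "auto simp: tr_Jmat Jmat_sq u_alg_def Jmat_conj_iff fn_ptK")
 show "sqrt (normal_form (1/2) so2so_alg X X) = fn ptL X"
  by (subst normal_form_involution[of Dmat "- 1", OF _ _ _ _ X])
    (use X l4 in "auto simp: tr_Dmat Dmat_sq so2so_alg_def blockdiag_iff fn_ptL")
qed

text \<open>The bracket multiplies the component of degree s by \<open>hw a b s\<close> and turns it
  by an isometry. So \<open>fn\<close> has to control just the components with nonzero
  \<open>hw\<close>: all three for \<open>Hmat 1 2\<close>, those in \<open>m2\<close> and
  \<open>m3\<close> for \<open>Hmat 1 1\<close>, those in \<open>m1\<close> and \<open>m2\<close>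
  for \<open>Hmat 1 0\<close>.\<close>

lemma bracket_bound:
 assumes p: "p : simplex2" and w: "!!s. s : Sg ==> hw a b s ~= 0 ==> wt p s > 0"
 shows "EX C>=0. ALL xi:so. norm (bracket xi (Hmat a b :: 'm mat)) <= C * fn p xi"
proof -
 define c where "c s = abs (hw a b s) / sqrt ((2 * real l - 2) * wt p s)" for s
 have c0: "c s >= 0" for s using l_pos wt_nonneg[OF p, of s] by (simp add: c_def)
 have c: "abs (hw a b s) * norm (Ps s xi) <= c s * fn p xi" if s: "s : Sg" for s and xi :: "'m mat"
 proof (cases "hw a b s = 0")
  case False
  hence ws: "(2 * real l - 2) * wt p s > 0" using w[OF s] l_pos by simp
  have "wt p s * (norm (Ps s xi))^2 <= (SUM s:Sg. wt p s * (norm (Ps s xi))^2)"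
   by (rule member_le_sum) (use s wt_nonneg[OF p] in auto)
  hence "sqrt ((2 * real l - 2) * wt p s * (norm (Ps s xi))^2) <= fn p xi"
   unfolding fn_eq using l_pos by (simp add: mult_left_mono)
  hence "sqrt ((2 * real l - 2) * wt p s) * norm (Ps s xi) <= fn p xi" by (simp add: real_sqrt_mult)
  hence "c s * (sqrt ((2 * real l - 2) * wt p s) * norm (Ps s xi)) <= c s * fn p xi"
   using c0 by (rule mult_left_mono)
  moreover have "c s * sqrt ((2 * real l - 2) * wt p s) = abs (hw a b s)"
   unfolding c_def times_divide_eq_left by (rule nonzero_mult_div_cancel_right) (use real_sqrt_gt_zero[OF ws] in linarith)
  ultimately show ?thesis by (simp only: mult.assoc[symmetric])
 qed (simp add: c_def)
 have "norm (bracket xi (Hmat a b)) <= (SUM s:Sg. c s) * fn p xi" if xi: "xi : so" for xi :: "'m mat"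
 proof -
  have k: "bracket (Hmat a b) (Pr 1 (-1) xi) = 0"
  proof -
   have "Pr 1 (-1) xi : Esp 1 (-1)" by (rule Pr_in_E) auto
   from EspD[OF this] show ?thesis
    by (simp add: bracket_def Hmat_def mat_lin mat_assoc DJ_simps)
  qed
  have "bracket (Hmat a b) xi = bracket (Hmat a b) (Pr 1 (-1) xi + (SUM s:Sg. Ps s xi))"
   using so_decomp[OF xi] by (simp add: sum_Sg add.assoc)
  also have "... = (SUM s:Sg. bracket (Hmat a b) (Ps s xi))"
   using k by (simp add: bracket_def mat_lin sum_Sg algebra_simps)
  also have "... = (SUM s:Sg. hw a b s *R Is s (Ps s xi))"
   by (intro sum.cong refl bracket_Hmat[OF card l4] Ps_in)
  finally have "norm (bracket xi (Hmat a b)) = norm (SUM s:Sg. hw a b s *R Is s (Ps s xi))"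
   using bracket_skew[of xi "Hmat a b"] by simp
  also have "... <= (SUM s:Sg. norm (hw a b s *R Is s (Ps s xi)))" by (rule norm_sum)
  also have "... <= (SUM s:Sg. c s * fn p xi)"
  proof (rule sum_mono)
   fix s assume s: "s : Sg"
   have "norm (Is s Y) = norm Y" for Y :: "'m mat" by (simp add: norm_eq_sqrt_inner Is_inner)
   thus "norm (hw a b s *R Is s (Ps s xi)) <= c s * fn p xi" using c[OF s, of xi] by simp
  qed
  finally show ?thesis by (simp add: sum_distrib_right)
 qed
 thus ?thesis using c0 by (intro exI[of _ "SUM s:Sg. c s"]) (auto intro: sum_nonneg)
qed

end

section \<open>Factorizations into rotations along the isotropy summands\<close>

lemma Xg_scale: "Xg (a *R u) v = a *R Xg u v" "Xg u (a *R v) = a *R Xg u v" "Xg (- u) v = - Xg u v" "Xg u (- v) = - Xg u v"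
 by (simp_all add: Xg_def vec_eq_iff algebra_simps)

lemma rot_commute:
 fixes X Z :: "real^'n^'n"
 assumes "X ** Z = Z ** X" shows "rot X t ** Z = Z ** rot X t"
proof -
 have "X ** X ** Z = Z ** (X ** X)" by (metis assms mat_assoc)
 thus ?thesis using assms by (simp add: rot_def mat_lin)
qed

lemma rot_uminus: "rot (- X) t = rot X (- t)"
 by (simp add: rot_def mat_lin)

lemma gen_uminus: "gen X ==> gen (- X)"
 by (simp add: gen_def so_iff tr_simps mat_lin)

lemma matrix_vector_neg: "A *v (- w) = - (A *v (w :: real^'n))"
 by (rule linear_neg[OF matrix_vector_mul_linear])

lemma rot_sum:
 fixes X W :: "real^'n^'n"
 assumes X: "gen X" and W: "gen W" and XW: "X ** W = 0" "W ** X = 0"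
 shows "gen (X + W)" "rot (X + W) t = rot X t ** rot W t" "rot X t ** rot W s = rot W s ** rot X t"
proof -
 have z: "V ** X ** W = 0" "V ** W ** X = 0" for V :: "real^'n^'n" using XW by (simp_all flip: mat_assoc)
 show "gen (X + W)"
  using X W by (simp add: gen_def so_iff tr_simps mat_lin XW z)
 show "rot (X + W) t = rot X t ** rot W t" "rot X t ** rot W s = rot W s ** rot X t"
  by (simp_all add: rot_def mat_lin XW z mat_assoc algebra_simps)
qed

text \<open>Number of factors and total angle are bounded over the whole group, so a bound for the
  cost of single plane rotations bounds all distances between the cosets concerned, with constants
  that do not depend on the metric.\<close>

lemma reach_bounded:
 fixes T :: "'n::finite set"
 shows "EX n R. R >= 0 & (ALL N H al be. hom_metric N (H :: (real^'n^'n) set) --> be >= 0 -->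
  (ALL X:planar T. ALL a:SO. ALL t. gdist N (coset H a) (coset H (a ** rot X t)) <= al + be * abs t) -->
  (ALL a:SO. ALL A:SO. fixes_off T A --> gdist N (coset H a) (coset H (a ** A)) <= real n * al + be * R))"
proof -
 obtain n C where C: "C >= 0" "ALL A:SO. fixes_off T A --> (EX r. reach (planar T) n r A & r <= C * norm (A - mat 1))"
  using SO_reach by blast
 let ?R = "C * (2 * sqrt (real CARD('n)))"
 have "gdist N (coset H a) (coset H (a ** A)) <= real n * al + be * ?R"
  if m: "hom_metric N H" "be >= 0" "ALL X:planar T. ALL a:SO. ALL t. gdist N (coset H a) (coset H (a ** rot X t)) <= al + be * abs t"
   "a : SO" "A : SO" "fixes_off T A" for N H al be and a A :: "real^'n^'n"
 proof -
  interpret hom_metric N H by fact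
  obtain r where r: "reach (planar T) n r A" "r <= C * norm (A - mat 1)" using C(2) m(5,6) by blast
  have "norm (A - mat 1) <= 2 * sqrt (real CARD('n))"
   using norm_triangle_ineq4[of A "mat 1"] SO_norm[OF that(5)] SO_norm[OF SO_id, where 'n = 'n] by simp
  hence "C * norm (A - mat 1) <= ?R" using C(1) by (rule mult_left_mono)
  hence "be * r <= be * ?R" using r(2) that(2) by (intro mult_left_mono) auto
  moreover have "d a (a ** A) <= real n * al + be * r"
   by (rule d_reach[OF planar_gen _ r(1) that(4)]) (use that(3) in blast)
  ultimately show ?thesis by linarith
 qed
 thus ?thesis using C(1) by (intro exI[of _ n] exI[of _ ?R]) auto
qed

lemma rot_id_or_flip:
 assumes u: "norm u = 1" "norm v = 1" "u \<bullet> v = 0" and w: "u \<bullet> w = 0" "v \<bullet> w = 0"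
 shows "rot (Xg u v) t *v w = w" "rot (Xg u v) t *v u = cos t *R u + sin t *R v" "rot (Xg u v) t *v v = cos t *R v - sin t *R u"
proof -
 have "u \<bullet> u = 1" "v \<bullet> v = 1" "v \<bullet> u = 0" using u by (simp_all add: norm_eq_1 inner_commute)
 thus "rot (Xg u v) t *v w = w" "rot (Xg u v) t *v u = cos t *R u + sin t *R v" "rot (Xg u v) t *v v = cos t *R v - sin t *R u"
  using u(3) w by (simp_all add: rot_Xg_vec[OF u] algebra_simps)
qed

abbreviation ax :: "'n => real^'n" where "ax p \<equiv> axis p 1"

lemma ax_simps [simp]: "ax p \<bullet> ax q = (if p = q then 1 else 0)" "norm (ax p) = 1"
 by (simp_all add: inner_axis_axis)

lemma mat_axis: "(A *v ax q) $ p = A $ p $ q"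
 by (simp add: matrix_vector_mult_basis column_def)

lemma Dmat_axis: "Dmat *v ax p = (if fst p = None then -1 else 1) *R ax p"
proof -
 have "(Dmat *v ax p) $ i = ((if fst p = None then -1 else 1) *R ax p) $ i" for i
  unfolding mat_axis by (auto simp: Dmat_def axis_def)
 thus ?thesis by (simp add: vec_eq_iff)
qed

lemma Jmat_axis: "Jmat *v ax (i, False) = ax (i, True)" "Jmat *v ax (i, True) = - ax (i, False)"
proof -
 have "(Jmat *v ax (i, False)) $ p = ax (i, True) $ p & (Jmat *v ax (i, True)) $ p = (- ax (i, False)) $ p" for p
  unfolding mat_axis by (cases p) (auto simp: Jmat_def axis_def)
 thus "Jmat *v ax (i, False) = ax (i, True)" "Jmat *v ax (i, True) = - ax (i, False)" by (simp_all add: vec_eq_iff)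
qed

lemma Jmat_axis_ex: "EX p' c. Jmat *v ax q = c *R ax p' & fst p' = fst q & p' ~= q & c : {1, -1}"
proof (cases q)
 case (Pair i c)
 thus ?thesis
  by (intro exI[of _ "(i, ~ c)"] exI[of _ "if c then -1 else 1"]) (cases c; simp add: Jmat_axis)
qed

lemma Jmat_vec: "Jmat *v (Jmat *v w) = - w" "(Jmat *v v) \<bullet> w = - (v \<bullet> (Jmat *v w))" "(Jmat *v v) \<bullet> (Jmat *v w) = v \<bullet> w"
proof -
 show 1: "Jmat *v (Jmat *v w) = - w" for w :: "real^('a option * bool)"
  by (simp add: matrix_vector_mul_assoc Jmat_sq)
   (simp add: vec_eq_iff matrix_vector_mult_def mat_def if_distrib if_distribR sum_negf cong: if_cong)
 show 2: "(Jmat *v v) \<bullet> w = - (v \<bullet> (Jmat *v w))" for v w :: "real^('a option * bool)"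
 proof -
  have "(Jmat *v v) \<bullet> w = v \<bullet> (transpose Jmat *v w)" by (metis dot_lmul_matrix transpose_matrix_vector transpose_transpose)
  thus ?thesis
   by (simp add: tr_Jmat) (simp add: matrix_vector_mult_def inner_vec_def sum_negf)
 qed
 show "(Jmat *v v) \<bullet> (Jmat *v w) = v \<bullet> w" by (simp add: 1 2)
qed

lemma Dmat_Xg: "Dmat ** Xg (ax p) (ax q) ** Dmat = (if (fst p = None) = (fst q = None) then 1 else -1) *R Xg (ax p) (ax q)"
 using Xg_conj[of Dmat "ax p" "ax q"] by (auto simp: tr_Dmat Dmat_axis Xg_scale)

lemma Jmat_Xg: "Jmat ** Xg u v ** Jmat = - Xg (Jmat *v u) (Jmat *v v)"
proof -
 have "- (Jmat ** Xg u v ** Jmat) = Xg (Jmat *v u) (Jmat *v v)"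
  using Xg_conj[of Jmat u v] by (simp add: tr_Jmat mat_lin)
 thus ?thesis by (metis minus_minus)
qed

lemma Ps_blockdiag:
 assumes "X : so" "Dmat ** X ** Dmat = X" shows "Pr (-1) b X = 0"
proof -
 have S: "X - transpose X = 2 *R X" using assms by (simp add: so_iff scaleR_2)
 have "Jmat ** Dmat ** X ** Dmat ** Jmat = Jmat ** (Dmat ** X ** Dmat) ** Jmat" by (simp add: mat_assoc)
 thus ?thesis unfolding Pr_def S by (simp add: mat_lin assms(2))
qed

lemma Ps_offdiag:
 assumes "X : so" "Dmat ** X ** Dmat = - X" shows "Pr 1 b X = 0"
proof -
 have S: "X - transpose X = 2 *R X" using assms by (simp add: so_iff scaleR_2)
 have "Jmat ** Dmat ** X ** Dmat ** Jmat = Jmat ** (Dmat ** X ** Dmat) ** Jmat" by (simp add: mat_assoc)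
 thus ?thesis unfolding Pr_def S by (simp add: mat_lin assms(2))
qed

text \<open>Every rotation in a plane that meets both blocks is a product of two rotations in \<open>m1\<close> (or two in
  \<open>m2\<close>), up to conjugation by a half turn in the second block.\<close>

lemma cross_rotation:
 fixes q r :: "'m::finite option * bool"
 assumes p: "fst p = None" and q: "fst q ~= None" and r: "fst r ~= None" "fst r ~= fst q" and b: "b : {1, -1 :: real}"
 defines "X \<equiv> Xg (ax p) (ax q)" and "W \<equiv> b *R Xg (Jmat *v ax p) (Jmat *v ax q)" and "Z \<equiv> Xg (Jmat *v ax q) (ax r)"
 shows "gen (X + W)" "X + W : Esp (-1) (- b)" "gen Z" "Dmat ** Z ** Dmat = Z"
  "rot X t = rot (X + W) (t/2) ** rot Z pi ** rot (X + W) (t/2) ** rot Z (- pi)"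
proof -
 define u v where "u = Jmat *v ax p" and "v = Jmat *v ax q"
 have j: "EX p' c. v = c *R ax p' & fst p' = fst q & p' ~= q & c : {1, -1}"
  "EX p' c. u = c *R ax p' & fst p' = fst p & p' ~= p & c : {1, -1}"
  unfolding u_def v_def by (rule Jmat_axis_ex)+
 have ne: "p ~= q" "p ~= r" "q ~= r" using assms(1-4) by auto
 have o: "u \<bullet> ax p = 0" "u \<bullet> ax q = 0" "u \<bullet> ax r = 0" "u \<bullet> v = 0" "v \<bullet> ax p = 0" "v \<bullet> ax q = 0" "v \<bullet> ax r = 0"
  "norm u = 1" "norm v = 1"
  using j assms(1-4) by auto
 have o': "ax p \<bullet> u = 0" "ax q \<bullet> u = 0" "v \<bullet> u = 0" "ax p \<bullet> v = 0" "ax q \<bullet> v = 0" "ax r \<bullet> u = 0"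
  using o by (simp_all add: inner_commute)
 have X: "gen X" unfolding X_def by (rule gen_Xg) (use ne in auto)
 have W1: "gen (Xg u v)" by (rule gen_Xg) (use o in auto)
 have W: "gen W" using b W1 by (auto simp: W_def gen_uminus u_def v_def)
 have "(X ** Xg u v) *v w = 0" "(Xg u v ** X) *v w = 0" for w
  unfolding X_def by (simp_all add: Xg_vec o o' inner_diff_right flip: matrix_vector_mul_assoc)
 hence "X ** Xg u v = 0" "Xg u v ** X = 0" by (simp_all add: matrix_eq)
 hence XW: "X ** W = 0" "W ** X = 0" by (simp_all add: W_def u_def v_def mat_lin)
 show gXW: "gen (X + W)" by (rule rot_sum[OF X W XW])
 show Z: "gen Z" unfolding Z_def by (rule gen_Xg) (use o in "auto simp: v_def")
 have D: "Dmat *v u = - u" "Dmat *v v = v" using j p q by (auto simp: matrix_vector_mult_scaleR Dmat_axis matrix_vector_neg)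
 show "Dmat ** Z ** Dmat = Z"
  using Xg_conj[of Dmat v "ax r"] r(1) D by (simp add: Z_def tr_Dmat Dmat_axis v_def)
 have DX: "Dmat ** X ** Dmat = - X" unfolding X_def Dmat_Xg by (subst if_not_P) (use p q in auto)
 have DW: "Dmat ** W ** Dmat = - W"
  using Xg_conj[of Dmat u v] D by (simp add: W_def u_def v_def tr_Dmat Xg_scale mat_lin)
 have JX: "Jmat ** X ** Jmat = - Xg u v" by (simp add: X_def Jmat_Xg u_def v_def)
 have JW: "Jmat ** Xg u v ** Jmat = - X" by (simp add: X_def Jmat_Xg u_def v_def Jmat_vec Xg_scale)
 have "Jmat ** (X + W) ** Jmat = (- b) *R (X + W)"
  using b JX JW by (auto simp: W_def u_def v_def mat_lin)
 moreover have "Dmat ** (X + W) ** Dmat = (- 1) *R (X + W)" using DX DW by (simp add: mat_lin)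
 ultimately show "X + W : Esp (-1) (- b)" using gXW by (simp add: Esp_def gen_def)
 \<comment> \<open>The half turn fixes the plane of \<open>X\<close> and reverses one axis of the
   plane of \<open>W\<close>. In the product the rotations of the second plane therefore cancel, and
   those of the first add up to the angle \<open>t\<close>.\<close>
 define S where "S = rot Z pi"
 have S: "S : SO" unfolding S_def by (rule rot_SO[OF Z])
 have zz: "norm v = 1" "norm (ax r) = 1" "v \<bullet> ax r = 0" using o by auto
 have "S *v ax p = ax p" "S *v ax q = ax q" "S *v u = u"
  unfolding S_def Z_def v_def[symmetric] by (rule rot_id_or_flip[OF zz]; use o o' ne in auto)+
 moreover have "S *v v = - v"
  using rot_id_or_flip(2)[OF zz, of 0 pi] by (simp add: S_def Z_def v_def)
 ultimately have SX: "S ** X ** transpose S = X" "S ** W ** transpose S = - W"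
  by (simp_all add: X_def W_def u_def v_def Xg_conj Xg_scale mat_lin)
 have XW': "X ** (- W) = 0" "- W ** X = 0" "gen (- W)" using XW W by (simp_all add: mat_lin gen_uminus)
 have "S ** (X + W) ** transpose S = X + - W" using SX by (simp add: mat_lin)
 hence "S ** rot (X + W) (t/2) ** transpose S = rot (X + - W) (t/2)" by (simp only: rot_conj[OF S])
 also have "... = rot (- W) (t/2) ** rot X (t/2)"
  using rot_sum(2,3)[OF X XW'(3,1,2)] by simp
 finally have "rot (X + W) (t/2) ** (S ** rot (X + W) (t/2) ** transpose S)
   = rot X (t/2) ** (rot W (t/2) ** rot W (- (t/2))) ** rot X (t/2)"
  by (simp add: rot_sum(2)[OF X W XW] rot_uminus mat_assoc)
 also have "... = rot X t" by (simp add: rot_add[OF W] rot_add[OF X])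
 finally show "rot X t = rot (X + W) (t/2) ** rot Z pi ** rot (X + W) (t/2) ** rot Z (- pi)"
  by (simp add: S_def rot_transpose[OF Z] mat_assoc)
qed

lemma in_U1U_if_fixes:
 assumes A: "A : SO" "A ** Jmat = Jmat ** A" and e: "A *v ax (None, False) = ax (None, False)"
 shows "(A :: 'm::finite mat) : U1U_grp"
proof -
 have "A *v ax (None, True) = A *v (Jmat *v ax (None, False))" by (simp add: Jmat_axis)
 also have "... = Jmat *v (A *v ax (None, False))" by (simp add: matrix_vector_mul_assoc A(2))
 finally have f: "A *v ax (None, c) = ax (None, c)" for c using e by (cases c) (simp_all add: Jmat_axis)
 have 1: "A $ p $ q = 0" if pq: "fst q = None" "fst p ~= None" for p q
 proof -
  have "(A *v ax (None, snd q)) $ p = ax (None, snd q) $ p" using f by simp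
  thus ?thesis unfolding mat_axis using pq by (cases q) (auto simp: axis_def)
 qed
 have 2: "A $ p $ q = 0" if pq: "fst p = None" "fst q ~= None" for p q
 proof -
  have "(A *v ax p) \<bullet> (A *v ax q) = 0" using pq by (auto simp: SO_inner[OF A(1)])
  moreover have "A *v ax p = ax p" using f[of "snd p"] pq by (cases p) simp
  ultimately show ?thesis by (simp add: inner_axis' mat_axis)
 qed
 have "A : U_grp" using A by (simp add: U_grp_def)
 thus ?thesis unfolding U1U_grp_def blockdiag_def using 1 2 by blast
qed

lemma polar_pair: "EX rh ph. rh >= 0 & a = rh * cos ph & b = rh * sin (ph::real)"
 using polar_angle[of a "abs (a - 1) + abs b" b] by (metis abs_ge_zero add_increasing add_increasing2 order_refl)

text \<open>Polar decomposition of \<open>U(l)\<close> along the projective space \<open>U(l)/(U(1) \<times> U(l-1))\<close>.\<close>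

lemma U_grp_decomp:
 assumes h: "(h :: 'm::finite mat) : U_grp"
 obtains X t k where "gen X" "X : Esp (-1) (-1)" "abs t <= pi" "k : U1U_grp" "h = rot X t ** k"
proof -
 let ?e = "ax (None, False) :: real^('m option * bool)" and ?f = "ax (None, True) :: real^('m option * bool)"
 have hJ: "h : SO" "h ** Jmat = Jmat ** h" using h by (auto simp: U_grp_def)
 define v0 where "v0 = h *v ?e"
 obtain rh ph where rh: "rh >= 0" "v0 \<bullet> ?e = rh * cos ph" "- (v0 \<bullet> ?f) = rh * sin ph" using polar_pair by metis
 \<comment> \<open>A phase in the centre of U(l) makes the first complex coordinate of the image of
   the basis vector real and nonnegative.\<close>
 define ka where "ka = cos ph *R (mat 1 :: 'm mat) + sin ph *R Jmat"
 have kaSO: "ka : SO" unfolding ka_def by (rule rotation_SO[OF Jmat_sq tr_Jmat])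
 have ka: "ka : U1U_grp"
  using kaSO by (simp add: U1U_iff) (simp add: ka_def mat_lin Dmat_Jmat)
 define g where "g = h ** ka"
 have g: "g : SO" "g ** Jmat = Jmat ** g"
 proof -
  show "g : SO" unfolding g_def by (rule SO_mult[OF hJ(1) kaSO])
  have "ka ** Jmat = Jmat ** ka" using ka by (simp add: U1U_iff)
  thus "g ** Jmat = Jmat ** g" unfolding g_def by (metis hJ(2) mat_assoc)
 qed
 have ht: "h = g ** transpose ka" using SO_transpose(2)[OF kaSO] by (simp add: g_def flip: mat_assoc)
 have kat: "transpose ka : U1U_grp" using ka unfolding U1U_stab by (rule stab_group)
 define v where "v = g *v ?e"
 have hf: "h *v ?f = Jmat *v v0"
  by (simp add: v0_def matrix_vector_mul_assoc flip: hJ(2)) (simp add: Jmat_axis flip: matrix_vector_mul_assoc)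
 have v: "v = cos ph *R v0 + sin ph *R (Jmat *v v0)"
 proof -
  have "ka *v ?e = cos ph *R ?e + sin ph *R ?f"
   by (simp add: ka_def matrix_vector_mult_add_rdistrib scaleR_matrix_vector_assoc[symmetric] Jmat_axis)
  hence "v = h *v (cos ph *R ?e + sin ph *R ?f)" by (simp add: v_def g_def flip: matrix_vector_mul_assoc)
  thus ?thesis by (simp add: matrix_vector_right_distrib matrix_vector_mult_scaleR hf v0_def)
 qed
 have Je: "Jmat *v ?e = ?f" "Jmat *v ?f = - ?e" by (simp_all add: Jmat_axis)
 have ve: "v \<bullet> ?e = rh"
 proof -
  have "v \<bullet> ?e = cos ph * (v0 \<bullet> ?e) + sin ph * (- (v0 \<bullet> ?f))" by (simp add: v inner_add_left Jmat_vec(2) Je)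
  also have "... = rh * ((sin ph)^2 + (cos ph)^2)" unfolding rh(2,3)
   by (simp add: algebra_simps power2_eq_square del: sin_cos_squared_add sin_cos_squared_add2 sin_cos_squared_add3)
  finally show ?thesis by simp
 qed
 have vf: "v \<bullet> ?f = 0"
 proof -
  have "v \<bullet> ?f = sin ph * (v0 \<bullet> ?e) - cos ph * (- (v0 \<bullet> ?f))" by (simp add: v inner_add_left Jmat_vec(2) Je inner_minus_right)
  thus ?thesis unfolding rh(2,3) by simp
 qed
 have vv: "v \<bullet> v = 1" unfolding v_def SO_inner[OF g(1)] by simp
 have "rh <= 1" using Cauchy_Schwarz_ineq2[of v ?e] ve vv by (simp add: norm_eq_sqrt_inner)
 show ?thesis
 proof (cases "rh = 1")
  case True
  have "(v - ?e) \<bullet> (v - ?e) = 0" using ve vv True by (simp add: inner_diff_left inner_diff_right inner_commute)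
  hence "g *v ?e = ?e" by (simp add: v_def)
  hence "g : U1U_grp" by (rule in_U1U_if_fixes[OF g])
  hence "h : U1U_grp" using ht kat unfolding U1U_stab by (simp add: stab_group)
  moreover have "gen (0 :: 'm mat)" by (simp add: gen_def so_iff tr_simps)
  moreover have "(0 :: 'm mat) : Esp (-1) (-1)" using subspace_0[OF subspace_E] .
  ultimately show ?thesis using that[of 0 0 h] by simp
 next
  case False
  hence r1: "rh < 1" using `rh <= 1` by simp
  define s where "s = sqrt (1 - rh^2)"
  have r2: "1 - rh^2 > 0" using r1 rh(1) by (simp add: power_less_one_iff abs_square_less_1)
  hence s: "s > 0" "s * s = 1 - rh^2" by (simp_all add: s_def)
  define w where "w = (1/s) *R (v - rh *R ?e)"
  have vw: "v = rh *R ?e + s *R w" using s by (simp add: w_def)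
  have we: "w \<bullet> ?e = 0" "w \<bullet> ?f = 0" using ve vf by (simp_all add: w_def inner_diff_left)
  have "(v - rh *R ?e) \<bullet> (v - rh *R ?e) = 1 - rh^2"
   using ve vv by (simp add: inner_diff_left inner_diff_right inner_commute power2_eq_square)
  moreover have "w \<bullet> w = (1/s) * (1/s) * ((v - rh *R ?e) \<bullet> (v - rh *R ?e))"
   unfolding w_def inner_scaleR_left inner_scaleR_right by (rule mult.assoc[symmetric])
  ultimately have ww: "w \<bullet> w = 1" unfolding s(2)[symmetric] using s(1) by simp
  define Jw where "Jw = Jmat *v w"
  have Jw: "Jw \<bullet> ?e = 0" "Jw \<bullet> ?f = 0" "Jw \<bullet> w = 0" "Jw \<bullet> Jw = 1"
   unfolding Jw_def using we ww Jmat_vec(2)[of w w] by (simp_all add: Jmat_vec Je inner_commute)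
  have nw: "norm w = 1" "norm Jw = 1" using ww Jw(4) by (simp_all add: norm_eq_1)
  have o: "?e \<bullet> w = 0" "?f \<bullet> w = 0" "?e \<bullet> Jw = 0" "?f \<bullet> Jw = 0" "w \<bullet> Jw = 0"
   using we Jw by (simp_all add: inner_commute)
  \<comment> \<open>The sum of the two generators turns the basis vector towards \<open>w\<close>
    complex linearly: one acts in the plane of the vector and \<open>w\<close>, the other in the
    image of that plane under J.\<close>
  define X1 X2 where "X1 = Xg ?e w" and "X2 = Xg ?f Jw"
  have X1: "gen X1" and X2: "gen X2" unfolding X1_def X2_def by (rule gen_Xg; use nw o in simp)+
  have "(X1 ** X2) *v z = 0" "(X2 ** X1) *v z = 0" for z
   unfolding X1_def X2_def by (simp_all add: Xg_vec o we Jw inner_diff_right flip: matrix_vector_mul_assoc)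
  hence X12: "X1 ** X2 = 0" "X2 ** X1 = 0" by (simp_all add: matrix_eq)
  define X where "X = X1 + X2"
  have X: "gen X" unfolding X_def by (rule rot_sum[OF X1 X2 X12])
  have "Jmat ** X1 ** Jmat = - X2" "Jmat ** X2 ** Jmat = - X1"
   by (simp_all add: X1_def X2_def Jmat_Xg Je Jw_def Jmat_vec Xg_scale)
  hence JX: "Jmat ** X ** Jmat = - X" by (simp add: X_def mat_lin)
  have Dw: "Dmat *v w = w" "Dmat *v Jw = Jw"
  proof -
   have "Dmat *v z = z" if "z \<bullet> ?e = 0" "z \<bullet> ?f = 0" for z
   proof -
    have zn: "z $ p = 0" if "fst p = None" for p
     using that `z \<bullet> ?e = 0` `z \<bullet> ?f = 0` by (cases p; cases "snd p") (auto simp: inner_axis)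
    have "(Dmat *v z) $ p = z $ p" for p
    proof -
     have "(Dmat *v z) $ p = (SUM q:UNIV. if q = p then (if fst p = None then -1 else 1) * z $ p else 0)"
      unfolding matrix_vector_mult_def vec_lambda_beta by (intro sum.cong refl) (auto simp: Dmat_def)
     thus ?thesis using zn[of p] by auto
    qed
    thus ?thesis by (simp add: vec_eq_iff)
   qed
   thus "Dmat *v w = w" "Dmat *v Jw = Jw" using we Jw by auto
  qed
  have "Dmat ** X1 ** Dmat = - X1" "Dmat ** X2 ** Dmat = - X2"
   using Xg_conj[of Dmat ?e w] Xg_conj[of Dmat ?f Jw]
   by (simp_all add: X1_def X2_def tr_Dmat Dmat_axis Dw Xg_scale)
  hence DX: "Dmat ** X ** Dmat = - X" by (simp add: X_def mat_lin)
  have XE: "X : Esp (-1) (-1)" using X DX JX by (simp add: Esp_def gen_def)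
  define t where "t = arccos rh"
  have t: "cos t = rh" "sin t = s" "abs t <= pi"
   using rh(1) r1 by (auto simp: t_def s_def sin_arccos arccos_lbound arccos_ubound intro: order_trans[OF arccos_ubound])
  have "rot X2 t *v ?e = ?e" unfolding X2_def
   by (rule rot_id_or_flip) (use nw o Jw in auto)
  moreover have "rot X1 t *v ?e = cos t *R ?e + sin t *R w" unfolding X1_def
   by (rule rot_id_or_flip(2)[of _ _ 0]) (use nw o in auto)
  ultimately have re: "rot X t *v ?e = v"
   unfolding X_def rot_sum(2)[OF X1 X2 X12] vw by (simp add: t flip: matrix_vector_mul_assoc)
  define k where "k = transpose (rot X t) ** g"
  have rS: "rot X t : SO" by (rule rot_SO[OF X])
  have "X ** Jmat = Jmat ** X" using JX Jmat_conj_iff(1)[of X] by simp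
  from rot_commute[OF this, of "- t"] have "rot X (- t) : stab Jmat" by (simp add: stab_def rot_SO[OF X])
  moreover have "g : stab Jmat" using g by (simp add: stab_def)
  ultimately have "rot X (- t) ** g : stab Jmat" by (rule stab_group(3))
  hence "k ** Jmat = Jmat ** k" unfolding k_def rot_transpose[OF X] by (simp add: stab_def)
  moreover have "k *v ?e = ?e"
  proof -
   have "k *v ?e = transpose (rot X t) *v (rot X t *v ?e)" by (simp add: k_def re v_def flip: matrix_vector_mul_assoc)
   thus ?thesis by (simp add: matrix_vector_mul_assoc SO_transpose(1)[OF rS])
  qed
  moreover have "k : SO" unfolding k_def by (intro SO_mult SO_inv rS g)
  ultimately have "k : U1U_grp" by (intro in_U1U_if_fixes)
  hence "k ** transpose ka : U1U_grp" using kat unfolding U1U_stab by (rule stab_group)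
  moreover have "h = rot X t ** (k ** transpose ka)"
   using SO_transpose(2)[OF rS] by (simp add: ht k_def mat_assoc)
  ultimately show ?thesis by (rule that[OF X XE t(3)])
 qed
qed

text \<open>The rotation of the first block alone already lies in \<open>U1U_grp\<close>. Dividing
  it off leaves a rotation that moves only the second block.\<close>

lemma SO2SO_decomp:
 assumes h: "(h :: 'm::finite mat) : SO2SO_grp"
 obtains k where "k : U1U_grp" "h ** k : SO" "fixes_off {p. fst p ~= None} (h ** k)"
proof -
 let ?e = "ax (None, False) :: real^('m option * bool)" and ?f = "ax (None, True) :: real^('m option * bool)"
 define al be where "al = h $ (None, False) $ (None, False)" and "be = h $ (None, True) $ (None, False)"
 note b = SO2SO_block[OF h, folded al_def be_def]
 have h0: "h : SO" "blockdiag h" using h by (auto simp: SO2SO_grp_def)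
 obtain ph where ph: "al = cos ph" "be = sin ph"
 proof -
  obtain t where "al = cos t" "be = sin t" using sincos_total_2pi[OF b(3)] by metis
  thus ?thesis by (rule that)
 qed
 have z: "h $ p $ q = 0" if "fst p ~= None" "fst q = None" for p q using h0(2)[unfolded blockdiag_def, rule_format, of p q] that by simp
 have he: "h *v ?e = al *R ?e + be *R ?f" "h *v ?f = (- be) *R ?e + al *R ?f"
 proof -
  have "(h *v ?e) $ p = (al *R ?e + be *R ?f) $ p & (h *v ?f) $ p = ((- be) *R ?e + al *R ?f) $ p" for p
  proof -
   obtain i c where p: "p = (i, c)" by (metis surj_pair)
   show ?thesis unfolding p mat_axis using b z[of "(i, c)"] by (cases i; cases c) (auto simp: axis_def al_def be_def)
  qed
  thus "h *v ?e = al *R ?e + be *R ?f" "h *v ?f = (- be) *R ?e + al *R ?f" by (simp_all add: vec_eq_iff)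
 qed
 define Y where "Y = Xg ?e ?f"
 have Y: "gen Y" unfolding Y_def by (rule gen_Xg) auto
 define k where "k = rot Y (- ph)"
 have "Jmat ** Y ** Jmat = - Y" by (simp add: Y_def Jmat_Xg Jmat_axis Xg_scale) (simp add: Xg_flip[of ?f])
 hence YJ: "Y ** Jmat = Jmat ** Y" using Jmat_conj_iff(1)[of Y] by simp
 have "Dmat ** Y ** Dmat = Y" by (simp add: Y_def Dmat_Xg)
 hence YD: "Y ** Dmat = Dmat ** Y" by (metis Dmat_sq_left mat_assoc)
 have k: "k : U1U_grp"
  unfolding U1U_iff k_def using rot_SO[OF Y] rot_commute[OF YJ] rot_commute[OF YD] by blast
 have ke: "k *v ?e = cos ph *R ?e - sin ph *R ?f" "k *v ?f = cos ph *R ?f + sin ph *R ?e"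
  unfolding k_def Y_def using rot_id_or_flip(2,3)[of ?e ?f 0 "- ph"] by auto
 have cs: "cos ph * cos ph + sin ph * sin ph = 1" by (simp flip: power2_eq_square)
 have "(h ** k) *v ?e = (cos ph * cos ph + sin ph * sin ph) *R ?e"
  by (simp only: matrix_vector_mul_assoc[symmetric] ke matrix_vector_mult_diff_distrib matrix_vector_mult_scaleR he ph)
    (simp add: algebra_simps del: sin_cos_squared_add3)
 moreover have "(h ** k) *v ?f = (cos ph * cos ph + sin ph * sin ph) *R ?f"
  by (simp only: matrix_vector_mul_assoc[symmetric] ke matrix_vector_right_distrib matrix_vector_mult_scaleR he ph)
    (simp add: algebra_simps del: sin_cos_squared_add3)
 ultimately have f: "(h ** k) *v ax (None, c) = ax (None, c)" for c using cs by (cases c) auto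
 have "fixes_off {p. fst p ~= None} (h ** k)"
  unfolding fixes_off_def using f by (metis (mono_tags) mem_Collect_eq prod.collapse)
 moreover have "h ** k : SO" using h0(1) k by (intro SO_mult) (auto simp: U1U_iff)
 ultimately show ?thesis using that k by blast
qed

lemma metric_on_cosets:
 fixes Z :: "real^'n^'n"
 assumes h: "hom_metric N (stab Z)" and c: "EX C>=0. ALL xi:so. norm (bracket xi Z) <= C * N xi"
 shows "metric_on (cosets (stab Z)) (gdist N)"
proof -
 interpret hom_metric N "stab Z" by (rule h)
 obtain C where C: "C >= 0" "!!xi. xi : so ==> norm (bracket xi Z) <= C * N xi" using c by blast
 have Z: "k : stab Z \<longleftrightarrow> k ** Z = Z ** k" if "k : SO" for k using that by (simp add: stab_def)
 show ?thesis
  unfolding metric_on_def cosets_eq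
  using d_nonneg d_commute d_eq_0[OF Z C(2,1)] d_triangle by simp
qed

text \<open>Reflecting one coordinate of the first block exchanges \<open>m1\<close> and \<open>m2\<close>; this reduces the limit at
  \<open>M\<close> to the one at \<open>K\<close>.\<close>

definition Fl :: "'m::finite mat" where
 "Fl = (\<chi> p q. if p = q then if p = (None, True) then - 1 else 1 else 0)"

lemma Fl_left:
 fixes X :: "'m::finite mat"
 shows "(Fl ** X) $ p $ q = (if p = (None, True) then - 1 else 1) * X $ p $ q"
proof -
 have "(SUM k:UNIV. (Fl :: 'm mat) $ p $ k * X $ k $ q) = (SUM k:UNIV. if k = p then (if p = (None, True) then - 1 else 1) * X $ p $ q else 0)"
  by (rule sum.cong) (auto simp: Fl_def)
 thus ?thesis by (simp add: matrix_matrix_mult_def)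
qed

lemma transpose_Fl: "transpose Fl = Fl"
proof -
 have "transpose Fl $ p $ q = (Fl :: 'a mat) $ p $ q" for p q
  by (cases "p = q") (simp_all add: transpose_def Fl_def)
 thus ?thesis by (simp only: vec_eq_iff) blast
qed

lemma Fl_right:
 fixes X :: "'m::finite mat"
 shows "(X ** Fl) $ p $ q = (if q = (None, True) then - 1 else 1) * X $ p $ q"
proof -
 have "X ** Fl = transpose (Fl ** transpose X)" by (simp add: tr_simps transpose_Fl)
 hence "(X ** Fl) $ p $ q = (Fl ** transpose X) $ q $ p" by (simp add: transpose_def)
 thus ?thesis by (simp add: Fl_left transpose_def)
qed

lemma Fl_sq: "Fl ** Fl = mat 1"
proof -
 have "(Fl ** Fl) $ p $ q = (mat 1 :: 'a mat) $ p $ q" for p q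
  unfolding Fl_left by (simp add: Fl_def mat_def)
 thus ?thesis unfolding vec_eq_iff by blast
qed

lemma Fl_DJ: "Fl ** Dmat = Dmat ** (Fl :: 'a::finite mat)" "Fl ** Jmat = Dmat ** Jmat ** (Fl :: 'a mat)"
proof -
 have "(Fl ** Dmat :: 'a mat) $ p $ q = (Dmat ** Fl) $ p $ q" for p q
  unfolding Fl_left Fl_right by (auto simp: Dmat_def)
 thus "Fl ** Dmat = Dmat ** (Fl :: 'a mat)" unfolding vec_eq_iff by blast
 have "(Fl ** Jmat :: 'a mat) $ p $ q = (Dmat ** Jmat ** Fl) $ p $ q" for p q
  unfolding Fl_left Fl_right Dmat_left by (cases p; cases q) (auto simp: Jmat_def)
 thus "Fl ** Jmat = Dmat ** Jmat ** (Fl :: 'a mat)" unfolding vec_eq_iff by blast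
qed

definition cj :: "'m::finite mat => 'm mat" where "cj X = Fl ** X ** Fl"

lemma cj_mult: "cj (X ** Y) = cj X ** cj Y"
proof -
 have "Fl ** X ** Fl ** (Fl ** Y ** Fl) = Fl ** X ** (Fl ** Fl) ** Y ** Fl" by (simp only: mat_assoc)
 thus ?thesis by (simp add: cj_def Fl_sq mat_assoc)
qed

lemma cj_cj: "cj (cj X) = X"
proof -
 have "cj (cj X) = (Fl ** Fl) ** X ** (Fl ** Fl)" by (simp only: cj_def mat_assoc)
 thus ?thesis by (simp add: Fl_sq)
qed

lemma cj_DJ: "cj Dmat = Dmat" "cj Jmat = Dmat ** Jmat"
proof -
 have "cj Dmat = Dmat ** (Fl ** Fl)" "cj Jmat = Dmat ** Jmat ** (Fl ** Fl)"
  by (simp_all only: cj_def Fl_DJ mat_assoc)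
 thus "cj Dmat = Dmat" "cj Jmat = Dmat ** Jmat" by (simp_all add: Fl_sq)
qed

lemma cj_linear: "cj (X + Y) = cj X + cj Y" "cj (X - Y) = cj X - cj Y" "cj (c *R X) = c *R cj X" "cj (transpose X) = transpose (cj X)"
 by (simp_all add: cj_def mat_lin tr_simps transpose_Fl mat_assoc)

lemma cj_SO: "A : SO ==> cj A : SO"
proof -
 assume A: "A : SO"
 have "det (Fl :: 'a mat) * det (Fl :: 'a mat) = 1" by (simp add: Fl_sq flip: det_mul)
 hence "det (cj A) = 1" using A by (simp add: cj_def det_mul SO_def rotation_matrix_def mult.assoc mult.left_commute)
 moreover have "cj A ** transpose (cj A) = cj (mat 1)" "transpose (cj A) ** cj A = cj (mat 1)"
  using SO_transpose[OF A] by (simp_all flip: cj_mult cj_linear(4))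
 moreover have "cj (mat 1) = (mat 1 :: 'a mat)" by (simp add: cj_def Fl_sq)
 ultimately show ?thesis by (simp add: SO_def rotation_matrix_def orthogonal_matrix_def)
qed

lemma cj_U1U: "A : U1U_grp ==> cj A : U1U_grp"
proof -
 assume "A : U1U_grp"
 hence A: "A : SO" "A ** Jmat = Jmat ** A" "A ** Dmat = Dmat ** A" by (auto simp: U1U_iff)
 have "cj A ** Dmat = Dmat ** cj A" using arg_cong[OF A(3), of cj] by (simp add: cj_mult cj_DJ)
 moreover have "A ** (Dmat ** Jmat) = Dmat ** Jmat ** A" using A by (metis mat_assoc)
 hence "cj A ** cj (Dmat ** Jmat) = cj (Dmat ** Jmat) ** cj A" by (simp flip: cj_mult)
 hence "cj A ** Jmat = Jmat ** cj A" by (simp add: cj_mult cj_DJ Dmat_sq mat_assoc)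
 ultimately show ?thesis using cj_SO[OF A(1)] by (simp add: U1U_iff)
qed

text \<open>Conjugation by \<open>Fl\<close> keeps D and turns J into D J. Hence the degree
  \<open>(a, b)\<close> becomes \<open>(a, a b)\<close>, which exchanges \<open>m1\<close> with
  \<open>m2\<close> and keeps \<open>m3\<close>.\<close>

lemma Pr_cj:
 fixes X :: "'m::finite mat"
 assumes "a : {1, -1}" shows "Pr a b (cj X) = cj (Pr a (a * b) X)"
proof -
 define S where "S = X - transpose X"
 have 1: "cj X - transpose (cj X) = cj S" by (simp add: S_def cj_linear)
 have 2: "Dmat ** cj S ** Dmat = cj (Dmat ** S ** Dmat)" by (simp add: cj_mult cj_DJ)
 have J: "Jmat = cj (Dmat ** Jmat)" by (simp add: cj_mult cj_DJ Dmat_sq mat_assoc)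
 have 3: "Jmat ** cj S ** Jmat = cj (Jmat ** Dmat ** S ** Dmat ** Jmat)"
 proof -
  have "Jmat ** cj S ** Jmat = cj (Dmat ** Jmat) ** cj S ** cj (Dmat ** Jmat)" by (simp only: J[symmetric])
  also have "... = cj (Dmat ** Jmat ** S ** (Dmat ** Jmat))" by (simp only: cj_mult)
  finally show ?thesis by (simp add: Dmat_Jmat Dmat_Jmat_right mat_assoc)
 qed
 have 4: "Jmat ** Dmat ** cj S ** Dmat ** Jmat = cj (Jmat ** S ** Jmat)"
 proof -
  have "cj (Jmat ** S ** Jmat) = Dmat ** Jmat ** cj S ** (Dmat ** Jmat)" by (simp add: cj_mult cj_DJ)
  thus ?thesis by (simp add: Dmat_Jmat Dmat_Jmat_right mat_assoc)
 qed
 have "a * (a * b) = b" using assms by auto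
 thus ?thesis unfolding Pr_def 1 2 3 4 by (simp add: cj_linear S_def algebra_simps)
qed

lemma norm_cj: "norm (cj X) = norm (X :: 'm::finite mat)"
 unfolding norm_eq_sqrt_inner cj_def inner_conj transpose_Fl
 by (simp add: cj_cj flip: cj_def)

lemma metric_on_unit: "metric_on {()} (%_ _. 0)"
 by (simp add: metric_on_def)

section \<open>Diameter bounds near the degenerate metrics\<close>

context
 fixes l :: nat
 assumes card: "CARD('m::finite option) = l" and l4: "l >= 4"
begin

abbreviation dp :: "real * real => 'm mat => 'm mat => real" where
 "dp p a b \<equiv> gdist (fn p) (coset U1U_grp a) (coset U1U_grp b)"

definition cst :: "real => real" where "cst w = sqrt ((2 * real l - 2) * (2 * real l) * w)"

lemma cst_nonneg: "w >= 0 ==> cst w >= 0"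
 using l4 by (simp add: cst_def)

lemma cst_tendsto: "(w \<longlongrightarrow> 0) F ==> ((%t. A * cst (w t)) \<longlongrightarrow> 0) F"
proof -
 assume "(w \<longlongrightarrow> 0) F"
 hence "((%t. A * cst (w t)) \<longlongrightarrow> A * cst 0) F" unfolding cst_def by (intro tendsto_intros)
 thus ?thesis by (simp add: cst_def)
qed

lemma cost:
 assumes p: "p : simplex2" and X: "gen X" "!!s. s : Sg ==> Ps s X ~= 0 ==> wt p s <= w" and w: "w >= 0" and a: "a : SO"
 shows "dp p a (a ** rot X t) <= abs t * cst w"
proof -
 interpret hom_metric "fn p" "U1U_grp :: 'm mat set" by (rule hom_metric_fn[OF card l4 p])
 have "fn p X <= cst w" unfolding cst_def by (rule fn_gen_le[OF card l4 X w])
 thus ?thesis using d_rot[OF X(1) a, of t] by (meson abs_ge_zero mult_left_mono order_trans)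
qed

lemma cost_off:
 assumes p: "p : simplex2" and X: "gen X" "Dmat ** X ** Dmat = - X" and a: "a : SO"
 shows "dp p a (a ** rot X t) <= abs t * cst (fst p + snd p)"
proof (rule cost[OF p X(1) _ _ a])
 have so: "X : so" using X by (simp add: gen_def)
 show "wt p s <= fst p + snd p" if "s : Sg" "Ps s X ~= 0" for s
  using that Ps_offdiag[OF so X(2)] p by (auto simp: Sg_def wt_def simplex2_def)
qed (use p in "auto simp: simplex2_def")

lemma cost_block:
 assumes p: "p : simplex2" and X: "gen X" "Dmat ** X ** Dmat = X" and a: "a : SO"
 shows "dp p a (a ** rot X t) <= abs t * cst (1 - fst p - snd p)"
proof (rule cost[OF p X(1) _ _ a])
 have so: "X : so" using X by (simp add: gen_def)
 show "wt p s <= 1 - fst p - snd p" if "s : Sg" "Ps s X ~= 0" for s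
  using that Ps_blockdiag[OF so X(2)] by (auto simp: Sg_def wt_def)
qed (use p in "auto simp: simplex2_def")

lemma cost_Es:
 assumes p: "p : simplex2" and X: "gen X" "X : Es s" "s : Sg" and a: "a : SO"
 shows "dp p a (a ** rot X t) <= abs t * cst (wt p s)"
proof (rule cost[OF p X(1) _ wt_nonneg[OF p] a])
 show "wt p t <= wt p s" if "t : Sg" "Ps t X ~= 0" for t
  using that Ps_Es[OF X(3) that(1) X(2)] by (auto split: if_splits)
qed

lemma cst_mono: "0 <= v ==> v <= w ==> cst v <= cst w"
 unfolding cst_def using l4 by (intro real_sqrt_le_mono mult_left_mono) auto

text \<open>Near \<open>O\<close> rotations joining the two blocks are cheap. A rotation within a
  block is conjugate to such a one by a quarter turn towards an axis of the other block; the two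
  quarter turns cost a fixed amount. The constant 2 pi is chosen to agree with the bound at
  \<open>P\<close> and \<open>Q\<close>.\<close>

lemma planar_cost_O:
 assumes p: "p : simplex2" and X: "X : planar (UNIV :: ('m option * bool) set)" and a: "a : SO"
 shows "dp p a (a ** rot X t) <= 2 * pi * cst (fst p + snd p) + cst (fst p + snd p) * abs t"
proof -
 interpret hom_metric "fn p" "U1U_grp :: 'm mat set" by (rule hom_metric_fn[OF card l4 p])
 let ?c = "cst (fst p + snd p)"
 have c: "?c >= 0" using p by (intro cst_nonneg) (auto simp: simplex2_def)
 obtain i j where ij: "X = Xg (ax i) (ax j)" "i ~= j" using X by (auto simp: planar_def)
 have gX: "gen X" using X planar_gen by auto
 show ?thesis
 proof (cases "(fst i = None) = (fst j = None)")
  case False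
  hence "Dmat ** X ** Dmat = - X" unfolding ij(1) Dmat_Xg by (subst if_not_P) auto
  from cost_off[OF p gX this a, of t] show ?thesis using c by (simp add: mult.commute add_increasing)
 next
  case True
  \<comment> \<open>An axis in the block that does not contain \<open>i\<close> and
    \<open>j\<close>.\<close>
  obtain r :: "'m option * bool" where r: "(fst r = None) ~= (fst i = None)"
  proof (cases "fst i = None")
   case True thus ?thesis using that[of "(Some undefined, False)"] by simp
  next
   case False thus ?thesis using that[of "(None, False)"] by simp
  qed
  hence ne: "r ~= i" "r ~= j" using True by auto
  define Y where "Y = Xg (ax r) (ax i :: real^('m option * bool))"
  define V where "V = Xg (ax r) (ax j :: real^('m option * bool))"
  have gen: "gen Y" "gen V" unfolding Y_def V_def by (rule gen_Xg; use ne in simp)+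
  have D: "Dmat ** Y ** Dmat = - Y" "Dmat ** V ** Dmat = - V"
   unfolding Y_def V_def Dmat_Xg by (subst if_not_P; use r True in auto)+
  define u where "u = rot Y (pi/2)"
  have u: "u : SO" "transpose u = rot Y (- (pi/2))" unfolding u_def using gen by (auto simp: rot_SO rot_transpose)
  have "u *v ax r = ax i" "u *v ax j = ax j"
   unfolding u_def Y_def using rot_id_or_flip(1)[of "ax r" "ax i" "ax j" "pi/2"] rot_id_or_flip(2)[of "ax r" "ax i" 0 "pi/2"] ne ij(2) by auto
  hence "X = u ** V ** transpose u" by (simp add: ij(1) V_def Xg_conj)
  hence "rot X t = u ** rot V t ** transpose u" using rot_conj[OF u(1), of V t] by (simp only:)
  hence e: "a ** rot X t = a ** u ** rot V t ** rot Y (- (pi/2))"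
   by (simp only: u(2) mat_assoc)
  have S: "a ** u : SO" "a ** u ** rot V t : SO" "a ** rot X t : SO" using a u gen gX by (auto intro!: SO_mult rot_SO)
  have "dp p a (a ** u) <= pi/2 * ?c" using cost_off[OF p gen(1) D(1) a, of "pi/2"] by (simp add: u_def)
  moreover have "dp p (a ** u) (a ** u ** rot V t) <= abs t * ?c" by (rule cost_off[OF p gen(2) D(2) S(1)])
  moreover have "dp p (a ** u ** rot V t) (a ** rot X t) <= pi/2 * ?c"
   using cost_off[OF p gen(1) D(1) S(2), of "- (pi/2)"] by (simp add: e)
  moreover have "dp p a (a ** rot X t) <= dp p a (a ** u) + dp p (a ** u) (a ** rot X t)"
   "dp p (a ** u) (a ** rot X t) <= dp p (a ** u) (a ** u ** rot V t) + dp p (a ** u ** rot V t) (a ** rot X t)"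
   using S a by (auto intro!: d_triangle)
  ultimately have "dp p a (a ** rot X t) <= pi * ?c + ?c * abs t" by (simp add: mult.commute)
  moreover have "pi * ?c >= 0" using c by simp
  ultimately show ?thesis by linarith
 qed
qed

text \<open>Near \<open>P\<close> (b = 1) the cheap summands are \<open>m1\<close> and
  \<open>m3\<close>, near \<open>Q\<close> (b = -1) they are \<open>m2\<close> and
  \<open>m3\<close>. Rotations within a block are cheap at once; a rotation joining the blocks is
  replaced by the product in \<open>cross_rotation\<close>, whose two half turns in the second block
  account for the term with 2 pi.\<close>

lemma planar_cost_PQ:
 assumes p: "p : simplex2" and X: "X : planar (UNIV :: ('m option * bool) set)" and a: "a : SO" and b: "b : {1, -1 :: real}"
 shows "dp p a (a ** rot X t) <= 2 * pi * cst (wt p (-1, - b) + (1 - fst p - snd p)) + cst (wt p (-1, - b) + (1 - fst p - snd p)) * abs t"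
proof -
 interpret hom_metric "fn p" "U1U_grp :: 'm mat set" by (rule hom_metric_fn[OF card l4 p])
 let ?c = "cst (wt p (-1, - b) + (1 - fst p - snd p))"
 have z: "1 - fst p - snd p >= 0" using p by (auto simp: simplex2_def)
 have c: "?c >= 0" using wt_nonneg[OF p] z by (intro cst_nonneg add_nonneg_nonneg)
 have cz: "cst (1 - fst p - snd p) <= ?c" and cw: "cst (wt p (-1, - b)) <= ?c"
  using wt_nonneg[OF p] z by (intro cst_mono; simp)+
 obtain i j where ij: "X = Xg (ax i) (ax j)" "i ~= j" using X by (auto simp: planar_def)
 have gX: "gen X" using X planar_gen by auto
 have cross: "dp p a (a ** rot (Xg (ax i) (ax q)) t) <= 2 * pi * ?c + ?c * abs t"
  if i: "fst i = None" and q: "fst q ~= None" for i q :: "'m option * bool" and t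
 proof -
  obtain j' :: 'm where j': "Some j' ~= fst q" using two_indices[OF card l4] by (metis option.inject)
  define r where "r = (Some j', False)"
  have r: "fst r ~= None" "fst r ~= fst q" using j' by (auto simp: r_def)
  define Y where "Y = Xg (ax i) (ax q) + b *R Xg (Jmat *v ax i) (Jmat *v ax q)"
  define Z where "Z = Xg (Jmat *v ax q) (ax r)"
  note cr = cross_rotation[OF i q r b, folded Y_def Z_def]
  have s: "(-1, - b) : Sg" using b by (auto simp: Sg_def)
  have Y: "Y : Es (-1, - b)" using cr(2) by simp
  define u where "u = rot Y (t/2)"
  have S: "a ** u : SO" "a ** u ** rot Z pi : SO" "a ** u ** rot Z pi ** u : SO" "a ** u ** rot Z pi ** u ** rot Z (- pi) : SO"
   using a cr(1,3) by (auto simp: u_def intro!: SO_mult rot_SO)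
  have 1: "dp p x (x ** u) <= abs t/2 * ?c" if "x : SO" for x
  proof -
   have "abs (t/2) * cst (wt p (-1, - b)) <= abs (t/2) * ?c" using cw by (rule mult_left_mono) simp
   thus ?thesis using cost_Es[OF p cr(1) Y s that, of "t/2"] unfolding u_def by simp
  qed
  have 2: "dp p x (x ** rot Z s) <= pi * ?c" if "x : SO" "abs s = pi" for x s
  proof -
   have "pi * cst (1 - fst p - snd p) <= pi * ?c" using cz by (rule mult_left_mono) simp
   with cost_block[OF p cr(3,4) that(1), of s] show ?thesis unfolding that(2) by (rule order_trans)
  qed
  have e: "a ** rot (Xg (ax i) (ax q)) t = a ** u ** rot Z pi ** u ** rot Z (- pi)"
   unfolding cr(5) u_def by (simp add: mat_assoc)
  let ?x1 = "a ** u" and ?x2 = "a ** u ** rot Z pi" and ?x3 = "a ** u ** rot Z pi ** u" and ?x4 = "a ** u ** rot Z pi ** u ** rot Z (- pi)"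
  have "dp p a ?x4 <= dp p a ?x1 + dp p ?x1 ?x4" "dp p ?x1 ?x4 <= dp p ?x1 ?x2 + dp p ?x2 ?x4" "dp p ?x2 ?x4 <= dp p ?x2 ?x3 + dp p ?x3 ?x4"
   using a S by (auto intro!: d_triangle)
  moreover have "dp p a ?x1 <= abs t/2 * ?c" "dp p ?x1 ?x2 <= pi * ?c" "dp p ?x2 ?x3 <= abs t/2 * ?c" "dp p ?x3 ?x4 <= pi * ?c"
   by (rule 1[OF a], rule 2[OF S(1)], simp, rule 1[OF S(2)], rule 2[OF S(3)], simp)
  ultimately have "dp p a ?x4 <= abs t/2 * ?c + (pi * ?c + (abs t/2 * ?c + pi * ?c))" by linarith
  also have "... = 2 * pi * ?c + ?c * abs t" by (simp add: field_simps)
  finally show ?thesis unfolding e .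
 qed
 show ?thesis
 proof (cases "(fst i = None) = (fst j = None)")
  case True
  hence "Dmat ** X ** Dmat = X" unfolding ij(1) Dmat_Xg by simp
  from cost_block[OF p gX this a, of t] have "dp p a (a ** rot X t) <= abs t * ?c"
   using cz by (meson abs_ge_zero mult_left_mono order_trans)
  moreover have "2 * pi * ?c >= 0" using c by simp
  ultimately show ?thesis by (simp add: mult.commute)
 next
  case False
  show ?thesis
  proof (cases "fst i = None")
   case True thus ?thesis using cross[of i j t] False by (simp add: ij(1))
  next
   case iN: False
   have "X = - Xg (ax j) (ax i)" unfolding ij(1) by (rule Xg_flip)
   hence "rot X t = rot (Xg (ax j) (ax i)) (- t)" by (simp only: rot_uminus)
   thus ?thesis using cross[of j i "- t"] False iN by simp
  qed
 qed
qed

text \<open>The three choices of \<open>w\<close> are the sums of those two parameters that vanish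
  at \<open>O\<close>, \<open>P\<close> and \<open>Q\<close>, respectively.\<close>

lemma point_collapse:
 "EX A. ALL p:simplex2. ALL w:{fst p + snd p, 1 - snd p, 1 - fst p}. ALL a:SO. ALL b:SO. dp p a b <= A * cst w"
proof -
 obtain n R where R: "ALL N H al be. hom_metric N (H :: 'm mat set) --> be >= 0 -->
  (ALL X:planar UNIV. ALL a:SO. ALL t. gdist N (coset H a) (coset H (a ** rot X t)) <= al + be * abs t) -->
  (ALL a:SO. ALL A:SO. fixes_off UNIV A --> gdist N (coset H a) (coset H (a ** A)) <= real n * al + be * R)"
  using reach_bounded by blast
 have "dp p a b <= (real n * (2 * pi) + R) * cst w"
  if p: "p : simplex2" and w: "w : {fst p + snd p, 1 - snd p, 1 - fst p}" and a: "a : SO" and b: "b : SO" for p w a b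
 proof -
  have w0: "w >= 0" using p w by (auto simp: simplex2_def)
  have cost: "dp p a (a ** rot X t) <= 2 * pi * cst w + cst w * abs t" if "X : planar UNIV" "a : SO" for X a t
   using w planar_cost_O[OF p that, of t] planar_cost_PQ[OF p that, of 1 t] planar_cost_PQ[OF p that, of "-1" t]
   by (auto simp: wt_def)
  have ab: "transpose a ** b : SO" using a b by (intro SO_mult SO_inv)
  have "dp p a (a ** (transpose a ** b)) <= real n * (2 * pi * cst w) + cst w * R"
   using R[rule_format, OF hom_metric_fn[OF card l4 p] cst_nonneg[OF w0] cost a ab] by (auto simp: fixes_off_def)
  thus ?thesis using SO_transpose(2)[OF a] by (simp add: mat_assoc algebra_simps)
 qed
 thus ?thesis by blast
qed

text \<open>The fibre is a complex projective space, and by the polar decomposition a single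
  rotation along \<open>m1\<close> of angle at most \<open>pi\<close> joins any two of its
  points.\<close>

lemma fibre_K:
 assumes p: "p : simplex2" and a: "a : SO" and h: "h : U_grp"
 shows "dp p a (a ** h) <= pi * cst (fst p)"
proof -
 interpret hom_metric "fn p" "U1U_grp :: 'm mat set" by (rule hom_metric_fn[OF card l4 p])
 obtain X t k where X: "gen X" "X : Esp (-1) (-1)" "abs t <= pi" "k : U1U_grp" "h = rot X t ** k"
  by (rule U_grp_decomp[OF h])
 have "dp p a (a ** h) = dp p a (a ** rot X t)"
  using coset_mult[OF X(4), of "a ** rot X t"] by (simp add: X(5) mat_assoc)
 also have "... <= abs t * cst (wt p (-1, -1))"
  by (rule cost_Es[OF p X(1) _ _ a]) (use X(2) in "auto simp: Sg_def")
 also have "... <= pi * cst (fst p)"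
  using X(3) cst_nonneg[OF wt_nonneg[OF p, of "(-1, -1)"]] by (simp add: wt_def mult_right_mono)
 finally show ?thesis .
qed

text \<open>In the fibre only rotations of the second block count. They cost at most the parameter
  of \<open>m3\<close>, since block diagonal generators have no component in \<open>m1\<close> or
  \<open>m2\<close>.\<close>

lemma fibre_L:
 "EX A. ALL p:simplex2. ALL a:SO. ALL h:SO2SO_grp. dp p a (a ** h) <= A * cst (1 - fst p - snd p)"
proof -
 let ?T = "{p. fst p ~= None} :: ('m option * bool) set"
 obtain n R where R: "ALL N H al be. hom_metric N (H :: 'm mat set) --> be >= 0 -->
  (ALL X:planar ?T. ALL a:SO. ALL t. gdist N (coset H a) (coset H (a ** rot X t)) <= al + be * abs t) -->
  (ALL a:SO. ALL A:SO. fixes_off ?T A --> gdist N (coset H a) (coset H (a ** A)) <= real n * al + be * R)"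
  using reach_bounded by blast
 have "dp p a (a ** h) <= R * cst (1 - fst p - snd p)"
  if p: "p : simplex2" and a: "a : SO" and h: "h : SO2SO_grp" for p a h
 proof -
  interpret hom_metric "fn p" "U1U_grp :: 'm mat set" by (rule hom_metric_fn[OF card l4 p])
  let ?c = "cst (1 - fst p - snd p)"
  have c: "?c >= 0" using p by (intro cst_nonneg) (auto simp: simplex2_def)
  obtain k where k: "k : U1U_grp" "h ** k : SO" "fixes_off ?T (h ** k)" by (rule SO2SO_decomp[OF h])
  have cost: "dp p a (a ** rot X t) <= 0 + ?c * abs t" if X: "X : planar ?T" and a: "a : SO" for X a t
  proof -
   have gX: "gen X" using X planar_gen by auto
   have "Dmat ** X ** Dmat = X" using X by (auto simp: planar_def Dmat_Xg)
   from cost_block[OF p gX this a, of t] show ?thesis by (simp add: mult.commute)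
  qed
  have "dp p a (a ** h) = dp p a (a ** (h ** k))" using coset_mult[OF k(1), of "a ** h"] by (simp add: mat_assoc)
  also have "... <= real n * 0 + ?c * R"
   using R[rule_format, OF hom_metric_axioms c cost a k(2,3)] by auto
  finally show ?thesis by (simp add: mult.commute)
 qed
 thus ?thesis by blast
qed

section \<open>Gromov-Hausdorff convergence of the flag manifold\<close>

lemma wt_tendsto: "(ph \<longlongrightarrow> p) F ==> ((%t. wt (ph t) s) \<longlongrightarrow> wt p s) F"
 unfolding wt_def by (auto intro!: tendsto_intros)

text \<open>All hypotheses of the locale except the shrinking of the fibres follow from convergence
  of the three weights.\<close>

lemma collapsing_fn:
 assumes h0: "hom_metric (fn p0) (H0 :: 'm mat set)" and p0: "p0 : simplex2" and K: "U1U_grp <= H0"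
  and ph: "!!t. ph t : simplex2" "(ph \<longlongrightarrow> p0) F"
  and fib: "!!ep. ep > 0 ==> \<forall>\<^sub>F t in F. ALL a:SO. ALL h:H0. dp (ph t) a (a ** h) <= ep"
 shows "collapsing (fn p0) H0 (%t. fn (ph t)) U1U_grp F (cst 1)"
proof (rule collapsing.intro)
 note lp = l_pos[OF card l4]
 show "hom_metric (fn p0) H0" by (rule h0)
 show "hom_metric (fn (ph t)) (U1U_grp :: 'm mat set)" for t by (rule hom_metric_fn[OF card l4 ph(1)])
 show "continuous_on UNIV (fn p0 :: 'm mat => real)" "continuous_on UNIV (fn (ph t) :: 'm mat => real)" for t
  by (rule fn_continuous[OF card l4])+
 show "fn p0 X <= cst 1" "fn (ph t) X <= cst 1" if "gen X" for X :: "'m mat" and t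
  unfolding cst_def by (rule fn_gen_le[OF card l4 that]; use wt_le_1 p0 ph(1) in auto)+
 fix ep :: real assume e: "ep > 0"
 have "\<forall>\<^sub>F t in F. wt p0 s <= (1 + ep)^2 * wt (ph t) s" for s
 proof (cases "wt p0 s = 0")
  case True thus ?thesis using wt_nonneg[OF ph(1)] by simp
 next
  case False
  hence "wt p0 s > 0" using wt_nonneg[OF p0, of s] by simp
  \<comment> \<open>The square appears because the weights stand under the root in
    \<open>fn\<close>.\<close>
  hence "wt p0 s < (1 + ep)^2 * wt p0 s" using e by (simp add: power2_eq_square algebra_simps add_pos_pos)
  moreover have "((%t. (1 + ep)^2 * wt (ph t) s) \<longlongrightarrow> (1 + ep)^2 * wt p0 s) F"
   by (intro tendsto_intros wt_tendsto ph)
  ultimately have "\<forall>\<^sub>F t in F. wt p0 s < (1 + ep)^2 * wt (ph t) s" by (rule order_tendstoD(1)[rotated])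
  thus ?thesis by (rule eventually_mono) simp
 qed
 hence "\<forall>\<^sub>F t in F. ALL s:Sg. wt p0 s <= (1 + ep)^2 * wt (ph t) s" by (intro eventually_ball_finite) auto
 thus "\<forall>\<^sub>F t in F. ALL xi:so. fn p0 xi <= (1 + ep) * fn (ph t) (xi :: 'm mat)"
 proof (rule eventually_mono, intro ballI)
  fix t and xi :: "'m mat" assume w: "ALL s:Sg. wt p0 s <= (1 + ep)^2 * wt (ph t) s"
  have "(SUM s:Sg. wt p0 s * (norm (Ps s xi))^2) <= (SUM s:Sg. (1 + ep)^2 * wt (ph t) s * (norm (Ps s xi))^2)"
   using w by (intro sum_mono mult_right_mono) auto
  also have "... = (1 + ep)^2 * (SUM s:Sg. wt (ph t) s * (norm (Ps s xi))^2)"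
   by (simp only: sum_distrib_left mult.assoc)
  finally have "(2 * real l - 2) * (SUM s:Sg. wt p0 s * (norm (Ps s xi))^2)
    <= (2 * real l - 2) * ((1 + ep)^2 * (SUM s:Sg. wt (ph t) s * (norm (Ps s xi))^2))"
   using lp by (intro mult_left_mono) auto
  also have "... = (1 + ep)^2 * ((2 * real l - 2) * (SUM s:Sg. wt (ph t) s * (norm (Ps s xi))^2))"
   by (rule mult.left_commute)
  finally have "(2 * real l - 2) * (SUM s:Sg. wt p0 s * (norm (Ps s xi))^2)
    <= (1 + ep)^2 * ((2 * real l - 2) * (SUM s:Sg. wt (ph t) s * (norm (Ps s xi))^2))" .
  hence "fn p0 xi <= sqrt ((1 + ep)^2 * ((2 * real l - 2) * (SUM s:Sg. wt (ph t) s * (norm (Ps s xi))^2)))"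
   unfolding fn_eq[OF card l4] by (rule real_sqrt_le_mono)
  thus "fn p0 xi <= (1 + ep) * fn (ph t) xi" unfolding fn_eq[OF card l4] real_sqrt_mult using e by simp
 qed
 \<comment> \<open>Chosen so that after multiplication by 2 l - 2 and taking the root, the additive
   error is \<open>ep * norm xi\<close>.\<close>
 define et where "et = ep^2 / (2 * real l - 2)"
 have et: "et > 0" "(2 * real l - 2) * et = ep^2" using e lp by (auto simp: et_def)
 have "\<forall>\<^sub>F t in F. wt (ph t) s <= wt p0 s + et" for s
  using order_tendstoD(2)[OF wt_tendsto[OF ph(2)], of s "wt p0 s + et"] et by (auto elim: eventually_mono)
 hence "\<forall>\<^sub>F t in F. ALL s:Sg. wt (ph t) s <= wt p0 s + et" by (intro eventually_ball_finite) auto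
 thus "\<forall>\<^sub>F t in F. ALL xi:so. fn (ph t) (xi :: 'm mat) <= fn p0 xi + ep * norm xi"
 proof (rule eventually_mono, intro ballI)
  fix t and xi :: "'m mat" assume w: "ALL s:Sg. wt (ph t) s <= wt p0 s + et"
  have "(SUM s:Sg. wt (ph t) s * (norm (Ps s xi))^2) <= (SUM s:Sg. (wt p0 s + et) * (norm (Ps s xi))^2)"
   using w by (intro sum_mono mult_right_mono) auto
  also have "... = (SUM s:Sg. wt p0 s * (norm (Ps s xi))^2) + et * (SUM s:Sg. (norm (Ps s xi))^2)"
   by (simp add: distrib_right sum.distrib sum_distrib_left)
  also have "... <= (SUM s:Sg. wt p0 s * (norm (Ps s xi))^2) + et * (norm xi)^2"
   using sum_Ps_le[OF card l4, of xi] et(1) by (simp add: mult_left_mono)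
  finally have "(2 * real l - 2) * (SUM s:Sg. wt (ph t) s * (norm (Ps s xi))^2)
    <= (2 * real l - 2) * ((SUM s:Sg. wt p0 s * (norm (Ps s xi))^2) + et * (norm xi)^2)"
   using lp by (intro mult_left_mono) auto
  also have "... = (2 * real l - 2) * (SUM s:Sg. wt p0 s * (norm (Ps s xi))^2) + ep^2 * (norm xi)^2"
   unfolding et(2)[symmetric] by (simp add: distrib_left)
  finally have "fn (ph t) xi <= sqrt ((2 * real l - 2) * (SUM s:Sg. wt p0 s * (norm (Ps s xi))^2) + ep^2 * (norm xi)^2)"
   unfolding fn_eq[OF card l4] by (rule real_sqrt_le_mono)
  also have "... <= fn p0 xi + sqrt (ep^2 * (norm xi)^2)"
   unfolding fn_eq[OF card l4] using lp wt_nonneg[OF p0]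
   by (intro sqrt_add_le_add_sqrt mult_nonneg_nonneg sum_nonneg) auto
  also have "sqrt (ep^2 * (norm xi)^2) = ep * norm xi" using e by (simp add: real_sqrt_mult)
  finally show "fn (ph t) xi <= fn p0 xi + ep * norm xi" .
 qed
 show "\<forall>\<^sub>F t in F. ALL a:SO. ALL h:H0. dp (ph t) a (a ** h) <= ep" by (rule fib[OF e])
qed (use K in auto)

lemma metric_flag: assumes "p : osimplex" shows "metric_on (flag_mfd :: 'm mat set set) (gdist (fn p))"
 unfolding flag_mfd_def U1U_stab
proof (rule metric_on_cosets)
 show "hom_metric (fn p) (stab (Hmat 1 2 :: 'm mat))"
  using hom_metric_fn[OF card l4 osimplex_sub[OF assms]] by (simp add: U1U_stab)
 show "EX C>=0. ALL xi:so. norm (bracket xi (Hmat 1 2 :: 'm mat)) <= C * fn p xi"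
  by (rule bracket_bound[OF card l4 osimplex_sub[OF assms]]) (rule wt_pos[OF card l4 assms])
qed

lemma metric_K: "metric_on (cosets (U_grp :: 'm mat set)) (gdist (fn ptK))"
 unfolding U_grp_stab
proof (rule metric_on_cosets)
 show "hom_metric (fn ptK) (stab (Hmat 1 1 :: 'm mat))" using hom_metric_K[OF card l4] by (simp add: U_grp_stab)
 show "EX C>=0. ALL xi:so. norm (bracket xi (Hmat 1 1 :: 'm mat)) <= C * fn ptK xi"
  by (rule bracket_bound[OF card l4 ptKL_in(1)]) (auto simp: Sg_def hw_def wt_def ptK_def)
qed

lemma metric_L: "metric_on (cosets (SO2SO_grp :: 'm mat set)) (gdist (fn ptL))"
 unfolding SO2SO_stab
proof (rule metric_on_cosets)
 show "hom_metric (fn ptL) (stab (Hmat 1 0 :: 'm mat))" using hom_metric_L[OF card l4] by (simp add: SO2SO_stab)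
 show "EX C>=0. ALL xi:so. norm (bracket xi (Hmat 1 0 :: 'm mat)) <= C * fn ptL xi"
  by (rule bracket_bound[OF card l4 ptKL_in(2)]) (auto simp: Sg_def hw_def wt_def ptL_def)
qed

lemma hom_dist_fn: "hom_dist (flag_form p) = gdist (fn p :: 'm mat => real)"
 unfolding hom_dist_gdist fn_def by simp

lemma hom_dist_normal:
 "hom_dist (normal_form (1/2) u_alg) = gdist (fn ptK :: 'm mat => real)"
 "hom_dist (normal_form (1/2) so2so_alg) = gdist (fn ptL :: 'm mat => real)"
 unfolding hom_dist_gdist
 by (rule gdist_cong; rule sqrt_normal_form[OF card l4]; assumption)+

text \<open>The map \<open>ta\<close> is the identity at \<open>K\<close> and \<open>L\<close>. At
  \<open>M\<close> it is conjugation by the reflection \<open>Fl\<close>, an isometry from the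
  metric of \<open>ph\<close> to that of the mirrored curve \<open>ps\<close>, which tends to
  \<open>K\<close>.\<close>

lemma gh_limit:
 fixes ta :: "'m mat => 'm mat" and H0 :: "'m mat set"
 assumes coll: "collapsing (fn p0) H0 (%t. fn (ps t)) U1U_grp F M" and met: "metric_on (cosets H0) (gdist (fn p0))"
  and ta: "ta ` SO = SO" "!!a k. k : U1U_grp ==> EX k':U1U_grp. ta (a ** k) = ta a ** k'"
  and iso: "!!t a b. a : SO ==> b : SO ==> dp (ph t) a b = dp (ps t) (ta a) (ta b)"
  and ph: "!!t. ph t : osimplex"
 shows "gh_tendsto (flag_mfd :: 'm mat set set) (%t. hom_dist (flag_form (ph t))) (cosets H0) (gdist (fn p0)) F"
proof -
 interpret collapsing "fn p0" H0 "%t. fn (ps t)" U1U_grp F M by (rule coll)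
 \<comment> \<open>The union runs over representatives that all give the same coset, so no choice of
   a representative is needed.\<close>
 define f where "f P = (UN x:P. coset H0 (ta x))" for P
 have f: "f (coset U1U_grp a) = coset H0 (ta a)" for a
 proof -
  have "coset H0 (ta (a ** k)) = coset H0 (ta a)" if k: "k : U1U_grp" for k
  proof -
   obtain k' where "k' : U1U_grp" "ta (a ** k) = ta a ** k'" using ta(2)[OF k] by blast
   thus ?thesis using Z.coset_mult[of k' "ta a"] KH by auto
  qed
  moreover have "U1U_grp ~= ({} :: 'm mat set)" using Jmat_U1U by blast
  ultimately show ?thesis unfolding f_def coset_def[of U1U_grp] by simp
 qed
 show ?thesis
 proof (rule gh_tendstoI[OF _ met, of _ f])
  show "flag_mfd ~= ({} :: 'm mat set set)" using SO_id by (auto simp: flag_mfd_def cosets_eq)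
  show "f ` flag_mfd = cosets H0"
  proof -
   have "(%a. coset H0 (ta a)) ` SO = coset H0 ` ta ` SO" by (simp only: image_image)
   thus ?thesis unfolding flag_mfd_def cosets_eq image_image f ta(1) .
  qed
  show "metric_on (flag_mfd :: 'm mat set set) (hom_dist (flag_form (ph t)))" for t
   unfolding hom_dist_fn by (rule metric_flag[OF ph])
  fix ep :: real assume "ep > 0"
  from d_uniform[OF this]
  show "\<forall>\<^sub>F t in F. ALL P:flag_mfd. ALL Q:flag_mfd. abs (hom_dist (flag_form (ph t)) P Q - gdist (fn p0) (f P) (f Q)) <= ep"
  proof (rule eventually_mono)
   fix t assume *: "ALL a:SO. ALL b:SO. abs (dt t a b - Z.d a b) <= ep"
   have "ta a : SO" if "a : SO" for a using ta(1) that by blast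
   thus "ALL P:flag_mfd. ALL Q:flag_mfd. abs (hom_dist (flag_form (ph t)) P Q - gdist (fn p0) (f P) (f Q)) <= ep"
    unfolding flag_mfd_def cosets_eq hom_dist_fn using * by (simp add: f iso)
  qed
 qed
qed

lemma eventually_small:
 assumes "(w \<longlongrightarrow> 0) F" "ep > 0" shows "\<forall>\<^sub>F t in F. A * cst (w t) <= ep"
 using order_tendstoD(2)[OF cst_tendsto[OF assms(1), of A] assms(2)] by (rule eventually_mono) simp

lemma collapsing_K:
 assumes ph: "!!t. ph t : simplex2" "(ph \<longlongrightarrow> ptK) F"
 shows "collapsing (fn ptK) (U_grp :: 'm mat set) (%t. fn (ph t)) U1U_grp F (cst 1)"
proof (rule collapsing_fn[OF hom_metric_K[OF card l4] ptKL_in(1) U1U_sub(1) ph])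
 fix ep :: real assume "ep > 0"
 moreover have "((%t. fst (ph t)) \<longlongrightarrow> 0) F" using tendsto_fst[OF ph(2)] by (simp add: ptK_def)
 ultimately have "\<forall>\<^sub>F t in F. pi * cst (fst (ph t)) <= ep" by (intro eventually_small)
 thus "\<forall>\<^sub>F t in F. ALL a:SO. ALL h:U_grp. dp (ph t) a (a ** h) <= ep"
  by (rule eventually_mono) (use fibre_K[OF ph(1)] in "blast intro: order_trans")
qed

lemma collapsing_L:
 assumes ph: "!!t. ph t : simplex2" "(ph \<longlongrightarrow> ptL) F"
 shows "collapsing (fn ptL) (SO2SO_grp :: 'm mat set) (%t. fn (ph t)) U1U_grp F (cst 1)"
proof (rule collapsing_fn[OF hom_metric_L[OF card l4] ptKL_in(2) U1U_sub(2) ph])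
 obtain A where A: "ALL p:simplex2. ALL a:SO. ALL h:SO2SO_grp. dp p a (a ** h) <= A * cst (1 - fst p - snd p)"
  using fibre_L by blast
 fix ep :: real assume "ep > 0"
 moreover have "((%t. 1 - fst (ph t) - snd (ph t)) \<longlongrightarrow> 1 - 1/2 - 1/2) F"
  using tendsto_fst[OF ph(2)] tendsto_snd[OF ph(2)] by (intro tendsto_intros) (simp_all add: ptL_def)
 ultimately have "\<forall>\<^sub>F t in F. A * cst (1 - fst (ph t) - snd (ph t)) <= ep" by (intro eventually_small) simp_all
 thus "\<forall>\<^sub>F t in F. ALL a:SO. ALL h:SO2SO_grp. dp (ph t) a (a ** h) <= ep"
  by (rule eventually_mono) (use A ph(1) in "blast intro: order_trans")
qed

lemma fn_cj: "fn (prod.swap p) (cj X) = fn p (X :: 'm mat)"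
proof -
 have "(norm (Ps s (cj X)))^2 = (norm (Pr (fst s) (fst s * snd s) X))^2" if "s : Sg" for s
  using Pr_cj[OF Sg_signs(1)[OF that], of "snd s" X] by (simp add: norm_cj)
 moreover have "(-1, -1) : Sg" "(-1, 1) : Sg" "(1, 1) : Sg" by (simp_all add: Sg_def)
 ultimately show ?thesis
  unfolding fn_eq[OF card l4] sum_Sg by (force simp: wt_def algebra_simps)
qed

lemma cj_isometry: "dp p a b = dp (prod.swap p) (cj a) (cj b)"
proof -
 have *: "EX c. is_path (fn (prod.swap p)) c r & c 0 : coset U1U_grp (cj a) & c 1 : coset U1U_grp (cj b)"
  if c: "is_path (fn p) c r" "c 0 : coset U1U_grp a" "c 1 : coset U1U_grp b" for p c r and a b :: "'m mat"
 proof (intro exI conjI)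
  show "is_path (fn (prod.swap p)) (%t. Fl ** c t ** Fl) r"
  proof (rule path_transform[OF c(1)])
   show "fn (prod.swap p) (transpose Fl ** xi ** Fl) = fn p xi" for xi :: "'m mat"
    using fn_cj[of p xi] by (simp add: cj_def transpose_Fl)
  qed (use cj_SO in "auto simp: transpose_Fl Fl_sq cj_def")
  have "cj x : coset U1U_grp (cj a)" if "x : coset U1U_grp a" for x a :: "'m mat"
   using that cj_U1U by (auto simp: coset_def cj_mult intro!: imageI)
  thus "Fl ** c 0 ** Fl : coset U1U_grp (cj a)" "Fl ** c 1 ** Fl : coset U1U_grp (cj b)"
   using c(2,3) by (simp_all add: cj_def)
 qed
 show ?thesis unfolding gdist_def
 proof (intro arg_cong[where f = Inf] Collect_cong iffI)
  fix r
  show "EX c. is_path (fn (prod.swap p)) c r & c 0 : coset U1U_grp (cj a) & c 1 : coset U1U_grp (cj b)"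
   if "EX c. is_path (fn p) c r & c 0 : coset U1U_grp a & c 1 : coset U1U_grp b"
   using that * by blast
  show "EX c. is_path (fn p) c r & c 0 : coset U1U_grp a & c 1 : coset U1U_grp b"
   if "EX c. is_path (fn (prod.swap p)) c r & c 0 : coset U1U_grp (cj a) & c 1 : coset U1U_grp (cj b)"
   using that *[of "prod.swap p" _ r "cj a" "cj b"] by (auto simp: cj_cj)
 qed
qed

lemma gh_K:
 assumes "!!t. ph t : osimplex" "(ph \<longlongrightarrow> ptK) F"
 shows "gh_tendsto (flag_mfd :: 'm mat set set) (%t. hom_dist (flag_form (ph t))) (cosets (U_grp :: 'm mat set)) (hom_dist (normal_form (1/2) u_alg)) F"
 unfolding hom_dist_normal
 by (rule gh_limit[OF collapsing_K metric_K, of ph _ "%a. a"]) (use assms osimplex_sub in auto)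

lemma gh_L:
 assumes "!!t. ph t : osimplex" "(ph \<longlongrightarrow> ptL) F"
 shows "gh_tendsto (flag_mfd :: 'm mat set set) (%t. hom_dist (flag_form (ph t))) (cosets (SO2SO_grp :: 'm mat set)) (hom_dist (normal_form (1/2) so2so_alg)) F"
 unfolding hom_dist_normal
 by (rule gh_limit[OF collapsing_L metric_L, of ph _ "%a. a"]) (use assms osimplex_sub in auto)

lemma gh_M:
 assumes "!!t. ph t : osimplex" "(ph \<longlongrightarrow> ptM) F"
 shows "gh_tendsto (flag_mfd :: 'm mat set set) (%t. hom_dist (flag_form (ph t))) (cosets (U_grp :: 'm mat set)) (hom_dist (normal_form (1/2) u_alg)) F"
 unfolding hom_dist_normal
proof (rule gh_limit[OF collapsing_K metric_K, of "%t. prod.swap (ph t)" _ cj])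
 show "prod.swap (ph t) : simplex2" for t using osimplex_sub[OF assms(1), of t] by (auto simp: simplex2_def)
 have "((%t. (snd (ph t), fst (ph t))) \<longlongrightarrow> (snd ptM, fst ptM)) F" by (intro tendsto_intros assms(2))
 thus "((%t. prod.swap (ph t)) \<longlongrightarrow> ptK) F" by (simp add: prod.swap_def ptM_def ptK_def)
 show "cj ` SO = (SO :: 'm mat set)" using cj_SO cj_cj by (metis (no_types, lifting) image_eqI image_subsetI subsetI subset_antisym)
 show "EX k':U1U_grp. cj (a ** k) = cj a ** k'" if "k : U1U_grp" for a k :: "'m mat" using cj_U1U[OF that] cj_mult by blast
qed (use assms(1) cj_isometry in auto)

lemma gh_point:
 assumes "!!t. ph t : osimplex" "(ph \<longlongrightarrow> v) F" "v : {ptO, ptP, ptQ}"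
 shows "gh_tendsto (flag_mfd :: 'm mat set set) (%t. hom_dist (flag_form (ph t))) {()} (%_ _. 0) F"
proof -
 obtain A where A: "ALL p:simplex2. ALL w:{fst p + snd p, 1 - snd p, 1 - fst p}. ALL a:SO. ALL b:SO. dp p a b <= A * cst w"
  using point_collapse by blast
 have lim: "((%t. fst (ph t) + snd (ph t)) \<longlongrightarrow> fst v + snd v) F" "((%t. 1 - snd (ph t)) \<longlongrightarrow> 1 - snd v) F"
  "((%t. 1 - fst (ph t)) \<longlongrightarrow> 1 - fst v) F"
  by (intro tendsto_intros assms(2))+
 obtain w where w: "((%t. w (ph t)) \<longlongrightarrow> 0) F" "!!p. w p : {fst p + snd p, 1 - snd p, 1 - fst p}"
 proof -
  consider "v = ptO" | "v = ptP" | "v = ptQ" using assms(3) by blast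
  thus ?thesis
  proof cases
   case 1 thus ?thesis using lim(1) that[of "%p. fst p + snd p"] by (simp add: ptO_def)
  next
   case 2 thus ?thesis using lim(2) that[of "%p. 1 - snd p"] by (simp add: ptP_def)
  next
   case 3 thus ?thesis using lim(3) that[of "%p. 1 - fst p"] by (simp add: ptQ_def)
  qed
 qed
 have ne: "flag_mfd ~= ({} :: 'm mat set set)" using SO_id by (auto simp: flag_mfd_def cosets_eq)
 show ?thesis
 proof (rule gh_tendstoI[OF ne metric_on_unit, of "%_. ()"])
  show "(%_. ()) ` (flag_mfd :: 'm mat set set) = {()}" using ne by auto
  show "metric_on (flag_mfd :: 'm mat set set) (hom_dist (flag_form (ph t)))" for t
   unfolding hom_dist_fn by (rule metric_flag[OF assms(1)])
  fix ep :: real assume "ep > 0"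
  from eventually_small[OF w(1) this, of A]
  show "\<forall>\<^sub>F t in F. ALL P:(flag_mfd :: 'm mat set set). ALL Q:flag_mfd. abs (hom_dist (flag_form (ph t)) P Q - 0) <= ep"
  proof (rule eventually_mono)
   fix t assume t: "A * cst (w (ph t)) <= ep"
   interpret hom_metric "fn (ph t)" "U1U_grp :: 'm mat set" by (rule hom_metric_fn[OF card l4 osimplex_sub[OF assms(1)]])
   have "abs (dp (ph t) a b) <= ep" if "a : SO" "b : SO" for a b
   proof -
    have "dp (ph t) a b <= A * cst (w (ph t))" using A osimplex_sub[OF assms(1)] w(2) that by blast
    thus ?thesis using t d_nonneg[OF that] by simp
   qed
   thus "ALL P:(flag_mfd :: 'm mat set set). ALL Q:flag_mfd. abs (hom_dist (flag_form (ph t)) P Q - 0) <= ep"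
    unfolding flag_mfd_def cosets_eq hom_dist_fn by simp
  qed
 qed
qed

end

theorem theorem5p11:
  fixes l :: nat
  assumes "CARD('m::finite option) = l" and "4 \<le> l"
  shows
    "(\<forall>g0 \<in> reg1 l \<union> reg3 l \<union> reg4 l. (proj_flow l g0 \<longlongrightarrow> ptK) at_top) \<and>
     (\<forall>g0 \<in> reg2 l \<union> reg5_6 l \<union> reg9 l. (proj_flow l g0 \<longlongrightarrow> ptL) at_top) \<and>
     (\<forall>g0 \<in> reg7 l \<union> reg8 l \<union> reg10 l. (proj_flow l g0 \<longlongrightarrow> ptM) at_top) \<and>
     (\<forall>g0 \<in> reg3 l \<union> reg8 l. (proj_flow l g0 \<longlongrightarrow> ptO) at_bot) \<and>
     (\<forall>g0 \<in> reg1 l \<union> reg2 l. (proj_flow l g0 \<longlongrightarrow> ptP) at_bot) \<and>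
     (\<forall>g0 \<in> reg9 l \<union> reg10 l. (proj_flow l g0 \<longlongrightarrow> ptQ) at_bot) \<and>
     {p \<in> interior simplex2. einstein (flag_form p :: 'm mat \<Rightarrow> 'm mat \<Rightarrow> real) \<and>
        kaehler (flag_form p :: 'm mat \<Rightarrow> 'm mat \<Rightarrow> real)} = {ptR, ptS l, ptT l} \<and>
     (\<forall>p \<in> {ptR, ptS l, ptT l}. hyperbolic_saddle (pr_field l) p) \<and>
     {p \<in> interior simplex2. einstein (flag_form p :: 'm mat \<Rightarrow> 'm mat \<Rightarrow> real) \<and>
        \<not> kaehler (flag_form p :: 'm mat \<Rightarrow> 'm mat \<Rightarrow> real)} = {ptN l} \<and>
     repeller (proj_flow l) (ptN l) \<and>
     (\<exists>c>0. \<forall>g0 \<in> reg1 l \<union> reg3 l \<union> reg4 l.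
        gh_tendsto (flag_mfd :: 'm mat set set) (flag_dist_at l g0)
          (cosets (U_grp :: 'm mat set)) (hom_dist (normal_form c u_alg)) at_top) \<and>
     (\<exists>c>0. \<forall>g0 \<in> reg2 l \<union> reg5_6 l \<union> reg9 l.
        gh_tendsto (flag_mfd :: 'm mat set set) (flag_dist_at l g0)
          (cosets (SO2SO_grp :: 'm mat set)) (hom_dist (normal_form c so2so_alg)) at_top) \<and>
     (\<exists>c>0. \<forall>g0 \<in> reg7 l \<union> reg8 l \<union> reg10 l.
        gh_tendsto (flag_mfd :: 'm mat set set) (flag_dist_at l g0)
          (cosets (U_grp :: 'm mat set)) (hom_dist (normal_form c u_alg)) at_top) \<and>
     (\<forall>g0 \<in> interior simplex2 - triangleKLM.
        gh_tendsto (flag_mfd :: 'm mat set set) (flag_dist_at l g0)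
          {()} (\<lambda>_ _. 0) at_bot)"
proof (intro conjI, goal_cases)
 note r = region_limits[OF assms(2)] and fl = flow_open_simplex[where l = l]
 have fd: "flag_dist_at l g0 = (%t. hom_dist (flag_form (flow l g0 t) :: 'm mat => 'm mat => real))" for g0
  by (simp add: flag_dist_at_def fun_eq_iff)
 case 1 show ?case using r(1) by blast
 case 2 show ?case using r(2) by blast
 case 3 show ?case using r(3) by blast
 case 4 show ?case using r(4) by blast
 case 5 show ?case using r(5) by blast
 case 6 show ?case using r(6) by blast
 case 7 show ?case by (rule einstein_kaehler_sets[OF assms])
 case 8 show ?case using RST_saddle[OF assms(2)] by blast
 case 9 show ?case by (rule einstein_kaehler_sets[OF assms])
 case 10 show ?case by (rule repeller_N[OF assms(2)])
 case 11 show ?case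
  unfolding fd by (intro exI[of _ "1/2"] conjI ballI gh_K[OF assms fl]) (use r(1) in auto)
 case 12 show ?case
  unfolding fd by (intro exI[of _ "1/2"] conjI ballI gh_L[OF assms fl]) (use r(2) in auto)
 case 13 show ?case
  unfolding fd by (intro exI[of _ "1/2"] conjI ballI gh_M[OF assms fl]) (use r(3) in auto)
 case 14 show ?case
 proof (intro ballI, goal_cases)
  case (1 g0)
  hence g0: "g0 : osimplex" "g0 ~: triangleKLM" by (simp_all add: interior_simplex2)
  obtain v where v: "v : {ptO, ptP, ptQ}" "(flow l g0 \<longlongrightarrow> v) at_bot"
   using flow_backward_outside[OF assms(2) g0] by blast
  show ?case unfolding fd by (rule gh_point[OF assms fl[OF g0(1)] v(2,1)])
 qed
qed

end
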